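(* There is a tricategory $\mathbf{Top}$ with objects spaces, hom-bicategories given by $\mathbf{Top}(X,Y)$, and composition given by the functor $\otimes:\mathbf{Top}(Y,Z)\times\mathbf{Top}(X,Y)\to\mathbf{Top}(X,Z)$.
   Context: Let $I=[0,1]$. For spaces $X,Y$, $\mathbf{Top}(X,Y)$ is the bicategory with: 0-cells the continuous maps $f:X\to Y$; 1-cells $f\Rightarrow g$ the homotopies $H:X\times I\to Y$ from $f$ to $g$; 2-cells $H\Rrightarrow J$ the equivalence classes $[\alpha]$ of homotopies $\alpha:X\times I\times I\to Y$ from $H$ to $J$ such that for each $t$, $\alpha(-,-,t)$ is a homotopy $f\Rightarrow g$, where $\alpha\sim\beta$ if there is a homotopy $\Gamma:X\times I^3\to Y$ from $\alpha$ to $\beta$ such that for each $u$, $\Gamma(-,-,-,u)$ is a homotopy $H\Rrightarrow J$ and each $\Gamma(-,-,t,u)$ is a homotopy $f\Rightarrow g$. Vertical composition of 2-cells is concatenation in the last coordinate $t$ (at double speed); composition of 1-cells and horizontal composition of 2-cells is concatenation in the coordinate $s$, i.e. $(H_2\circ H_1)(-,s)=H_1(-,2s)$ for $s\le\frac12$ and $H_2(-,2s-1)$ for $s\ge\frac12$. Identities are constant homotopies; associativity and unit constraints are the classes of the standard reparametrization homotopies. The strict functor $\otimes$ is defined by: $g\otimes f=gf$ on 0-cells; $(J\otimes H)(x,s)=J(H(x,s),s)$ on 1-cells; $[\beta]\otimes[\alpha]=[\beta\otimes\alpha]$ with $(\beta\otimes\alpha)(x,s,t)=\beta(\alpha(x,s,t),s,t)$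 on 2-cells. *)

theory Defs
  imports "HOL-Analysis.Analysis"
begin

section \<open>Bicategories\<close>

text \<open>
  Composition is written in functional order: for \<open>f : a \<rightarrow> b\<close> and \<open>g : b \<rightarrow> c\<close> the composite is
  \<open>g \<odot> f : a \<rightarrow> c\<close>, and likewise for the vertical composition \<open>\<cdot>\<close> and the horizontal
  composition \<open>\<star>\<close> of 2-cells.  All operations are relevant only on composable arguments from
  the carriers.
\<close>

record ('o, 'm, 'c) bicat =
  ob :: "'o set"
  arr1 :: "'m set"
  arr2 :: "'c set"
  src1 :: "'m \<Rightarrow> 'o"
  trg1 :: "'m \<Rightarrow> 'o"
  src2 :: "'c \<Rightarrow> 'm"
  trg2 :: "'c \<Rightarrow> 'm"
  id1 :: "'o \<Rightarrow> 'm"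
  id2 :: "'m \<Rightarrow> 'c"
  comp1 :: "'m \<Rightarrow> 'm \<Rightarrow> 'm" (infixr "\<odot>\<index>" 75)
  vcomp :: "'c \<Rightarrow> 'c \<Rightarrow> 'c" (infixr "\<cdot>\<index>" 65)
  hcomp :: "'c \<Rightarrow> 'c \<Rightarrow> 'c" (infixr "\<star>\<index>" 70)
  assoc :: "'m \<Rightarrow> 'm \<Rightarrow> 'm \<Rightarrow> 'c"
  lunit :: "'m \<Rightarrow> 'c"
  runit :: "'m \<Rightarrow> 'c"

definition hom1 :: "('o, 'm, 'c) bicat \<Rightarrow> 'o \<Rightarrow> 'o \<Rightarrow> 'm set" where
  "hom1 B a b = {f \<in> arr1 B. src1 B f = a \<and> trg1 B f = b}"

definition hom2 :: "('o, 'm, 'c) bicat \<Rightarrow> 'm \<Rightarrow> 'm \<Rightarrow> 'c set" where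
  "hom2 B f g = {\<alpha> \<in> arr2 B. src2 B \<alpha> = f \<and> trg2 B \<alpha> = g}"

definition inverse2 :: "('o, 'm, 'c) bicat \<Rightarrow> 'c \<Rightarrow> 'c \<Rightarrow> bool" where
  "inverse2 B \<alpha> \<beta> \<longleftrightarrow> \<beta> \<in> hom2 B (trg2 B \<alpha>) (src2 B \<alpha>) \<and>
     \<beta> \<cdot>\<^bsub>B\<^esub> \<alpha> = id2 B (src2 B \<alpha>) \<and> \<alpha> \<cdot>\<^bsub>B\<^esub> \<beta> = id2 B (trg2 B \<alpha>)"

definition iso2 :: "('o, 'm, 'c) bicat \<Rightarrow> 'm \<Rightarrow> 'm \<Rightarrow> 'c set" where
  "iso2 B f g = {\<alpha> \<in> hom2 B f g. \<exists>\<beta>. inverse2 B \<alpha> \<beta>}"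

definition inv2 :: "('o, 'm, 'c) bicat \<Rightarrow> 'c \<Rightarrow> 'c" where
  "inv2 B \<alpha> = (THE \<beta>. inverse2 B \<alpha> \<beta>)"

locale bicategory =
  fixes B :: "('o, 'm, 'c) bicat" (structure)
  assumes src1_ob: "f \<in> arr1 B \<Longrightarrow> src1 B f \<in> ob B"
    and trg1_ob: "f \<in> arr1 B \<Longrightarrow> trg1 B f \<in> ob B"
    and src2_arr1: "\<alpha> \<in> arr2 B \<Longrightarrow> src2 B \<alpha> \<in> arr1 B"
    and trg2_arr1: "\<alpha> \<in> arr2 B \<Longrightarrow> trg2 B \<alpha> \<in> arr1 B"
    and src1_src2: "\<alpha> \<in> arr2 B \<Longrightarrow> src1 B (src2 B \<alpha>) = src1 B (trg2 B \<alpha>)"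
    and trg1_src2: "\<alpha> \<in> arr2 B \<Longrightarrow> trg1 B (src2 B \<alpha>) = trg1 B (trg2 B \<alpha>)"
    and id1_hom: "a \<in> ob B \<Longrightarrow> id1 B a \<in> hom1 B a a"
    and comp1_hom: "\<lbrakk>g \<in> hom1 B b c; f \<in> hom1 B a b\<rbrakk> \<Longrightarrow> g \<odot> f \<in> hom1 B a c"
    and id2_hom: "f \<in> arr1 B \<Longrightarrow> id2 B f \<in> hom2 B f f"
    and vcomp_hom: "\<lbrakk>\<beta> \<in> hom2 B g h; \<alpha> \<in> hom2 B f g\<rbrakk> \<Longrightarrow> \<beta> \<cdot> \<alpha> \<in> hom2 B f h"
    and vcomp_id_left: "\<alpha> \<in> hom2 B f g \<Longrightarrow> id2 B g \<cdot> \<alpha> = \<alpha>"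
    and vcomp_id_right: "\<alpha> \<in> hom2 B f g \<Longrightarrow> \<alpha> \<cdot> id2 B f = \<alpha>"
    and vcomp_assoc: "\<lbrakk>\<gamma> \<in> hom2 B h k; \<beta> \<in> hom2 B g h; \<alpha> \<in> hom2 B f g\<rbrakk>
          \<Longrightarrow> (\<gamma> \<cdot> \<beta>) \<cdot> \<alpha> = \<gamma> \<cdot> (\<beta> \<cdot> \<alpha>)"
    and hcomp_hom: "\<lbrakk>g \<in> hom1 B b c; f \<in> hom1 B a b; \<beta> \<in> hom2 B g g'; \<alpha> \<in> hom2 B f f'\<rbrakk>
          \<Longrightarrow> \<beta> \<star> \<alpha> \<in> hom2 B (g \<odot> f) (g' \<odot> f')"
    and hcomp_id: "\<lbrakk>g \<in> hom1 B b c; f \<in> hom1 B a b\<rbrakk> \<Longrightarrow> id2 B g \<star> id2 B f = id2 B (g \<odot> f)"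
    and interchange: "\<lbrakk>g \<in> hom1 B b c; f \<in> hom1 B a b;
          \<beta> \<in> hom2 B g g'; \<beta>' \<in> hom2 B g' g''; \<alpha> \<in> hom2 B f f'; \<alpha>' \<in> hom2 B f' f''\<rbrakk>
          \<Longrightarrow> (\<beta>' \<cdot> \<beta>) \<star> (\<alpha>' \<cdot> \<alpha>) = (\<beta>' \<star> \<alpha>') \<cdot> (\<beta> \<star> \<alpha>)"
    and assoc_iso: "\<lbrakk>h \<in> hom1 B c d; g \<in> hom1 B b c; f \<in> hom1 B a b\<rbrakk>
          \<Longrightarrow> assoc B h g f \<in> iso2 B ((h \<odot> g) \<odot> f) (h \<odot> (g \<odot> f))"
    and assoc_natural: "\<lbrakk>h \<in> hom1 B c d; g \<in> hom1 B b c; f \<in> hom1 B a b;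
          \<gamma> \<in> hom2 B h h'; \<beta> \<in> hom2 B g g'; \<alpha> \<in> hom2 B f f'\<rbrakk>
          \<Longrightarrow> assoc B h' g' f' \<cdot> ((\<gamma> \<star> \<beta>) \<star> \<alpha>) = (\<gamma> \<star> (\<beta> \<star> \<alpha>)) \<cdot> assoc B h g f"
    and lunit_iso: "f \<in> hom1 B a b \<Longrightarrow> lunit B f \<in> iso2 B (id1 B b \<odot> f) f"
    and lunit_natural: "\<lbrakk>f \<in> hom1 B a b; \<alpha> \<in> hom2 B f f'\<rbrakk>
          \<Longrightarrow> lunit B f' \<cdot> (id2 B (id1 B b) \<star> \<alpha>) = \<alpha> \<cdot> lunit B f"
    and runit_iso: "f \<in> hom1 B a b \<Longrightarrow> runit B f \<in> iso2 B (f \<odot> id1 B a) f"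
    and runit_natural: "\<lbrakk>f \<in> hom1 B a b; \<alpha> \<in> hom2 B f f'\<rbrakk>
          \<Longrightarrow> runit B f' \<cdot> (\<alpha> \<star> id2 B (id1 B a)) = \<alpha> \<cdot> runit B f"
    and pentagon: "\<lbrakk>k \<in> hom1 B d e; h \<in> hom1 B c d; g \<in> hom1 B b c; f \<in> hom1 B a b\<rbrakk>
          \<Longrightarrow> (id2 B k \<star> assoc B h g f) \<cdot> assoc B k (h \<odot> g) f \<cdot> (assoc B k h g \<star> id2 B f)
            = assoc B k h (g \<odot> f) \<cdot> assoc B (k \<odot> h) g f"
    and triangle: "\<lbrakk>g \<in> hom1 B b c; f \<in> hom1 B a b\<rbrakk>
          \<Longrightarrow> (id2 B g \<star> lunit B f) \<cdot> assoc B g (id1 B b) f = runit B g \<star> id2 B f"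

definition unit_bicat :: "(unit, unit, unit) bicat" where
  "unit_bicat = \<lparr>ob = UNIV, arr1 = UNIV, arr2 = UNIV,
     src1 = \<lambda>_. (), trg1 = \<lambda>_. (), src2 = \<lambda>_. (), trg2 = \<lambda>_. (),
     id1 = \<lambda>_. (), id2 = \<lambda>_. (), comp1 = \<lambda>_ _. (), vcomp = \<lambda>_ _. (), hcomp = \<lambda>_ _. (),
     assoc = \<lambda>_ _ _. (), lunit = \<lambda>_. (), runit = \<lambda>_. ()\<rparr>"

definition prod_bicat ::
  "('o1, 'm1, 'c1) bicat \<Rightarrow> ('o2, 'm2, 'c2) bicat \<Rightarrow> ('o1 \<times> 'o2, 'm1 \<times> 'm2, 'c1 \<times> 'c2) bicat"
  where
  "prod_bicat B C = \<lparr>ob = ob B \<times> ob C, arr1 = arr1 B \<times> arr1 C, arr2 = arr2 B \<times> arr2 C,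
     src1 = map_prod (src1 B) (src1 C), trg1 = map_prod (trg1 B) (trg1 C),
     src2 = map_prod (src2 B) (src2 C), trg2 = map_prod (trg2 B) (trg2 C),
     id1 = map_prod (id1 B) (id1 C), id2 = map_prod (id2 B) (id2 C),
     comp1 = \<lambda>(g, g') (f, f'). (g \<odot>\<^bsub>B\<^esub> f, g' \<odot>\<^bsub>C\<^esub> f'),
     vcomp = \<lambda>(\<beta>, \<beta>') (\<alpha>, \<alpha>'). (\<beta> \<cdot>\<^bsub>B\<^esub> \<alpha>, \<beta>' \<cdot>\<^bsub>C\<^esub> \<alpha>'),
     hcomp = \<lambda>(\<beta>, \<beta>') (\<alpha>, \<alpha>'). (\<beta> \<star>\<^bsub>B\<^esub> \<alpha>, \<beta>' \<star>\<^bsub>C\<^esub> \<alpha>'),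
     assoc = \<lambda>(h, h') (g, g') (f, f'). (assoc B h g f, assoc C h' g' f'),
     lunit = map_prod (lunit B) (lunit C), runit = map_prod (runit B) (runit C)\<rparr>"


section \<open>Functors (homomorphisms) of bicategories\<close>

text \<open>
  The constraints are \<open>pf_comp2 F g f : F g \<odot> F f \<Rightarrow> F (g \<odot> f)\<close> and
  \<open>pf_unit F a : 1 \<Rightarrow> F 1\<close>.
\<close>

record ('o, 'm, 'c, 'p, 'n, 'd) pfun =
  pf0 :: "'o \<Rightarrow> 'p"
  pf1 :: "'m \<Rightarrow> 'n"
  pf2 :: "'c \<Rightarrow> 'd"
  pf_comp2 :: "'m \<Rightarrow> 'm \<Rightarrow> 'd"
  pf_unit :: "'o \<Rightarrow> 'd"

locale pseudofunctor = B: bicategory B + C: bicategory C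
  for B :: "('o, 'm, 'c) bicat" and C :: "('p, 'n, 'd) bicat" +
  fixes F :: "('o, 'm, 'c, 'p, 'n, 'd) pfun"
  assumes pf0_ob: "a \<in> ob B \<Longrightarrow> pf0 F a \<in> ob C"
    and pf1_hom: "f \<in> hom1 B a b \<Longrightarrow> pf1 F f \<in> hom1 C (pf0 F a) (pf0 F b)"
    and pf2_hom: "\<alpha> \<in> hom2 B f g \<Longrightarrow> pf2 F \<alpha> \<in> hom2 C (pf1 F f) (pf1 F g)"
    and pf2_id: "f \<in> arr1 B \<Longrightarrow> pf2 F (id2 B f) = id2 C (pf1 F f)"
    and pf2_vcomp: "\<lbrakk>\<beta> \<in> hom2 B g h; \<alpha> \<in> hom2 B f g\<rbrakk>
          \<Longrightarrow> pf2 F (\<beta> \<cdot>\<^bsub>B\<^esub> \<alpha>) = pf2 F \<beta> \<cdot>\<^bsub>C\<^esub> pf2 F \<alpha>"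
    and pf_comp2_iso: "\<lbrakk>g \<in> hom1 B b c; f \<in> hom1 B a b\<rbrakk>
          \<Longrightarrow> pf_comp2 F g f \<in> iso2 C (pf1 F g \<odot>\<^bsub>C\<^esub> pf1 F f) (pf1 F (g \<odot>\<^bsub>B\<^esub> f))"
    and pf_comp2_natural: "\<lbrakk>g \<in> hom1 B b c; f \<in> hom1 B a b; \<beta> \<in> hom2 B g g'; \<alpha> \<in> hom2 B f f'\<rbrakk>
          \<Longrightarrow> pf_comp2 F g' f' \<cdot>\<^bsub>C\<^esub> (pf2 F \<beta> \<star>\<^bsub>C\<^esub> pf2 F \<alpha>) = pf2 F (\<beta> \<star>\<^bsub>B\<^esub> \<alpha>) \<cdot>\<^bsub>C\<^esub> pf_comp2 F g f"
    and pf_unit_iso: "a \<in> ob B \<Longrightarrow> pf_unit F a \<in> iso2 C (id1 C (pf0 F a)) (pf1 F (id1 B a))"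
    and pf_assoc: "\<lbrakk>h \<in> hom1 B c d; g \<in> hom1 B b c; f \<in> hom1 B a b\<rbrakk>
          \<Longrightarrow> pf2 F (assoc B h g f) \<cdot>\<^bsub>C\<^esub> pf_comp2 F (h \<odot>\<^bsub>B\<^esub> g) f
                \<cdot>\<^bsub>C\<^esub> (pf_comp2 F h g \<star>\<^bsub>C\<^esub> id2 C (pf1 F f))
            = pf_comp2 F h (g \<odot>\<^bsub>B\<^esub> f) \<cdot>\<^bsub>C\<^esub> (id2 C (pf1 F h) \<star>\<^bsub>C\<^esub> pf_comp2 F g f)
                \<cdot>\<^bsub>C\<^esub> assoc C (pf1 F h) (pf1 F g) (pf1 F f)"
    and pf_lunit: "f \<in> hom1 B a b
          \<Longrightarrow> pf2 F (lunit B f) \<cdot>\<^bsub>C\<^esub> pf_comp2 F (id1 B b) f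
                \<cdot>\<^bsub>C\<^esub> (pf_unit F b \<star>\<^bsub>C\<^esub> id2 C (pf1 F f)) = lunit C (pf1 F f)"
    and pf_runit: "f \<in> hom1 B a b
          \<Longrightarrow> pf2 F (runit B f) \<cdot>\<^bsub>C\<^esub> pf_comp2 F f (id1 B a)
                \<cdot>\<^bsub>C\<^esub> (id2 C (pf1 F f) \<star>\<^bsub>C\<^esub> pf_unit F a) = runit C (pf1 F f)"

definition pf_strict :: "('o, 'm, 'c) bicat \<Rightarrow> ('p, 'n, 'd) bicat \<Rightarrow>
    ('o \<Rightarrow> 'p) \<Rightarrow> ('m \<Rightarrow> 'n) \<Rightarrow> ('c \<Rightarrow> 'd) \<Rightarrow> ('o, 'm, 'c, 'p, 'n, 'd) pfun" where
  "pf_strict B C F0 F1 F2 = \<lparr>pf0 = F0, pf1 = F1, pf2 = F2,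
     pf_comp2 = \<lambda>g f. id2 C (F1 (g \<odot>\<^bsub>B\<^esub> f)), pf_unit = \<lambda>a. id2 C (F1 (id1 B a))\<rparr>"

definition pf_id :: "('o, 'm, 'c) bicat \<Rightarrow> ('o, 'm, 'c, 'o, 'm, 'c) pfun" where
  "pf_id B = pf_strict B B (\<lambda>x. x) (\<lambda>f. f) (\<lambda>\<alpha>. \<alpha>)"

text \<open>The functor constant at an object \<open>x\<close> of \<open>C\<close>; its composition constraint is
  \<open>1 \<odot> 1 \<Rightarrow> 1\<close>.\<close>

definition pf_const :: "('p, 'n, 'd) bicat \<Rightarrow> 'p \<Rightarrow> ('o, 'm, 'c, 'p, 'n, 'd) pfun" where
  "pf_const C x = \<lparr>pf0 = \<lambda>_. x, pf1 = \<lambda>_. id1 C x, pf2 = \<lambda>_. id2 C (id1 C x),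
     pf_comp2 = \<lambda>_ _. lunit C (id1 C x), pf_unit = \<lambda>_. id2 C (id1 C x)\<rparr>"

definition pf_comp :: "('q, 'l, 'e) bicat \<Rightarrow> ('p, 'n, 'd, 'q, 'l, 'e) pfun \<Rightarrow>
    ('o, 'm, 'c, 'p, 'n, 'd) pfun \<Rightarrow> ('o, 'm, 'c, 'q, 'l, 'e) pfun" where
  "pf_comp D G F = \<lparr>pf0 = \<lambda>x. pf0 G (pf0 F x), pf1 = \<lambda>f. pf1 G (pf1 F f),
     pf2 = \<lambda>\<alpha>. pf2 G (pf2 F \<alpha>),
     pf_comp2 = \<lambda>g f. pf2 G (pf_comp2 F g f) \<cdot>\<^bsub>D\<^esub> pf_comp2 G (pf1 F g) (pf1 F f),
     pf_unit = \<lambda>a. pf2 G (pf_unit F a) \<cdot>\<^bsub>D\<^esub> pf_unit G (pf0 F a)\<rparr>"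

definition pf_pair :: "('o, 'm, 'c, 'p, 'n, 'd) pfun \<Rightarrow> ('o, 'm, 'c, 'q, 'l, 'e) pfun \<Rightarrow>
    ('o, 'm, 'c, 'p \<times> 'q, 'n \<times> 'l, 'd \<times> 'e) pfun" where
  "pf_pair F G = \<lparr>pf0 = \<lambda>x. (pf0 F x, pf0 G x), pf1 = \<lambda>f. (pf1 F f, pf1 G f),
     pf2 = \<lambda>\<alpha>. (pf2 F \<alpha>, pf2 G \<alpha>),
     pf_comp2 = \<lambda>g f. (pf_comp2 F g f, pf_comp2 G g f),
     pf_unit = \<lambda>a. (pf_unit F a, pf_unit G a)\<rparr>"

definition pf_prod :: "('o, 'm, 'c, 'p, 'n, 'd) pfun \<Rightarrow> ('o', 'm', 'c', 'q, 'l, 'e) pfun \<Rightarrow>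
    ('o \<times> 'o', 'm \<times> 'm', 'c \<times> 'c', 'p \<times> 'q, 'n \<times> 'l, 'd \<times> 'e) pfun" where
  "pf_prod F G = \<lparr>pf0 = map_prod (pf0 F) (pf0 G), pf1 = map_prod (pf1 F) (pf1 G),
     pf2 = map_prod (pf2 F) (pf2 G),
     pf_comp2 = \<lambda>(g, g') (f, f'). (pf_comp2 F g f, pf_comp2 G g' f'),
     pf_unit = map_prod (pf_unit F) (pf_unit G)\<rparr>"

text \<open>Iterated products are nested to the right; these strict functors regroup the factors.\<close>

definition pf_group3 :: "('o1, 'm1, 'c1) bicat \<Rightarrow> ('o2, 'm2, 'c2) bicat \<Rightarrow> ('o3, 'm3, 'c3) bicat \<Rightarrow>
    ('o1 \<times> 'o2 \<times> 'o3, 'm1 \<times> 'm2 \<times> 'm3, 'c1 \<times> 'c2 \<times> 'c3,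
     ('o1 \<times> 'o2) \<times> 'o3, ('m1 \<times> 'm2) \<times> 'm3, ('c1 \<times> 'c2) \<times> 'c3) pfun" where
  "pf_group3 B C D = pf_strict (prod_bicat B (prod_bicat C D)) (prod_bicat (prod_bicat B C) D)
     (\<lambda>(x, y, z). ((x, y), z)) (\<lambda>(x, y, z). ((x, y), z)) (\<lambda>(x, y, z). ((x, y), z))"

definition pf_group4 :: "('o1, 'm1, 'c1) bicat \<Rightarrow> ('o2, 'm2, 'c2) bicat \<Rightarrow> ('o3, 'm3, 'c3) bicat \<Rightarrow>
    ('o4, 'm4, 'c4) bicat \<Rightarrow>
    ('o1 \<times> 'o2 \<times> 'o3 \<times> 'o4, 'm1 \<times> 'm2 \<times> 'm3 \<times> 'm4, 'c1 \<times> 'c2 \<times> 'c3 \<times> 'c4,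
     ('o1 \<times> 'o2 \<times> 'o3) \<times> 'o4, ('m1 \<times> 'm2 \<times> 'm3) \<times> 'm4, ('c1 \<times> 'c2 \<times> 'c3) \<times> 'c4) pfun" where
  "pf_group4 B C D E = pf_strict (prod_bicat B (prod_bicat C (prod_bicat D E)))
     (prod_bicat (prod_bicat B (prod_bicat C D)) E)
     (\<lambda>(w, x, y, z). ((w, x, y), z)) (\<lambda>(w, x, y, z). ((w, x, y), z))
     (\<lambda>(w, x, y, z). ((w, x, y), z))"

text \<open>For a functor \<open>I\<close> from the unit bicategory to \<open>U\<close>: the functors
  \<open>I \<times> 1 : B \<rightarrow> U \<times> B\<close> and \<open>1 \<times> I : B \<rightarrow> B \<times> U\<close>.\<close>

definition pf_ins_left :: "('p, 'n, 'd) bicat \<Rightarrow> (unit, unit, unit, 'p, 'n, 'd) pfun \<Rightarrow>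
    ('o, 'm, 'c) bicat \<Rightarrow> ('o, 'm, 'c, 'p \<times> 'o, 'n \<times> 'm, 'd \<times> 'c) pfun" where
  "pf_ins_left U I B = pf_comp (prod_bicat U B) (pf_prod I (pf_id B))
     (pf_strict B (prod_bicat unit_bicat B) (\<lambda>x. ((), x)) (\<lambda>f. ((), f)) (\<lambda>\<alpha>. ((), \<alpha>)))"

definition pf_ins_right :: "('p, 'n, 'd) bicat \<Rightarrow> (unit, unit, unit, 'p, 'n, 'd) pfun \<Rightarrow>
    ('o, 'm, 'c) bicat \<Rightarrow> ('o, 'm, 'c, 'o \<times> 'p, 'm \<times> 'n, 'c \<times> 'd) pfun" where
  "pf_ins_right U I B = pf_comp (prod_bicat B U) (pf_prod (pf_id B) I)
     (pf_strict B (prod_bicat B unit_bicat) (\<lambda>x. (x, ())) (\<lambda>f. (f, ())) (\<lambda>\<alpha>. (\<alpha>, ())))"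


section \<open>Pseudonatural transformations, modifications, adjoint equivalences\<close>

text \<open>
  A transformation \<open>\<sigma> : F \<Rightarrow> G\<close> between functors \<open>B \<rightarrow> C\<close> has components
  \<open>tr0 \<sigma> a : F a \<rightarrow> G a\<close> and invertible naturality cells
  \<open>tr1 \<sigma> f : G f \<odot> tr0 \<sigma> a \<Rightarrow> tr0 \<sigma> b \<odot> F f\<close> for \<open>f : a \<rightarrow> b\<close>.
\<close>

record ('o, 'm, 'n, 'd) ptrans =
  tr0 :: "'o \<Rightarrow> 'n"
  tr1 :: "'m \<Rightarrow> 'd"

locale pseudonatural =
  F: pseudofunctor B C F + G: pseudofunctor B C G
  for B :: "('o, 'm, 'c) bicat" and C :: "('p, 'n, 'd) bicat"
    and F :: "('o, 'm, 'c, 'p, 'n, 'd) pfun" and G :: "('o, 'm, 'c, 'p, 'n, 'd) pfun" +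
  fixes \<sigma> :: "('o, 'm, 'n, 'd) ptrans"
  assumes tr0_hom: "a \<in> ob B \<Longrightarrow> tr0 \<sigma> a \<in> hom1 C (pf0 F a) (pf0 G a)"
    and tr1_iso: "f \<in> hom1 B a b
          \<Longrightarrow> tr1 \<sigma> f \<in> iso2 C (pf1 G f \<odot>\<^bsub>C\<^esub> tr0 \<sigma> a) (tr0 \<sigma> b \<odot>\<^bsub>C\<^esub> pf1 F f)"
    and tr1_natural: "\<lbrakk>f \<in> hom1 B a b; \<alpha> \<in> hom2 B f f'\<rbrakk>
          \<Longrightarrow> tr1 \<sigma> f' \<cdot>\<^bsub>C\<^esub> (pf2 G \<alpha> \<star>\<^bsub>C\<^esub> id2 C (tr0 \<sigma> a))
            = (id2 C (tr0 \<sigma> b) \<star>\<^bsub>C\<^esub> pf2 F \<alpha>) \<cdot>\<^bsub>C\<^esub> tr1 \<sigma> f"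
    and tr1_comp: "\<lbrakk>g \<in> hom1 B b c; f \<in> hom1 B a b\<rbrakk>
          \<Longrightarrow> tr1 \<sigma> (g \<odot>\<^bsub>B\<^esub> f) \<cdot>\<^bsub>C\<^esub> (pf_comp2 G g f \<star>\<^bsub>C\<^esub> id2 C (tr0 \<sigma> a))
            = (id2 C (tr0 \<sigma> c) \<star>\<^bsub>C\<^esub> pf_comp2 F g f)
                \<cdot>\<^bsub>C\<^esub> assoc C (tr0 \<sigma> c) (pf1 F g) (pf1 F f)
                \<cdot>\<^bsub>C\<^esub> (tr1 \<sigma> g \<star>\<^bsub>C\<^esub> id2 C (pf1 F f))
                \<cdot>\<^bsub>C\<^esub> inv2 C (assoc C (pf1 G g) (tr0 \<sigma> b) (pf1 F f))
                \<cdot>\<^bsub>C\<^esub> (id2 C (pf1 G g) \<star>\<^bsub>C\<^esub> tr1 \<sigma> f)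
                \<cdot>\<^bsub>C\<^esub> assoc C (pf1 G g) (pf1 G f) (tr0 \<sigma> a)"
    and tr1_id: "a \<in> ob B
          \<Longrightarrow> tr1 \<sigma> (id1 B a) \<cdot>\<^bsub>C\<^esub> (pf_unit G a \<star>\<^bsub>C\<^esub> id2 C (tr0 \<sigma> a))
            = (id2 C (tr0 \<sigma> a) \<star>\<^bsub>C\<^esub> pf_unit F a)
                \<cdot>\<^bsub>C\<^esub> inv2 C (runit C (tr0 \<sigma> a)) \<cdot>\<^bsub>C\<^esub> lunit C (tr0 \<sigma> a)"

definition tr_id :: "('p, 'n, 'd) bicat \<Rightarrow> ('o, 'm, 'c, 'p, 'n, 'd) pfun \<Rightarrow> ('o, 'm, 'n, 'd) ptrans"
  where
  "tr_id C F = \<lparr>tr0 = \<lambda>a. id1 C (pf0 F a),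
     tr1 = \<lambda>f. inv2 C (lunit C (pf1 F f)) \<cdot>\<^bsub>C\<^esub> runit C (pf1 F f)\<rparr>"

text \<open>The composite of \<open>\<sigma> : F \<Rightarrow> G\<close> and \<open>\<tau> : G \<Rightarrow> H\<close>, for functors from \<open>B\<close> to \<open>C\<close>.\<close>

definition tr_comp :: "('o, 'm, 'c) bicat \<Rightarrow> ('p, 'n, 'd) bicat \<Rightarrow>
    ('o, 'm, 'c, 'p, 'n, 'd) pfun \<Rightarrow> ('o, 'm, 'c, 'p, 'n, 'd) pfun \<Rightarrow>
    ('o, 'm, 'c, 'p, 'n, 'd) pfun \<Rightarrow>
    ('o, 'm, 'n, 'd) ptrans \<Rightarrow> ('o, 'm, 'n, 'd) ptrans \<Rightarrow> ('o, 'm, 'n, 'd) ptrans" where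
  "tr_comp B C F G H \<tau> \<sigma> = \<lparr>tr0 = \<lambda>a. tr0 \<tau> a \<odot>\<^bsub>C\<^esub> tr0 \<sigma> a,
     tr1 = \<lambda>f. let a = src1 B f; b = trg1 B f in
       inv2 C (assoc C (tr0 \<tau> b) (tr0 \<sigma> b) (pf1 F f))
       \<cdot>\<^bsub>C\<^esub> (id2 C (tr0 \<tau> b) \<star>\<^bsub>C\<^esub> tr1 \<sigma> f)
       \<cdot>\<^bsub>C\<^esub> assoc C (tr0 \<tau> b) (pf1 G f) (tr0 \<sigma> a)
       \<cdot>\<^bsub>C\<^esub> (tr1 \<tau> f \<star>\<^bsub>C\<^esub> id2 C (tr0 \<sigma> a))
       \<cdot>\<^bsub>C\<^esub> inv2 C (assoc C (pf1 H f) (tr0 \<tau> a) (tr0 \<sigma> a))\<rparr>"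

text \<open>For \<open>\<sigma> : F \<Rightarrow> G : B \<rightarrow> C\<close> and \<open>K : C \<rightarrow> D\<close>, the whiskering \<open>K \<sigma> : K F \<Rightarrow> K G\<close>.\<close>

definition tr_whisk_left :: "('o, 'm, 'c) bicat \<Rightarrow> ('q, 'l, 'e) bicat \<Rightarrow>
    ('p, 'n, 'd, 'q, 'l, 'e) pfun \<Rightarrow>
    ('o, 'm, 'c, 'p, 'n, 'd) pfun \<Rightarrow> ('o, 'm, 'c, 'p, 'n, 'd) pfun \<Rightarrow>
    ('o, 'm, 'n, 'd) ptrans \<Rightarrow> ('o, 'm, 'l, 'e) ptrans" where
  "tr_whisk_left B D K F G \<sigma> = \<lparr>tr0 = \<lambda>a. pf1 K (tr0 \<sigma> a),
     tr1 = \<lambda>f. inv2 D (pf_comp2 K (tr0 \<sigma> (trg1 B f)) (pf1 F f))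
       \<cdot>\<^bsub>D\<^esub> pf2 K (tr1 \<sigma> f)
       \<cdot>\<^bsub>D\<^esub> pf_comp2 K (pf1 G f) (tr0 \<sigma> (src1 B f))\<rparr>"

text \<open>For \<open>\<sigma> : F \<Rightarrow> G : B \<rightarrow> C\<close> and \<open>E : A \<rightarrow> B\<close>, the whiskering \<open>\<sigma> E : F E \<Rightarrow> G E\<close>.\<close>

definition tr_whisk_right :: "('p, 'n, 'l, 'e) ptrans \<Rightarrow> ('o, 'm, 'c, 'p, 'n, 'd) pfun \<Rightarrow>
    ('o, 'm, 'l, 'e) ptrans" where
  "tr_whisk_right \<sigma> E = \<lparr>tr0 = \<lambda>a. tr0 \<sigma> (pf0 E a), tr1 = \<lambda>f. tr1 \<sigma> (pf1 E f)\<rparr>"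

definition tr_prod :: "('o, 'm, 'n, 'd) ptrans \<Rightarrow> ('o', 'm', 'n', 'd') ptrans \<Rightarrow>
    ('o \<times> 'o', 'm \<times> 'm', 'n \<times> 'n', 'd \<times> 'd') ptrans" where
  "tr_prod \<sigma> \<tau> = \<lparr>tr0 = map_prod (tr0 \<sigma>) (tr0 \<tau>), tr1 = map_prod (tr1 \<sigma>) (tr1 \<tau>)\<rparr>"

locale modification =
  \<sigma>: pseudonatural B C F G \<sigma> + \<tau>: pseudonatural B C F G \<tau>
  for B :: "('o, 'm, 'c) bicat" and C :: "('p, 'n, 'd) bicat"
    and F :: "('o, 'm, 'c, 'p, 'n, 'd) pfun" and G :: "('o, 'm, 'c, 'p, 'n, 'd) pfun"
    and \<sigma> :: "('o, 'm, 'n, 'd) ptrans" and \<tau> :: "('o, 'm, 'n, 'd) ptrans" +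
  fixes \<Gamma> :: "'o \<Rightarrow> 'd"
  assumes mod_hom: "a \<in> ob B \<Longrightarrow> \<Gamma> a \<in> hom2 C (tr0 \<sigma> a) (tr0 \<tau> a)"
    and mod_natural: "f \<in> hom1 B a b
          \<Longrightarrow> tr1 \<tau> f \<cdot>\<^bsub>C\<^esub> (id2 C (pf1 G f) \<star>\<^bsub>C\<^esub> \<Gamma> a)
            = (\<Gamma> b \<star>\<^bsub>C\<^esub> id2 C (pf1 F f)) \<cdot>\<^bsub>C\<^esub> tr1 \<sigma> f"

text \<open>A modification is invertible iff all its components are; the inverse components then
  form a modification.\<close>

locale invertible_modification = modification +
  assumes mod_iso: "a \<in> ob B \<Longrightarrow> \<Gamma> a \<in> iso2 C (tr0 \<sigma> a) (tr0 \<tau> a)"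

record ('o, 'm, 'n, 'd) adj_eqv =
  fwd :: "('o, 'm, 'n, 'd) ptrans"
  bwd :: "('o, 'm, 'n, 'd) ptrans"
  adj_unit :: "'o \<Rightarrow> 'd"
  adj_counit :: "'o \<Rightarrow> 'd"

text \<open>
  An adjoint equivalence \<open>F \<simeq> G\<close> in the bicategory of functors \<open>B \<rightarrow> C\<close>, transformations and
  modifications, whose 2-cells are composed componentwise.  The last two conditions are the
  triangle identities of this bicategory, read at an object \<open>a\<close>.
\<close>

locale adjoint_equivalence =
  fixes B :: "('o, 'm, 'c) bicat" and C :: "('p, 'n, 'd) bicat"
    and F :: "('o, 'm, 'c, 'p, 'n, 'd) pfun" and G :: "('o, 'm, 'c, 'p, 'n, 'd) pfun"
    and A :: "('o, 'm, 'n, 'd) adj_eqv"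
  assumes fwd_pseudonatural: "pseudonatural B C F G (fwd A)"
    and bwd_pseudonatural: "pseudonatural B C G F (bwd A)"
    and unit_modification:
      "invertible_modification B C F F (tr_id C F) (tr_comp B C F G F (bwd A) (fwd A)) (adj_unit A)"
    and counit_modification:
      "invertible_modification B C G G (tr_comp B C G F G (fwd A) (bwd A)) (tr_id C G) (adj_counit A)"
    and fwd_triangle: "\<And>a. a \<in> ob B \<Longrightarrow> (let f = tr0 (fwd A) a; g = tr0 (bwd A) a in
        lunit C f \<cdot>\<^bsub>C\<^esub> (adj_counit A a \<star>\<^bsub>C\<^esub> id2 C f) \<cdot>\<^bsub>C\<^esub> inv2 C (assoc C f g f)
        \<cdot>\<^bsub>C\<^esub> (id2 C f \<star>\<^bsub>C\<^esub> adj_unit A a) \<cdot>\<^bsub>C\<^esub> inv2 C (runit C f) = id2 C f)"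
    and bwd_triangle: "\<And>a. a \<in> ob B \<Longrightarrow> (let f = tr0 (fwd A) a; g = tr0 (bwd A) a in
        runit C g \<cdot>\<^bsub>C\<^esub> (id2 C g \<star>\<^bsub>C\<^esub> adj_counit A a) \<cdot>\<^bsub>C\<^esub> assoc C g f g
        \<cdot>\<^bsub>C\<^esub> (adj_unit A a \<star>\<^bsub>C\<^esub> id2 C g) \<cdot>\<^bsub>C\<^esub> inv2 C (lunit C g) = id2 C g)"


section \<open>Pasting in a bicategory\<close>

text \<open>
  A nonempty list \<open>[f\<^sub>n, \<dots>, f\<^sub>1]\<close> of composable 1-cells stands for its right-bracketed composite
  \<open>f\<^sub>n \<odot> (\<dots> \<odot> f\<^sub>1)\<close>.  A pasting step \<open>(p, l, \<alpha>, l', s)\<close> replaces the middle part of the path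
  \<open>p @ l @ s\<close> by \<open>l'\<close> along a 2-cell \<open>\<alpha> : path_comp l \<Rightarrow> path_comp l'\<close>, with the associativity
  constraints inserted that are needed to bracket \<open>l\<close> and \<open>l'\<close> together; \<open>p\<close> and \<open>s\<close> may be empty.
\<close>

fun path_comp :: "('o, 'm, 'c) bicat \<Rightarrow> 'm list \<Rightarrow> 'm" where
  "path_comp B [] = undefined"
| "path_comp B [f] = f"
| "path_comp B (f # g # l) = f \<odot>\<^bsub>B\<^esub> path_comp B (g # l)"

text \<open>\<open>path_join B l s : path_comp l \<odot> path_comp s \<Rightarrow> path_comp (l @ s)\<close> for nonempty \<open>l\<close>, \<open>s\<close>.\<close>

fun path_join :: "('o, 'm, 'c) bicat \<Rightarrow> 'm list \<Rightarrow> 'm list \<Rightarrow> 'c" where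
  "path_join B [] s = undefined"
| "path_join B [f] s = id2 B (f \<odot>\<^bsub>B\<^esub> path_comp B s)"
| "path_join B (f # g # l) s =
     (id2 B f \<star>\<^bsub>B\<^esub> path_join B (g # l) s) \<cdot>\<^bsub>B\<^esub> assoc B f (path_comp B (g # l)) (path_comp B s)"

type_synonym ('m, 'c) paste_step = "'m list \<times> 'm list \<times> 'c \<times> 'm list \<times> 'm list"

fun paste_step :: "('o, 'm, 'c) bicat \<Rightarrow> ('m, 'c) paste_step \<Rightarrow> 'c" where
  "paste_step B (p, l, \<alpha>, l', s) = foldr (\<lambda>f \<beta>. id2 B f \<star>\<^bsub>B\<^esub> \<beta>) p
     (if s = [] then \<alpha>
      else path_join B l' s \<cdot>\<^bsub>B\<^esub> (\<alpha> \<star>\<^bsub>B\<^esub> id2 B (path_comp B s)) \<cdot>\<^bsub>B\<^esub> inv2 B (path_join B l s))"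

text \<open>The steps are listed in the order in which they are performed.\<close>

fun pasting :: "('o, 'm, 'c) bicat \<Rightarrow> ('m, 'c) paste_step list \<Rightarrow> 'c" where
  "pasting B [] = undefined"
| "pasting B [x] = paste_step B x"
| "pasting B (x # y # l) = pasting B (y # l) \<cdot>\<^bsub>B\<^esub> paste_step B x"

text \<open>\<open>pf_path B C F l : path_comp (map F l) \<Rightarrow> F (path_comp l)\<close>\<close>

fun pf_path :: "('o, 'm, 'c) bicat \<Rightarrow> ('p, 'n, 'd) bicat \<Rightarrow> ('o, 'm, 'c, 'p, 'n, 'd) pfun \<Rightarrow>
    'm list \<Rightarrow> 'd" where
  "pf_path B C F [] = undefined"
| "pf_path B C F [f] = id2 C (pf1 F f)"
| "pf_path B C F (f # g # l) =
     pf_comp2 F f (path_comp B (g # l)) \<cdot>\<^bsub>C\<^esub> (id2 C (pf1 F f) \<star>\<^bsub>C\<^esub> pf_path B C F (g # l))"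

text \<open>For \<open>\<alpha> : path_comp l \<Rightarrow> path_comp l'\<close>, the 2-cell \<open>F \<alpha>\<close> regarded as a 2-cell
  \<open>path_comp (map F l) \<Rightarrow> path_comp (map F l')\<close>; in the second definition
  \<open>\<alpha> : path_comp l \<Rightarrow> 1\<^sub>x\<close> and the result is a 2-cell \<open>path_comp (map F l) \<Rightarrow> 1\<close>.\<close>

definition pf_cell :: "('o, 'm, 'c) bicat \<Rightarrow> ('p, 'n, 'd) bicat \<Rightarrow> ('o, 'm, 'c, 'p, 'n, 'd) pfun \<Rightarrow>
    'm list \<Rightarrow> 'm list \<Rightarrow> 'c \<Rightarrow> 'd" where
  "pf_cell B C F l l' \<alpha> = inv2 C (pf_path B C F l') \<cdot>\<^bsub>C\<^esub> pf2 F \<alpha> \<cdot>\<^bsub>C\<^esub> pf_path B C F l"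

definition pf_cell_unit :: "('o, 'm, 'c) bicat \<Rightarrow> ('p, 'n, 'd) bicat \<Rightarrow>
    ('o, 'm, 'c, 'p, 'n, 'd) pfun \<Rightarrow> 'm list \<Rightarrow> 'o \<Rightarrow> 'c \<Rightarrow> 'd" where
  "pf_cell_unit B C F l x \<alpha> = inv2 C (pf_unit F x) \<cdot>\<^bsub>C\<^esub> pf2 F \<alpha> \<cdot>\<^bsub>C\<^esub> pf_path B C F l"


section \<open>Tricategories\<close>

text \<open>
  Tricategories in the sense of Gordon, Power and Street, in Gurski's algebraic form: the
  equivalences are given as adjoint equivalences, and these are part of the data.
  \<open>tcomp T a b c : T(b,c) \<times> T(a,b) \<rightarrow> T(a,c)\<close> is the composition functor, \<open>tunit T a : 1 \<rightarrow> T(a,a)\<close>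
  the unit; \<open>tassoc\<close>, \<open>tlunit\<close>, \<open>trunit\<close> are the adjoint equivalences \<open>a\<close>, \<open>l\<close>, \<open>r\<close> and
  \<open>tpi\<close>, \<open>tmu\<close>, \<open>tlambda\<close>, \<open>trho\<close> the modifications.
\<close>

record ('x, 'o, 'm, 'c) tricat =
  tob :: "'x set"
  thom :: "'x \<Rightarrow> 'x \<Rightarrow> ('o, 'm, 'c) bicat"
  tcomp :: "'x \<Rightarrow> 'x \<Rightarrow> 'x \<Rightarrow> ('o \<times> 'o, 'm \<times> 'm, 'c \<times> 'c, 'o, 'm, 'c) pfun"
  tunit :: "'x \<Rightarrow> (unit, unit, unit, 'o, 'm, 'c) pfun"
  tassoc :: "'x \<Rightarrow> 'x \<Rightarrow> 'x \<Rightarrow> 'x \<Rightarrow> ('o \<times> 'o \<times> 'o, 'm \<times> 'm \<times> 'm, 'm, 'c) adj_eqv"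
  tlunit :: "'x \<Rightarrow> 'x \<Rightarrow> ('o, 'm, 'm, 'c) adj_eqv"
  trunit :: "'x \<Rightarrow> 'x \<Rightarrow> ('o, 'm, 'm, 'c) adj_eqv"
  tpi :: "'x \<Rightarrow> 'x \<Rightarrow> 'x \<Rightarrow> 'x \<Rightarrow> 'x \<Rightarrow> 'o \<times> 'o \<times> 'o \<times> 'o \<Rightarrow> 'c"
  tmu :: "'x \<Rightarrow> 'x \<Rightarrow> 'x \<Rightarrow> 'o \<times> 'o \<Rightarrow> 'c"
  tlambda :: "'x \<Rightarrow> 'x \<Rightarrow> 'x \<Rightarrow> 'o \<times> 'o \<Rightarrow> 'c"
  trho :: "'x \<Rightarrow> 'x \<Rightarrow> 'x \<Rightarrow> 'o \<times> 'o \<Rightarrow> 'c"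

subsection \<open>The functors and transformations between which the constraints live\<close>

context
  fixes T :: "('x, 'o, 'm, 'c) tricat"
begin

definition thom2 where "thom2 a b c = prod_bicat (thom T b c) (thom T a b)"
definition thom3 where "thom3 a b c d = prod_bicat (thom T c d) (thom2 a b c)"
definition thom4 where "thom4 a b c d e = prod_bicat (thom T d e) (thom3 a b c d)"

text \<open>\<open>\<otimes> \<times> 1 : T(c,d) \<times> T(b,c) \<times> T(a,b) \<rightarrow> T(b,d) \<times> T(a,b)\<close>, and, for any bicategory \<open>A\<close> in
  place of \<open>T(a,b)\<close>, the functor \<open>\<otimes> \<times> 1 : T(c,d) \<times> T(b,c) \<times> A \<rightarrow> T(b,d) \<times> A\<close>.\<close>

definition comp_times ::
  "'x \<Rightarrow> 'x \<Rightarrow> 'x \<Rightarrow> ('p, 'n, 'd) bicat \<Rightarrow>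
   ('o \<times> 'o \<times> 'p, 'm \<times> 'm \<times> 'n, 'c \<times> 'c \<times> 'd, 'o \<times> 'p, 'm \<times> 'n, 'c \<times> 'd) pfun" where
  "comp_times b c d A = pf_comp (prod_bicat (thom T b d) A)
     (pf_prod (tcomp T b c d) (pf_id A)) (pf_group3 (thom T c d) (thom T b c) A)"

definition times_comp ::
  "('p, 'n, 'd) bicat \<Rightarrow> 'x \<Rightarrow> 'x \<Rightarrow> 'x \<Rightarrow>
   ('p \<times> 'o \<times> 'o, 'n \<times> 'm \<times> 'm, 'd \<times> 'c \<times> 'c, 'p \<times> 'o, 'n \<times> 'm, 'd \<times> 'c) pfun" where
  "times_comp A a b c = pf_prod (pf_id A) (tcomp T a b c)"

text \<open>\<open>(h, g, f) \<mapsto> (h \<otimes> g) \<otimes> f\<close> and \<open>(h, g, f) \<mapsto> h \<otimes> (g \<otimes> f)\<close>\<close>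

definition comp3_left where
  "comp3_left a b c d = pf_comp (thom T a d) (tcomp T a b d) (comp_times b c d (thom T a b))"
definition comp3_right where
  "comp3_right a b c d = pf_comp (thom T a d) (tcomp T a c d) (times_comp (thom T c d) a b c)"

text \<open>\<open>f \<mapsto> I\<^sub>b \<otimes> f\<close> and \<open>f \<mapsto> f \<otimes> I\<^sub>a\<close>\<close>

definition unit_comp where
  "unit_comp a b = pf_comp (thom T a b) (tcomp T a b b)
     (pf_ins_left (thom T b b) (tunit T b) (thom T a b))"
definition comp_unit where
  "comp_unit a b = pf_comp (thom T a b) (tcomp T a a b)
     (pf_ins_right (thom T a a) (tunit T a) (thom T a b))"

text \<open>The source \<open>\<otimes>(1 \<times> a) \<circ> (a(1 \<times> \<otimes> \<times> 1) \<circ> \<otimes>(a \<times> 1))\<close> and the target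
  \<open>a(1 \<times> 1 \<times> \<otimes>) \<circ> a(\<otimes> \<times> 1 \<times> 1)\<close> of \<open>\<pi>\<close>; with components
  \<open>(1\<^sub>k \<otimes> a\<^sub>h\<^sub>g\<^sub>f) \<odot> (a\<^sub>k\<^sub>,\<^sub>h\<^sub>g\<^sub>,\<^sub>f \<odot> (a\<^sub>k\<^sub>h\<^sub>g \<otimes> 1\<^sub>f))\<close> and \<open>a\<^sub>k\<^sub>,\<^sub>h\<^sub>,\<^sub>g\<^sub>f \<odot> a\<^sub>k\<^sub>h\<^sub>,\<^sub>g\<^sub>,\<^sub>f\<close>.\<close>

definition comp4_first where
  "comp4_first a b c d e = pf_comp (thom T a e) (comp3_left a b c e)
     (comp_times c d e (thom2 a b c))"
definition comp4_last where
  "comp4_last a b c d e = pf_comp (thom T a e) (comp3_right a c d e)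
     (pf_prod (pf_id (thom T d e)) (times_comp (thom T c d) a b c))"

definition pi_source where
  "pi_source a b c d e =
    (let Q = thom4 a b c d e; C = thom T a e;
         reg = pf_group4 (thom T d e) (thom T c d) (thom T b c) (thom T a b);
         mid = pf_prod (pf_id (thom T d e)) (comp_times b c d (thom T a b));
         D = prod_bicat (thom T b e) (thom T a b);
         L = pf_comp D (pf_prod (comp3_left b c d e) (pf_id (thom T a b))) reg;
         R = pf_comp D (pf_prod (comp3_right b c d e) (pf_id (thom T a b))) reg;
         L' = pf_prod (pf_id (thom T d e)) (comp3_left a b c d);
         R' = pf_prod (pf_id (thom T d e)) (comp3_right a b c d);
         \<sigma>1 = tr_whisk_left Q C (tcomp T a b e) L R
                (tr_whisk_right (tr_prod (fwd (tassoc T b c d e))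
                   (tr_id (thom T a b) (pf_id (thom T a b)))) reg);
         \<sigma>2 = tr_whisk_right (fwd (tassoc T a b d e)) mid;
         \<sigma>3 = tr_whisk_left Q C (tcomp T a d e) L' R'
                (tr_prod (tr_id (thom T d e) (pf_id (thom T d e))) (fwd (tassoc T a b c d)));
         F0 = comp4_first a b c d e;
         F1 = pf_comp C (comp3_left a b d e) mid;
         F2 = pf_comp C (comp3_right a b d e) mid;
         F3 = comp4_last a b c d e
     in tr_comp Q C F0 F2 F3 \<sigma>3 (tr_comp Q C F0 F1 F2 \<sigma>2 \<sigma>1))"

definition pi_target where
  "pi_target a b c d e =
    (let Q = thom4 a b c d e; C = thom T a e;
         fst2 = comp_times c d e (thom2 a b c);
         lst2 = pf_prod (pf_id (thom T d e)) (times_comp (thom T c d) a b c)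
     in tr_comp Q C (comp4_first a b c d e) (pf_comp C (comp3_right a b c e) fst2)
          (comp4_last a b c d e)
          (tr_whisk_right (fwd (tassoc T a c d e)) lst2)
          (tr_whisk_right (fwd (tassoc T a b c e)) fst2))"

text \<open>The source of \<open>\<mu>\<close>, with components \<open>(1\<^sub>g \<otimes> l\<^sub>f) \<odot> (a\<^sub>g\<^sub>I\<^sub>f \<odot> (r\<^sup>\<bullet>\<^sub>g \<otimes> 1\<^sub>f))\<close>; the target is the
  identity transformation of \<open>\<otimes>\<close>.\<close>

definition mu_source where
  "mu_source a b c =
    (let Q = thom2 a b c; C = thom T a c; comp = tcomp T a b c;
         ig = pf_id (thom T b c); jf = pf_id (thom T a b);
         mid = pf_prod ig (pf_ins_left (thom T b b) (tunit T b) (thom T a b));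
         \<sigma>1 = tr_whisk_left Q C comp (pf_prod ig jf) (pf_prod (comp_unit b c) jf)
                (tr_prod (bwd (trunit T b c)) (tr_id (thom T a b) jf));
         \<sigma>2 = tr_whisk_right (fwd (tassoc T a b b c)) mid;
         \<sigma>3 = tr_whisk_left Q C comp (pf_prod ig (unit_comp a b)) (pf_prod ig jf)
                (tr_prod (tr_id (thom T b c) ig) (fwd (tlunit T a b)));
         F1 = pf_comp C (comp3_left a b b c) mid;
         F2 = pf_comp C (comp3_right a b b c) mid
     in tr_comp Q C comp F2 comp \<sigma>3 (tr_comp Q C comp F1 F2 \<sigma>2 \<sigma>1))"

text \<open>The boundary of \<open>\<lambda>\<close>, with components \<open>l\<^sub>g \<otimes> 1\<^sub>f\<close> and \<open>l\<^sub>g\<^sub>f \<odot> a\<^sub>I\<^sub>g\<^sub>f\<close>.\<close>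

definition unit_comp2 where
  "unit_comp2 a b c = pf_comp (thom T a c) (comp3_left a b c c)
     (pf_ins_left (thom T c c) (tunit T c) (thom2 a b c))"

definition lambda_source where
  "lambda_source a b c =
    (let ig = pf_id (thom T b c); jf = pf_id (thom T a b)
     in tr_whisk_left (thom2 a b c) (thom T a c) (tcomp T a b c)
          (pf_prod (unit_comp b c) jf) (pf_prod ig jf)
          (tr_prod (fwd (tlunit T b c)) (tr_id (thom T a b) jf)))"

definition lambda_target where
  "lambda_target a b c =
    (let C = thom T a c; comp = tcomp T a b c;
         ins = pf_ins_left (thom T c c) (tunit T c) (thom2 a b c)
     in tr_comp (thom2 a b c) C (unit_comp2 a b c) (pf_comp C (comp3_right a b c c) ins) comp
          (tr_whisk_right (fwd (tlunit T a c)) comp)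
          (tr_whisk_right (fwd (tassoc T a b c c)) ins))"

text \<open>The boundary of \<open>\<rho>\<close>, with components \<open>1\<^sub>g \<otimes> r\<^sup>\<bullet>\<^sub>f\<close> and \<open>a\<^sub>g\<^sub>f\<^sub>I \<odot> r\<^sup>\<bullet>\<^sub>g\<^sub>f\<close>.\<close>

definition comp2_unit where
  "comp2_unit a b c = pf_comp (thom T a c) (comp3_right a a b c)
     (pf_prod (pf_id (thom T b c)) (pf_ins_right (thom T a a) (tunit T a) (thom T a b)))"

definition rho_source where
  "rho_source a b c =
    (let ig = pf_id (thom T b c); jf = pf_id (thom T a b)
     in tr_whisk_left (thom2 a b c) (thom T a c) (tcomp T a b c)
          (pf_prod ig jf) (pf_prod ig (comp_unit a b))
          (tr_prod (tr_id (thom T b c) ig) (bwd (trunit T a b))))"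

definition rho_target where
  "rho_target a b c =
    (let C = thom T a c; comp = tcomp T a b c;
         ins = pf_prod (pf_id (thom T b c)) (pf_ins_right (thom T a a) (tunit T a) (thom T a b))
     in tr_comp (thom2 a b c) C comp (pf_comp C (comp3_left a a b c) ins) (comp2_unit a b c)
          (tr_whisk_right (fwd (tassoc T a a b c)) ins)
          (tr_whisk_right (bwd (trunit T a c)) comp))"


subsection \<open>The axioms\<close>

definition tens where "tens a b c g f = pf0 (tcomp T a b c) (g, f)"

text \<open>The functors \<open>g \<otimes> - : T(a,b) \<rightarrow> T(a,c)\<close> and \<open>- \<otimes> f : T(b,c) \<rightarrow> T(a,c)\<close>.\<close>

definition tens_left where
  "tens_left a b c g = pf_comp (thom T a c) (tcomp T a b c)
     (pf_pair (pf_const (thom T b c) g) (pf_id (thom T a b)))"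
definition tens_right where
  "tens_right a b c f = pf_comp (thom T a c) (tcomp T a b c)
     (pf_pair (pf_id (thom T b c)) (pf_const (thom T a b) f))"

definition asc where "asc a b c d h g f = tr0 (fwd (tassoc T a b c d)) (h, g, f)"

definition asc_nat where
  "asc_nat a b c d \<gamma> \<beta> \<alpha> = tr1 (fwd (tassoc T a b c d)) (\<gamma>, \<beta>, \<alpha>)"

definition unit_ob where "unit_ob a = pf0 (tunit T a) ()"
definition lft where "lft a b f = tr0 (fwd (tlunit T a b)) f"
definition rgt where "rgt a b f = tr0 (bwd (trunit T a b)) f"

definition pi_dom where
  "pi_dom a b c d e k h g f =
    [pf1 (tens_left a d e k) (asc a b c d h g f),
     asc a b d e k (tens b c d h g) f,
     pf1 (tens_right a b e f) (asc b c d e k h g)]"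

definition pi_cod where
  "pi_cod a b c d e k h g f =
    [asc a c d e k h (tens a b c g f), asc a b c e (tens c d e k h) g f]"

definition mu_dom where
  "mu_dom a b c g f =
    [pf1 (tens_left a b c g) (lft a b f),
     asc a b b c g (unit_ob b) f,
     pf1 (tens_right a b c f) (rgt b c g)]"

text \<open>The coherence cells \<open>(1\<^sub>h \<otimes> 1\<^sub>g) \<otimes> p \<Rightarrow> 1\<^sub>h\<^sub>g \<otimes> p\<close> and \<open>p \<otimes> (1\<^sub>g \<otimes> 1\<^sub>f) \<Rightarrow> p \<otimes> 1\<^sub>g\<^sub>f\<close>.\<close>

definition fuse_left where
  "fuse_left a b c d h g p = pf2 (tcomp T a b d)
     (inv2 (thom T b d) (pf_unit (tcomp T b c d) (h, g)), id2 (thom T a b) p)"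
definition fuse_right where
  "fuse_right a b c d p g f = pf2 (tcomp T a c d)
     (id2 (thom T c d) p, inv2 (thom T a c) (pf_unit (tcomp T a b c) (g, f)))"

text \<open>The nonabelian 4-cocycle condition, for \<open>f : a \<rightarrow> b\<close>, \<open>g : b \<rightarrow> c\<close>, \<open>h : c \<rightarrow> d\<close>, \<open>j : d \<rightarrow> e\<close>,
  \<open>k : e \<rightarrow> x\<close>: the two pastings of the boundary of the associahedron, with the path from
  \<open>(((k j) h) g) f\<close> to \<open>k (j (h (g f)))\<close> of length six as source and the one of length three as
  target.\<close>

definition cocycle_axiom where
  "cocycle_axiom a b c d e x k j h g f \<longleftrightarrow>
    (let C = thom T a x;
         gf = tens a b c g f; hg = tens b c d h g; jh = tens c d e j h; kj = tens d e x k j;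
         Lk = tens_left a e x k; Rf = tens_right a b x f;
         a_hgf = asc a b c d h g f; a_jhg = asc b c d e j h g; a_kjh = asc c d e x k j h;
         p1 = pf1 Lk (pf1 (tens_left a d e j) a_hgf);
         p2 = pf1 Lk (asc a b d e j hg f);
         p3 = asc a b e x k (tens b d e j hg) f;
         p4 = pf1 Rf (pf1 (tens_left b e x k) a_jhg);
         p5 = pf1 Rf (asc b c e x k jh g);
         p6 = pf1 Rf (pf1 (tens_right b c x g) a_kjh);
         \<comment> \<open>left-hand side\<close>
         q4 = pf1 Rf (asc b d e x k j hg);
         q5 = pf1 Rf (asc b c d x kj h g);
         u1 = asc a d e x k j (tens a b d hg f);
         u2 = asc a b d x kj hg f;
         v0 = pf1 (tcomp T a d x) (pf1 (tcomp T d e x) (id1 (thom T e x) k, id1 (thom T d e) j), a_hgf);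
         v1 = pf1 (tens_left a d x kj) a_hgf;
         w1 = asc a d e x k j (tens a c d h gf);
         w2 = asc a c d x kj h gf;
         w3 = asc a b c x (tens c d x kj h) g f;
         \<comment> \<open>right-hand side\<close>
         r3 = pf1 Lk (pf1 (tens_right a b e f) a_jhg);
         r4 = asc a b e x k (tens b c e jh g) f;
         s1 = pf1 Lk (asc a c d e j h gf);
         s2 = pf1 Lk (asc a b c e jh g f);
         t2 = asc a c e x k jh gf;
         t3 = asc a b c x (tens c e x k jh) g f;
         y0 = pf1 (tcomp T a c x) (a_kjh, pf1 (tcomp T a b c) (id1 (thom T b c) g, id1 (thom T a b) f));
         y1 = pf1 (tens_right a c x gf) a_kjh
     in pasting C
          [([p1, p2, p3], [p4, p5, p6],
              pf_cell (thom T b x) C Rf (pi_dom b c d e x k j h g) (pi_cod b c d e x k j h g)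
                (tpi T b c d e x (k, j, h, g)), [q4, q5], []),
           ([p1], [p2, p3, q4], tpi T a b d e x (k, j, hg, f), [u1, u2], [q5]),
           ([], [p1, u1], asc_nat a d e x (id1 (thom T e x) k) (id1 (thom T d e) j) a_hgf,
              [w1, v0], [u2, q5]),
           ([w1], [v0], fuse_left a d e x k j a_hgf, [v1], [u2, q5]),
           ([w1], [v1, u2, q5], tpi T a b c d x (kj, h, g, f), [w2, w3], [])]
      = pasting C
          [([p1, p2], [p3, p4],
              inv2 C (asc_nat a b e x (id1 (thom T e x) k) a_jhg (id1 (thom T a b) f)),
              [r3, r4], [p5, p6]),
           ([], [p1, p2, r3],
              pf_cell (thom T a e) C Lk (pi_dom a b c d e j h g f) (pi_cod a b c d e j h g f)
                (tpi T a b c d e (j, h, g, f)), [s1, s2], [r4, p5, p6]),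
           ([s1], [s2, r4, p5], tpi T a b c e x (k, jh, g, f), [t2, t3], [p6]),
           ([s1, t2], [t3, p6],
              inv2 C (asc_nat a b c x a_kjh (id1 (thom T b c) g) (id1 (thom T a b) f)),
              [y0, w3], []),
           ([s1, t2], [y0], fuse_right a b c x a_kjh g f, [y1], [w3]),
           ([], [s1, t2, y1], tpi T a c d e x (k, j, h, gf), [w1, w2], [w3])])"

text \<open>The left normalization axiom, for \<open>f : a \<rightarrow> b\<close>, \<open>g : b \<rightarrow> c\<close>, \<open>h : c \<rightarrow> d\<close>, with the unit
  inserted between \<open>h\<close> and \<open>g\<close>.\<close>

definition left_normalization where
  "left_normalization a b c d h g f \<longleftrightarrow>
    (let C = thom T a d; I = unit_ob c;
         gf = tens a b c g f; hg = tens b c d h g;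
         Lh = tens_left a c d h; Rf = tens_right a b d f;
         a_hgf = asc a b c d h g f; r_h = rgt c d h; l_g = lft b c g;
         p2 = pf1 Rf (pf1 (tens_left b c d h) l_g);
         p3 = pf1 Rf (asc b c c d h I g);
         p4 = pf1 Rf (pf1 (tens_right b c d g) r_h);
         q1 = pf1 Lh (pf1 (tens_right a b c f) l_g);
         q2 = asc a b c d h (tens b c c I g) f;
         s1 = pf1 Lh (lft a c gf);
         s2 = pf1 Lh (asc a b c c I g f);
         t2 = asc a c c d h I gf;
         t3 = asc a b c d (tens c c d h I) g f;
         y0 = pf1 (tcomp T a c d) (r_h, pf1 (tcomp T a b c) (id1 (thom T b c) g, id1 (thom T a b) f));
         y1 = pf1 (tens_right a c d gf) r_h
     in pasting C
          [([a_hgf], [p2, p3, p4],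
              pf_cell_unit (thom T b d) C Rf (mu_dom b c d h g) hg (tmu T b c d (h, g)),
              [id1 C (tens a b d hg f)], []),
           ([], [a_hgf, id1 C (tens a b d hg f)], runit C a_hgf, [a_hgf], [])]
      = pasting C
          [([], [a_hgf, p2],
              inv2 C (asc_nat a b c d (id1 (thom T c d) h) l_g (id1 (thom T a b) f)),
              [q1, q2], [p3, p4]),
           ([], [q1],
              pf_cell (thom T a c) C Lh [pf1 (tens_right a b c f) l_g]
                [lft a c gf, asc a b c c I g f] (tlambda T a b c (g, f)),
              [s1, s2], [q2, p3, p4]),
           ([s1], [s2, q2, p3], tpi T a b c c d (h, I, g, f), [t2, t3], [p4]),
           ([s1, t2], [t3, p4],
              inv2 C (asc_nat a b c d r_h (id1 (thom T b c) g) (id1 (thom T a b) f)),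
              [y0, a_hgf], []),
           ([s1, t2], [y0], fuse_right a b c d r_h g f, [y1], [a_hgf]),
           ([], [s1, t2, y1], tmu T a c d (h, gf), [id1 C (tens a c d h gf)], [a_hgf]),
           ([], [id1 C (tens a c d h gf), a_hgf], lunit C a_hgf, [a_hgf], [])])"

text \<open>The right normalization axiom, with the unit inserted between \<open>g\<close> and \<open>f\<close>.\<close>

definition right_normalization where
  "right_normalization a b c d h g f \<longleftrightarrow>
    (let C = thom T a d; I = unit_ob b;
         gf = tens a b c g f; hg = tens b c d h g;
         Lh = tens_left a c d h; Rf = tens_right a b d f;
         a_hgf = asc a b c d h g f; r_g = rgt b c g; l_f = lft a b f;
         p1 = pf1 Lh (pf1 (tens_left a b c g) l_f);
         p2 = pf1 Lh (asc a b b c g I f);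
         p3 = pf1 Lh (pf1 (tens_right a b c f) r_g);
         q3 = asc a b c d h (tens b b c g I) f;
         q4 = pf1 Rf (pf1 (tens_left b c d h) r_g);
         s4 = pf1 Rf (asc b b c d h g I);
         s5 = pf1 Rf (rgt b d hg);
         t2 = asc a b c d h g (tens a b b I f);
         t3 = asc a b b d hg I f;
         v0 = pf1 (tcomp T a b d) (pf1 (tcomp T b c d) (id1 (thom T c d) h, id1 (thom T b c) g), l_f);
         v1 = pf1 (tens_left a b d hg) l_f
     in pasting C
          [([], [p1, p2, p3],
              pf_cell_unit (thom T a c) C Lh (mu_dom a b c g f) gf (tmu T a b c (g, f)),
              [id1 C (tens a c d h gf)], [a_hgf]),
           ([], [id1 C (tens a c d h gf), a_hgf], lunit C a_hgf, [a_hgf], [])]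
      = pasting C
          [([p1, p2], [p3, a_hgf],
              asc_nat a b c d (id1 (thom T c d) h) r_g (id1 (thom T a b) f),
              [q3, q4], []),
           ([p1, p2, q3], [q4],
              pf_cell (thom T b d) C Rf [pf1 (tens_left b c d h) r_g]
                [asc b b c d h g I, rgt b d hg] (trho T b c d (h, g)),
              [s4, s5], []),
           ([p1], [p2, q3, s4], tpi T a b b c d (h, g, I, f), [t2, t3], [s5]),
           ([], [p1, t2],
              asc_nat a b c d (id1 (thom T c d) h) (id1 (thom T b c) g) l_f,
              [a_hgf, v0], [t3, s5]),
           ([a_hgf], [v0], fuse_left a b c d h g l_f, [v1], [t3, s5]),
           ([a_hgf], [v1, t3, s5], tmu T a b d (hg, f), [id1 C (tens a b d hg f)], []),
           ([], [a_hgf, id1 C (tens a b d hg f)], runit C a_hgf, [a_hgf], [])])"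

end

locale tricategory =
  fixes T :: "('x, 'o, 'm, 'c) tricat"
  assumes hom_bicategory: "\<lbrakk>a \<in> tob T; b \<in> tob T\<rbrakk> \<Longrightarrow> bicategory (thom T a b)"
    and comp_pseudofunctor: "\<lbrakk>a \<in> tob T; b \<in> tob T; c \<in> tob T\<rbrakk>
          \<Longrightarrow> pseudofunctor (thom2 T a b c) (thom T a c) (tcomp T a b c)"
    and unit_pseudofunctor: "a \<in> tob T \<Longrightarrow> pseudofunctor unit_bicat (thom T a a) (tunit T a)"
    and assoc_equivalence: "\<lbrakk>a \<in> tob T; b \<in> tob T; c \<in> tob T; d \<in> tob T\<rbrakk>
          \<Longrightarrow> adjoint_equivalence (thom3 T a b c d) (thom T a d)
                (comp3_left T a b c d) (comp3_right T a b c d) (tassoc T a b c d)"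
    and lunit_equivalence: "\<lbrakk>a \<in> tob T; b \<in> tob T\<rbrakk>
          \<Longrightarrow> adjoint_equivalence (thom T a b) (thom T a b)
                (unit_comp T a b) (pf_id (thom T a b)) (tlunit T a b)"
    and runit_equivalence: "\<lbrakk>a \<in> tob T; b \<in> tob T\<rbrakk>
          \<Longrightarrow> adjoint_equivalence (thom T a b) (thom T a b)
                (comp_unit T a b) (pf_id (thom T a b)) (trunit T a b)"
    and pi_modification: "\<lbrakk>a \<in> tob T; b \<in> tob T; c \<in> tob T; d \<in> tob T; e \<in> tob T\<rbrakk>
          \<Longrightarrow> invertible_modification (thom4 T a b c d e) (thom T a e)
                (comp4_first T a b c d e) (comp4_last T a b c d e)
                (pi_source T a b c d e) (pi_target T a b c d e) (tpi T a b c d e)"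
    and mu_modification: "\<lbrakk>a \<in> tob T; b \<in> tob T; c \<in> tob T\<rbrakk>
          \<Longrightarrow> invertible_modification (thom2 T a b c) (thom T a c)
                (tcomp T a b c) (tcomp T a b c)
                (mu_source T a b c) (tr_id (thom T a c) (tcomp T a b c)) (tmu T a b c)"
    and lambda_modification: "\<lbrakk>a \<in> tob T; b \<in> tob T; c \<in> tob T\<rbrakk>
          \<Longrightarrow> invertible_modification (thom2 T a b c) (thom T a c)
                (unit_comp2 T a b c) (tcomp T a b c)
                (lambda_source T a b c) (lambda_target T a b c) (tlambda T a b c)"
    and rho_modification: "\<lbrakk>a \<in> tob T; b \<in> tob T; c \<in> tob T\<rbrakk>
          \<Longrightarrow> invertible_modification (thom2 T a b c) (thom T a c)
                (tcomp T a b c) (comp2_unit T a b c)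
                (rho_source T a b c) (rho_target T a b c) (trho T a b c)"
    and cocycle: "\<lbrakk>a \<in> tob T; b \<in> tob T; c \<in> tob T; d \<in> tob T; e \<in> tob T; x \<in> tob T;
           f \<in> ob (thom T a b); g \<in> ob (thom T b c); h \<in> ob (thom T c d);
           j \<in> ob (thom T d e); k \<in> ob (thom T e x)\<rbrakk>
          \<Longrightarrow> cocycle_axiom T a b c d e x k j h g f"
    and left_normal: "\<lbrakk>a \<in> tob T; b \<in> tob T; c \<in> tob T; d \<in> tob T;
           f \<in> ob (thom T a b); g \<in> ob (thom T b c); h \<in> ob (thom T c d)\<rbrakk>
          \<Longrightarrow> left_normalization T a b c d h g f"
    and right_normal: "\<lbrakk>a \<in> tob T; b \<in> tob T; c \<in> tob T; d \<in> tob T;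
           f \<in> ob (thom T a b); g \<in> ob (thom T b c); h \<in> ob (thom T c d)\<rbrakk>
          \<Longrightarrow> right_normalization T a b c d h g f"


section \<open>The bicategories of maps, homotopies and homotopy classes of homotopies\<close>

text \<open>
  A space is an abstract topology on a subset of an arbitrary type \<open>'a\<close>.  Maps are taken to be
  extensional (\<open>undefined\<close> outside the underlying set of the domain), so that equality of maps is
  equality of functions.  \<open>X \<times> I \<times> I\<close> is \<open>cyl (cyl X)\<close>, with points \<open>((x, s), t)\<close>.
\<close>

definition cyl :: "'w topology \<Rightarrow> ('w \<times> real) topology" where
  "cyl W = prod_topology W (top_of_set {0..1})"

definition maps :: "'w topology \<Rightarrow> 'a topology \<Rightarrow> ('w \<Rightarrow> 'a) set" where
  "maps W Y = {f \<in> extensional (topspace W). continuous_map W Y f}"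

definition slice :: "'w topology \<Rightarrow> ('w \<times> real \<Rightarrow> 'a) \<Rightarrow> real \<Rightarrow> 'w \<Rightarrow> 'a" where
  "slice W K t = (\<lambda>x\<in>topspace W. K (x, t))"

definition homotopy ::
  "'w topology \<Rightarrow> 'a topology \<Rightarrow> ('w \<Rightarrow> 'a) \<Rightarrow> ('w \<Rightarrow> 'a) \<Rightarrow> ('w \<times> real \<Rightarrow> 'a) \<Rightarrow> bool" where
  "homotopy W Y f g K \<longleftrightarrow> K \<in> maps (cyl W) Y \<and> slice W K 0 = f \<and> slice W K 1 = g"

definition homotopy2 where
  "homotopy2 X Y f g H J \<alpha> \<longleftrightarrow> homotopy (cyl X) Y H J \<alpha> \<and>
     (\<forall>t\<in>{0..1}. homotopy X Y f g (slice (cyl X) \<alpha> t))"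

definition homotopy3 where
  "homotopy3 X Y f g H J \<alpha> \<beta> \<Gamma> \<longleftrightarrow> homotopy (cyl (cyl X)) Y \<alpha> \<beta> \<Gamma> \<and>
     (\<forall>u\<in>{0..1}. homotopy2 X Y f g H J (slice (cyl (cyl X)) \<Gamma> u))"

type_synonym 'a cell2 = "(('a \<times> real) \<times> real \<Rightarrow> 'a) set"

definition cls :: "'a topology \<Rightarrow> 'a topology \<Rightarrow> (('a \<times> real) \<times> real \<Rightarrow> 'a) \<Rightarrow> 'a cell2" where
  "cls X Y \<alpha> = {\<beta>. \<exists>f g H J \<Gamma>. homotopy3 X Y f g H J \<alpha> \<beta> \<Gamma>}"

definition const_htpy :: "'w topology \<Rightarrow> ('w \<Rightarrow> 'a) \<Rightarrow> 'w \<times> real \<Rightarrow> 'a" where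
  "const_htpy W K = (\<lambda>(x, t)\<in>topspace (cyl W). K x)"

text \<open>Concatenation in the last coordinate, first \<open>H\<close> and then \<open>J\<close>.\<close>

definition concat_htpy ::
  "'w topology \<Rightarrow> ('w \<times> real \<Rightarrow> 'a) \<Rightarrow> ('w \<times> real \<Rightarrow> 'a) \<Rightarrow> 'w \<times> real \<Rightarrow> 'a" where
  "concat_htpy W J H = (\<lambda>(x, s)\<in>topspace (cyl W).
     if s \<le> 1/2 then H (x, 2 * s) else J (x, 2 * s - 1))"

definition hconcat_htpy :: "'a topology \<Rightarrow> (('a \<times> real) \<times> real \<Rightarrow> 'a) \<Rightarrow>
    (('a \<times> real) \<times> real \<Rightarrow> 'a) \<Rightarrow> ('a \<times> real) \<times> real \<Rightarrow> 'a" where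
  "hconcat_htpy X \<beta> \<alpha> = (\<lambda>((x, s), t)\<in>topspace (cyl (cyl X)).
     if s \<le> 1/2 then \<alpha> ((x, 2 * s), t) else \<beta> ((x, 2 * s - 1), t))"

text \<open>The homotopy from \<open>(x, s) \<mapsto> K (x, \<phi> s)\<close> to \<open>K\<close> given by the straight-line homotopy from
  the reparametrization \<open>\<phi>\<close> to the identity of the unit interval.\<close>

definition reparam :: "'a topology \<Rightarrow> (real \<Rightarrow> real) \<Rightarrow> ('a \<times> real \<Rightarrow> 'a) \<Rightarrow>
    ('a \<times> real) \<times> real \<Rightarrow> 'a" where
  "reparam X \<phi> K = (\<lambda>((x, s), t)\<in>topspace (cyl (cyl X)). K (x, (1 - t) * \<phi> s + t * s))"

text \<open>\<open>(H\<^sub>3 \<circ> H\<^sub>2) \<circ> H\<^sub>1\<close> is \<open>H\<^sub>3 \<circ> (H\<^sub>2 \<circ> H\<^sub>1)\<close> reparametrized by \<open>assoc_param\<close>.\<close>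

definition assoc_param :: "real \<Rightarrow> real" where
  "assoc_param s = (if s \<le> 1/2 then s / 2 else if s \<le> 3/4 then s - 1/4 else 2 * s - 1)"

definition Top_hom :: "'a topology \<Rightarrow> 'a topology \<Rightarrow> ('a \<Rightarrow> 'a, 'a \<times> real \<Rightarrow> 'a, 'a cell2) bicat"
  where
  "Top_hom X Y = \<lparr>
     ob = maps X Y,
     arr1 = {H. \<exists>f g. homotopy X Y f g H},
     arr2 = {cls X Y \<alpha> |\<alpha>. \<exists>f g H J. homotopy2 X Y f g H J \<alpha>},
     src1 = \<lambda>H. slice X H 0,
     trg1 = \<lambda>H. slice X H 1,
     src2 = \<lambda>A. the_elem ((\<lambda>\<alpha>. slice (cyl X) \<alpha> 0) ` A),
     trg2 = \<lambda>A. the_elem ((\<lambda>\<alpha>. slice (cyl X) \<alpha> 1) ` A),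
     id1 = const_htpy X,
     id2 = \<lambda>H. cls X Y (const_htpy (cyl X) H),
     comp1 = concat_htpy X,
     vcomp = \<lambda>B A. \<Union>\<beta>\<in>B. \<Union>\<alpha>\<in>A. cls X Y (concat_htpy (cyl X) \<beta> \<alpha>),
     hcomp = \<lambda>B A. \<Union>\<beta>\<in>B. \<Union>\<alpha>\<in>A. cls X Y (hconcat_htpy X \<beta> \<alpha>),
     assoc = \<lambda>H3 H2 H1. cls X Y (reparam X assoc_param (concat_htpy X H3 (concat_htpy X H2 H1))),
     lunit = \<lambda>H. cls X Y (reparam X (\<lambda>s. min (2 * s) 1) H),
     runit = \<lambda>H. cls X Y (reparam X (\<lambda>s. max 0 (2 * s - 1)) H)\<rparr>"

definition Top_tensor :: "'a topology \<Rightarrow> 'a topology \<Rightarrow> 'a topology \<Rightarrow>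
    (('a \<Rightarrow> 'a) \<times> ('a \<Rightarrow> 'a), ('a \<times> real \<Rightarrow> 'a) \<times> ('a \<times> real \<Rightarrow> 'a), 'a cell2 \<times> 'a cell2,
     'a \<Rightarrow> 'a, 'a \<times> real \<Rightarrow> 'a, 'a cell2) pfun" where
  "Top_tensor X Y Z = pf_strict (prod_bicat (Top_hom Y Z) (Top_hom X Y)) (Top_hom X Z)
     (\<lambda>(g, f). \<lambda>x\<in>topspace X. g (f x))
     (\<lambda>(J, H). \<lambda>(x, s)\<in>topspace (cyl X). J (H (x, s), s))
     (\<lambda>(B, A). \<Union>\<beta>\<in>B. \<Union>\<alpha>\<in>A.
        cls X Z (\<lambda>((x, s), t)\<in>topspace (cyl (cyl X)). \<beta> ((\<alpha> ((x, s), t), s), t)))"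

end

theory Submission
  imports Defs
begin

text \<open>
  The operation \<open>\<otimes>\<close> is strictly associative and strictly unital: on representatives both sides are
  the same function.  Hence \<open>a\<close>, \<open>l\<close> and \<open>r\<close> can be taken to be identity transformations and
  \<open>\<pi>\<close>, \<open>\<mu>\<close>, \<open>\<lambda>\<close>, \<open>\<rho>\<close> to have identity components.  As concatenation of homotopies is only weakly
  unital, the naturality cell of an identity transformation at \<open>H\<close> is still the composite
  \<open>H \<odot> 1 \<Rightarrow> H \<Rightarrow> 1 \<odot> H\<close> of unit constraints, so that its transformation laws are instances of coherence
  in a bicategory.  The components at objects are constant homotopies, and a concatenation of
  constant homotopies is constant; therefore the cocycle and normalization axioms compare pastings
  in which every cell is an identity.

  That maps, homotopies and classes form a bicategory rests on one fact: two reparametrizations of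
  the same homotopy that agree on the boundary of the square are homotopic along straight lines.
  It reduces the pentagon and the triangle to identities between piecewise linear maps of \<open>I\<close>.
\<close>

section \<open>Unit constraints in bicategories\<close>

text \<open>Two locales separate the algebra from the topology.
  \<open>unit_strict_bicategory\<close> records what makes identities usable as constraint data: 1
  \<odot> 1 is literally 1, and both unit constraints at 1 are identity 2-cells. Otherwise even the
  constant functor behind \<open>tens_left\<close> would have a nontrivial composition constraint,
  and \<pi>, \<mu>, \<lambda>, \<rho> would need genuine coherence cells as components.

  The obstacle is that (h g) f and h (g f) are given by different records: their values may differ
  off the carriers, and their constraints are different terms. Functors are therefore compared on
  the carriers only (\<open>pf_agree\<close>), and a transformation counts as an identity by its
  values (\<open>tr_is_id\<close>). This notion survives composition, whiskering and products, so
  the boundaries of the modifications can be treated piece by piece.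

  For spaces, the relation that defines 2-cells quantifies over all endpoints. Rewritten as homotopy
  relative to the boundary of the square, it becomes accessible to convexity: of I for the
  structural cells, and of I \<times> I for arbitrary cells, where naturality compares two ways of
  traversing the same square.\<close>

lemma hom1I: "f \<in> arr1 B \<Longrightarrow> f \<in> hom1 B (src1 B f) (trg1 B f)"
  by (simp add: hom1_def)

lemma hom2I: "\<alpha> \<in> arr2 B \<Longrightarrow> \<alpha> \<in> hom2 B (src2 B \<alpha>) (trg2 B \<alpha>)"
  by (simp add: hom2_def)

lemma iso2_hom2: "\<alpha> \<in> iso2 B f g \<Longrightarrow> \<alpha> \<in> hom2 B f g"
  by (simp add: iso2_def)

section \<open>Invertible 2-cells and their inverses\<close>

context bicategory
begin

lemma hom1_ob: "f \<in> hom1 B a b \<Longrightarrow> a \<in> ob B" "f \<in> hom1 B a b \<Longrightarrow> b \<in> ob B"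
  using src1_ob trg1_ob by (auto simp: hom1_def)

lemma hom2_arr1: "\<alpha> \<in> hom2 B f g \<Longrightarrow> f \<in> arr1 B" "\<alpha> \<in> hom2 B f g \<Longrightarrow> g \<in> arr1 B"
  using src2_arr1 trg2_arr1 by (auto simp: hom2_def)

lemma hom2_hom1: "\<alpha> \<in> hom2 B f g \<Longrightarrow> f \<in> hom1 B a b \<Longrightarrow> g \<in> hom1 B a b"
  using src1_src2 trg1_src2 trg2_arr1 by (auto simp: hom1_def hom2_def)

lemma vcomp_id [simp]: "f \<in> arr1 B \<Longrightarrow> id2 B f \<cdot> id2 B f = id2 B f"
  by (rule vcomp_id_left[OF id2_hom])

lemma inverse2_id: "f \<in> arr1 B \<Longrightarrow> inverse2 B (id2 B f) (id2 B f)"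
  using id2_hom[of f] by (simp add: inverse2_def hom2_def)

lemma id2_iso: "f \<in> arr1 B \<Longrightarrow> id2 B f \<in> iso2 B f f"
  using inverse2_id id2_hom by (auto simp: iso2_def)

text \<open>\<open>inv2\<close> is a definite description. As two-sided inverses are unique,
  exhibiting one evaluates it.\<close>

lemma inv2_unique:
  assumes "\<alpha> \<in> hom2 B f g" "\<beta> \<in> hom2 B g f" "\<beta> \<cdot> \<alpha> = id2 B f" "\<alpha> \<cdot> \<beta> = id2 B g"
  shows "inv2 B \<alpha> = \<beta>"
  unfolding inv2_def
proof (rule the_equality)
  show "inverse2 B \<alpha> \<beta>" using assms by (simp add: inverse2_def hom2_def)
next
  fix \<gamma> assume "inverse2 B \<alpha> \<gamma>"
  then have \<gamma>: "\<gamma> \<in> hom2 B g f" "\<gamma> \<cdot> \<alpha> = id2 B f"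
    using assms(1) by (auto simp: inverse2_def hom2_def)
  have "\<gamma> = \<gamma> \<cdot> (\<alpha> \<cdot> \<beta>)" using vcomp_id_right[OF \<gamma>(1)] assms(4) by simp
  also have "\<dots> = (\<gamma> \<cdot> \<alpha>) \<cdot> \<beta>" using vcomp_assoc[OF \<gamma>(1) assms(1,2)] by simp
  also have "\<dots> = \<beta>" using vcomp_id_left[OF assms(2)] \<gamma>(2) by simp
  finally show "\<gamma> = \<beta>" .
qed

lemma inv2:
  assumes "\<alpha> \<in> iso2 B f g"
  shows inv2_hom: "inv2 B \<alpha> \<in> hom2 B g f"
    and inv2_left: "inv2 B \<alpha> \<cdot> \<alpha> = id2 B f"
    and inv2_right: "\<alpha> \<cdot> inv2 B \<alpha> = id2 B g"
    and inv2_iso: "inv2 B \<alpha> \<in> iso2 B g f"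
proof -
  from assms obtain \<beta> where \<alpha>: "\<alpha> \<in> hom2 B f g" and "inverse2 B \<alpha> \<beta>"
    by (auto simp: iso2_def)
  then have \<beta>: "\<beta> \<in> hom2 B g f" "\<beta> \<cdot> \<alpha> = id2 B f" "\<alpha> \<cdot> \<beta> = id2 B g"
    by (auto simp: inverse2_def hom2_def)
  have "inv2 B \<alpha> = \<beta>" using inv2_unique[OF \<alpha> \<beta>] .
  then show "inv2 B \<alpha> \<in> hom2 B g f" "inv2 B \<alpha> \<cdot> \<alpha> = id2 B f" "\<alpha> \<cdot> inv2 B \<alpha> = id2 B g"
    "inv2 B \<alpha> \<in> iso2 B g f"
    using \<alpha> \<beta> by (auto simp: iso2_def inverse2_def hom2_def)
qed

lemma inv2_id [simp]: "f \<in> arr1 B \<Longrightarrow> inv2 B (id2 B f) = id2 B f"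
  by (rule inv2_unique) (simp_all add: id2_hom)

lemma inverse2_iso: "\<alpha> \<in> hom2 B f g \<Longrightarrow> \<beta> \<in> hom2 B g f \<Longrightarrow>
    \<beta> \<cdot> \<alpha> = id2 B f \<Longrightarrow> \<alpha> \<cdot> \<beta> = id2 B g \<Longrightarrow> \<alpha> \<in> iso2 B f g"
  by (auto simp: iso2_def inverse2_def hom2_def)

lemma vcomp_iso:
  assumes \<beta>: "\<beta> \<in> iso2 B g h" and \<alpha>: "\<alpha> \<in> iso2 B f g"
  shows "\<beta> \<cdot> \<alpha> \<in> iso2 B f h"
proof (rule inverse2_iso)
  note h = iso2_hom2[OF \<alpha>] iso2_hom2[OF \<beta>] inv2_hom[OF \<alpha>] inv2_hom[OF \<beta>]
  show "\<beta> \<cdot> \<alpha> \<in> hom2 B f h" using h vcomp_hom by blast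
  show "inv2 B \<alpha> \<cdot> inv2 B \<beta> \<in> hom2 B h f" using h vcomp_hom by blast
  have "(inv2 B \<alpha> \<cdot> inv2 B \<beta>) \<cdot> (\<beta> \<cdot> \<alpha>) = inv2 B \<alpha> \<cdot> (inv2 B \<beta> \<cdot> \<beta>) \<cdot> \<alpha>"
    using vcomp_assoc[OF h(3) h(4) vcomp_hom[OF h(2,1)]] vcomp_assoc[OF h(4) h(2) h(1)] by simp
  then show "(inv2 B \<alpha> \<cdot> inv2 B \<beta>) \<cdot> \<beta> \<cdot> \<alpha> = id2 B f"
    using inv2_left[OF \<alpha>] inv2_left[OF \<beta>] vcomp_id_left[OF h(1)] by simp
  have "(\<beta> \<cdot> \<alpha>) \<cdot> inv2 B \<alpha> \<cdot> inv2 B \<beta> = \<beta> \<cdot> (\<alpha> \<cdot> inv2 B \<alpha>) \<cdot> inv2 B \<beta>"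
    using vcomp_assoc[OF h(2) h(1) vcomp_hom[OF h(3,4)]] vcomp_assoc[OF h(1) h(3) h(4)] by simp
  then show "(\<beta> \<cdot> \<alpha>) \<cdot> inv2 B \<alpha> \<cdot> inv2 B \<beta> = id2 B h"
    using inv2_right[OF \<alpha>] inv2_right[OF \<beta>] vcomp_id_left[OF h(4)] by simp
qed

lemma hcomp_iso:
  assumes f: "g \<in> hom1 B b c" "f \<in> hom1 B a b" and \<beta>: "\<beta> \<in> iso2 B g g'" and \<alpha>: "\<alpha> \<in> iso2 B f f'"
  shows "\<beta> \<star> \<alpha> \<in> iso2 B (g \<odot> f) (g' \<odot> f')"
proof (rule inverse2_iso)
  note h = iso2_hom2[OF \<alpha>] iso2_hom2[OF \<beta>] inv2_hom[OF \<alpha>] inv2_hom[OF \<beta>]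
  note f' = hom2_hom1[OF h(2) f(1)] hom2_hom1[OF h(1) f(2)]
  show "\<beta> \<star> \<alpha> \<in> hom2 B (g \<odot> f) (g' \<odot> f')" using hcomp_hom f h by blast
  show "inv2 B \<beta> \<star> inv2 B \<alpha> \<in> hom2 B (g' \<odot> f') (g \<odot> f)" using hcomp_hom f' h by blast
  show "(inv2 B \<beta> \<star> inv2 B \<alpha>) \<cdot> (\<beta> \<star> \<alpha>) = id2 B (g \<odot> f)"
    using interchange[OF f h(2) h(4) h(1) h(3)] hcomp_id[OF f] inv2_left \<alpha> \<beta> by simp
  show "(\<beta> \<star> \<alpha>) \<cdot> (inv2 B \<beta> \<star> inv2 B \<alpha>) = id2 B (g' \<odot> f')"
    using interchange[OF f' h(4) h(2) h(3) h(1)] hcomp_id[OF f'] inv2_right \<alpha> \<beta> by simp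
qed

end

text \<open>The equations \<open>lunit_comp\<close> and \<open>runit_comp\<close> hold in every bicategory (Kelly), but in the
  example below they are no harder to verify than the triangle axiom.\<close>

locale unit_strict_bicategory = bicategory B for B :: "('o, 'm, 'c) bicat" (structure) +
  assumes id1_comp: "a \<in> ob B \<Longrightarrow> id1 B a \<odot> id1 B a = id1 B a"
    and lunit_id: "a \<in> ob B \<Longrightarrow> lunit B (id1 B a) = id2 B (id1 B a)"
    and runit_id: "a \<in> ob B \<Longrightarrow> runit B (id1 B a) = id2 B (id1 B a)"
    and lunit_comp: "\<lbrakk>g \<in> hom1 B b c; f \<in> hom1 B a b\<rbrakk>
          \<Longrightarrow> lunit B (g \<odot> f) \<cdot> assoc B (id1 B c) g f = lunit B g \<star> id2 B f"
    and runit_comp: "\<lbrakk>g \<in> hom1 B b c; f \<in> hom1 B a b\<rbrakk>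
          \<Longrightarrow> (id2 B g \<star> runit B f) \<cdot> assoc B g f (id1 B a) = runit B (g \<odot> f)"

text \<open>The same term as \<open>tr1\<close> of \<open>tr_id\<close>, named so that its laws can
  be stated inside one bicategory, without functors.\<close>

definition unit_swap :: "('o, 'm, 'c) bicat \<Rightarrow> 'm \<Rightarrow> 'c" where
  "unit_swap B f = inv2 B (lunit B f) \<cdot>\<^bsub>B\<^esub> runit B f"

section \<open>Coherence of the cell f 1 \<Rightarrow> f \<Rightarrow> 1 f\<close>

context bicategory
begin

lemma unit_swap_iso:
  assumes "f \<in> hom1 B a b"
  shows "unit_swap B f \<in> iso2 B (f \<odot> id1 B a) (id1 B b \<odot> f)"
  unfolding unit_swap_def using vcomp_iso[OF inv2_iso[OF lunit_iso] runit_iso] assms by blast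

lemma cancel_left:
  assumes "\<alpha> \<in> iso2 B g h" "\<beta> \<in> hom2 B f g" "\<gamma> \<in> hom2 B f g" "\<alpha> \<cdot> \<beta> = \<alpha> \<cdot> \<gamma>"
  shows "\<beta> = \<gamma>"
proof -
  note h = inv2_hom[OF assms(1)] iso2_hom2[OF assms(1)]
  have "(inv2 B \<alpha> \<cdot> \<alpha>) \<cdot> \<beta> = (inv2 B \<alpha> \<cdot> \<alpha>) \<cdot> \<gamma>"
    using assms(4) vcomp_assoc[OF h assms(2)] vcomp_assoc[OF h assms(3)] by simp
  then show ?thesis using inv2_left assms vcomp_id_left by metis
qed

text \<open>Composability is expressed through \<open>src2\<close> and \<open>trg2\<close> instead
  of hom-sets: no intermediate 1-cell has to be guessed, so the equation can serve as a rewrite rule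
  for rebracketing.\<close>

lemma vcomp_assoc': "\<lbrakk>\<gamma> \<in> arr2 B; \<beta> \<in> arr2 B; \<alpha> \<in> arr2 B; src2 B \<gamma> = trg2 B \<beta>; src2 B \<beta> = trg2 B \<alpha>\<rbrakk>
    \<Longrightarrow> (\<gamma> \<cdot> \<beta>) \<cdot> \<alpha> = \<gamma> \<cdot> \<beta> \<cdot> \<alpha>"
  by (rule vcomp_assoc[of \<gamma> "trg2 B \<beta>" "trg2 B \<gamma>" \<beta> "trg2 B \<alpha>" \<alpha> "src2 B \<alpha>"]) (auto simp: hom2_def)

lemma vcomp_arr2: 
  assumes "\<beta> \<in> arr2 B" "\<alpha> \<in> arr2 B" "src2 B \<beta> = trg2 B \<alpha>"
  shows "\<beta> \<cdot> \<alpha> \<in> arr2 B" "src2 B (\<beta> \<cdot> \<alpha>) = src2 B \<alpha>" "trg2 B (\<beta> \<cdot> \<alpha>) = trg2 B \<beta>"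
  using vcomp_hom[of \<beta> "src2 B \<beta>" "trg2 B \<beta>" \<alpha> "src2 B \<alpha>"] assms by (auto simp: hom2_def)

lemma vcomp_id_left': "\<alpha> \<in> arr2 B \<Longrightarrow> trg2 B \<alpha> = g \<Longrightarrow> id2 B g \<cdot> \<alpha> = \<alpha>"
  by (rule vcomp_id_left) (auto simp: hom2_def)

lemma vcomp_id_right': "\<alpha> \<in> arr2 B \<Longrightarrow> src2 B \<alpha> = g \<Longrightarrow> \<alpha> \<cdot> id2 B g = \<alpha>"
  by (rule vcomp_id_right) (auto simp: hom2_def)

text \<open>The naturality axioms speak about \<open>lunit\<close>, not about its inverse. Hence
  both sides are compared after composing with the invertible \<open>lunit B f'\<close>, where each
  of them becomes \<alpha> followed after \<open>runit B f\<close>.\<close>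

lemma unit_swap_natural:
  assumes f: "f \<in> hom1 B a b" and \<alpha>: "\<alpha> \<in> hom2 B f f'"
  shows "unit_swap B f' \<cdot> (\<alpha> \<star> id2 B (id1 B a)) = (id2 B (id1 B b) \<star> \<alpha>) \<cdot> unit_swap B f"
proof -
  have f': "f' \<in> hom1 B a b" by (rule hom2_hom1[OF \<alpha> f])
  note ob = hom1_ob[OF f]
  note i = id1_hom[OF ob(1)] id1_hom[OF ob(2)]
  have i1: "id2 B (id1 B a) \<in> hom2 B (id1 B a) (id1 B a)" "id2 B (id1 B b) \<in> hom2 B (id1 B b) (id1 B b)"
    using i id2_hom by (auto simp: hom1_def)
  note L = lunit_iso[OF f] lunit_iso[OF f'] runit_iso[OF f] runit_iso[OF f']
  note h = iso2_hom2[OF L(1)] iso2_hom2[OF L(2)] iso2_hom2[OF L(3)] iso2_hom2[OF L(4)]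
    inv2_hom[OF L(1)] inv2_hom[OF L(2)]
    hcomp_hom[OF f i(1) \<alpha> i1(1)] hcomp_hom[OF i(2) f i1(2) \<alpha>] 
  note n = lunit_natural[OF f \<alpha>] runit_natural[OF f \<alpha>]
  have "lunit B f' \<cdot> (unit_swap B f' \<cdot> (\<alpha> \<star> id2 B (id1 B a))) = runit B f' \<cdot> (\<alpha> \<star> id2 B (id1 B a))"
    unfolding unit_swap_def using h inv2_right[OF L(2)]
    by (simp add: hom2_def vcomp_assoc' vcomp_arr2 vcomp_id_left' flip: vcomp_assoc')
  also have "\<dots> = \<alpha> \<cdot> runit B f" by (rule n)
  also have "\<dots> = \<alpha> \<cdot> (lunit B f \<cdot> inv2 B (lunit B f)) \<cdot> runit B f"
    using inv2_right[OF L(1)] vcomp_id_left[OF h(3)] by simp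
  also have "\<dots> = (\<alpha> \<cdot> lunit B f) \<cdot> unit_swap B f"
    unfolding unit_swap_def using h \<alpha> by (simp add: hom2_def vcomp_assoc' vcomp_arr2)
  also have "\<dots> = lunit B f' \<cdot> ((id2 B (id1 B b) \<star> \<alpha>) \<cdot> unit_swap B f)"
    unfolding n(1)[symmetric] unit_swap_def using h by (simp add: hom2_def vcomp_assoc' vcomp_arr2)
  finally show ?thesis
    using cancel_left[OF L(2)] vcomp_hom[OF iso2_hom2[OF unit_swap_iso[OF f']] h(7)]
       vcomp_hom[OF h(8) iso2_hom2[OF unit_swap_iso[OF f]]] by blast
qed

end

context unit_strict_bicategory
begin

lemma unit_swap_id: "a \<in> ob B \<Longrightarrow> unit_swap B (id1 B a) = id2 B (id1 B a)"
  using id1_hom[of a] by (simp add: unit_swap_def lunit_id runit_id hom1_def)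

text \<open>The triangle axiom at identity 1-cells: both unit constraints are identities there, and
  only the associator is left.\<close>

lemma assoc_id: "a \<in> ob B \<Longrightarrow> assoc B (id1 B a) (id1 B a) (id1 B a) = id2 B (id1 B a)"
  using triangle[OF id1_hom id1_hom, of a] id1_hom[of a] hcomp_id[OF id1_hom id1_hom, of a]
    vcomp_id_left[OF iso2_hom2[OF assoc_iso[OF id1_hom id1_hom id1_hom]], of a]
  by (simp add: lunit_id runit_id id1_comp)

text \<open>This is condition \<open>tr1_comp\<close> for an identity transformation. The right-hand
  side is regrouped into three blocks: the left one is the inverse of \<open>lunit\<close> at g f,
  the middle one collapses by the triangle axiom, the right one is \<open>runit\<close> at g
  f.\<close>

lemma unit_swap_comp:
  assumes g: "g \<in> hom1 B b c" and f: "f \<in> hom1 B a b"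
  shows "unit_swap B (g \<odot> f) = assoc B (id1 B c) g f \<cdot> (unit_swap B g \<star> id2 B f)
     \<cdot> inv2 B (assoc B g (id1 B b) f) \<cdot> (id2 B g \<star> unit_swap B f) \<cdot> assoc B g f (id1 B a)"
proof -
  note ob = hom1_ob[OF f] hom1_ob(2)[OF g]
  note i = id1_hom[OF ob(1)] id1_hom[OF ob(2)] id1_hom[OF ob(3)]
  note gf = comp1_hom[OF g f]
  have I: "id2 B g \<in> iso2 B g g" "id2 B f \<in> iso2 B f f"
    using f g by (auto intro: id2_iso simp: hom1_def)
  note A1 = assoc_iso[OF i(3) g f] and A2 = assoc_iso[OF g i(2) f] and A3 = assoc_iso[OF g f i(1)]
  note Lf = lunit_iso[OF f] and Rf = runit_iso[OF f] and Lg = lunit_iso[OF g] and Rg = runit_iso[OF g]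
  note Lgf = lunit_iso[OF gf] and Rgf = runit_iso[OF gf]
  note gLf = hcomp_iso[OF g comp1_hom[OF i(2) f] I(1) Lf]
  note gLf' = hcomp_iso[OF g f I(1) inv2_iso[OF Lf]]
  note gRf = hcomp_iso[OF g comp1_hom[OF f i(1)] I(1) Rf]
  note Lgf2 = hcomp_iso[OF comp1_hom[OF i(3) g] f Lg I(2)]
  note Lgf2' = hcomp_iso[OF g f inv2_iso[OF Lg] I(2)]
  note Rgf2 = hcomp_iso[OF comp1_hom[OF g i(2)] f Rg I(2)]
  note isos = A1 A2 A3 Lf Rf Lg Rg Lgf Rgf gLf gLf' gRf Lgf2 Lgf2' Rgf2
  note hs = isos[THEN iso2_hom2] isos[THEN inv2_hom]
  have e1: "unit_swap B g \<star> id2 B f = (inv2 B (lunit B g) \<star> id2 B f) \<cdot> (runit B g \<star> id2 B f)"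
    using interchange[OF comp1_hom[OF g i(2)] f iso2_hom2[OF Rg] inv2_hom[OF Lg] iso2_hom2[OF I(2)] iso2_hom2[OF I(2)]]
      f by (simp add: unit_swap_def hom1_def)
  have e2: "id2 B g \<star> unit_swap B f = (id2 B g \<star> inv2 B (lunit B f)) \<cdot> (id2 B g \<star> runit B f)"
    using interchange[OF g comp1_hom[OF f i(1)] iso2_hom2[OF I(1)] iso2_hom2[OF I(1)] iso2_hom2[OF Rf] inv2_hom[OF Lf]]
      g by (simp add: unit_swap_def hom1_def)
  have c1: "(id2 B g \<star> lunit B f) \<cdot> (id2 B g \<star> inv2 B (lunit B f)) = id2 B (g \<odot> f)"
    using interchange[OF g f iso2_hom2[OF I(1)] iso2_hom2[OF I(1)] inv2_hom[OF Lf] iso2_hom2[OF Lf]]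
      g inv2_right[OF Lf] hcomp_id[OF g f] by (simp add: hom1_def)
  have c2: "(lunit B g \<star> id2 B f) \<cdot> (inv2 B (lunit B g) \<star> id2 B f) = id2 B (g \<odot> f)"
    using interchange[OF g f inv2_hom[OF Lg] iso2_hom2[OF Lg] iso2_hom2[OF I(2)] iso2_hom2[OF I(2)]]
      f inv2_right[OF Lg] hcomp_id[OF g f] by (simp add: hom1_def)
  \<comment> \<open>The inverse form of \<open>lunit_comp\<close>, obtained by cancelling
    \<open>lunit\<close> at g f.\<close>
  have d1: "inv2 B (lunit B (g \<odot> f)) = assoc B (id1 B c) g f \<cdot> (inv2 B (lunit B g) \<star> id2 B f)"
  proof (rule cancel_left[OF Lgf])
    show "inv2 B (lunit B (g \<odot> f)) \<in> hom2 B (g \<odot> f) (id1 B c \<odot> g \<odot> f)"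
      by (rule inv2_hom[OF Lgf])
    show "assoc B (id1 B c) g f \<cdot> (inv2 B (lunit B g) \<star> id2 B f) \<in> hom2 B (g \<odot> f) (id1 B c \<odot> g \<odot> f)"
      by (rule vcomp_hom[OF iso2_hom2[OF A1] iso2_hom2[OF Lgf2']])
    have "lunit B (g \<odot> f) \<cdot> assoc B (id1 B c) g f \<cdot> (inv2 B (lunit B g) \<star> id2 B f)
      = (lunit B (g \<odot> f) \<cdot> assoc B (id1 B c) g f) \<cdot> (inv2 B (lunit B g) \<star> id2 B f)"
      using hs by (simp add: hom2_def vcomp_assoc')
    also have "\<dots> = id2 B (g \<odot> f)" by (simp add: lunit_comp[OF g f] c2)
    finally show "lunit B (g \<odot> f) \<cdot> inv2 B (lunit B (g \<odot> f)) =
      lunit B (g \<odot> f) \<cdot> assoc B (id1 B c) g f \<cdot> (inv2 B (lunit B g) \<star> id2 B f)"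
      using inv2_right[OF Lgf] by simp
  qed
  \<comment> \<open>By the triangle axiom the first factor ends in an associator, which cancels its
    inverse; what remains is \<open>lunit\<close> against its own inverse, whiskered with g.\<close>
  have d2: "(runit B g \<star> id2 B f) \<cdot> inv2 B (assoc B g (id1 B b) f) \<cdot> (id2 B g \<star> inv2 B (lunit B f)) = id2 B (g \<odot> f)"
  proof -
    have "((id2 B g \<star> lunit B f) \<cdot> assoc B g (id1 B b) f) \<cdot> inv2 B (assoc B g (id1 B b) f) \<cdot> (id2 B g \<star> inv2 B (lunit B f))
      = (id2 B g \<star> lunit B f) \<cdot> (assoc B g (id1 B b) f \<cdot> inv2 B (assoc B g (id1 B b) f)) \<cdot> (id2 B g \<star> inv2 B (lunit B f))"
      using hs by (simp add: hom2_def vcomp_assoc' vcomp_arr2)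
    then show ?thesis using hs by (simp add: triangle[OF g f] inv2_right[OF A2] c1 vcomp_id_left' hom2_def)
  qed
  have "assoc B (id1 B c) g f \<cdot> (unit_swap B g \<star> id2 B f)
     \<cdot> inv2 B (assoc B g (id1 B b) f) \<cdot> (id2 B g \<star> unit_swap B f) \<cdot> assoc B g f (id1 B a)
    = (assoc B (id1 B c) g f \<cdot> (inv2 B (lunit B g) \<star> id2 B f)) \<cdot>
      ((runit B g \<star> id2 B f) \<cdot> inv2 B (assoc B g (id1 B b) f) \<cdot> (id2 B g \<star> inv2 B (lunit B f))) \<cdot>
      ((id2 B g \<star> runit B f) \<cdot> assoc B g f (id1 B a))"
    unfolding e1 e2 using hs by (simp add: hom2_def vcomp_assoc' vcomp_arr2)
  also have "\<dots> = unit_swap B (g \<odot> f)"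
    unfolding d1[symmetric] d2 runit_comp[OF g f] unit_swap_def
    using hs by (simp add: hom2_def vcomp_id_left')
  finally show ?thesis by simp
qed

text \<open>The left-hand side is the naturality cell that \<open>tr_comp\<close> assigns to a
  composite of two identity transformations. Its boundary is already that of a single one because 1
  \<odot> 1 = 1.\<close>

lemma unit_swap_unit_swap:
  assumes f: "f \<in> hom1 B a b"
  shows "inv2 B (assoc B (id1 B b) (id1 B b) f) \<cdot> (id2 B (id1 B b) \<star> unit_swap B f)
     \<cdot> assoc B (id1 B b) f (id1 B a) \<cdot> (unit_swap B f \<star> id2 B (id1 B a))
     \<cdot> inv2 B (assoc B f (id1 B a) (id1 B a)) = unit_swap B f"
proof -
  note ob = hom1_ob[OF f]
  note i = id1_hom[OF ob(1)] id1_hom[OF ob(2)]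
  have I: "id2 B (id1 B a) \<in> iso2 B (id1 B a) (id1 B a)" "id2 B (id1 B b) \<in> iso2 B (id1 B b) (id1 B b)"
     "id2 B f \<in> iso2 B f f"
    using f i by (auto intro: id2_iso simp: hom1_def)
  note A1 = assoc_iso[OF i(2) i(2) f] and A2 = assoc_iso[OF i(2) f i(1)] and A3 = assoc_iso[OF f i(1) i(1)]
  note L = lunit_iso[OF f] and R = runit_iso[OF f]
  note f1 = comp1_hom[OF f i(1)] and f2 = comp1_hom[OF i(2) f]
  note bL = hcomp_iso[OF i(2) f2 I(2) L] and bL' = hcomp_iso[OF i(2) f I(2) inv2_iso[OF L]]
  note bR = hcomp_iso[OF i(2) f1 I(2) R]
  note Ra = hcomp_iso[OF f1 i(1) R I(1)]
  note La = hcomp_iso[OF f2 i(1) L I(1)] and La' = hcomp_iso[OF f i(1) inv2_iso[OF L] I(1)]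
  note Rbf = runit_iso[OF f2]
  have I4: "id2 B (id1 B b \<odot> f) \<in> iso2 B (id1 B b \<odot> f) (id1 B b \<odot> f)"
    "id2 B (f \<odot> id1 B a) \<in> iso2 B (f \<odot> id1 B a) (f \<odot> id1 B a)"
    using f1 f2 by (auto intro: id2_iso simp: hom1_def)
  note isos = A1 A2 A3 L R bL bL' bR Ra La La' Rbf I I4
  note hs = isos[THEN iso2_hom2] isos[THEN inv2_hom]
  have e1: "unit_swap B f \<star> id2 B (id1 B a) = (inv2 B (lunit B f) \<star> id2 B (id1 B a)) \<cdot> (runit B f \<star> id2 B (id1 B a))"
    using interchange[OF f1 i(1) iso2_hom2[OF R] inv2_hom[OF L] iso2_hom2[OF I(1)] iso2_hom2[OF I(1)]]
      i by (simp add: unit_swap_def hom1_def)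
  have e2: "id2 B (id1 B b) \<star> unit_swap B f = (id2 B (id1 B b) \<star> inv2 B (lunit B f)) \<cdot> (id2 B (id1 B b) \<star> runit B f)"
    using interchange[OF i(2) f1 iso2_hom2[OF I(2)] iso2_hom2[OF I(2)] iso2_hom2[OF R] inv2_hom[OF L]]
      i by (simp add: unit_swap_def hom1_def)
  \<comment> \<open>Since \<open>runit\<close> is trivial at an identity 1-cell, the triangle axiom
    says that this associator is inverse to the whiskered \<open>lunit\<close>.\<close>
  have d1: "(id2 B (id1 B b) \<star> inv2 B (lunit B f)) = assoc B (id1 B b) (id1 B b) f"
  proof (rule cancel_left[OF bL])
    show "id2 B (id1 B b) \<star> inv2 B (lunit B f) \<in> hom2 B (id1 B b \<odot> f) (id1 B b \<odot> id1 B b \<odot> f)"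
      by (rule iso2_hom2[OF bL'])
    show "assoc B (id1 B b) (id1 B b) f \<in> hom2 B (id1 B b \<odot> f) (id1 B b \<odot> id1 B b \<odot> f)"
      using iso2_hom2[OF A1] by (simp add: id1_comp[OF ob(2)])
    have "(id2 B (id1 B b) \<star> lunit B f) \<cdot> (id2 B (id1 B b) \<star> inv2 B (lunit B f)) = id2 B (id1 B b \<odot> f)"
      using interchange[OF i(2) f iso2_hom2[OF I(2)] iso2_hom2[OF I(2)] inv2_hom[OF L] iso2_hom2[OF L]]
        i inv2_right[OF L] hcomp_id[OF i(2) f] by (simp add: hom1_def)
    then show "(id2 B (id1 B b) \<star> lunit B f) \<cdot> (id2 B (id1 B b) \<star> inv2 B (lunit B f)) =
      (id2 B (id1 B b) \<star> lunit B f) \<cdot> assoc B (id1 B b) (id1 B b) f"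
      using triangle[OF i(2) f] hcomp_id[OF i(2) f] runit_id[OF ob(2)] by simp
  qed
  \<comment> \<open>The triangle axiom again, now with the trivial \<open>lunit\<close> at an
    identity 1-cell.\<close>
  have d2: "(runit B f \<star> id2 B (id1 B a)) = assoc B f (id1 B a) (id1 B a)"
    using triangle[OF f i(1)] hcomp_id[OF f i(1)] lunit_id[OF ob(1)] hs
    by (simp add: hom2_def vcomp_id_left' id1_comp[OF ob(1)])
  \<comment> \<open>Naturality of \<open>runit\<close> at the 2-cell inverse to
    \<open>lunit B f\<close>.\<close>
  have d3: "runit B (id1 B b \<odot> f) \<cdot> (inv2 B (lunit B f) \<star> id2 B (id1 B a)) = unit_swap B f"
    unfolding unit_swap_def by (rule runit_natural[OF f inv2_hom[OF L]])
  have "inv2 B (assoc B (id1 B b) (id1 B b) f) \<cdot> (id2 B (id1 B b) \<star> unit_swap B f)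
     \<cdot> assoc B (id1 B b) f (id1 B a) \<cdot> (unit_swap B f \<star> id2 B (id1 B a))
     \<cdot> inv2 B (assoc B f (id1 B a) (id1 B a))
    = (inv2 B (assoc B (id1 B b) (id1 B b) f) \<cdot> (id2 B (id1 B b) \<star> inv2 B (lunit B f)))
     \<cdot> (((id2 B (id1 B b) \<star> runit B f) \<cdot> assoc B (id1 B b) f (id1 B a)) \<cdot> (inv2 B (lunit B f) \<star> id2 B (id1 B a)))
     \<cdot> ((runit B f \<star> id2 B (id1 B a)) \<cdot> inv2 B (assoc B f (id1 B a) (id1 B a)))"
    unfolding e1 e2 using hs by (simp add: hom2_def vcomp_assoc' vcomp_arr2 id1_comp ob)
  also have "\<dots> = unit_swap B f"
    unfolding runit_comp[OF i(2) f] d1 d2 d3 inv2_left[OF A1] inv2_right[OF A3]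
    using iso2_hom2[OF unit_swap_iso[OF f]]
    by (simp add: id1_comp ob hom2_def vcomp_id_left' vcomp_id_right')
  finally show ?thesis .
qed

end

section \<open>Products and strict functors\<close>

text \<open>Phrased with projections rather than pairs, so that the rules also apply to variables of
  product type.\<close>

lemma prod_bicat_simps [simp]:
  "p \<in> ob (prod_bicat B C) \<longleftrightarrow> fst p \<in> ob B \<and> snd p \<in> ob C"
  "q \<in> arr1 (prod_bicat B C) \<longleftrightarrow> fst q \<in> arr1 B \<and> snd q \<in> arr1 C"
  "r \<in> arr2 (prod_bicat B C) \<longleftrightarrow> fst r \<in> arr2 B \<and> snd r \<in> arr2 C"
  "src1 (prod_bicat B C) q = (src1 B (fst q), src1 C (snd q))"
  "trg1 (prod_bicat B C) q = (trg1 B (fst q), trg1 C (snd q))"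
  "src2 (prod_bicat B C) r = (src2 B (fst r), src2 C (snd r))"
  "trg2 (prod_bicat B C) r = (trg2 B (fst r), trg2 C (snd r))"
  "id1 (prod_bicat B C) p = (id1 B (fst p), id1 C (snd p))"
  "id2 (prod_bicat B C) q = (id2 B (fst q), id2 C (snd q))"
  "q' \<odot>\<^bsub>prod_bicat B C\<^esub> q = (fst q' \<odot>\<^bsub>B\<^esub> fst q, snd q' \<odot>\<^bsub>C\<^esub> snd q)"
  "r' \<cdot>\<^bsub>prod_bicat B C\<^esub> r = (fst r' \<cdot>\<^bsub>B\<^esub> fst r, snd r' \<cdot>\<^bsub>C\<^esub> snd r)"
  "r' \<star>\<^bsub>prod_bicat B C\<^esub> r = (fst r' \<star>\<^bsub>B\<^esub> fst r, snd r' \<star>\<^bsub>C\<^esub> snd r)"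
  "assoc (prod_bicat B C) q'' q' q = (assoc B (fst q'') (fst q') (fst q), assoc C (snd q'') (snd q') (snd q))"
  "lunit (prod_bicat B C) q = (lunit B (fst q), lunit C (snd q))"
  "runit (prod_bicat B C) q = (runit B (fst q), runit C (snd q))"
  by (cases p; cases q; cases q'; cases q''; cases r; cases r'; simp add: prod_bicat_def)+

lemma hom1_prod [simp]: "q \<in> hom1 (prod_bicat B C) p p' \<longleftrightarrow>
    fst q \<in> hom1 B (fst p) (fst p') \<and> snd q \<in> hom1 C (snd p) (snd p')"
  by (cases p; cases p') (auto simp: hom1_def)

lemma hom2_prod [simp]: "r \<in> hom2 (prod_bicat B C) q q' \<longleftrightarrow>
    fst r \<in> hom2 B (fst q) (fst q') \<and> snd r \<in> hom2 C (snd q) (snd q')"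
  by (cases q; cases q') (auto simp: hom2_def)

lemma inverse2_prod: "inverse2 (prod_bicat B C) r r' \<longleftrightarrow>
    inverse2 B (fst r) (fst r') \<and> inverse2 C (snd r) (snd r')"
  by (auto simp: inverse2_def)

lemma iso2_prod [simp]: "r \<in> iso2 (prod_bicat B C) q q' \<longleftrightarrow>
    fst r \<in> iso2 B (fst q) (fst q') \<and> snd r \<in> iso2 C (snd q) (snd q')"
proof -
  have "(\<exists>x. inverse2 B (fst r) (fst x) \<and> inverse2 C (snd r) (snd x)) \<longleftrightarrow>
    (\<exists>x. inverse2 B (fst r) x) \<and> (\<exists>x. inverse2 C (snd r) x)"
    by (metis fst_conv snd_conv)
  then show ?thesis
    unfolding iso2_def by (auto simp: inverse2_prod)
qed

lemma bicategory_prod: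
  assumes "bicategory B" "bicategory C"
  shows "bicategory (prod_bicat B C)"
proof -
  interpret B: bicategory B by fact
  interpret C: bicategory C by fact
  show ?thesis
  proof (unfold_locales, goal_cases)
    case 1 then show ?case by (simp add: B.src1_ob C.src1_ob)
  next case 2 then show ?case by (simp add: B.trg1_ob C.trg1_ob)
  next case 3 then show ?case by (simp add: B.src2_arr1 C.src2_arr1)
  next case 4 then show ?case by (simp add: B.trg2_arr1 C.trg2_arr1)
  next case 5 then show ?case by (simp add: B.src1_src2 C.src1_src2)
  next case 6 then show ?case by (simp add: B.trg1_src2 C.trg1_src2)
  next case 7 then show ?case by (simp add: B.id1_hom C.id1_hom)
  next case 8 then show ?case by (auto intro: B.comp1_hom C.comp1_hom)
  next case 9 then show ?case by (simp add: B.id2_hom C.id2_hom)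
  next case 10 then show ?case by (auto intro: B.vcomp_hom C.vcomp_hom)
  next case 11 then show ?case by (auto simp: prod_eq_iff intro: B.vcomp_id_left C.vcomp_id_left)
  next case 12 then show ?case by (auto simp: prod_eq_iff intro: B.vcomp_id_right C.vcomp_id_right)
  next case 13 then show ?case by (auto intro: prod_eqI B.vcomp_assoc C.vcomp_assoc)
  next case 14 then show ?case by (auto intro: B.hcomp_hom C.hcomp_hom)
  next case 15 then show ?case by (auto intro: B.hcomp_id C.hcomp_id)
  next case 16 then show ?case by (auto intro: B.interchange C.interchange)
  next case 17 then show ?case by (auto intro: B.assoc_iso C.assoc_iso)
  next case 18 then show ?case by (auto intro: B.assoc_natural C.assoc_natural)
  next case 19 then show ?case by (auto intro: B.lunit_iso C.lunit_iso)
  next case 20 then show ?case by (auto intro: B.lunit_natural C.lunit_natural)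
  next case 21 then show ?case by (auto intro: B.runit_iso C.runit_iso)
  next case 22 then show ?case by (auto intro: B.runit_natural C.runit_natural)
  next case 23 then show ?case by (auto intro: B.pentagon C.pentagon)
  next case 24 then show ?case by (auto intro: B.triangle C.triangle)
  qed
qed

lemma unit_strict_bicategory_prod:
  assumes "unit_strict_bicategory B" "unit_strict_bicategory C"
  shows "unit_strict_bicategory (prod_bicat B C)"
proof -
  interpret B: unit_strict_bicategory B by fact
  interpret C: unit_strict_bicategory C by fact
  interpret P: bicategory "prod_bicat B C"
    by (rule bicategory_prod) unfold_locales
  show ?thesis
  proof (unfold_locales, goal_cases)
    case 1 then show ?case by (simp add: B.id1_comp C.id1_comp)
  next case 2 then show ?case by (simp add: B.lunit_id C.lunit_id)
  next case 3 then show ?case by (simp add: B.runit_id C.runit_id)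
  next case 4 then show ?case by (auto intro: B.lunit_comp C.lunit_comp)
  next case 5 then show ?case by (auto intro: B.runit_comp C.runit_comp)
  qed
qed

lemma unit_bicat: "unit_strict_bicategory unit_bicat"
  by unfold_locales (simp_all add: unit_bicat_def hom1_def hom2_def iso2_def inverse2_def)

text \<open>The description \<open>inv2\<close> splits into components only through uniqueness of
  inverses in the product, hence the invertibility assumption.\<close>

lemma inv2_prod:
  assumes "bicategory B" "bicategory C" "r \<in> iso2 (prod_bicat B C) q q'"
  shows "inv2 (prod_bicat B C) r = (inv2 B (fst r), inv2 C (snd r))"
proof -
  have i: "fst r \<in> iso2 B (fst q) (fst q')" "snd r \<in> iso2 C (snd q) (snd q')" using assms(3) by auto
  note l = bicategory.inv2[OF assms(1) i(1)] bicategory.inv2[OF assms(2) i(2)]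
  show ?thesis
    by (rule bicategory.inv2_unique[OF bicategory_prod[OF assms(1,2)] iso2_hom2[OF assms(3)]])
      (simp_all add: l)
qed

text \<open>A predicate instead of the record \<open>pf_strict\<close>: composites and constant
  functors carry constraints that are different terms and turn into identities only when evaluated
  on composable arguments from the carriers.\<close>

locale strict_functor =
  fixes B :: "('o, 'm, 'c) bicat" and C :: "('p, 'n, 'd) bicat"
    and F :: "('o, 'm, 'c, 'p, 'n, 'd) pfun"
  assumes pf0_ob: "a \<in> ob B \<Longrightarrow> pf0 F a \<in> ob C"
    and pf1_hom: "f \<in> hom1 B a b \<Longrightarrow> pf1 F f \<in> hom1 C (pf0 F a) (pf0 F b)"
    and pf2_hom: "\<alpha> \<in> hom2 B f g \<Longrightarrow> pf2 F \<alpha> \<in> hom2 C (pf1 F f) (pf1 F g)"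
    and pf1_id: "a \<in> ob B \<Longrightarrow> pf1 F (id1 B a) = id1 C (pf0 F a)"
    and pf1_comp: "\<lbrakk>g \<in> hom1 B b c; f \<in> hom1 B a b\<rbrakk> \<Longrightarrow> pf1 F (g \<odot>\<^bsub>B\<^esub> f) = pf1 F g \<odot>\<^bsub>C\<^esub> pf1 F f"
    and pf2_id: "f \<in> arr1 B \<Longrightarrow> pf2 F (id2 B f) = id2 C (pf1 F f)"
    and pf2_vcomp: "\<lbrakk>\<beta> \<in> hom2 B g h; \<alpha> \<in> hom2 B f g\<rbrakk>
          \<Longrightarrow> pf2 F (\<beta> \<cdot>\<^bsub>B\<^esub> \<alpha>) = pf2 F \<beta> \<cdot>\<^bsub>C\<^esub> pf2 F \<alpha>"
    and pf2_hcomp: "\<lbrakk>g \<in> hom1 B b c; f \<in> hom1 B a b; \<beta> \<in> hom2 B g g'; \<alpha> \<in> hom2 B f f'\<rbrakk>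
          \<Longrightarrow> pf2 F (\<beta> \<star>\<^bsub>B\<^esub> \<alpha>) = pf2 F \<beta> \<star>\<^bsub>C\<^esub> pf2 F \<alpha>"
    and pf2_assoc: "\<lbrakk>h \<in> hom1 B c d; g \<in> hom1 B b c; f \<in> hom1 B a b\<rbrakk>
          \<Longrightarrow> pf2 F (assoc B h g f) = assoc C (pf1 F h) (pf1 F g) (pf1 F f)"
    and pf2_lunit: "f \<in> hom1 B a b \<Longrightarrow> pf2 F (lunit B f) = lunit C (pf1 F f)"
    and pf2_runit: "f \<in> hom1 B a b \<Longrightarrow> pf2 F (runit B f) = runit C (pf1 F f)"
    and pf_comp2_eq: "\<lbrakk>g \<in> hom1 B b c; f \<in> hom1 B a b\<rbrakk>
          \<Longrightarrow> pf_comp2 F g f = id2 C (pf1 F (g \<odot>\<^bsub>B\<^esub> f))"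
    and pf_unit_eq: "a \<in> ob B \<Longrightarrow> pf_unit F a = id2 C (pf1 F (id1 B a))"
begin

lemma pf1_arr1: "f \<in> arr1 B \<Longrightarrow> pf1 F f \<in> arr1 C"
  using pf1_hom[of f "src1 B f" "trg1 B f"] by (simp add: hom1_def)

text \<open>With identity constraints the coherence conditions shrink to preservation of
  \<open>assoc\<close>, \<open>lunit\<close> and \<open>runit\<close>, and naturality of the
  composition constraint to preservation of horizontal composites.\<close>

lemma pf_strict_functor:
  assumes "bicategory B" "bicategory C"
  shows "pseudofunctor B C F"
proof -
  interpret B: bicategory B by fact
  interpret C: bicategory C by fact
  show ?thesis
  proof (unfold_locales, goal_cases)
    case 1 then show ?case by (rule pf0_ob)
  next case 2 then show ?case by (rule pf1_hom)
  next case 3 then show ?case by (rule pf2_hom)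
  next case 4 then show ?case by (rule pf2_id)
  next case 5 then show ?case by (rule pf2_vcomp)
  next case (6 g b c f a)
    then show ?case using C.id2_iso[of "pf1 F (g \<odot>\<^bsub>B\<^esub> f)"] pf1_hom[OF B.comp1_hom[OF 6]]
      by (simp add: pf_comp2_eq pf1_comp hom1_def)
  next case (7 g b c f a \<beta> g' \<alpha> f')
    note h = B.hom2_hom1[OF 7(3,1)] B.hom2_hom1[OF 7(4,2)]
    note k = pf2_hom[OF B.hcomp_hom[OF 7]]
    show ?case
      using C.vcomp_id_left[OF k] C.vcomp_id_right[OF k]
      by (simp add: pf_comp2_eq[OF h] pf_comp2_eq[OF 7(1,2)] pf2_hcomp[OF 7])
  next case (8 a)
    then show ?case using C.id2_iso[of "pf1 F (id1 B a)"] pf1_hom[OF B.id1_hom[OF 8]]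
      by (simp add: pf_unit_eq pf1_id hom1_def)
  next case (9 h c d g b f a)
    note c = B.comp1_hom[OF 9(1,2)] B.comp1_hom[OF 9(2,3)]
    note k = pf2_hom[OF iso2_hom2[OF B.assoc_iso[OF 9]]]
    note i = pf1_hom[OF 9(1)] pf1_hom[OF 9(2)] pf1_hom[OF 9(3)] pf1_hom[OF c(1)] pf1_hom[OF c(2)]
      pf1_hom[OF B.comp1_hom[OF c(1) 9(3)]] pf1_hom[OF B.comp1_hom[OF 9(1) c(2)]]
    show ?case
      using C.vcomp_id_left[OF k] C.vcomp_id_right[OF k] i
      by (simp add: pf_comp2_eq[OF c(1) 9(3)] pf_comp2_eq[OF 9(1) c(2)]  pf_comp2_eq[OF 9(1,2)]
        pf_comp2_eq[OF 9(2,3)] C.hcomp_id[OF pf1_hom[OF c(1)] pf1_hom[OF 9(3)]]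
        C.hcomp_id[OF pf1_hom[OF 9(1)] pf1_hom[OF c(2)]] pf1_comp[OF 9(1) c(2)]
        pf1_comp[OF c(1) 9(3)] pf2_assoc[OF 9] hom1_def)
  next case (10 f a b)
    note ob = B.hom1_ob[OF 10]
    note i = B.id1_hom[OF ob(2)]
    note k = pf2_hom[OF iso2_hom2[OF B.lunit_iso[OF 10]]]
    show ?case
      using C.vcomp_id_right[OF k] pf1_hom[OF B.comp1_hom[OF i 10]] C.hcomp_id[OF pf1_hom[OF i] pf1_hom[OF 10]]
      by (simp add: pf_comp2_eq[OF i 10] pf_unit_eq[OF ob(2)] pf2_lunit[OF 10] pf1_comp[OF i 10] hom1_def)
  next case (11 f a b)
    note ob = B.hom1_ob[OF 11]
    note i = B.id1_hom[OF ob(1)]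
    note k = pf2_hom[OF iso2_hom2[OF B.runit_iso[OF 11]]]
    show ?case
      using C.vcomp_id_right[OF k] pf1_hom[OF B.comp1_hom[OF 11 i]] C.hcomp_id[OF pf1_hom[OF 11] pf1_hom[OF i]]
      by (simp add: pf_comp2_eq[OF 11 i] pf_unit_eq[OF ob(1)] pf2_runit[OF 11] pf1_comp[OF 11 i] hom1_def)
  qed
qed

lemma pf2_iso:
  assumes "bicategory B" "bicategory C" and \<alpha>: "\<alpha> \<in> iso2 B f g"
  shows "pf2 F \<alpha> \<in> iso2 C (pf1 F f) (pf1 F g)" "pf2 F (inv2 B \<alpha>) = inv2 C (pf2 F \<alpha>)"
proof -
  interpret B: bicategory B by fact
  interpret C: bicategory C by fact
  note i = iso2_hom2[OF \<alpha>] B.inv2_hom[OF \<alpha>]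
  note ar = B.hom2_arr1[OF i(1)]
  have "pf2 F (inv2 B \<alpha>) \<cdot>\<^bsub>C\<^esub> pf2 F \<alpha> = id2 C (pf1 F f)"
    using pf2_vcomp[OF i(2) i(1)] B.inv2_left[OF \<alpha>] pf2_id ar by simp
  moreover have "pf2 F \<alpha> \<cdot>\<^bsub>C\<^esub> pf2 F (inv2 B \<alpha>) = id2 C (pf1 F g)"
    using pf2_vcomp[OF i(1) i(2)] B.inv2_right[OF \<alpha>] pf2_id ar by simp
  ultimately show "pf2 F \<alpha> \<in> iso2 C (pf1 F f) (pf1 F g)" "pf2 F (inv2 B \<alpha>) = inv2 C (pf2 F \<alpha>)"
    using C.inverse2_iso C.inv2_unique pf2_hom[OF i(1)] pf2_hom[OF i(2)] by (blast, metis)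
qed

text \<open>The reason why whiskering with a strict functor on the left takes identity
  transformations to identity transformations.\<close>

lemma pf2_unit_swap:
  assumes "bicategory B" "bicategory C" and f: "f \<in> hom1 B a b"
  shows "pf2 F (unit_swap B f) = unit_swap C (pf1 F f)"
proof -
  interpret B: bicategory B by fact
  show ?thesis
    unfolding unit_swap_def
      pf2_vcomp[OF B.inv2_hom[OF B.lunit_iso[OF f]] iso2_hom2[OF B.runit_iso[OF f]]]
    by (simp add: pf2_lunit[OF f] pf2_runit[OF f] pf2_iso(2)[OF assms(1,2) B.lunit_iso[OF f]])
qed

end

section \<open>Closure properties of strict functors\<close>

lemma strict_functor_comp:
  assumes "strict_functor B C F" "strict_functor C D G" "bicategory B" "bicategory D"
  shows "strict_functor B D (pf_comp D G F)"
proof -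
  interpret F: strict_functor B C F by fact
  interpret G: strict_functor C D G by fact
  interpret B: bicategory B by fact
  interpret D: bicategory D by fact
  show ?thesis
  proof (unfold_locales, goal_cases)
    case 1 then show ?case by (simp add: pf_comp_def F.pf0_ob G.pf0_ob)
  next case 2 then show ?case by (auto simp: pf_comp_def intro: F.pf1_hom G.pf1_hom)
  next case 3 then show ?case by (auto simp: pf_comp_def intro: F.pf2_hom G.pf2_hom)
  next case 4 then show ?case by (simp add: pf_comp_def F.pf1_id G.pf1_id F.pf0_ob)
  next case (5 g b c f a) then show ?case
      by (simp add: pf_comp_def F.pf1_comp[OF 5] G.pf1_comp[OF F.pf1_hom F.pf1_hom, OF 5])
  next case 6 then show ?case by (simp add: pf_comp_def F.pf2_id G.pf2_id F.pf1_arr1)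
  next case 7 show ?case
      by (simp add: pf_comp_def F.pf2_vcomp[OF 7] G.pf2_vcomp[OF F.pf2_hom F.pf2_hom, OF 7])
  next case 8 show ?case
      by (simp add: pf_comp_def F.pf2_hcomp[OF 8]
        G.pf2_hcomp[OF F.pf1_hom F.pf1_hom F.pf2_hom F.pf2_hom, OF 8])
  next case 9 show ?case
      by (simp add: pf_comp_def F.pf2_assoc[OF 9] G.pf2_assoc[OF F.pf1_hom F.pf1_hom F.pf1_hom, OF 9])
  next case 10 show ?case
      by (simp add: pf_comp_def F.pf2_lunit[OF 10] G.pf2_lunit[OF F.pf1_hom, OF 10])
  next case 11 show ?case
      by (simp add: pf_comp_def F.pf2_runit[OF 11] G.pf2_runit[OF F.pf1_hom, OF 11])
  \<comment> \<open>The composite constraint is G of an identity cell after an identity cell of G;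
    strictness of F and G makes both the identity of the same 1-cell.\<close>
  next case 12
    note h = F.pf1_hom[OF B.comp1_hom[OF 12]]
    from G.pf1_hom[OF h] h show ?case
      by (simp add: pf_comp_def F.pf_comp2_eq[OF 12] G.pf_comp2_eq[OF F.pf1_hom F.pf1_hom, OF 12]
       F.pf1_comp[OF 12] G.pf2_id hom1_def)
  next case 13
    note h = F.pf1_hom[OF B.id1_hom[OF 13]]
    from G.pf1_hom[OF h] h show ?case
      by (simp add: pf_comp_def F.pf_unit_eq[OF 13] G.pf_unit_eq[OF F.pf0_ob, OF 13]
       F.pf1_id[OF 13] G.pf2_id hom1_def)
  qed
qed

lemma strict_functor_prod:
  assumes "strict_functor B C F" "strict_functor B' C' G"
  shows "strict_functor (prod_bicat B B') (prod_bicat C C') (pf_prod F G)"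
proof -
  interpret F: strict_functor B C F by fact
  interpret G: strict_functor B' C' G by fact
  show ?thesis
    by unfold_locales
      (auto simp: pf_prod_def F.pf0_ob G.pf0_ob F.pf1_id G.pf1_id F.pf2_id G.pf2_id F.pf_unit_eq G.pf_unit_eq split_beta
         intro: F.pf1_hom G.pf1_hom F.pf2_hom G.pf2_hom F.pf1_comp G.pf1_comp
            F.pf2_vcomp G.pf2_vcomp F.pf2_hcomp G.pf2_hcomp F.pf2_assoc G.pf2_assoc
            F.pf2_lunit G.pf2_lunit F.pf2_runit G.pf2_runit F.pf_comp2_eq G.pf_comp2_eq)
qed

lemma strict_functor_pair:
  assumes "strict_functor B C F" "strict_functor B C' G"
  shows "strict_functor B (prod_bicat C C') (pf_pair F G)"
proof -
  interpret F: strict_functor B C F by fact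
  interpret G: strict_functor B C' G by fact
  show ?thesis
    by unfold_locales
      (auto simp: pf_pair_def F.pf0_ob G.pf0_ob F.pf1_id G.pf1_id F.pf2_id G.pf2_id F.pf_unit_eq G.pf_unit_eq
         intro: F.pf1_hom G.pf1_hom F.pf2_hom G.pf2_hom F.pf1_comp G.pf1_comp
            F.pf2_vcomp G.pf2_vcomp F.pf2_hcomp G.pf2_hcomp F.pf2_assoc G.pf2_assoc
            F.pf2_lunit G.pf2_lunit F.pf2_runit G.pf2_runit F.pf_comp2_eq G.pf_comp2_eq)
qed

lemma strict_functor_id: "strict_functor B B (pf_id B)"
  by unfold_locales (simp_all add: pf_id_def pf_strict_def)

lemma strict_functor_group3:
  "strict_functor (prod_bicat B (prod_bicat C D)) (prod_bicat (prod_bicat B C) D) (pf_group3 B C D)"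
  by unfold_locales (auto simp: pf_group3_def pf_strict_def split_beta)

lemma strict_functor_group4:
  "strict_functor (prod_bicat B (prod_bicat C (prod_bicat D E)))
     (prod_bicat (prod_bicat B (prod_bicat C D)) E) (pf_group4 B C D E)"
  by unfold_locales (auto simp: pf_group4_def pf_strict_def split_beta)

lemma strict_functor_ins_left:
  assumes "strict_functor unit_bicat U I" "bicategory U" "bicategory B"
  shows "strict_functor B (prod_bicat U B) (pf_ins_left U I B)"
  unfolding pf_ins_left_def
proof (rule strict_functor_comp[OF _ strict_functor_prod[OF assms(1) strict_functor_id] assms(3)
      bicategory_prod[OF assms(2,3)]])
  show "strict_functor B (prod_bicat unit_bicat B)
    (pf_strict B (prod_bicat unit_bicat B) (Pair ()) (Pair ()) (Pair ()))"
    by unfold_locales (auto simp: pf_strict_def unit_bicat_def hom1_def hom2_def)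
qed

lemma strict_functor_ins_right:
  assumes "strict_functor unit_bicat U I" "bicategory U" "bicategory B"
  shows "strict_functor B (prod_bicat B U) (pf_ins_right U I B)"
  unfolding pf_ins_right_def
proof (rule strict_functor_comp[OF _ strict_functor_prod[OF strict_functor_id assms(1)] assms(3)
      bicategory_prod[OF assms(3,2)]])
  show "strict_functor B (prod_bicat B unit_bicat)
    (pf_strict B (prod_bicat B unit_bicat) (\<lambda>x. (x, ())) (\<lambda>x. (x, ())) (\<lambda>x. (x, ())))"
    by unfold_locales (auto simp: pf_strict_def unit_bicat_def hom1_def hom2_def)
qed

text \<open>Strict units enter here: the composition constraint of \<open>pf_const\<close> is the
  \<open>lunit\<close> of an identity 1-cell, and it must have the identity 1-cell itself as its
  source.\<close>

lemma strict_functor_const: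
  assumes "unit_strict_bicategory C" "x \<in> ob C"
  shows "strict_functor B C (pf_const C x)"
proof -
  interpret C: unit_strict_bicategory C by fact
  note i = C.id1_hom[OF assms(2)]
  then have a: "id1 C x \<in> arr1 C" by (simp add: hom1_def)
  show ?thesis
    by unfold_locales
     (use assms(2) i a C.hcomp_id[OF i i] in
       \<open>simp_all add: pf_const_def C.id2_hom C.id1_comp C.lunit_id C.runit_id C.assoc_id\<close>)
qed

section \<open>Identity transformations\<close>

text \<open>Weaker than equality of records, which fails for functors with arbitrary values off the
  carriers. The constraints are left out because \<open>strict_functor\<close> determines them
  wherever they matter.\<close>

definition pf_agree :: "('o, 'm, 'c) bicat \<Rightarrow> ('o, 'm, 'c, 'p, 'n, 'd) pfun \<Rightarrow>
    ('o, 'm, 'c, 'p, 'n, 'd) pfun \<Rightarrow> bool" where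
  "pf_agree B F G \<longleftrightarrow> (\<forall>a\<in>ob B. pf0 F a = pf0 G a) \<and> (\<forall>f\<in>arr1 B. pf1 F f = pf1 G f) \<and>
     (\<forall>\<alpha>\<in>arr2 B. pf2 F \<alpha> = pf2 G \<alpha>)"

lemma pf_agreeI:
  assumes "\<And>a. a \<in> ob B \<Longrightarrow> pf0 F a = pf0 G a" "\<And>f. f \<in> arr1 B \<Longrightarrow> pf1 F f = pf1 G f"
    "\<And>\<alpha>. \<alpha> \<in> arr2 B \<Longrightarrow> pf2 F \<alpha> = pf2 G \<alpha>"
  shows "pf_agree B F G"
  using assms by (simp add: pf_agree_def)

lemma pf_agreeD:
  assumes "pf_agree B F G"
  shows "a \<in> ob B \<Longrightarrow> pf0 F a = pf0 G a" "f \<in> arr1 B \<Longrightarrow> pf1 F f = pf1 G f"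
    "\<alpha> \<in> arr2 B \<Longrightarrow> pf2 F \<alpha> = pf2 G \<alpha>"
  using assms by (auto simp: pf_agree_def)

lemma pf_agree_refl: "pf_agree B F F"
  by (simp add: pf_agree_def)

lemma pf_agree_sym: "pf_agree B F G \<Longrightarrow> pf_agree B G F"
  by (simp add: pf_agree_def)

text \<open>\<open>\<sigma>\<close> is the identity transformation of \<open>F\<close>, or equally of any functor agreeing with \<open>F\<close>.\<close>

definition tr_is_id :: "('o, 'm, 'c) bicat \<Rightarrow> ('p, 'n, 'd) bicat \<Rightarrow> ('o, 'm, 'c, 'p, 'n, 'd) pfun \<Rightarrow>
    ('o, 'm, 'n, 'd) ptrans \<Rightarrow> bool" where
  "tr_is_id B C F \<sigma> \<longleftrightarrow> (\<forall>a\<in>ob B. tr0 \<sigma> a = id1 C (pf0 F a)) \<and>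
     (\<forall>f\<in>arr1 B. tr1 \<sigma> f = unit_swap C (pf1 F f))"

lemma tr_is_id_agree: "tr_is_id B C F \<sigma> \<Longrightarrow> pf_agree B F G \<Longrightarrow> tr_is_id B C G \<sigma>"
  by (simp add: tr_is_id_def pf_agree_def)

lemma tr_is_id_tr_id: "tr_is_id B C F (tr_id C F)"
  by (simp add: tr_is_id_def tr_id_def unit_swap_def)

text \<open>The cells of \<open>tr_comp\<close> mention the values of all three functors. Agreement
  rewrites them to values of F, after which \<open>unit_swap_unit_swap\<close> applies.\<close>

lemma tr_is_id_comp:
  assumes "unit_strict_bicategory C" "bicategory B" "strict_functor B C F"
    "pf_agree B F G" "pf_agree B F H" "tr_is_id B C F \<sigma>" "tr_is_id B C F \<tau>"
  shows "tr_is_id B C F (tr_comp B C F G H \<tau> \<sigma>)"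
proof -
  interpret C: unit_strict_bicategory C by fact
  interpret B: bicategory B by fact
  interpret F: strict_functor B C F by fact
  show ?thesis
    unfolding tr_is_id_def
  proof (intro conjI ballI)
    fix a assume "a \<in> ob B"
    then show "tr0 (tr_comp B C F G H \<tau> \<sigma>) a = id1 C (pf0 F a)"
      using assms(6,7) by (simp add: tr_comp_def tr_is_id_def C.id1_comp F.pf0_ob)
  next
    fix f assume f: "f \<in> arr1 B"
    show "tr1 (tr_comp B C F G H \<tau> \<sigma>) f = unit_swap C (pf1 F f)"
      using assms(4-7) f C.unit_swap_unit_swap[OF F.pf1_hom[OF hom1I[OF f]]] B.src1_ob[OF f] B.trg1_ob[OF f]
      by (simp add: tr_comp_def tr_is_id_def pf_agree_def Let_def)
  qed
qed

lemma tr_is_id_whisk_left: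
  assumes "bicategory B" "unit_strict_bicategory C" "bicategory D" "strict_functor B C F"
    "strict_functor C D K" "pf_agree B F G" "tr_is_id B C F \<sigma>"
  shows "tr_is_id B D (pf_comp D K F) (tr_whisk_left B D K F G \<sigma>)"
proof -
  interpret C: unit_strict_bicategory C by fact
  interpret B: bicategory B by fact
  interpret D: bicategory D by fact
  interpret F: strict_functor B C F by fact
  interpret K: strict_functor C D K by fact
  show ?thesis
    unfolding tr_is_id_def
  proof (intro conjI ballI)
    fix a assume "a \<in> ob B"
    then show "tr0 (tr_whisk_left B D K F G \<sigma>) a = id1 D (pf0 (pf_comp D K F) a)"
      using assms(7) by (simp add: tr_whisk_left_def tr_is_id_def pf_comp_def K.pf1_id F.pf0_ob)
  next
    fix f assume f: "f \<in> arr1 B"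
    note Ff = F.pf1_hom[OF hom1I[OF f]]
    note ob = F.pf0_ob[OF B.src1_ob[OF f]] F.pf0_ob[OF B.trg1_ob[OF f]]
    note i = C.id1_hom[OF ob(1)] C.id1_hom[OF ob(2)]
    note k = K.pf2_hom[OF iso2_hom2[OF C.unit_swap_iso[OF Ff]]]
    \<comment> \<open>\<open>tr_whisk_left\<close> conjugates with constraints of K; at these
      arguments they are identities.\<close>
    have *: "pf_comp2 K (pf1 F f) (id1 C (pf0 F (src1 B f))) = id2 D (pf1 K (pf1 F f \<odot>\<^bsub>C\<^esub> id1 C (pf0 F (src1 B f))))"
      "pf_comp2 K (id1 C (pf0 F (trg1 B f))) (pf1 F f) = id2 D (pf1 K (id1 C (pf0 F (trg1 B f)) \<odot>\<^bsub>C\<^esub> pf1 F f))"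
      by (rule K.pf_comp2_eq[OF Ff i(1)] K.pf_comp2_eq[OF i(2) Ff])+
    show "tr1 (tr_whisk_left B D K F G \<sigma>) f = unit_swap D (pf1 (pf_comp D K F) f)"
      using assms(6,7) f  B.src1_ob[OF f] B.trg1_ob[OF f] * k D.vcomp_id_left[OF k] D.vcomp_id_right[OF k]
        D.hom2_arr1[OF k] K.pf2_unit_swap[OF _ _ Ff] C.bicategory_axioms D.bicategory_axioms
      by (simp add: tr_whisk_left_def tr_is_id_def pf_agree_def Let_def pf_comp_def)
  qed
qed

lemma tr_is_id_whisk_right:
  assumes "tr_is_id C D K \<sigma>" "strict_functor B C E"
  shows "tr_is_id B D (pf_comp D K E) (tr_whisk_right \<sigma> E)"
proof -
  interpret E: strict_functor B C E by fact
  show ?thesis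
    using assms(1) by (simp add: tr_is_id_def tr_whisk_right_def pf_comp_def E.pf0_ob E.pf1_arr1)
qed

lemma tr_is_id_prod:
  assumes "tr_is_id B C F \<sigma>" "tr_is_id B' C' F' \<sigma>'" "strict_functor B C F" "strict_functor B' C' F'"
    "bicategory C" "bicategory C'"
  shows "tr_is_id (prod_bicat B B') (prod_bicat C C') (pf_prod F F') (tr_prod \<sigma> \<sigma>')"
proof -
  interpret F: strict_functor B C F by fact
  interpret F': strict_functor B' C' F' by fact
  interpret C: bicategory C by fact
  interpret C': bicategory C' by fact
  interpret P: bicategory "prod_bicat C C'" by (rule bicategory_prod) fact+
  show ?thesis
    unfolding tr_is_id_def
  proof (intro conjI ballI)
    fix p assume "p \<in> ob (prod_bicat B B')"
    then show "tr0 (tr_prod \<sigma> \<sigma>') p = id1 (prod_bicat C C') (pf0 (pf_prod F F') p)"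
      using assms(1,2) by (cases p) (simp add: tr_prod_def tr_is_id_def pf_prod_def)
  next
    fix q assume q: "q \<in> arr1 (prod_bicat B B')"
    obtain f f' where [simp]: "q = (f, f')" by force
    from q have f: "f \<in> arr1 B" "f' \<in> arr1 B'" by simp_all
    note h = F.pf1_hom[OF hom1I[OF f(1)]] F'.pf1_hom[OF hom1I[OF f(2)]]
    \<comment> \<open>Invertibility of the paired unit constraint allows \<open>inv2\<close> in the
      product to be computed componentwise.\<close>
    have "(lunit C (pf1 F f), lunit C' (pf1 F' f')) \<in> iso2 (prod_bicat C C')
      (id1 C (pf0 F (trg1 B f)) \<odot>\<^bsub>C\<^esub> pf1 F f, id1 C' (pf0 F' (trg1 B' f')) \<odot>\<^bsub>C'\<^esub> pf1 F' f')
      (pf1 F f, pf1 F' f')"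
      using C.lunit_iso[OF h(1)] C'.lunit_iso[OF h(2)] by simp
    from inv2_prod[OF C.bicategory_axioms C'.bicategory_axioms this]
    show "tr1 (tr_prod \<sigma> \<sigma>') q = unit_swap (prod_bicat C C') (pf1 (pf_prod F F') q)"
      using assms(1,2) f
      by (simp add: tr_prod_def tr_is_id_def pf_prod_def unit_swap_def)
  qed
qed

text \<open>The laws of a transformation turn into \<open>unit_swap_natural\<close>,
  \<open>unit_swap_comp\<close> and \<open>unit_swap_id\<close>. Source and target may be different
  records, as for the associativity transformation.\<close>

lemma pseudonatural_id:
  assumes "bicategory B" "unit_strict_bicategory C" "strict_functor B C F" "strict_functor B C G"
    "pf_agree B F G" "tr_is_id B C F \<sigma>"
  shows "pseudonatural B C F G \<sigma>"
proof -
  interpret C: unit_strict_bicategory C by fact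
  interpret B: bicategory B by fact
  interpret F: strict_functor B C F by fact
  interpret G: strict_functor B C G by fact
  interpret PF: pseudofunctor B C F by (rule F.pf_strict_functor) unfold_locales
  interpret PG: pseudofunctor B C G by (rule G.pf_strict_functor) unfold_locales
  have G0: "pf0 G a = pf0 F a" if "a \<in> ob B" for a using assms(5) that by (simp add: pf_agree_def)
  have G1: "pf1 G f = pf1 F f" if "f \<in> hom1 B a b" for f a b
    using assms(5) that by (simp add: pf_agree_def hom1_def)
  have G2: "pf2 G \<alpha> = pf2 F \<alpha>" if "\<alpha> \<in> hom2 B f g" for f g \<alpha>
    using assms(5) that by (simp add: pf_agree_def hom2_def)
  have s0: "tr0 \<sigma> a = id1 C (pf0 F a)" if "a \<in> ob B" for a
    using assms(6) that by (simp add: tr_is_id_def)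
  have s1: "tr1 \<sigma> f = unit_swap C (pf1 F f)" if "f \<in> hom1 B a b" for f a b
    using assms(6) that by (simp add: tr_is_id_def hom1_def)
  show ?thesis
  proof (unfold_locales, goal_cases)
    case (1 a) then show ?case by (simp add: s0 G0 C.id1_hom F.pf0_ob)
  next
    case (2 f a b)
    note ob = B.hom1_ob[OF 2]
    show ?case using C.unit_swap_iso[OF F.pf1_hom[OF 2]] by (simp add: s0 ob s1[OF 2] G1[OF 2])
  next
    case (3 f a b \<alpha> f')
    note ob = B.hom1_ob[OF 3(1)]
    show ?case
      using C.unit_swap_natural[OF F.pf1_hom[OF 3(1)] F.pf2_hom[OF 3(2)]]
      by (simp add: s0 ob s1[OF 3(1)] s1[OF B.hom2_hom1[OF 3(2,1)]] G2[OF 3(2)])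
  next
    case (4 g b c f a)
    note ob = B.hom1_ob[OF 4(1)] B.hom1_ob[OF 4(2)]
    note gf = B.comp1_hom[OF 4]
    note i = C.id1_hom[OF F.pf0_ob[OF ob(3)]] C.id1_hom[OF F.pf0_ob[OF ob(2)]]
    note k = iso2_hom2[OF C.unit_swap_iso[OF F.pf1_hom[OF gf]]]
    note Fc = F.pf1_comp[OF 4]
    \<comment> \<open>The composition constraints of G and F appear whiskered on the two sides of
      \<open>tr1_comp\<close>; both whiskerings are identities.\<close>
    have "unit_swap C (pf1 F (g \<odot>\<^bsub>B\<^esub> f)) \<cdot>\<^bsub>C\<^esub> (id2 C (pf1 F (g \<odot>\<^bsub>B\<^esub> f)) \<star>\<^bsub>C\<^esub> id2 C (id1 C (pf0 F a)))
      = (id2 C (id1 C (pf0 F c)) \<star>\<^bsub>C\<^esub> id2 C (pf1 F (g \<odot>\<^bsub>B\<^esub> f))) \<cdot>\<^bsub>C\<^esub> unit_swap C (pf1 F (g \<odot>\<^bsub>B\<^esub> f))"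
      by (simp add: C.hcomp_id[OF F.pf1_hom[OF gf] i(1)] C.hcomp_id[OF i(2) F.pf1_hom[OF gf]]
        C.vcomp_id_left[OF k] C.vcomp_id_right[OF k])
    then show ?case
      using C.unit_swap_comp[OF F.pf1_hom F.pf1_hom, OF 4]
      by (simp add: s0 ob s1[OF 4(1)] s1[OF 4(2)] s1[OF gf] G1[OF 4(1)] G1[OF 4(2)] G1[OF gf]
         F.pf_comp2_eq[OF 4] G.pf_comp2_eq[OF 4] Fc)
  next
    case (5 a)
    note i = C.id1_hom[OF F.pf0_ob[OF 5]] B.id1_hom[OF 5]
    have "id1 C (pf0 F a) \<in> arr1 C" using i by (simp add: hom1_def)
    with C.hcomp_id[OF i(1) i(1)] show ?case
      by (simp add: s0 5 s1[OF i(2)] F.pf_unit_eq G.pf_unit_eq F.pf1_id G.pf1_id G0 C.unit_swap_id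
        F.pf0_ob C.runit_id C.lunit_id C.id1_comp)
  qed
qed

text \<open>The two transformations are in general different terms, such as the two sides of \<pi>.
  Both have the values of one identity transformation, so identity components already satisfy the
  modification law.\<close>

lemma invertible_modification_id:
  assumes "bicategory B" "unit_strict_bicategory C" "strict_functor B C F" "strict_functor B C G"
    "pf_agree B F G" "tr_is_id B C F \<sigma>" "tr_is_id B C F \<tau>"
    and \<Gamma>: "\<And>a. a \<in> ob B \<Longrightarrow> \<Gamma> a = id2 C (id1 C (pf0 F a))"
  shows "invertible_modification B C F G \<sigma> \<tau> \<Gamma>"
proof -
  interpret B: bicategory B by fact
  interpret C: unit_strict_bicategory C by fact
  interpret F: strict_functor B C F by fact
  interpret S: pseudonatural B C F G \<sigma> by (rule pseudonatural_id) fact+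
  interpret T: pseudonatural B C F G \<tau> by (rule pseudonatural_id) fact+
  have s0: "tr0 \<sigma> a = id1 C (pf0 F a)" "tr0 \<tau> a = id1 C (pf0 F a)" if "a \<in> ob B" for a
    using assms(6,7) that by (simp_all add: tr_is_id_def)
  have s1: "tr1 \<sigma> f = unit_swap C (pf1 F f)" "tr1 \<tau> f = unit_swap C (pf1 F f)"
    if "f \<in> hom1 B a b" for f a b
    using assms(6,7) that by (simp_all add: tr_is_id_def hom1_def)
  have i: "id1 C (pf0 F a) \<in> arr1 C" if "a \<in> ob B" for a
    using C.id1_hom[OF F.pf0_ob[OF that]] by (simp add: hom1_def)
  show ?thesis
  proof (unfold_locales, goal_cases)
    case (1 a) then show ?case by (simp add: \<Gamma> s0 C.id2_hom i)
  next
    case (2 f a b)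
    note ob = B.hom1_ob[OF 2]
    note id = C.id1_hom[OF F.pf0_ob[OF ob(1)]] C.id1_hom[OF F.pf0_ob[OF ob(2)]]
    note k = iso2_hom2[OF C.unit_swap_iso[OF F.pf1_hom[OF 2]]]
    have "pf1 G f = pf1 F f" using assms(5) 2 by (simp add: pf_agree_def hom1_def)
    then show ?case
      by (simp add: s1[OF 2] \<Gamma> ob C.hcomp_id[OF F.pf1_hom[OF 2] id(1)]
        C.hcomp_id[OF id(2) F.pf1_hom[OF 2]] C.vcomp_id_left[OF k] C.vcomp_id_right[OF k])
  next
    case (3 a) then show ?case by (simp add: \<Gamma> s0 C.id2_iso i)
  qed
qed

text \<open>One transformation serves in both directions, since it depends only on values that F and
  G share. Unit and counit can be identity 2-cells because 1 \<odot> 1 = 1.\<close>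

definition eqv_id :: "('p, 'n, 'd) bicat \<Rightarrow> ('o, 'm, 'c, 'p, 'n, 'd) pfun \<Rightarrow> ('o, 'm, 'n, 'd) adj_eqv" where
  "eqv_id C F = \<lparr>fwd = tr_id C F, bwd = tr_id C F,
     adj_unit = \<lambda>a. id2 C (id1 C (pf0 F a)), adj_counit = \<lambda>a. id2 C (id1 C (pf0 F a))\<rparr>"

text \<open>In the triangle identities every 1-cell is an identity, where \<open>assoc\<close>,
  \<open>lunit\<close> and \<open>runit\<close> are all trivial.\<close>

lemma adjoint_equivalence_id:
  assumes "bicategory B" "unit_strict_bicategory C" "strict_functor B C F" "strict_functor B C G"
    "pf_agree B F G"
  shows "adjoint_equivalence B C F G (eqv_id C F)"
proof -
  interpret C: unit_strict_bicategory C by fact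
  interpret F: strict_functor B C F by fact
  note sym = pf_agree_sym[OF assms(5)]
  note id = tr_is_id_tr_id[of B C F]
  note idG = tr_is_id_agree[OF id assms(5)]
  have p0: "pf0 G a = pf0 F a" if "a \<in> ob B" for a using assms(5) that by (simp add: pf_agree_def)
  have tri: "x \<in> ob C \<Longrightarrow> id2 C (id1 C x) \<star>\<^bsub>C\<^esub> id2 C (id1 C x) = id2 C (id1 C x)"
    "x \<in> ob C \<Longrightarrow> id1 C x \<in> arr1 C" for x
    using C.hcomp_id[OF C.id1_hom C.id1_hom] C.id1_comp C.id1_hom by (auto simp: hom1_def)
  show ?thesis
  proof (rule adjoint_equivalence.intro, goal_cases)
    case 1 show ?case unfolding eqv_id_def adj_eqv.simps by (rule pseudonatural_id[OF assms id])
  next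
    case 2 show ?case unfolding eqv_id_def adj_eqv.simps
      by (rule pseudonatural_id[OF assms(1,2,4,3) sym idG])
  next
    case 3 show ?case unfolding eqv_id_def adj_eqv.simps
      by (rule invertible_modification_id[OF assms(1,2,3,3) pf_agree_refl id
          tr_is_id_comp[OF assms(2,1,3,5) pf_agree_refl id id]]) simp
  next
    case 4 show ?case unfolding eqv_id_def adj_eqv.simps
      by (rule invertible_modification_id[OF assms(1,2,4,4) pf_agree_refl
          tr_is_id_comp[OF assms(2,1,4) sym pf_agree_refl idG idG] tr_is_id_agree[OF tr_is_id_tr_id pf_agree_refl]])
         (simp add: p0)
  next
    case (5 a) then show ?case
      by (simp add: eqv_id_def tr_id_def tri F.pf0_ob C.lunit_id C.runit_id C.assoc_id)
  next
    case (6 a) then show ?case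
      by (simp add: eqv_id_def tr_id_def tri F.pf0_ob C.lunit_id C.runit_id C.assoc_id)
  qed
qed

section \<open>Tricategories with strict composition\<close>

context unit_strict_bicategory
begin

lemma id1_arr1: "x \<in> ob B \<Longrightarrow> id1 B x \<in> arr1 B"
  using id1_hom by (simp add: hom1_def)

lemma id2_id1_hcomp: "x \<in> ob B \<Longrightarrow> id2 B (id1 B x) \<star> id2 B (id1 B x) = id2 B (id1 B x)"
  using hcomp_id[OF id1_hom id1_hom] id1_comp by simp

lemma path_comp_id1:
  assumes "x \<in> ob B" "l \<noteq> []" "set l \<subseteq> {id1 B x}"
  shows "path_comp B l = id1 B x"
  using assms(2,3) by (induction l rule: induct_list012) (auto simp: id1_comp assms(1))

lemma path_join_id1:
  assumes "x \<in> ob B" "l \<noteq> []" "s \<noteq> []" "set l \<subseteq> {id1 B x}" "set s \<subseteq> {id1 B x}"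
  shows "path_join B l s = id2 B (id1 B x)"
  using assms(2,4)
proof (induction l rule: induct_list012)
  case (3 f g l)
  then show ?case
    using assms(1,3,5) path_comp_id1[of x "g # l"]
    by (auto simp: path_comp_id1 id2_id1_hcomp assoc_id id1_arr1)
qed (use assms(1,3,5) in \<open>auto simp: path_comp_id1 id1_comp\<close>)

text \<open>The shape of every step in the cocycle and normalization axioms once it is evaluated:
  the 1-cells on the boundary are components of identity transformations, all at the same total
  composite.\<close>

definition identity_step :: "'o \<Rightarrow> ('m, 'c) paste_step \<Rightarrow> bool" where
  "identity_step x = (\<lambda>(p, l, \<alpha>, l', s). l \<noteq> [] \<and> l' \<noteq> [] \<and> \<alpha> = id2 B (id1 B x) \<and>
     set p \<union> set l \<union> set l' \<union> set s \<subseteq> {id1 B x})"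

lemma paste_step_id1:
  assumes x: "x \<in> ob B" and "identity_step x u"
  shows "paste_step B u = id2 B (id1 B x)"
proof -
  obtain p l \<alpha> l' s where u: "u = (p, l, \<alpha>, l', s)" by (cases u)
  have s: "l \<noteq> []" "l' \<noteq> []" "\<alpha> = id2 B (id1 B x)" "set p \<subseteq> {id1 B x}" "set l \<subseteq> {id1 B x}"
    "set l' \<subseteq> {id1 B x}" "set s \<subseteq> {id1 B x}"
    using assms(2) by (auto simp: identity_step_def u)
  have "(if s = [] then \<alpha> else path_join B l' s \<cdot> (\<alpha> \<star> id2 B (path_comp B s)) \<cdot> inv2 B (path_join B l s))
    = id2 B (id1 B x)"
    using x s by (simp add: path_join_id1 path_comp_id1 id2_id1_hcomp id1_arr1)
  moreover have "foldr (\<lambda>f \<beta>. id2 B f \<star> \<beta>) p (id2 B (id1 B x)) = id2 B (id1 B x)"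
    using s(4) by (induction p) (simp_all add: x id2_id1_hcomp)
  ultimately show ?thesis unfolding u paste_step.simps by simp
qed

text \<open>Removes all associativity constraints from a coherence axiom: what remains is to inspect
  the listed steps one at a time.\<close>

lemma pasting_id1:
  assumes "x \<in> ob B" "us \<noteq> []" "\<forall>u\<in>set us. identity_step x u"
  shows "pasting B us = id2 B (id1 B x)"
  using assms(2,3)
  by (induction us rule: induct_list012) (simp_all add: paste_step_id1[OF assms(1)] assms(1) id1_arr1)

end

context strict_functor
begin

lemma pf_path_id1:
  assumes "unit_strict_bicategory B" "unit_strict_bicategory C"
    and "x \<in> ob B" "l \<noteq> []" "set l \<subseteq> {id1 B x}"
  shows "pf_path B C F l = id2 C (id1 C (pf0 F x))"
proof -
  interpret B: unit_strict_bicategory B by fact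
  interpret C: unit_strict_bicategory C by fact
  show ?thesis using assms(4,5)
  proof (induction l rule: induct_list012)
    case (3 f g l)
    then show ?case
      using assms(3) B.path_comp_id1[of x "g # l"] pf_comp2_eq[OF B.id1_hom B.id1_hom, of x]
      by (simp add: pf1_id C.id2_id1_hcomp pf0_ob C.id1_arr1 B.id1_comp)
  qed (use assms(3) pf1_id in auto)
qed

text \<open>The axioms transport \<open>tpi\<close>, \<open>tlambda\<close> and \<open>trho\<close>
  through the functors \<open>tens_left\<close> and \<open>tens_right\<close>; this and
  \<open>pf_cell_unit_id1\<close>, which treats \<open>tmu\<close>, keep them identities.\<close>

lemma pf_cell_id1:
  assumes "unit_strict_bicategory B" "unit_strict_bicategory C"
    and "x \<in> ob B" "l \<noteq> []" "set l \<subseteq> {id1 B x}" "l' \<noteq> []" "set l' \<subseteq> {id1 B x}"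
  shows "pf_cell B C F l l' (id2 B (id1 B x)) = id2 C (id1 C (pf0 F x))"
proof -
  interpret B: unit_strict_bicategory B by fact
  interpret C: unit_strict_bicategory C by fact
  show ?thesis
    using pf0_ob[OF assms(3)] assms(3-)
    by (simp add: pf_cell_def pf_path_id1[OF assms(1,2,3)] pf2_id pf1_id B.id1_arr1 C.id1_arr1)
qed

lemma pf_cell_unit_id1:
  assumes "unit_strict_bicategory B" "unit_strict_bicategory C"
    and "x \<in> ob B" "l \<noteq> []" "set l \<subseteq> {id1 B x}"
  shows "pf_cell_unit B C F l x (id2 B (id1 B x)) = id2 C (id1 C (pf0 F x))"
proof -
  interpret B: unit_strict_bicategory B by fact
  interpret C: unit_strict_bicategory C by fact
  show ?thesis
    using pf0_ob[OF assms(3)] assms(3-)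
    by (simp add: pf_cell_unit_def pf_path_id1[OF assms(1,2,3)] pf_unit_eq pf2_id pf1_id B.id1_arr1 C.id1_arr1)
qed

end

text \<open>Evaluates only the actions on objects, 1-cells and 2-cells. The constraints stay folded
  and are controlled by \<open>strict_functor\<close>.\<close>

lemma functor_sel:
  "pf0 (pf_comp D G F) x = pf0 G (pf0 F x)" "pf1 (pf_comp D G F) f = pf1 G (pf1 F f)"
  "pf2 (pf_comp D G F) \<alpha> = pf2 G (pf2 F \<alpha>)"
  "pf0 (pf_prod F F') p = (pf0 F (fst p), pf0 F' (snd p))"
  "pf1 (pf_prod F F') q = (pf1 F (fst q), pf1 F' (snd q))"
  "pf2 (pf_prod F F') r = (pf2 F (fst r), pf2 F' (snd r))"
  "pf0 (pf_pair F G') x = (pf0 F x, pf0 G' x)" "pf1 (pf_pair F G') f = (pf1 F f, pf1 G' f)"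
  "pf2 (pf_pair F G') \<alpha> = (pf2 F \<alpha>, pf2 G' \<alpha>)"
  "pf0 (pf_id A) y = y" "pf1 (pf_id A) h = h" "pf2 (pf_id A) \<beta> = \<beta>"
  "pf0 (pf_const A z) x = z" "pf1 (pf_const A z) f = id1 A z" "pf2 (pf_const A z) \<alpha> = id2 A (id1 A z)"
  "pf0 (pf_group3 X Y Z) t = ((fst t, fst (snd t)), snd (snd t))"
  "pf1 (pf_group3 X Y Z) t1 = ((fst t1, fst (snd t1)), snd (snd t1))"
  "pf2 (pf_group3 X Y Z) t2 = ((fst t2, fst (snd t2)), snd (snd t2))"
  "pf0 (pf_group4 W X Y Z) u = ((fst u, fst (snd u), fst (snd (snd u))), snd (snd (snd u)))"
  "pf1 (pf_group4 W X Y Z) u1 = ((fst u1, fst (snd u1), fst (snd (snd u1))), snd (snd (snd u1)))"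
  "pf2 (pf_group4 W X Y Z) u2 = ((fst u2, fst (snd u2), fst (snd (snd u2))), snd (snd (snd u2)))"
  "pf0 (pf_ins_left U I A) y = (pf0 I (), y)" "pf1 (pf_ins_left U I A) h = (pf1 I (), h)"
  "pf2 (pf_ins_left U I A) \<beta> = (pf2 I (), \<beta>)"
  "pf0 (pf_ins_right U I A) y = (y, pf0 I ())" "pf1 (pf_ins_right U I A) h = (h, pf1 I ())"
  "pf2 (pf_ins_right U I A) \<beta> = (\<beta>, pf2 I ())"
  by (simp_all add: pf_comp_def pf_prod_def pf_pair_def pf_id_def pf_const_def pf_strict_def
      pf_group3_def pf_group4_def pf_ins_left_def pf_ins_right_def split_beta map_prod_def)

text \<open>The interface between algebra and topology: only these hypotheses have to be checked for
  spaces. The equations prescribe the constraints because they are data of a \<open>tricat\<close>,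
  not merely asserted to exist.\<close>

locale strict_tricategory =
  fixes T :: "('x, 'o, 'm, 'c) tricat"
  assumes hom: "\<lbrakk>a \<in> tob T; b \<in> tob T\<rbrakk> \<Longrightarrow> unit_strict_bicategory (thom T a b)"
    and comp: "\<lbrakk>a \<in> tob T; b \<in> tob T; c \<in> tob T\<rbrakk>
          \<Longrightarrow> strict_functor (thom2 T a b c) (thom T a c) (tcomp T a b c)"
    and unit: "a \<in> tob T \<Longrightarrow> strict_functor unit_bicat (thom T a a) (tunit T a)"
    and assoc_agree: "\<lbrakk>a \<in> tob T; b \<in> tob T; c \<in> tob T; d \<in> tob T\<rbrakk>
          \<Longrightarrow> pf_agree (thom3 T a b c d) (comp3_left T a b c d) (comp3_right T a b c d)"
    and lunit_agree: "\<lbrakk>a \<in> tob T; b \<in> tob T\<rbrakk>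
          \<Longrightarrow> pf_agree (thom T a b) (unit_comp T a b) (pf_id (thom T a b))"
    and runit_agree: "\<lbrakk>a \<in> tob T; b \<in> tob T\<rbrakk>
          \<Longrightarrow> pf_agree (thom T a b) (comp_unit T a b) (pf_id (thom T a b))"
    and tassoc_eq: "tassoc T a b c d = eqv_id (thom T a d) (comp3_left T a b c d)"
    and tlunit_eq: "tlunit T a b = eqv_id (thom T a b) (unit_comp T a b)"
    and trunit_eq: "trunit T a b = eqv_id (thom T a b) (comp_unit T a b)"
    and tpi_eq: "tpi T a b c d e p = id2 (thom T a e) (id1 (thom T a e) (pf0 (comp4_first T a b c d e) p))"
    and tmu_eq: "tmu T a b c q = id2 (thom T a c) (id1 (thom T a c) (pf0 (tcomp T a b c) q))"
    and tlambda_eq: "tlambda T a b c q = id2 (thom T a c) (id1 (thom T a c) (pf0 (unit_comp2 T a b c) q))"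
    and trho_eq: "trho T a b c q = id2 (thom T a c) (id1 (thom T a c) (pf0 (tcomp T a b c) q))"
begin

section \<open>Strictness of the functors derived from the composition\<close>

abbreviation "Ob \<equiv> tob T"

lemma bicategory_hom: "a \<in> Ob \<Longrightarrow> b \<in> Ob \<Longrightarrow> bicategory (thom T a b)"
  using hom unit_strict_bicategory.axioms(1) by blast

lemma unit_strict_thom2: "a \<in> Ob \<Longrightarrow> b \<in> Ob \<Longrightarrow> c \<in> Ob \<Longrightarrow> unit_strict_bicategory (thom2 T a b c)"
  by (simp add: thom2_def unit_strict_bicategory_prod hom)

lemma unit_strict_thom3: "a \<in> Ob \<Longrightarrow> b \<in> Ob \<Longrightarrow> c \<in> Ob \<Longrightarrow> d \<in> Ob \<Longrightarrow> unit_strict_bicategory (thom3 T a b c d)"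
  by (simp add: thom3_def unit_strict_thom2 unit_strict_bicategory_prod hom)

lemma unit_strict_thom4: "a \<in> Ob \<Longrightarrow> b \<in> Ob \<Longrightarrow> c \<in> Ob \<Longrightarrow> d \<in> Ob \<Longrightarrow> e \<in> Ob \<Longrightarrow>
    unit_strict_bicategory (thom4 T a b c d e)"
  by (simp add: thom4_def unit_strict_thom3 unit_strict_bicategory_prod hom)

lemmas thoms_unit_strict = hom unit_strict_thom2 unit_strict_thom3 unit_strict_thom4
lemmas thoms_bicategory = thoms_unit_strict[THEN unit_strict_bicategory.axioms(1)]

lemma strict_comp_times:
  assumes "b \<in> Ob" "c \<in> Ob" "d \<in> Ob" "bicategory A"
  shows "strict_functor (prod_bicat (thom T c d) (prod_bicat (thom T b c) A)) (prod_bicat (thom T b d) A)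
    (comp_times T b c d A)"
  unfolding comp_times_def
  by (rule strict_functor_comp[OF strict_functor_group3 strict_functor_prod[OF comp[unfolded thom2_def] strict_functor_id]])
     (simp_all add: assms bicategory_prod bicategory_hom)

lemma strict_times_comp:
  assumes "a \<in> Ob" "b \<in> Ob" "c \<in> Ob"
  shows "strict_functor (prod_bicat A (thom2 T a b c)) (prod_bicat A (thom T a c)) (times_comp T A a b c)"
  unfolding times_comp_def
  by (rule strict_functor_prod[OF strict_functor_id comp]) (simp_all add: assms)

lemma strict_comp3_left:
  assumes "a \<in> Ob" "b \<in> Ob" "c \<in> Ob" "d \<in> Ob"
  shows "strict_functor (thom3 T a b c d) (thom T a d) (comp3_left T a b c d)"
  unfolding comp3_left_def
  by (rule strict_functor_comp[OF _ comp]) 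
    (use assms in \<open>simp_all add: strict_comp_times thom3_def thom2_def bicategory_prod bicategory_hom\<close>)

lemma strict_comp3_right:
  assumes "a \<in> Ob" "b \<in> Ob" "c \<in> Ob" "d \<in> Ob"
  shows "strict_functor (thom3 T a b c d) (thom T a d) (comp3_right T a b c d)"
  unfolding comp3_right_def thom3_def
  by (rule strict_functor_comp[OF strict_times_comp comp[unfolded thom2_def]]) 
    (use assms in \<open>simp_all add: thom2_def bicategory_prod bicategory_hom\<close>)

lemma strict_comp4_first:
  assumes "a \<in> Ob" "b \<in> Ob" "c \<in> Ob" "d \<in> Ob" "e \<in> Ob"
  shows "strict_functor (thom4 T a b c d e) (thom T a e) (comp4_first T a b c d e)"
  unfolding comp4_first_def
  by (rule strict_functor_comp[OF _ strict_comp3_left])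
    (use assms in \<open>simp_all add: thom4_def thom3_def strict_comp_times bicategory_hom thoms_bicategory bicategory_prod\<close>)

lemma strict_times_times_comp:
  assumes "a \<in> Ob" "b \<in> Ob" "c \<in> Ob" "d \<in> Ob" "e \<in> Ob"
  shows "strict_functor (thom4 T a b c d e) (thom3 T a c d e)
    (pf_prod (pf_id (thom T d e)) (times_comp T (thom T c d) a b c))"
proof -
  have "strict_functor (thom3 T a b c d) (thom2 T a c d) (times_comp T (thom T c d) a b c)"
    using strict_times_comp[of a b c "thom T c d"] assms by (simp add: thom3_def thom2_def)
  from strict_functor_prod[OF strict_functor_id this] show ?thesis
    by (simp add: thom4_def thom3_def)
qed

lemma strict_comp4_last:
  assumes "a \<in> Ob" "b \<in> Ob" "c \<in> Ob" "d \<in> Ob" "e \<in> Ob"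
  shows "strict_functor (thom4 T a b c d e) (thom T a e) (comp4_last T a b c d e)"
  unfolding comp4_last_def
  by (rule strict_functor_comp[OF strict_times_times_comp strict_comp3_right])
    (use assms in \<open>simp_all add: thoms_bicategory\<close>)

lemma strict_times_comp_times:
  assumes "a \<in> Ob" "b \<in> Ob" "c \<in> Ob" "d \<in> Ob" "e \<in> Ob"
  shows "strict_functor (thom4 T a b c d e) (thom3 T a b d e)
    (pf_prod (pf_id (thom T d e)) (comp_times T b c d (thom T a b)))"
proof -
  have "strict_functor (thom3 T a b c d) (thom2 T a b d) (comp_times T b c d (thom T a b))"
    using strict_comp_times[of b c d "thom T a b"] assms by (simp add: thom3_def thom2_def bicategory_hom)
  from strict_functor_prod[OF strict_functor_id this] show ?thesis
    by (simp add: thom4_def thom3_def)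
qed

lemma strict_ins_left:
  assumes "b \<in> Ob" "bicategory A"
  shows "strict_functor A (prod_bicat (thom T b b) A) (pf_ins_left (thom T b b) (tunit T b) A)"
  by (rule strict_functor_ins_left) (simp_all add: assms unit bicategory_hom)

lemma strict_ins_right:
  assumes "b \<in> Ob" "bicategory A"
  shows "strict_functor A (prod_bicat A (thom T b b)) (pf_ins_right (thom T b b) (tunit T b) A)"
  by (rule strict_functor_ins_right) (simp_all add: assms unit bicategory_hom)

lemma strict_unit_comp:
  assumes "a \<in> Ob" "b \<in> Ob"
  shows "strict_functor (thom T a b) (thom T a b) (unit_comp T a b)"
  unfolding unit_comp_def
  by (rule strict_functor_comp[OF strict_ins_left comp[unfolded thom2_def]]) (simp_all add: assms bicategory_hom)

lemma strict_comp_unit: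
  assumes "a \<in> Ob" "b \<in> Ob"
  shows "strict_functor (thom T a b) (thom T a b) (comp_unit T a b)"
  unfolding comp_unit_def
  by (rule strict_functor_comp[OF strict_ins_right comp[unfolded thom2_def]]) (simp_all add: assms bicategory_hom)

lemma strict_ins_mid:
  assumes "a \<in> Ob" "b \<in> Ob" "c \<in> Ob"
  shows "strict_functor (thom2 T a b c) (thom3 T a b b c)
     (pf_prod (pf_id (thom T b c)) (pf_ins_left (thom T b b) (tunit T b) (thom T a b)))"
  using strict_functor_prod[OF strict_functor_id strict_ins_left[OF assms(2) bicategory_hom[OF assms(1,2)]], of "thom T b c"]
  by (simp add: thom2_def thom3_def)

lemma strict_ins_end:
  assumes "a \<in> Ob" "b \<in> Ob" "c \<in> Ob"
  shows "strict_functor (thom2 T a b c) (thom3 T a a b c)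
     (pf_prod (pf_id (thom T b c)) (pf_ins_right (thom T a a) (tunit T a) (thom T a b)))"
  using strict_functor_prod[OF strict_functor_id strict_ins_right[OF assms(1) bicategory_hom[OF assms(1,2)]], of "thom T b c"]
  by (simp add: thom2_def thom3_def)

lemma strict_ins_start:
  assumes "a \<in> Ob" "b \<in> Ob" "c \<in> Ob"
  shows "strict_functor (thom2 T a b c) (thom3 T a b c c)
     (pf_ins_left (thom T c c) (tunit T c) (thom2 T a b c))"
  using strict_ins_left[OF assms(3), of "thom2 T a b c"] assms by (simp add: thom3_def thoms_bicategory)

lemma strict_unit_comp2:
  assumes "a \<in> Ob" "b \<in> Ob" "c \<in> Ob"
  shows "strict_functor (thom2 T a b c) (thom T a c) (unit_comp2 T a b c)"
  unfolding unit_comp2_def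
  by (rule strict_functor_comp[OF strict_ins_start strict_comp3_left]) (simp_all add: assms thoms_bicategory)

lemma strict_comp2_unit:
  assumes "a \<in> Ob" "b \<in> Ob" "c \<in> Ob"
  shows "strict_functor (thom2 T a b c) (thom T a c) (comp2_unit T a b c)"
  unfolding comp2_unit_def
  by (rule strict_functor_comp[OF strict_ins_end strict_comp3_right]) (simp_all add: assms thoms_bicategory)

section \<open>Typing and strict laws of the composition\<close>

lemma comp_type:
  assumes "a \<in> Ob" "b \<in> Ob" "c \<in> Ob"
  shows "fst p \<in> ob (thom T b c) \<Longrightarrow> snd p \<in> ob (thom T a b) \<Longrightarrow> pf0 (tcomp T a b c) p \<in> ob (thom T a c)"
    "fst q \<in> arr1 (thom T b c) \<Longrightarrow> snd q \<in> arr1 (thom T a b) \<Longrightarrow> pf1 (tcomp T a b c) q \<in> arr1 (thom T a c)"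
    "fst r \<in> arr2 (thom T b c) \<Longrightarrow> snd r \<in> arr2 (thom T a b) \<Longrightarrow> pf2 (tcomp T a b c) r \<in> arr2 (thom T a c)"
proof -
  interpret strict_functor "thom2 T a b c" "thom T a c" "tcomp T a b c" by (rule comp) fact+
  show "fst p \<in> ob (thom T b c) \<Longrightarrow> snd p \<in> ob (thom T a b) \<Longrightarrow> pf0 (tcomp T a b c) p \<in> ob (thom T a c)"
    using pf0_ob[of p] by (simp add: thom2_def)
  show "fst q \<in> arr1 (thom T b c) \<Longrightarrow> snd q \<in> arr1 (thom T a b) \<Longrightarrow> pf1 (tcomp T a b c) q \<in> arr1 (thom T a c)"
    using pf1_arr1[of q] by (simp add: thom2_def)
  show "fst r \<in> arr2 (thom T b c) \<Longrightarrow> snd r \<in> arr2 (thom T a b) \<Longrightarrow> pf2 (tcomp T a b c) r \<in> arr2 (thom T a c)"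
    using pf2_hom[OF hom2I, of r] by (simp add: thom2_def hom2_def)
qed

text \<open>\<open>assoc_agree\<close> unpacked on each level and oriented so that rewriting moves
  brackets to the right.\<close>

lemma comp_assoc:
  assumes "a \<in> Ob" "b \<in> Ob" "c \<in> Ob" "d \<in> Ob"
  shows "h \<in> ob (thom T c d) \<Longrightarrow> g \<in> ob (thom T b c) \<Longrightarrow> f \<in> ob (thom T a b) \<Longrightarrow>
      pf0 (tcomp T a b d) (pf0 (tcomp T b c d) (h, g), f) = pf0 (tcomp T a c d) (h, pf0 (tcomp T a b c) (g, f))"
    "H \<in> arr1 (thom T c d) \<Longrightarrow> G \<in> arr1 (thom T b c) \<Longrightarrow> F \<in> arr1 (thom T a b) \<Longrightarrow>
      pf1 (tcomp T a b d) (pf1 (tcomp T b c d) (H, G), F) = pf1 (tcomp T a c d) (H, pf1 (tcomp T a b c) (G, F))"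
    "\<gamma> \<in> arr2 (thom T c d) \<Longrightarrow> \<beta> \<in> arr2 (thom T b c) \<Longrightarrow> \<alpha> \<in> arr2 (thom T a b) \<Longrightarrow>
      pf2 (tcomp T a b d) (pf2 (tcomp T b c d) (\<gamma>, \<beta>), \<alpha>) = pf2 (tcomp T a c d) (\<gamma>, pf2 (tcomp T a b c) (\<beta>, \<alpha>))"
  using pf_agreeD(1)[OF assoc_agree[OF assms], of "(h, g, f)"]
    pf_agreeD(2)[OF assoc_agree[OF assms], of "(H, G, F)"]
    pf_agreeD(3)[OF assoc_agree[OF assms], of "(\<gamma>, \<beta>, \<alpha>)"]
  by (simp_all add: comp3_left_def comp3_right_def comp_times_def times_comp_def thom3_def
      thom2_def functor_sel)

lemma comp_unit_eqs:
  assumes "a \<in> Ob" "b \<in> Ob"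
  shows "f \<in> ob (thom T a b) \<Longrightarrow> pf0 (tcomp T a b b) (pf0 (tunit T b) (), f) = f"
    "F \<in> arr1 (thom T a b) \<Longrightarrow> pf1 (tcomp T a b b) (pf1 (tunit T b) (), F) = F"
    "\<alpha> \<in> arr2 (thom T a b) \<Longrightarrow> pf2 (tcomp T a b b) (pf2 (tunit T b) (), \<alpha>) = \<alpha>"
    "f \<in> ob (thom T a b) \<Longrightarrow> pf0 (tcomp T a a b) (f, pf0 (tunit T a) ()) = f"
    "F \<in> arr1 (thom T a b) \<Longrightarrow> pf1 (tcomp T a a b) (F, pf1 (tunit T a) ()) = F"
    "\<alpha> \<in> arr2 (thom T a b) \<Longrightarrow> pf2 (tcomp T a a b) (\<alpha>, pf2 (tunit T a) ()) = \<alpha>"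
  using lunit_agree[OF assms] runit_agree[OF assms]
  by (simp_all add: pf_agree_def unit_comp_def comp_unit_def functor_sel)

lemma unit_type:
  assumes "a \<in> Ob"
  shows "pf0 (tunit T a) () \<in> ob (thom T a a)" "pf1 (tunit T a) () \<in> arr1 (thom T a a)"
    "pf2 (tunit T a) () \<in> arr2 (thom T a a)"
proof -
  interpret strict_functor unit_bicat "thom T a a" "tunit T a" by (rule unit) fact+
  show "pf0 (tunit T a) () \<in> ob (thom T a a)" using pf0_ob by (simp add: unit_bicat_def)
  show "pf1 (tunit T a) () \<in> arr1 (thom T a a)" using pf1_arr1 by (simp add: unit_bicat_def)
  show "pf2 (tunit T a) () \<in> arr2 (thom T a a)" using pf2_hom[of "()" "()" "()"]
    by (simp add: unit_bicat_def hom2_def)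
qed

text \<open>Under these rules iterated composites of the same factors reach a common right-bracketed
  form with the units erased. This settles the \<open>pf_agree\<close> goals below.\<close>

lemmas functor_simps = thom4_def thom3_def thom2_def comp3_left_def comp3_right_def
  comp4_first_def comp4_last_def unit_comp2_def comp2_unit_def unit_comp_def comp_unit_def
  comp_times_def times_comp_def functor_sel
  comp_type comp_assoc comp_unit_eqs unit_type

section \<open>Boundaries of the modifications as identity transformations\<close>

lemma tr_is_id_assoc: "tr_is_id B (thom T a d) (comp3_left T a b c d) (fwd (tassoc T a b c d))"
  by (simp add: tassoc_eq eqv_id_def tr_is_id_tr_id)

lemma tr_is_id_lunit: "tr_is_id B (thom T a b) (unit_comp T a b) (fwd (tlunit T a b))"
  by (simp add: tlunit_eq eqv_id_def tr_is_id_tr_id)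

lemma tr_is_id_runit: "tr_is_id B (thom T a b) (comp_unit T a b) (bwd (trunit T a b))"
  by (simp add: trunit_eq eqv_id_def tr_is_id_tr_id)

text \<open>The backward transformation starts at the identity functor, so its property is moved
  there from \<open>comp_unit\<close>.\<close>

lemma tr_is_id_runit':
  "a \<in> Ob \<Longrightarrow> b \<in> Ob \<Longrightarrow> tr_is_id (thom T a b) (thom T a b) (pf_id (thom T a b)) (bwd (trunit T a b))"
  by (rule tr_is_id_agree[OF tr_is_id_runit runit_agree])

text \<open>Each whiskered piece is an identity transformation of its own source functor. Strict
  associativity makes that functor agree with \<open>comp4_first\<close>, and only then can the
  pieces be composed.\<close>

lemma pi_target_id:
  assumes "a \<in> Ob" "b \<in> Ob" "c \<in> Ob" "d \<in> Ob" "e \<in> Ob"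
  shows "tr_is_id (thom4 T a b c d e) (thom T a e) (comp4_first T a b c d e) (pi_target T a b c d e)"
proof -
  let ?Q = "thom4 T a b c d e" and ?C = "thom T a e"
  have sf: "strict_functor ?Q (thom3 T a b c e) (comp_times T c d e (thom2 T a b c))"
    using strict_comp_times[of c d e "thom2 T a b c"] assms thoms_bicategory
    by (simp add: thom4_def thom3_def)
  have 1: "tr_is_id ?Q ?C (comp4_first T a b c d e)
    (tr_whisk_right (fwd (tassoc T a b c e)) (comp_times T c d e (thom2 T a b c)))"
    unfolding comp4_first_def by (rule tr_is_id_whisk_right[OF tr_is_id_assoc sf])
  have "tr_is_id ?Q ?C (pf_comp ?C (comp3_left T a c d e) (pf_prod (pf_id (thom T d e)) (times_comp T (thom T c d) a b c)))
    (tr_whisk_right (fwd (tassoc T a c d e)) (pf_prod (pf_id (thom T d e)) (times_comp T (thom T c d) a b c)))"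
    by (rule tr_is_id_whisk_right[OF tr_is_id_assoc strict_times_times_comp]) fact+
  then have 2: "tr_is_id ?Q ?C (comp4_first T a b c d e)
    (tr_whisk_right (fwd (tassoc T a c d e)) (pf_prod (pf_id (thom T d e)) (times_comp T (thom T c d) a b c)))"
    by (rule tr_is_id_agree) (rule pf_agreeI; use assms in \<open>simp add: functor_simps\<close>)
  have ag: "pf_agree ?Q (comp4_first T a b c d e) (pf_comp ?C (comp3_right T a b c e) (comp_times T c d e (thom2 T a b c)))"
    "pf_agree ?Q (comp4_first T a b c d e) (comp4_last T a b c d e)"
    by (rule pf_agreeI; use assms in \<open>simp add: functor_simps\<close>)+
  show ?thesis
    unfolding pi_target_def Let_def
    by (rule tr_is_id_comp[OF hom[OF assms(1,5)] thoms_bicategory(4)[OF assms] strict_comp4_first[OF assms] ag 1 2])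
qed

text \<open>The scheme of \<open>pi_target_id\<close> with three pieces; the outer two are products
  of an associativity transformation with an identity, whiskered by the composition functor.\<close>

lemma pi_source_id:
  assumes "a \<in> Ob" "b \<in> Ob" "c \<in> Ob" "d \<in> Ob" "e \<in> Ob"
  shows "tr_is_id (thom4 T a b c d e) (thom T a e) (comp4_first T a b c d e) (pi_source T a b c d e)"
proof -
  let ?Q = "thom4 T a b c d e" and ?C = "thom T a e" and ?F = "comp4_first T a b c d e"
  let ?reg = "pf_group4 (thom T d e) (thom T c d) (thom T b c) (thom T a b)"
  let ?D = "prod_bicat (thom T b e) (thom T a b)"
  let ?mid = "pf_prod (pf_id (thom T d e)) (comp_times T b c d (thom T a b))"
  let ?D' = "prod_bicat (thom T d e) (thom T a d)"
  let ?L = "pf_comp ?D (pf_prod (comp3_left T b c d e) (pf_id (thom T a b))) ?reg"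
    and ?R = "pf_comp ?D (pf_prod (comp3_right T b c d e) (pf_id (thom T a b))) ?reg"
    and ?L' = "pf_prod (pf_id (thom T d e)) (comp3_left T a b c d)"
    and ?R' = "pf_prod (pf_id (thom T d e)) (comp3_right T a b c d)"
    and ?\<tau> = "tr_whisk_right (tr_prod (fwd (tassoc T b c d e)) (tr_id (thom T a b) (pf_id (thom T a b)))) ?reg"
    and ?\<tau>' = "tr_prod (tr_id (thom T d e) (pf_id (thom T d e))) (fwd (tassoc T a b c d))"
  note b = thoms_bicategory
  have agL: "pf_agree ?Q (?L)
     (?R)"
    and agL': "pf_agree ?Q (?L')
      (?R')"
    by (rule pf_agreeI; use assms in \<open>simp add: functor_simps\<close>)+
  \<comment> \<open>\<open>thom4\<close> is nested to the right, whereas a \<times> 1 expects its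
    first three factors bracketed together.\<close>
  have reg: "strict_functor ?Q (prod_bicat (thom3 T b c d e) (thom T a b)) ?reg"
    unfolding thom4_def thom3_def thom2_def by (rule strict_functor_group4)
  have usD: "unit_strict_bicategory ?D" "unit_strict_bicategory ?D'"
    using assms by (simp_all add: unit_strict_bicategory_prod hom)
  have "tr_is_id ?Q ?D (?L)
    (?\<tau>)"
    by (rule tr_is_id_whisk_right[OF tr_is_id_prod[OF tr_is_id_assoc tr_is_id_tr_id strict_comp3_left strict_functor_id] reg])
      (use assms in \<open>simp_all add: b\<close>)
  then have "tr_is_id ?Q ?C (pf_comp ?C (tcomp T a b e) (?L))
    (tr_whisk_left ?Q ?C (tcomp T a b e)
     (?L)
     (?R)
      (?\<tau>))"
  proof (rule tr_is_id_whisk_left[rotated 6])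
    show "strict_functor ?Q ?D (?L)"
      by (rule strict_functor_comp[OF reg strict_functor_prod[OF strict_comp3_left strict_functor_id]])
        (use assms usD in \<open>simp_all add: b unit_strict_bicategory.axioms(1)\<close>)
  qed (use assms b(1,4) usD comp[of a b e, unfolded thom2_def] agL in simp_all)
  then have 1: "tr_is_id ?Q ?C ?F
    (tr_whisk_left ?Q ?C (tcomp T a b e)
     (?L)
     (?R)
      (?\<tau>))"
    by (rule tr_is_id_agree) (rule pf_agreeI; use assms in \<open>simp add: functor_simps\<close>)
  have "tr_is_id ?Q ?C (pf_comp ?C (comp3_left T a b d e) ?mid) (tr_whisk_right (fwd (tassoc T a b d e)) ?mid)"
    by (rule tr_is_id_whisk_right[OF tr_is_id_assoc strict_times_comp_times]) fact+
  then have 2: "tr_is_id ?Q ?C ?F (tr_whisk_right (fwd (tassoc T a b d e)) ?mid)"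
    by (rule tr_is_id_agree) (rule pf_agreeI; use assms in \<open>simp add: functor_simps\<close>)
  have sf3: "strict_functor ?Q ?D' (?L')"
    unfolding thom4_def by (rule strict_functor_prod[OF strict_functor_id strict_comp3_left]) fact+
  have "tr_is_id ?Q ?D' (?L')
     (?\<tau>')"
    unfolding thom4_def
    by (rule tr_is_id_prod[OF tr_is_id_tr_id tr_is_id_assoc strict_functor_id strict_comp3_left])
      (use assms in \<open>simp_all add: b\<close>)
  then have "tr_is_id ?Q ?C (pf_comp ?C (tcomp T a d e) (?L'))
    (tr_whisk_left ?Q ?C (tcomp T a d e) (?L')
      (?R')
     (?\<tau>'))"
    by (rule tr_is_id_whisk_left[rotated 6])
      (use assms b(1,4) usD comp[of a d e, unfolded thom2_def] sf3 agL' in simp_all)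
  then have 3: "tr_is_id ?Q ?C ?F
    (tr_whisk_left ?Q ?C (tcomp T a d e) (?L')
      (?R')
     (?\<tau>'))"
    by (rule tr_is_id_agree) (rule pf_agreeI; use assms in \<open>simp add: functor_simps\<close>)
  have ag: "pf_agree ?Q ?F (pf_comp ?C (comp3_left T a b d e) ?mid)"
    "pf_agree ?Q ?F (pf_comp ?C (comp3_right T a b d e) ?mid)"
    "pf_agree ?Q ?F (comp4_last T a b c d e)"
    by (rule pf_agreeI; use assms in \<open>simp add: functor_simps\<close>)+
  note Q = thoms_bicategory(4)[OF assms] and C = hom[OF assms(1,5)] and F = strict_comp4_first[OF assms]
  show ?thesis
    unfolding pi_source_def Let_def
    by (rule tr_is_id_comp[OF C Q F ag(2,3) tr_is_id_comp[OF C Q F ag(1,2) 1 2] 3])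
qed

text \<open>All three pieces live over composites in which a unit stands between g and f; the strict
  unit laws erase it, so each piece is an identity of the composition functor.\<close>

lemma mu_source_id:
  assumes "a \<in> Ob" "b \<in> Ob" "c \<in> Ob"
  shows "tr_is_id (thom2 T a b c) (thom T a c) (tcomp T a b c) (mu_source T a b c)"
proof -
  let ?Q = "thom2 T a b c" and ?C = "thom T a c" and ?F = "tcomp T a b c"
  let ?ig = "pf_id (thom T b c)" and ?jf = "pf_id (thom T a b)"
  let ?mid = "pf_prod ?ig (pf_ins_left (thom T b b) (tunit T b) (thom T a b))"
  let ?P = "pf_prod ?ig ?jf" and ?U = "pf_prod ?ig (unit_comp T a b)"
    and ?\<tau> = "tr_prod (bwd (trunit T b c)) (tr_id (thom T a b) ?jf)"
    and ?\<tau>' = "tr_prod (tr_id (thom T b c) ?ig) (fwd (tlunit T a b))"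
  note b = thoms_bicategory
  note Q = thoms_bicategory(2)[OF assms] and C = hom[OF assms(1,3)] and F = comp[OF assms]
  note W = tr_is_id_whisk_left[OF Q unit_strict_thom2[OF assms] b(1)[OF assms(1,3)] _ F]
  have sij: "strict_functor ?Q ?Q (?P)" "strict_functor ?Q ?Q (?U)"
    unfolding thom2_def using assms
    by (auto intro!: strict_functor_prod strict_functor_id strict_unit_comp)
  have "tr_is_id ?Q ?Q (?P) (?\<tau>)"
    unfolding thom2_def
    by (rule tr_is_id_prod[OF tr_is_id_runit' tr_is_id_tr_id strict_functor_id strict_functor_id])
      (use assms in \<open>simp_all add: b\<close>)
  then have "tr_is_id ?Q ?C (pf_comp ?C ?F (?P))
     (tr_whisk_left ?Q ?C ?F (?P) (pf_prod (comp_unit T b c) ?jf) 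
       (?\<tau>))"
    by (rule W[OF sij(1), rotated]) (rule pf_agreeI; use assms in \<open>simp add: functor_simps\<close>)
  then have 1: "tr_is_id ?Q ?C ?F
     (tr_whisk_left ?Q ?C ?F (?P) (pf_prod (comp_unit T b c) ?jf) 
       (?\<tau>))"
    by (rule tr_is_id_agree) (rule pf_agreeI; use assms in \<open>simp add: functor_simps\<close>)
  have "tr_is_id ?Q ?C (pf_comp ?C (comp3_left T a b b c) ?mid) (tr_whisk_right (fwd (tassoc T a b b c)) ?mid)"
    by (rule tr_is_id_whisk_right[OF tr_is_id_assoc strict_ins_mid]) fact+
  then have 2: "tr_is_id ?Q ?C ?F (tr_whisk_right (fwd (tassoc T a b b c)) ?mid)"
    by (rule tr_is_id_agree) (rule pf_agreeI; use assms in \<open>simp add: functor_simps\<close>)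
  have "tr_is_id ?Q ?Q (?U) (?\<tau>')"
    unfolding thom2_def
    by (rule tr_is_id_prod[OF tr_is_id_tr_id tr_is_id_lunit strict_functor_id strict_unit_comp])
      (use assms in \<open>simp_all add: b\<close>)
  then have "tr_is_id ?Q ?C (pf_comp ?C ?F (?U))
     (tr_whisk_left ?Q ?C ?F (?U) (?P) 
       (?\<tau>'))"
    by (rule W[OF sij(2), rotated]) (rule pf_agreeI; use assms in \<open>simp add: functor_simps\<close>)
  then have 3: "tr_is_id ?Q ?C ?F
     (tr_whisk_left ?Q ?C ?F (?U) (?P) 
       (?\<tau>'))"
    by (rule tr_is_id_agree) (rule pf_agreeI; use assms in \<open>simp add: functor_simps\<close>)
  have ag: "pf_agree ?Q ?F (pf_comp ?C (comp3_left T a b b c) ?mid)"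
    "pf_agree ?Q ?F (pf_comp ?C (comp3_right T a b b c) ?mid)"
    by (rule pf_agreeI; use assms in \<open>simp add: functor_simps\<close>)+
  show ?thesis
    unfolding mu_source_def Let_def
    by (rule tr_is_id_comp[OF C Q F ag(2) pf_agree_refl tr_is_id_comp[OF C Q F ag 1 2] 3])
qed

lemma lambda_source_id:
  assumes "a \<in> Ob" "b \<in> Ob" "c \<in> Ob"
  shows "tr_is_id (thom2 T a b c) (thom T a c) (unit_comp2 T a b c) (lambda_source T a b c)"
proof -
  let ?Q = "thom2 T a b c" and ?C = "thom T a c" and ?F = "tcomp T a b c"
  let ?ig = "pf_id (thom T b c)" and ?jf = "pf_id (thom T a b)"
  note b = thoms_bicategory
  note Q = thoms_bicategory(2)[OF assms]
  note W = tr_is_id_whisk_left[OF Q unit_strict_thom2[OF assms] b(1)[OF assms(1,3)] _ comp[OF assms]]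
  have s: "strict_functor ?Q ?Q (pf_prod (unit_comp T b c) ?jf)"
    unfolding thom2_def using assms by (auto intro!: strict_functor_prod strict_functor_id strict_unit_comp)
  have "tr_is_id ?Q ?Q (pf_prod (unit_comp T b c) ?jf) (tr_prod (fwd (tlunit T b c)) (tr_id (thom T a b) ?jf))"
    unfolding thom2_def
    by (rule tr_is_id_prod[OF tr_is_id_lunit tr_is_id_tr_id strict_unit_comp strict_functor_id])
      (use assms in \<open>simp_all add: b\<close>)
  then have "tr_is_id ?Q ?C (pf_comp ?C ?F (pf_prod (unit_comp T b c) ?jf))
     (tr_whisk_left ?Q ?C ?F (pf_prod (unit_comp T b c) ?jf) (pf_prod ?ig ?jf) 
       (tr_prod (fwd (tlunit T b c)) (tr_id (thom T a b) ?jf)))"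
    by (rule W[OF s, rotated]) (rule pf_agreeI; use assms in \<open>simp add: functor_simps\<close>)
  then show ?thesis
    unfolding lambda_source_def Let_def
    by (rule tr_is_id_agree) (rule pf_agreeI; use assms in \<open>simp add: functor_simps\<close>)
qed

text \<open>The associativity piece starts at (I g) f by definition. The unit piece starts at I (g
  f), which agrees with it by the strict laws.\<close>

lemma lambda_target_id:
  assumes "a \<in> Ob" "b \<in> Ob" "c \<in> Ob"
  shows "tr_is_id (thom2 T a b c) (thom T a c) (unit_comp2 T a b c) (lambda_target T a b c)"
proof -
  let ?Q = "thom2 T a b c" and ?C = "thom T a c" and ?F = "unit_comp2 T a b c"
  let ?ins = "pf_ins_left (thom T c c) (tunit T c) (thom2 T a b c)"
  note Q = thoms_bicategory(2)[OF assms] and C = hom[OF assms(1,3)] and F = strict_unit_comp2[OF assms]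
  have 1: "tr_is_id ?Q ?C ?F (tr_whisk_right (fwd (tassoc T a b c c)) ?ins)"
    unfolding unit_comp2_def
    by (rule tr_is_id_whisk_right[OF tr_is_id_assoc strict_ins_start]) fact+
  have "tr_is_id ?Q ?C (pf_comp ?C (unit_comp T a c) (tcomp T a b c)) (tr_whisk_right (fwd (tlunit T a c)) (tcomp T a b c))"
    by (rule tr_is_id_whisk_right[OF tr_is_id_lunit comp]) fact+
  then have 2: "tr_is_id ?Q ?C ?F (tr_whisk_right (fwd (tlunit T a c)) (tcomp T a b c))"
    by (rule tr_is_id_agree) (rule pf_agreeI; use assms in \<open>simp add: functor_simps\<close>)
  have ag: "pf_agree ?Q ?F (pf_comp ?C (comp3_right T a b c c) ?ins)" "pf_agree ?Q ?F (tcomp T a b c)"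
    by (rule pf_agreeI; use assms in \<open>simp add: functor_simps\<close>)+
  show ?thesis
    unfolding lambda_target_def Let_def
    by (rule tr_is_id_comp[OF C Q F ag 1 2])
qed

lemma rho_source_id:
  assumes "a \<in> Ob" "b \<in> Ob" "c \<in> Ob"
  shows "tr_is_id (thom2 T a b c) (thom T a c) (tcomp T a b c) (rho_source T a b c)"
proof -
  let ?Q = "thom2 T a b c" and ?C = "thom T a c" and ?F = "tcomp T a b c"
  let ?ig = "pf_id (thom T b c)" and ?jf = "pf_id (thom T a b)"
  note b = thoms_bicategory
  note Q = thoms_bicategory(2)[OF assms]
  note W = tr_is_id_whisk_left[OF Q unit_strict_thom2[OF assms] b(1)[OF assms(1,3)] _ comp[OF assms]]
  have s: "strict_functor ?Q ?Q (pf_prod ?ig ?jf)"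
    unfolding thom2_def using assms by (auto intro!: strict_functor_prod strict_functor_id)
  have "tr_is_id ?Q ?Q (pf_prod ?ig ?jf) (tr_prod (tr_id (thom T b c) ?ig) (bwd (trunit T a b)))"
    unfolding thom2_def
    by (rule tr_is_id_prod[OF tr_is_id_tr_id tr_is_id_runit' strict_functor_id strict_functor_id])
      (use assms in \<open>simp_all add: b\<close>)
  then have "tr_is_id ?Q ?C (pf_comp ?C ?F (pf_prod ?ig ?jf))
     (tr_whisk_left ?Q ?C ?F (pf_prod ?ig ?jf) (pf_prod ?ig (comp_unit T a b))
       (tr_prod (tr_id (thom T b c) ?ig) (bwd (trunit T a b))))"
    by (rule W[OF s, rotated]) (rule pf_agreeI; use assms in \<open>simp add: functor_simps\<close>)
  then show ?thesis
    unfolding rho_source_def Let_def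
    by (rule tr_is_id_agree) (rule pf_agreeI; use assms in \<open>simp add: functor_simps\<close>)
qed

lemma rho_target_id:
  assumes "a \<in> Ob" "b \<in> Ob" "c \<in> Ob"
  shows "tr_is_id (thom2 T a b c) (thom T a c) (tcomp T a b c) (rho_target T a b c)"
proof -
  let ?Q = "thom2 T a b c" and ?C = "thom T a c" and ?F = "tcomp T a b c"
  let ?ins = "pf_prod (pf_id (thom T b c)) (pf_ins_right (thom T a a) (tunit T a) (thom T a b))"
  note Q = thoms_bicategory(2)[OF assms] and C = hom[OF assms(1,3)] and F = comp[OF assms]
  have "tr_is_id ?Q ?C (pf_comp ?C (pf_id ?C) ?F) (tr_whisk_right (bwd (trunit T a c)) ?F)"
    by (rule tr_is_id_whisk_right[OF tr_is_id_runit' comp]) fact+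
  then have 1: "tr_is_id ?Q ?C ?F (tr_whisk_right (bwd (trunit T a c)) ?F)"
    by (rule tr_is_id_agree) (rule pf_agreeI; use assms in \<open>simp add: functor_simps\<close>)
  have "tr_is_id ?Q ?C (pf_comp ?C (comp3_left T a a b c) ?ins) (tr_whisk_right (fwd (tassoc T a a b c)) ?ins)"
    by (rule tr_is_id_whisk_right[OF tr_is_id_assoc strict_ins_end]) fact+
  then have 2: "tr_is_id ?Q ?C ?F (tr_whisk_right (fwd (tassoc T a a b c)) ?ins)"
    by (rule tr_is_id_agree) (rule pf_agreeI; use assms in \<open>simp add: functor_simps\<close>)
  have ag: "pf_agree ?Q ?F (pf_comp ?C (comp3_left T a a b c) ?ins)" "pf_agree ?Q ?F (comp2_unit T a b c)"
    by (rule pf_agreeI; use assms in \<open>simp add: functor_simps\<close>)+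
  show ?thesis
    unfolding rho_target_def Let_def
    by (rule tr_is_id_comp[OF C Q F ag 1 2])
qed

section \<open>The four invertible modifications\<close>

lemma pentagon_modification:
  assumes "a \<in> Ob" "b \<in> Ob" "c \<in> Ob" "d \<in> Ob" "e \<in> Ob"
  shows "invertible_modification (thom4 T a b c d e) (thom T a e) (comp4_first T a b c d e)
    (comp4_last T a b c d e) (pi_source T a b c d e) (pi_target T a b c d e) (tpi T a b c d e)"
proof (rule invertible_modification_id)
  show "pf_agree (thom4 T a b c d e) (comp4_first T a b c d e) (comp4_last T a b c d e)"
    by (rule pf_agreeI; use assms in \<open>simp add: functor_simps\<close>)
qed (use assms in \<open>simp_all add: thoms_unit_strict thoms_bicategory strict_comp4_first strict_comp4_last
   pi_source_id pi_target_id tpi_eq\<close>)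

lemma triangle_modification:
  assumes "a \<in> Ob" "b \<in> Ob" "c \<in> Ob"
  shows "invertible_modification (thom2 T a b c) (thom T a c) (tcomp T a b c) (tcomp T a b c)
    (mu_source T a b c) (tr_id (thom T a c) (tcomp T a b c)) (tmu T a b c)"
  by (rule invertible_modification_id)
    (use assms in \<open>simp_all add: thoms_unit_strict thoms_bicategory comp pf_agree_refl mu_source_id tr_is_id_tr_id tmu_eq\<close>)

lemma left_unit_modification:
  assumes "a \<in> Ob" "b \<in> Ob" "c \<in> Ob"
  shows "invertible_modification (thom2 T a b c) (thom T a c) (unit_comp2 T a b c) (tcomp T a b c)
    (lambda_source T a b c) (lambda_target T a b c) (tlambda T a b c)"
proof (rule invertible_modification_id)
  show "pf_agree (thom2 T a b c) (unit_comp2 T a b c) (tcomp T a b c)"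
    by (rule pf_agreeI; use assms in \<open>simp add: functor_simps\<close>)
qed (use assms in \<open>simp_all add: thoms_unit_strict thoms_bicategory comp strict_unit_comp2
   lambda_source_id lambda_target_id tlambda_eq\<close>)

lemma right_unit_modification:
  assumes "a \<in> Ob" "b \<in> Ob" "c \<in> Ob"
  shows "invertible_modification (thom2 T a b c) (thom T a c) (tcomp T a b c) (comp2_unit T a b c)
    (rho_source T a b c) (rho_target T a b c) (trho T a b c)"
proof (rule invertible_modification_id)
  show "pf_agree (thom2 T a b c) (tcomp T a b c) (comp2_unit T a b c)"
    by (rule pf_agreeI; use assms in \<open>simp add: functor_simps\<close>)
qed (use assms in \<open>simp_all add: thoms_unit_strict thoms_bicategory comp strict_comp2_unit
   rho_source_id rho_target_id trho_eq\<close>)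

section \<open>Evaluation of the cocycle and normalization axioms\<close>

lemma tens_ob: "\<lbrakk>a \<in> Ob; b \<in> Ob; c \<in> Ob; g \<in> ob (thom T b c); f \<in> ob (thom T a b)\<rbrakk>
    \<Longrightarrow> tens T a b c g f \<in> ob (thom T a c)"
  by (simp add: tens_def comp_type)

lemma tens_assoc: "\<lbrakk>a \<in> Ob; b \<in> Ob; c \<in> Ob; d \<in> Ob; h \<in> ob (thom T c d); g \<in> ob (thom T b c);
     f \<in> ob (thom T a b)\<rbrakk> \<Longrightarrow> tens T a b d (tens T b c d h g) f = tens T a c d h (tens T a b c g f)"
  by (simp add: tens_def comp_assoc)

lemma unit_ob: "a \<in> Ob \<Longrightarrow> unit_ob T a \<in> ob (thom T a a)"
  by (simp add: unit_ob_def unit_type)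

lemma tens_unit: "\<lbrakk>a \<in> Ob; b \<in> Ob; f \<in> ob (thom T a b)\<rbrakk> \<Longrightarrow> tens T a b b (unit_ob T b) f = f"
  "\<lbrakk>a \<in> Ob; b \<in> Ob; f \<in> ob (thom T a b)\<rbrakk> \<Longrightarrow> tens T a a b f (unit_ob T a) = f"
  by (simp_all add: tens_def unit_ob_def comp_unit_eqs)

text \<open>The second and third equations together evaluate the cells \<open>fuse_left\<close> and
  \<open>fuse_right\<close> at identity 1-cells.\<close>

lemma comp_id1:
  assumes "a \<in> Ob" "b \<in> Ob" "c \<in> Ob" "g \<in> ob (thom T b c)" "f \<in> ob (thom T a b)"
  shows "pf1 (tcomp T a b c) (id1 (thom T b c) g, id1 (thom T a b) f) = id1 (thom T a c) (tens T a b c g f)"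
    "pf2 (tcomp T a b c) (id2 (thom T b c) (id1 (thom T b c) g), id2 (thom T a b) (id1 (thom T a b) f))
     = id2 (thom T a c) (id1 (thom T a c) (tens T a b c g f))"
    "pf_unit (tcomp T a b c) (g, f) = id2 (thom T a c) (id1 (thom T a c) (tens T a b c g f))"
proof -
  interpret strict_functor "thom2 T a b c" "thom T a c" "tcomp T a b c" by (rule comp) fact+
  interpret X: unit_strict_bicategory "thom2 T a b c" by (rule unit_strict_thom2) fact+
  have ob: "(g, f) \<in> ob (thom2 T a b c)" using assms by (simp add: thom2_def)
  show 1: "pf1 (tcomp T a b c) (id1 (thom T b c) g, id1 (thom T a b) f) = id1 (thom T a c) (tens T a b c g f)"
    using pf1_id[OF ob] by (simp add: thom2_def tens_def)
  show "pf2 (tcomp T a b c) (id2 (thom T b c) (id1 (thom T b c) g), id2 (thom T a b) (id1 (thom T a b) f))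
     = id2 (thom T a c) (id1 (thom T a c) (tens T a b c g f))"
    using pf2_id[OF X.id1_arr1[OF ob]] 1 by (simp add: thom2_def)
  show "pf_unit (tcomp T a b c) (g, f) = id2 (thom T a c) (id1 (thom T a c) (tens T a b c g f))"
    using pf_unit_eq[OF ob] 1 by (simp add: thom2_def)
qed

lemma strict_tens_left:
  assumes "a \<in> Ob" "b \<in> Ob" "c \<in> Ob" "g \<in> ob (thom T b c)"
  shows "strict_functor (thom T a b) (thom T a c) (tens_left T a b c g)"
  unfolding tens_left_def
  by (rule strict_functor_comp[OF strict_functor_pair[OF strict_functor_const strict_functor_id] comp[unfolded thom2_def]])
    (use assms in \<open>simp_all add: thoms_unit_strict thoms_bicategory\<close>)

lemma strict_tens_right:
  assumes "a \<in> Ob" "b \<in> Ob" "c \<in> Ob" "f \<in> ob (thom T a b)"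
  shows "strict_functor (thom T b c) (thom T a c) (tens_right T a b c f)"
  unfolding tens_right_def
  by (rule strict_functor_comp[OF strict_functor_pair[OF strict_functor_id strict_functor_const] comp[unfolded thom2_def]])
    (use assms in \<open>simp_all add: thoms_unit_strict thoms_bicategory\<close>)

lemma tens_left_right_id1:
  assumes "a \<in> Ob" "b \<in> Ob" "c \<in> Ob" "g \<in> ob (thom T b c)" "f \<in> ob (thom T a b)"
  shows "pf1 (tens_left T a b c g) (id1 (thom T a b) f) = id1 (thom T a c) (tens T a b c g f)"
    "pf1 (tens_right T a b c f) (id1 (thom T b c) g) = id1 (thom T a c) (tens T a b c g f)"
  using comp_id1[OF assms] by (simp_all add: tens_left_def tens_right_def functor_sel)

lemma pf0_tens: "pf0 (tens_left T a b c g) f = tens T a b c g f"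
  "pf0 (tens_right T a b c f) g = tens T a b c g f"
  by (simp_all add: tens_left_def tens_right_def functor_sel tens_def)

text \<open>In the axioms \<open>asc_nat\<close> is taken only at 1-cells that evaluate to
  identities; there \<open>unit_swap_id\<close> turns the naturality cell into an identity
  2-cell.\<close>

lemma asc_eq:
  assumes "a \<in> Ob" "b \<in> Ob" "c \<in> Ob" "d \<in> Ob" "h \<in> ob (thom T c d)" "g \<in> ob (thom T b c)" "f \<in> ob (thom T a b)"
  shows "asc T a b c d h g f = id1 (thom T a d) (tens T a c d h (tens T a b c g f))"
    "asc_nat T a b c d (id1 (thom T c d) h) (id1 (thom T b c) g) (id1 (thom T a b) f)
     = id2 (thom T a d) (id1 (thom T a d) (tens T a c d h (tens T a b c g f)))"
proof -
  interpret L: strict_functor "thom3 T a b c d" "thom T a d" "comp3_left T a b c d"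
    by (rule strict_comp3_left) fact+
  interpret X: unit_strict_bicategory "thom3 T a b c d" by (rule unit_strict_thom3) fact+
  interpret C: unit_strict_bicategory "thom T a d" by (rule hom) fact+
  have ob: "(h, g, f) \<in> ob (thom3 T a b c d)" using assms by (simp add: thom3_def thom2_def)
  have p: "pf0 (comp3_left T a b c d) (h, g, f) = tens T a c d h (tens T a b c g f)"
    using assms by (simp add: functor_simps tens_def)
  have i: "id1 (thom3 T a b c d) (h, g, f) = (id1 (thom T c d) h, id1 (thom T b c) g, id1 (thom T a b) f)"
    by (simp add: thom3_def thom2_def)
  show "asc T a b c d h g f = id1 (thom T a d) (tens T a c d h (tens T a b c g f))"
    using tr_is_id_assoc[of "thom3 T a b c d" a d b c] ob p by (simp add: asc_def tr_is_id_def)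
  show "asc_nat T a b c d (id1 (thom T c d) h) (id1 (thom T b c) g) (id1 (thom T a b) f)
     = id2 (thom T a d) (id1 (thom T a d) (tens T a c d h (tens T a b c g f)))"
    using tr_is_id_assoc[of "thom3 T a b c d" a d b c] X.id1_arr1[OF ob] L.pf1_id[OF ob]
      C.unit_swap_id[OF L.pf0_ob[OF ob]]
    by (simp add: asc_nat_def tr_is_id_def p i)
qed

lemma unit_constraint_eq:
  assumes "a \<in> Ob" "b \<in> Ob" "f \<in> ob (thom T a b)"
  shows "lft T a b f = id1 (thom T a b) f" "rgt T a b f = id1 (thom T a b) f"
  using assms
  by (simp_all add: lft_def rgt_def tlunit_eq trunit_eq eqv_id_def tr_id_def unit_comp_def comp_unit_def
      functor_sel comp_unit_eqs)

lemma modification_eq: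
  assumes "a \<in> Ob" "b \<in> Ob" "c \<in> Ob" "g \<in> ob (thom T b c)" "f \<in> ob (thom T a b)"
  shows "tmu T a b c (g, f) = id2 (thom T a c) (id1 (thom T a c) (tens T a b c g f))"
    "tlambda T a b c (g, f) = id2 (thom T a c) (id1 (thom T a c) (tens T a b c g f))"
    "trho T a b c (g, f) = id2 (thom T a c) (id1 (thom T a c) (tens T a b c g f))"
  using assms by (simp_all add: tmu_eq tlambda_eq trho_eq tens_def functor_simps)

lemma pi_eq:
  assumes "a \<in> Ob" "b \<in> Ob" "c \<in> Ob" "d \<in> Ob" "e \<in> Ob" "k \<in> ob (thom T d e)" "h \<in> ob (thom T c d)"
    "g \<in> ob (thom T b c)" "f \<in> ob (thom T a b)"
  shows "tpi T a b c d e (k, h, g, f)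
    = id2 (thom T a e) (id1 (thom T a e) (tens T a d e k (tens T a c d h (tens T a b c g f))))"
  using assms by (simp add: tpi_eq tens_def functor_simps)

lemma unitor_id1:
  assumes "a \<in> Ob" "b \<in> Ob" "f \<in> ob (thom T a b)"
  shows "lunit (thom T a b) (id1 (thom T a b) f) = id2 (thom T a b) (id1 (thom T a b) f)"
    "runit (thom T a b) (id1 (thom T a b) f) = id2 (thom T a b) (id1 (thom T a b) f)"
    "inv2 (thom T a b) (id2 (thom T a b) (id1 (thom T a b) f)) = id2 (thom T a b) (id1 (thom T a b) f)"
proof -
  interpret unit_strict_bicategory "thom T a b" by (rule hom) fact+
  show "lunit (thom T a b) (id1 (thom T a b) f) = id2 (thom T a b) (id1 (thom T a b) f)"
    "runit (thom T a b) (id1 (thom T a b) f) = id2 (thom T a b) (id1 (thom T a b) f)"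
    "inv2 (thom T a b) (id2 (thom T a b) (id1 (thom T a b) f)) = id2 (thom T a b) (id1 (thom T a b) f)"
    using assms(3) by (simp_all add: lunit_id runit_id id1_arr1)
qed

lemmas pf_cell_tens =
  strict_functor.pf_cell_id1[OF strict_tens_left hom hom]
  strict_functor.pf_cell_id1[OF strict_tens_right hom hom]
  strict_functor.pf_cell_unit_id1[OF strict_tens_left hom hom]
  strict_functor.pf_cell_unit_id1[OF strict_tens_right hom hom]

text \<open>Normalizes the 1-cells of the axioms to identities at one right-bracketed object, and
  their 2-cells to the identity 2-cells of these.\<close>

lemmas axiom_simps = tens_ob tens_assoc unit_ob tens_unit comp_id1 tens_left_right_id1 asc_eq
  unit_constraint_eq modification_eq pi_eq unitor_id1 pf0_tens pf_cell_tens
  pi_dom_def pi_cod_def mu_dom_def fuse_left_def fuse_right_def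

text \<open>By strict associativity every vertex of the associahedron is the single object
  \<open>?X\<close>. Both pastings then consist of identity steps at \<open>?X\<close> and equal the
  same identity 2-cell.\<close>

lemma cocycle:
  assumes "a \<in> Ob" "b \<in> Ob" "c \<in> Ob" "d \<in> Ob" "e \<in> Ob" "x \<in> Ob"
    "f \<in> ob (thom T a b)" "g \<in> ob (thom T b c)" "h \<in> ob (thom T c d)"
    "j \<in> ob (thom T d e)" "k \<in> ob (thom T e x)"
  shows "cocycle_axiom T a b c d e x k j h g f"
proof -
  interpret C: unit_strict_bicategory "thom T a x" by (rule hom) fact+
  let ?X = "tens T a e x k (tens T a d e j (tens T a c d h (tens T a b c g f)))"
  have X: "?X \<in> ob (thom T a x)" using assms by (simp add: tens_ob)
  show ?thesis
    unfolding cocycle_axiom_def Let_def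
    by (subst (1 2) C.pasting_id1[OF X])
      (use assms in \<open>simp_all add: C.identity_step_def axiom_simps\<close>)
qed

text \<open>The argument of \<open>cocycle\<close>; vertices containing the inserted unit also
  evaluate to \<open>?X\<close>, by the strict unit laws.\<close>

lemma left_normalization:
  assumes "a \<in> Ob" "b \<in> Ob" "c \<in> Ob" "d \<in> Ob"
    "f \<in> ob (thom T a b)" "g \<in> ob (thom T b c)" "h \<in> ob (thom T c d)"
  shows "left_normalization T a b c d h g f"
proof -
  interpret C: unit_strict_bicategory "thom T a d" by (rule hom) fact+
  let ?X = "tens T a c d h (tens T a b c g f)"
  have X: "?X \<in> ob (thom T a d)" using assms by (simp add: tens_ob)
  show ?thesis
    unfolding left_normalization_def Let_def
    by (subst (1 2) C.pasting_id1[OF X])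
      (use assms in \<open>simp_all add: C.identity_step_def axiom_simps\<close>)
qed

lemma right_normalization:
  assumes "a \<in> Ob" "b \<in> Ob" "c \<in> Ob" "d \<in> Ob"
    "f \<in> ob (thom T a b)" "g \<in> ob (thom T b c)" "h \<in> ob (thom T c d)"
  shows "right_normalization T a b c d h g f"
proof -
  interpret C: unit_strict_bicategory "thom T a d" by (rule hom) fact+
  let ?X = "tens T a c d h (tens T a b c g f)"
  have X: "?X \<in> ob (thom T a d)" using assms by (simp add: tens_ob)
  show ?thesis
    unfolding right_normalization_def Let_def
    by (subst (1 2) C.pasting_id1[OF X])
      (use assms in \<open>simp_all add: C.identity_step_def axiom_simps\<close>)
qed

lemma tricategory: "tricategory T"
proof (rule tricategory.intro, goal_cases)
  case 1 then show ?case by (rule thoms_bicategory)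
next case 2 then show ?case by (simp add: strict_functor.pf_strict_functor comp thoms_bicategory)
next case 3 then show ?case
    by (simp add: strict_functor.pf_strict_functor unit thoms_bicategory unit_bicat unit_strict_bicategory.axioms(1))
next case 4 then show ?case
    by (simp add: tassoc_eq adjoint_equivalence_id thoms_unit_strict thoms_bicategory strict_comp3_left strict_comp3_right assoc_agree)
next case 5 then show ?case
    by (simp add: tlunit_eq adjoint_equivalence_id thoms_unit_strict thoms_bicategory strict_unit_comp strict_functor_id lunit_agree)
next case 6 then show ?case
    by (simp add: trunit_eq adjoint_equivalence_id thoms_unit_strict thoms_bicategory strict_comp_unit strict_functor_id runit_agree)
next case 7 then show ?case by (rule pentagon_modification)
next case 8 then show ?case by (rule triangle_modification)
next case 9 then show ?case by (rule left_unit_modification)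
next case 10 then show ?case by (rule right_unit_modification)
next case 11 then show ?case by (rule cocycle)
next case 12 then show ?case by (rule left_normalization)
next case 13 then show ?case by (rule right_normalization)
qed

end

section \<open>Homotopies relative to the boundary of the square\<close>

lemma topspace_cyl [simp]: "topspace (cyl W) = topspace W \<times> {0..1}"
  by (simp add: cyl_def)

lemma continuous_map_cylI:
  assumes "continuous_map Z W q" "continuous_map Z euclideanreal r" "\<And>z. z \<in> topspace Z \<Longrightarrow> 0 \<le> r z \<and> r z \<le> 1"
  shows "continuous_map Z (cyl W) (\<lambda>z. (q z, r z))"
  unfolding cyl_def
  by (intro continuous_map_pairedI continuous_map_into_subtopology) (use assms in auto)

lemma continuous_map_cyl_fst: "continuous_map Z (cyl W) h \<Longrightarrow> continuous_map Z W (\<lambda>z. fst (h z))"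
  using continuous_map_fst_of[of Z W "top_of_set {0..1}" h] by (simp add: cyl_def o_def)

lemma continuous_map_cyl_snd: "continuous_map Z (cyl W) h \<Longrightarrow> continuous_map Z euclideanreal (\<lambda>z. snd (h z))"
  using continuous_map_snd_of[of Z W "top_of_set {0..1}" h]
  by (simp add: cyl_def o_def continuous_map_in_subtopology)

lemma continuous_map_of: "continuous_map W Y f \<Longrightarrow> continuous_map Z W h \<Longrightarrow> continuous_map Z Y (\<lambda>z. f (h z))"
  using continuous_map_compose[of Z W h Y f] by (simp add: o_def)

lemma continuous_map_ident: "continuous_map Z Z (\<lambda>z. z)"
  using continuous_map_id[of Z] by (simp add: id_def)

lemma continuous_map_cyl_proj:
  "continuous_map (cyl Z) Z (\<lambda>z. fst z)"
  "continuous_map (cyl (cyl Z)) Z (\<lambda>z. fst (fst z))"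
  "continuous_map (cyl (cyl (cyl Z))) Z (\<lambda>z. fst (fst (fst z)))"
  "continuous_map (cyl Z) euclideanreal (\<lambda>z. snd z)"
  "continuous_map (cyl (cyl Z)) euclideanreal (\<lambda>z. snd (fst z))"
  "continuous_map (cyl (cyl (cyl Z))) euclideanreal (\<lambda>z. snd (fst (fst z)))"
  by (rule continuous_map_cyl_fst continuous_map_cyl_snd continuous_map_ident)+

lemmas cyl_intros = continuous_map_cylI continuous_map_cyl_proj
  continuous_map_ident continuous_map_add continuous_map_diff continuous_map_real_mult
  continuous_map_const[THEN iffD2]

text \<open>Carries \<open>continuous_on\<close> facts about parameters over to maps out of abstract
  topologies.\<close>

lemma continuous_map_param:
  fixes \<rho> :: "'a::topological_space \<Rightarrow> 'b::topological_space"
  assumes "continuous_on S \<rho>" "continuous_map Z euclidean r" "\<And>z. z \<in> topspace Z \<Longrightarrow> r z \<in> S"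
  shows "continuous_map Z euclidean (\<lambda>z. \<rho> (r z))"
proof (rule continuous_map_of[where f = \<rho> and h = r])
  show "continuous_map (top_of_set S) euclidean \<rho>" using assms(1) by simp
  show "continuous_map Z (top_of_set S) r"
    using assms(2,3) by (auto intro: continuous_map_into_subtopology)
qed

text \<open>The glued coordinate r and the remaining data q are arbitrary maps on Z, so the same
  lemma serves concatenation in s, in t and in the parameter u of a homotopy between cells.\<close>

lemma continuous_map_glue:
  assumes A: "continuous_map (cyl W) Y A" and B: "continuous_map (cyl W) Y B"
    and AB: "\<And>w. w \<in> topspace W \<Longrightarrow> A (w, 1) = B (w, 0)"
    and q: "continuous_map Z W q" and r: "continuous_map Z euclideanreal r"
    and r01: "\<And>z. z \<in> topspace Z \<Longrightarrow> 0 \<le> r z \<and> r z \<le> 1"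
  shows "continuous_map Z Y (\<lambda>z. if r z \<le> 1/2 then A (q z, 2 * r z) else B (q z, 2 * r z - 1))"
proof (rule continuous_map_cases_le[OF r])
  show "continuous_map Z euclideanreal (\<lambda>z. 1/2)" by simp
  show "continuous_map (subtopology Z {z \<in> topspace Z. r z \<le> 1/2}) Y (\<lambda>z. A (q z, 2 * r z))"
    by (rule continuous_map_of[OF A], rule continuous_map_cylI)
      (use q r r01 in \<open>auto intro!: cyl_intros intro: continuous_map_from_subtopology\<close>)
  show "continuous_map (subtopology Z {z \<in> topspace Z. 1/2 \<le> r z}) Y (\<lambda>z. B (q z, 2 * r z - 1))"
    by (rule continuous_map_of[OF B], rule continuous_map_cylI)
      (use q r r01 in \<open>auto intro!: cyl_intros intro: continuous_map_from_subtopology\<close>)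
  show "A (q z, 2 * r z) = B (q z, 2 * r z - 1)" if "z \<in> topspace Z" "r z = 1/2" for z
  proof -
    have "q z \<in> topspace W" "2 * r z = 1" using q that by (auto simp: continuous_map_def)
    with AB[of "q z"] show ?thesis by simp
  qed
qed

lemma mapsI: "continuous_map W Y f \<Longrightarrow> restrict f (topspace W) \<in> maps W Y"
  by (auto simp: maps_def elim: continuous_map_eq)

lemma maps_cont: "f \<in> maps W Y \<Longrightarrow> continuous_map W Y f"
  by (simp add: maps_def)

lemma maps_in: "f \<in> maps W Y \<Longrightarrow> w \<in> topspace W \<Longrightarrow> f w \<in> topspace Y"
  by (auto simp: maps_def continuous_map_def)

lemma maps_eqI: "f \<in> maps W Y \<Longrightarrow> g \<in> maps W Y \<Longrightarrow> (\<And>w. w \<in> topspace W \<Longrightarrow> f w = g w) \<Longrightarrow> f = g"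
  by (auto simp: maps_def intro: extensionalityI)

lemma slice_apply [simp]: "x \<in> topspace W \<Longrightarrow> slice W K t x = K (x, t)"
  by (simp add: slice_def)

lemma slice_maps:
  assumes "continuous_map (cyl W) Y K" "0 \<le> t" "t \<le> 1"
  shows "slice W K t \<in> maps W Y"
  unfolding slice_def
  by (rule mapsI[OF continuous_map_of[OF assms(1)]]) (use assms in \<open>auto intro!: cyl_intros\<close>)

lemma slice_eq: "(\<And>x. x \<in> topspace W \<Longrightarrow> K (x, t) = f x) \<Longrightarrow> f \<in> extensional (topspace W) \<Longrightarrow> slice W K t = f"
  by (auto simp: slice_def restrict_def extensional_def fun_eq_iff)

section \<open>Homotopies and cells without named endpoints\<close>

lemma homotopy_iff: "(\<exists>f g. homotopy W Y f g K) \<longleftrightarrow> K \<in> maps (cyl W) Y"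
  by (auto simp: homotopy_def)

text \<open>\<open>homotopy2\<close> with its four endpoints quantified away: H and J are recovered
  as the slices at t = 0 and t = 1, and what is left is independence of t on the two sides.\<close>

definition cells :: "'a topology \<Rightarrow> 'b topology \<Rightarrow> (('a \<times> real) \<times> real \<Rightarrow> 'b) set" where
  "cells X Y = {\<alpha> \<in> maps (cyl (cyl X)) Y. \<exists>f g. \<forall>x\<in>topspace X. \<forall>t\<in>{0..1}.
     \<alpha> ((x, 0), t) = f x \<and> \<alpha> ((x, 1), t) = g x}"

lemma cells_maps: "\<alpha> \<in> cells X Y \<Longrightarrow> \<alpha> \<in> maps (cyl (cyl X)) Y"
  by (simp add: cells_def)

lemma cells_cont: "\<alpha> \<in> cells X Y \<Longrightarrow> continuous_map (cyl (cyl X)) Y \<alpha>"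
  by (simp add: cells_def maps_def)

lemma cellsI:
  assumes "\<alpha> \<in> maps (cyl (cyl X)) Y"
    "\<And>x t. x \<in> topspace X \<Longrightarrow> 0 \<le> t \<Longrightarrow> t \<le> 1 \<Longrightarrow> \<alpha> ((x, 0), t) = f x"
    "\<And>x t. x \<in> topspace X \<Longrightarrow> 0 \<le> t \<Longrightarrow> t \<le> 1 \<Longrightarrow> \<alpha> ((x, 1), t) = g x"
  shows "\<alpha> \<in> cells X Y"
  unfolding cells_def using assms by auto

lemma cellsE:
  assumes "\<alpha> \<in> cells X Y"
  obtains f g where "\<And>x t. x \<in> topspace X \<Longrightarrow> 0 \<le> t \<Longrightarrow> t \<le> 1 \<Longrightarrow> \<alpha> ((x, 0), t) = f x"
    "\<And>x t. x \<in> topspace X \<Longrightarrow> 0 \<le> t \<Longrightarrow> t \<le> 1 \<Longrightarrow> \<alpha> ((x, 1), t) = g x"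
proof -
  from assms obtain f g where "\<forall>x\<in>topspace X. \<forall>t\<in>{0..1}. \<alpha> ((x, 0), t) = f x \<and> \<alpha> ((x, 1), t) = g x"
    unfolding cells_def by blast
  then show ?thesis by (intro that[of f g]) auto
qed

lemma homotopy2_slices:
  assumes "\<alpha> \<in> cells X Y"
  shows "homotopy2 X Y (slice X (slice (cyl X) \<alpha> 0) 0) (slice X (slice (cyl X) \<alpha> 0) 1)
     (slice (cyl X) \<alpha> 0) (slice (cyl X) \<alpha> 1) \<alpha>"
  unfolding homotopy2_def homotopy_def
proof (intro conjI ballI refl)
  show "\<alpha> \<in> maps (cyl (cyl X)) Y" using assms by (rule cells_maps)
  fix t :: real assume t: "t \<in> {0..1}"
  show "slice (cyl X) \<alpha> t \<in> maps (cyl X) Y"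
    using slice_maps[OF cells_cont[OF assms]] t by simp
  obtain f g where fg: "\<And>x t. x \<in> topspace X \<Longrightarrow> 0 \<le> t \<Longrightarrow> t \<le> 1 \<Longrightarrow> \<alpha> ((x, 0), t) = f x"
    "\<And>x t. x \<in> topspace X \<Longrightarrow> 0 \<le> t \<Longrightarrow> t \<le> 1 \<Longrightarrow> \<alpha> ((x, 1), t) = g x"
    using cellsE[OF assms] by blast
  show "slice X (slice (cyl X) \<alpha> t) 0 = slice X (slice (cyl X) \<alpha> 0) 0"
    "slice X (slice (cyl X) \<alpha> t) 1 = slice X (slice (cyl X) \<alpha> 0) 1"
    using t fg by (auto simp: slice_def restrict_def)
qed

lemma homotopy2_cells:
  assumes "homotopy2 X Y f g H J \<alpha>"
  shows "\<alpha> \<in> cells X Y" "slice (cyl X) \<alpha> 0 = H" "slice (cyl X) \<alpha> 1 = J"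
proof -
  have *: "slice X (slice (cyl X) \<alpha> t) 0 = f" "slice X (slice (cyl X) \<alpha> t) 1 = g" if "t \<in> {0..1}" for t
    using assms that by (auto simp: homotopy2_def homotopy_def)
  have "\<alpha> ((x, 0), t) = f x" "\<alpha> ((x, 1), t) = g x" if "x \<in> topspace X" "0 \<le> t" "t \<le> 1" for x t
    using fun_cong[OF *(1)[of t], of x] fun_cong[OF *(2)[of t], of x] that by simp_all
  moreover have "\<alpha> \<in> maps (cyl (cyl X)) Y" using assms by (simp add: homotopy2_def homotopy_def)
  ultimately show "\<alpha> \<in> cells X Y" by (rule cellsI[rotated])
  show "slice (cyl X) \<alpha> 0 = H" "slice (cyl X) \<alpha> 1 = J"
    using assms by (auto simp: homotopy2_def homotopy_def)
qed

lemma cells_iff: "\<alpha> \<in> cells X Y \<longleftrightarrow> (\<exists>f g H J. homotopy2 X Y f g H J \<alpha>)"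
  using homotopy2_slices homotopy2_cells(1) by blast

text \<open>Homotopy relative to \<open>X \<times> \<partial>(I \<times> I)\<close>.\<close>

definition rel_homotopy :: "'a topology \<Rightarrow> 'b topology \<Rightarrow> (('a \<times> real) \<times> real \<Rightarrow> 'b) \<Rightarrow>
    (('a \<times> real) \<times> real \<Rightarrow> 'b) \<Rightarrow> ((('a \<times> real) \<times> real) \<times> real \<Rightarrow> 'b) \<Rightarrow> bool"
  where
  "rel_homotopy X Y \<alpha> \<beta> \<Gamma> \<longleftrightarrow> continuous_map (cyl (cyl (cyl X))) Y \<Gamma> \<and>
     (\<forall>x\<in>topspace X. \<forall>s\<in>{0..1}. \<forall>t\<in>{0..1}.
        \<Gamma> (((x, s), t), 0) = \<alpha> ((x, s), t) \<and> \<Gamma> (((x, s), t), 1) = \<beta> ((x, s), t) \<and>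
        (s = 0 \<or> s = 1 \<or> t = 0 \<or> t = 1 \<longrightarrow> (\<forall>u\<in>{0..1}. \<Gamma> (((x, s), t), u) = \<alpha> ((x, s), t))))"

text \<open>Both members are required to be cells so that this is the relation behind
  \<open>cls\<close> for every argument, as \<open>cls_eq\<close> shows.\<close>

definition eqv :: "'a topology \<Rightarrow> 'b topology \<Rightarrow> (('a \<times> real) \<times> real \<Rightarrow> 'b) \<Rightarrow> (('a \<times> real) \<times> real \<Rightarrow> 'b) \<Rightarrow> bool"
  where
  "eqv X Y \<alpha> \<beta> \<longleftrightarrow> \<alpha> \<in> cells X Y \<and> \<beta> \<in> cells X Y \<and> (\<exists>\<Gamma>. rel_homotopy X Y \<alpha> \<beta> \<Gamma>)"

lemma rel_homotopyD:
  assumes "rel_homotopy X Y \<alpha> \<beta> \<Gamma>"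
  shows "continuous_map (cyl (cyl (cyl X))) Y \<Gamma>"
    "x \<in> topspace X \<Longrightarrow> 0 \<le> s \<Longrightarrow> s \<le> 1 \<Longrightarrow> 0 \<le> t \<Longrightarrow> t \<le> 1 \<Longrightarrow> \<Gamma> (((x, s), t), 0) = \<alpha> ((x, s), t)"
    "x \<in> topspace X \<Longrightarrow> 0 \<le> s \<Longrightarrow> s \<le> 1 \<Longrightarrow> 0 \<le> t \<Longrightarrow> t \<le> 1 \<Longrightarrow> \<Gamma> (((x, s), t), 1) = \<beta> ((x, s), t)"
    "x \<in> topspace X \<Longrightarrow> 0 \<le> s \<Longrightarrow> s \<le> 1 \<Longrightarrow> 0 \<le> t \<Longrightarrow> t \<le> 1 \<Longrightarrow> 0 \<le> u \<Longrightarrow> u \<le> 1 \<Longrightarrow>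
       s = 0 \<or> s = 1 \<or> t = 0 \<or> t = 1 \<Longrightarrow> \<Gamma> (((x, s), t), u) = \<alpha> ((x, s), t)"
  using assms unfolding rel_homotopy_def by (blast, simp_all only: Ball_def atLeastAtMost_iff)

lemma eqvI:
  assumes "\<alpha> \<in> cells X Y" "\<beta> \<in> cells X Y" "continuous_map (cyl (cyl (cyl X))) Y \<Gamma>"
    "\<And>x s t. x \<in> topspace X \<Longrightarrow> 0 \<le> s \<Longrightarrow> s \<le> 1 \<Longrightarrow> 0 \<le> t \<Longrightarrow> t \<le> 1 \<Longrightarrow> \<Gamma> (((x, s), t), 0) = \<alpha> ((x, s), t)"
    "\<And>x s t. x \<in> topspace X \<Longrightarrow> 0 \<le> s \<Longrightarrow> s \<le> 1 \<Longrightarrow> 0 \<le> t \<Longrightarrow> t \<le> 1 \<Longrightarrow> \<Gamma> (((x, s), t), 1) = \<beta> ((x, s), t)"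
    "\<And>x s t u. x \<in> topspace X \<Longrightarrow> 0 \<le> s \<Longrightarrow> s \<le> 1 \<Longrightarrow> 0 \<le> t \<Longrightarrow> t \<le> 1 \<Longrightarrow> 0 \<le> u \<Longrightarrow> u \<le> 1 \<Longrightarrow>
       s = 0 \<or> s = 1 \<or> t = 0 \<or> t = 1 \<Longrightarrow> \<Gamma> (((x, s), t), u) = \<alpha> ((x, s), t)"
  shows "eqv X Y \<alpha> \<beta>"
proof -
  have "rel_homotopy X Y \<alpha> \<beta> \<Gamma>"
    unfolding rel_homotopy_def
  proof (intro conjI ballI impI)
    fix x and s t u :: real
    assume "x \<in> topspace X" "s \<in> {0..1}" "t \<in> {0..1}"
    then show "\<Gamma> (((x, s), t), 0) = \<alpha> ((x, s), t)" "\<Gamma> (((x, s), t), 1) = \<beta> ((x, s), t)"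
      using assms(4,5) by simp_all
    assume "s = 0 \<or> s = 1 \<or> t = 0 \<or> t = 1" "u \<in> {0..1}"
    then show "\<Gamma> (((x, s), t), u) = \<alpha> ((x, s), t)"
      using assms(6)[of x s t u] \<open>x \<in> topspace X\<close> \<open>s \<in> {0..1}\<close> \<open>t \<in> {0..1}\<close> by simp
  qed (rule assms(3))
  then show ?thesis using assms(1,2) unfolding eqv_def by blast
qed

lemma eqv_cells: "eqv X Y \<alpha> \<beta> \<Longrightarrow> \<alpha> \<in> cells X Y" "eqv X Y \<alpha> \<beta> \<Longrightarrow> \<beta> \<in> cells X Y"
  unfolding eqv_def by blast+

lemma eqvE:
  assumes "eqv X Y \<alpha> \<beta>"
  obtains \<Gamma> where "rel_homotopy X Y \<alpha> \<beta> \<Gamma>"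
  using assms unfolding eqv_def by blast

lemma eqv_boundary:
  assumes "eqv X Y \<alpha> \<beta>" "x \<in> topspace X" "0 \<le> s" "s \<le> 1" "0 \<le> t" "t \<le> 1" "s = 0 \<or> s = 1 \<or> t = 0 \<or> t = 1"
  shows "\<beta> ((x, s), t) = \<alpha> ((x, s), t)"
proof -
  obtain \<Gamma> where "rel_homotopy X Y \<alpha> \<beta> \<Gamma>" by (rule eqvE[OF assms(1)])
  from rel_homotopyD(3)[OF this, of x s t] rel_homotopyD(4)[OF this, of x s t 1]
  show ?thesis using assms(2-) by simp
qed

lemma eqv_refl:
  assumes "\<alpha> \<in> cells X Y"
  shows "eqv X Y \<alpha> \<alpha>"
proof (rule eqvI[OF assms assms, of "\<lambda>z. \<alpha> (fst z)"])
  show "continuous_map (cyl (cyl (cyl X))) Y (\<lambda>z. \<alpha> (fst z))"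
    by (intro continuous_map_of[OF cells_cont[OF assms]] cyl_intros)
qed simp_all

lemma eqv_sym:
  assumes "eqv X Y \<alpha> \<beta>"
  shows "eqv X Y \<beta> \<alpha>"
proof -
  obtain \<Gamma> where \<Gamma>': "rel_homotopy X Y \<alpha> \<beta> \<Gamma>" by (rule eqvE[OF assms])
  note \<Gamma> = rel_homotopyD[OF \<Gamma>']
  show ?thesis
  proof (rule eqvI[OF eqv_cells(2,1)[OF assms], of "\<lambda>z. \<Gamma> (fst z, 1 - snd z)"])
    show "continuous_map (cyl (cyl (cyl X))) Y (\<lambda>z. \<Gamma> (fst z, 1 - snd z))"
      by (intro continuous_map_of[OF \<Gamma>(1)] cyl_intros) auto
  qed (use \<Gamma> eqv_boundary[OF assms] in simp_all)
qed

lemma eqv_trans: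
  assumes "eqv X Y \<alpha> \<beta>" "eqv X Y \<beta> \<gamma>"
  shows "eqv X Y \<alpha> \<gamma>"
proof -
  obtain \<Gamma> where \<Gamma>': "rel_homotopy X Y \<alpha> \<beta> \<Gamma>" by (rule eqvE[OF assms(1)])
  note \<Gamma> = rel_homotopyD[OF \<Gamma>']
  obtain \<Delta> where \<Delta>': "rel_homotopy X Y \<beta> \<gamma> \<Delta>" by (rule eqvE[OF assms(2)])
  note \<Delta> = rel_homotopyD[OF \<Delta>']
  show ?thesis
  proof (rule eqvI[OF eqv_cells(1)[OF assms(1)] eqv_cells(2)[OF assms(2)],
      of "\<lambda>z. if snd z \<le> 1/2 then \<Gamma> (fst z, 2 * snd z) else \<Delta> (fst z, 2 * snd z - 1)"])
    show "continuous_map (cyl (cyl (cyl X))) Y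
       (\<lambda>z. if snd z \<le> 1/2 then \<Gamma> (fst z, 2 * snd z) else \<Delta> (fst z, 2 * snd z - 1))"
      by (rule continuous_map_glue[OF \<Gamma>(1) \<Delta>(1)])
        (use \<Gamma>(3) \<Delta>(2) in \<open>auto intro!: cyl_intros\<close>)
  \<comment> \<open>On the boundary \<Delta> rests at \<beta>, which \<open>eqv_boundary\<close>
    identifies with \<alpha>.\<close>
  qed (use \<Gamma> \<Delta> eqv_boundary[OF assms(1)] in auto)
qed

text \<open>All slices of \<Gamma> share H and J at t = 0, 1 and share f and g at s = 0, 1; together
  this says that \<Gamma> rests on the boundary of the square.\<close>

lemma homotopy3_eqv:
  assumes "homotopy3 X Y f g H J \<alpha> \<beta> \<Gamma>"
  shows "eqv X Y \<alpha> \<beta>"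
proof -
  have \<Gamma>: "\<Gamma> \<in> maps (cyl (cyl (cyl X))) Y" "slice (cyl (cyl X)) \<Gamma> 0 = \<alpha>" "slice (cyl (cyl X)) \<Gamma> 1 = \<beta>"
    and *: "\<And>u. u \<in> {0..1} \<Longrightarrow> homotopy2 X Y f g H J (slice (cyl (cyl X)) \<Gamma> u)"
    using assms by (auto simp: homotopy3_def homotopy_def)
  have c: "\<alpha> \<in> cells X Y" "\<beta> \<in> cells X Y"
    using homotopy2_cells(1)[OF *, of 0] homotopy2_cells(1)[OF *, of 1] \<Gamma>(2,3) by simp_all
  show ?thesis
  proof (rule eqvI[OF c maps_cont[OF \<Gamma>(1)]])
    fix x s t u :: real
    show "\<Gamma> (((x, s), t), 0) = \<alpha> ((x, s), t)" if "x \<in> topspace X" "0 \<le> s" "s \<le> 1" "0 \<le> t" "t \<le> 1" for x s t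
      using that by (simp flip: \<Gamma>(2))
    show "\<Gamma> (((x, s), t), 1) = \<beta> ((x, s), t)" if "x \<in> topspace X" "0 \<le> s" "s \<le> 1" "0 \<le> t" "t \<le> 1" for x s t
      using that by (simp flip: \<Gamma>(3))
  next
    fix x and s t u :: real
    assume x: "x \<in> topspace X" "0 \<le> s" "s \<le> 1" "0 \<le> t" "t \<le> 1" "0 \<le> u" "u \<le> 1"
      and b: "s = 0 \<or> s = 1 \<or> t = 0 \<or> t = 1"
    let ?\<Gamma> = "\<lambda>v. slice (cyl (cyl X)) \<Gamma> v"
    have h: "homotopy2 X Y f g H J (?\<Gamma> v)" if "0 \<le> v" "v \<le> 1" for v using * that by simp
    have t: "?\<Gamma> v ((x, s), 0) = H (x, s)" "?\<Gamma> v ((x, s), 1) = J (x, s)" if "0 \<le> v" "v \<le> 1" for v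
      using fun_cong[OF homotopy2_cells(2)[OF h[OF that]], of "(x, s)"]
        fun_cong[OF homotopy2_cells(3)[OF h[OF that]], of "(x, s)"] x by simp_all
    have s: "?\<Gamma> v ((x, 0), t) = f x" "?\<Gamma> v ((x, 1), t) = g x" if "0 \<le> v" "v \<le> 1" for v
    proof -
      have "slice X (slice (cyl X) (?\<Gamma> v) t) 0 = f" "slice X (slice (cyl X) (?\<Gamma> v) t) 1 = g"
        using h[OF that] x by (auto simp: homotopy2_def homotopy_def)
      from fun_cong[OF this(1), of x] fun_cong[OF this(2), of x]
      show "?\<Gamma> v ((x, 0), t) = f x" "?\<Gamma> v ((x, 1), t) = g x" using x by simp_all
    qed
    have "?\<Gamma> u ((x, s), t) = ?\<Gamma> 0 ((x, s), t)"
      using b t[of 0] t[of u] s[of 0] s[of u] x by auto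
    then show "\<Gamma> (((x, s), t), u) = \<alpha> ((x, s), t)" using x \<Gamma>(2) by simp
  qed
qed

lemma eqv_homotopy3:
  assumes "eqv X Y \<alpha> \<beta>"
  shows "\<exists>f g H J \<Gamma>. homotopy3 X Y f g H J \<alpha> \<beta> \<Gamma>"
proof -
  note \<alpha> = eqv_cells(1)[OF assms] and \<beta> = eqv_cells(2)[OF assms]
  obtain \<Gamma> where \<Gamma>': "rel_homotopy X Y \<alpha> \<beta> \<Gamma>" by (rule eqvE[OF assms])
  note \<Gamma> = rel_homotopyD[OF \<Gamma>']
  \<comment> \<open>\<open>homotopy3\<close> asks for an extensional map,
    \<open>rel_homotopy\<close> only for a continuous one.\<close>
  let ?\<Gamma> = "restrict \<Gamma> (topspace (cyl (cyl (cyl X))))"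
  let ?H = "slice (cyl X) \<alpha> 0" and ?J = "slice (cyl X) \<alpha> 1"
  have m: "?\<Gamma> \<in> maps (cyl (cyl (cyl X))) Y" by (rule mapsI[OF \<Gamma>(1)])
  have ext: "\<alpha> \<in> extensional (topspace (cyl (cyl X)))" "\<beta> \<in> extensional (topspace (cyl (cyl X)))"
    using cells_maps \<alpha> \<beta> by (auto simp: maps_def)
  have "homotopy3 X Y (slice X ?H 0) (slice X ?H 1) ?H ?J \<alpha> \<beta> ?\<Gamma>"
    unfolding homotopy3_def homotopy_def[of "cyl (cyl X)"]
  proof (intro conjI ballI m)
    show "slice (cyl (cyl X)) ?\<Gamma> 0 = \<alpha>" "slice (cyl (cyl X)) ?\<Gamma> 1 = \<beta>"
      using \<Gamma>(2,3) ext by (auto intro!: slice_eq)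
    fix u :: real assume u: "u \<in> {0..1}"
    obtain f g where fg: "\<And>x t. x \<in> topspace X \<Longrightarrow> 0 \<le> t \<Longrightarrow> t \<le> 1 \<Longrightarrow> \<alpha> ((x, 0), t) = f x"
      "\<And>x t. x \<in> topspace X \<Longrightarrow> 0 \<le> t \<Longrightarrow> t \<le> 1 \<Longrightarrow> \<alpha> ((x, 1), t) = g x"
      using cellsE[OF \<alpha>] by blast
    have "slice (cyl (cyl X)) ?\<Gamma> u \<in> cells X Y"
      by (rule cellsI[OF slice_maps[OF maps_cont[OF m]], of u f g]) (use u \<Gamma>(4) fg in simp_all)
    from homotopy2_slices[OF this]
    show "homotopy2 X Y (slice X ?H 0) (slice X ?H 1) ?H ?J (slice (cyl (cyl X)) ?\<Gamma> u)"
    proof (rule back_subst[where P="\<lambda>x. x"])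
      \<comment> \<open>At t = 0 and t = 1 the slice of \<Gamma> has the values of \<alpha>, so the
        endpoint data of the two propositions coincide.\<close>
      have "slice (cyl X) (slice (cyl (cyl X)) ?\<Gamma> u) t = slice (cyl X) \<alpha> t" if "t = 0 \<or> t = 1" for t
        using that u \<Gamma>(4) by (auto simp: slice_def restrict_def)
      then show "homotopy2 X Y (slice X (slice (cyl X) (slice (cyl (cyl X)) ?\<Gamma> u) 0) 0)
         (slice X (slice (cyl X) (slice (cyl (cyl X)) ?\<Gamma> u) 0) 1) (slice (cyl X) (slice (cyl (cyl X)) ?\<Gamma> u) 0)
         (slice (cyl X) (slice (cyl (cyl X)) ?\<Gamma> u) 1) (slice (cyl (cyl X)) ?\<Gamma> u) =
         homotopy2 X Y (slice X ?H 0) (slice X ?H 1) ?H ?J (slice (cyl (cyl X)) ?\<Gamma> u)"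
        by simp
    qed
  qed
  then show ?thesis by blast
qed

section \<open>Equivalence classes of cells\<close>

lemma cls_eq: "cls X Y \<alpha> = {\<beta>. eqv X Y \<alpha> \<beta>}"
  using homotopy3_eqv eqv_homotopy3 by (auto simp: cls_def)

lemma cls_cong: "eqv X Y \<alpha> \<beta> \<Longrightarrow> cls X Y \<alpha> = cls X Y \<beta>"
  unfolding cls_eq using eqv_sym eqv_trans by blast

lemma cls_self: "\<alpha> \<in> cells X Y \<Longrightarrow> \<alpha> \<in> cls X Y \<alpha>"
  by (simp add: cls_eq eqv_refl)

lemma eqv_slice:
  assumes "eqv X Y \<alpha> \<beta>" "t = 0 \<or> t = 1"
  shows "slice (cyl X) \<beta> t = slice (cyl X) \<alpha> t"
  using eqv_boundary[OF assms(1)] assms(2) by (auto simp: slice_def restrict_def)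

text \<open>\<open>src2\<close> and \<open>trg2\<close> are read off from a whole class; the image
  is a singleton because equivalent cells agree on the boundary.\<close>

lemma cls_image_slice:
  assumes "\<alpha> \<in> cells X Y" "t = 0 \<or> t = 1"
  shows "the_elem ((\<lambda>\<beta>. slice (cyl X) \<beta> t) ` cls X Y \<alpha>) = slice (cyl X) \<alpha> t"
proof -
  have "(\<lambda>\<beta>. slice (cyl X) \<beta> t) ` cls X Y \<alpha> = {slice (cyl X) \<alpha> t}"
    using cls_self[OF assms(1)] eqv_slice[OF _ assms(2)] by (auto simp: cls_eq)
  then show ?thesis by simp
qed

section \<open>Concatenation of cells and its compatibility with equivalence\<close>

lemma concat_htpy_apply [simp]: "w \<in> topspace W \<Longrightarrow> 0 \<le> s \<Longrightarrow> s \<le> 1 \<Longrightarrow>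
    concat_htpy W J H (w, s) = (if s \<le> 1/2 then H (w, 2 * s) else J (w, 2 * s - 1))"
  by (simp add: concat_htpy_def)

lemma hconcat_htpy_apply [simp]: "x \<in> topspace X \<Longrightarrow> 0 \<le> s \<Longrightarrow> s \<le> 1 \<Longrightarrow> 0 \<le> t \<Longrightarrow> t \<le> 1 \<Longrightarrow>
    hconcat_htpy X \<beta> \<alpha> ((x, s), t) = (if s \<le> 1/2 then \<alpha> ((x, 2 * s), t) else \<beta> ((x, 2 * s - 1), t))"
  by (simp add: hconcat_htpy_def)

lemma reparam_apply [simp]: "x \<in> topspace X \<Longrightarrow> 0 \<le> s \<Longrightarrow> s \<le> 1 \<Longrightarrow> 0 \<le> t \<Longrightarrow> t \<le> 1 \<Longrightarrow>
    reparam X \<phi> K ((x, s), t) = K (x, (1 - t) * \<phi> s + t * s)"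
  by (simp add: reparam_def)

lemma const_htpy_apply [simp]: "w \<in> topspace W \<Longrightarrow> 0 \<le> s \<Longrightarrow> s \<le> 1 \<Longrightarrow> const_htpy W K (w, s) = K w"
  by (simp add: const_htpy_def)

lemma concat_htpy_maps:
  assumes "H \<in> maps (cyl W) Y" "J \<in> maps (cyl W) Y" "\<And>w. w \<in> topspace W \<Longrightarrow> H (w, 1) = J (w, 0)"
  shows "concat_htpy W J H \<in> maps (cyl W) Y"
proof -
  have "continuous_map (cyl W) Y (\<lambda>z. if snd z \<le> 1/2 then H (fst z, 2 * snd z) else J (fst z, 2 * snd z - 1))"
    by (rule continuous_map_glue[OF assms(1,2)[THEN maps_cont] assms(3)]) (auto intro!: cyl_intros)
  from mapsI[OF this] show ?thesis
    by (simp add: concat_htpy_def case_prod_unfold)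
qed

lemma const_htpy_maps:
  assumes "K \<in> maps W Y"
  shows "const_htpy W K \<in> maps (cyl W) Y"
proof -
  have "continuous_map (cyl W) Y (\<lambda>z. K (fst z))"
    by (rule continuous_map_of[OF maps_cont[OF assms]]) (intro cyl_intros)
  from mapsI[OF this] show ?thesis by (simp add: const_htpy_def case_prod_unfold)
qed

lemma hconcat_htpy_maps:
  assumes "\<alpha> \<in> maps (cyl (cyl X)) Y" "\<beta> \<in> maps (cyl (cyl X)) Y"
    "\<And>x t. x \<in> topspace X \<Longrightarrow> 0 \<le> t \<Longrightarrow> t \<le> 1 \<Longrightarrow> \<alpha> ((x, 1), t) = \<beta> ((x, 0), t)"
  shows "hconcat_htpy X \<beta> \<alpha> \<in> maps (cyl (cyl X)) Y"
proof -
  \<comment> \<open>Exchanging s and t turns concatenation in s into concatenation in the last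
    coordinate, the form required by \<open>continuous_map_glue\<close>.\<close>
  let ?sw = "\<lambda>z. ((fst (fst z), snd z), snd (fst z))"
  have sw: "continuous_map (cyl (cyl X)) (cyl (cyl X)) ?sw" by (intro cyl_intros) auto
  have "continuous_map (cyl (cyl X)) Y
    (\<lambda>z. if snd (fst z) \<le> 1/2 then \<alpha> (?sw ((fst (fst z), snd z), 2 * snd (fst z)))
      else \<beta> (?sw ((fst (fst z), snd z), 2 * snd (fst z) - 1)))"
    by (rule continuous_map_glue[OF continuous_map_of[OF maps_cont[OF assms(1)] sw]
          continuous_map_of[OF maps_cont[OF assms(2)] sw]])
      (use assms(3) in \<open>auto intro!: cyl_intros\<close>)
  from mapsI[OF this] show ?thesis
    by (simp add: hconcat_htpy_def case_prod_unfold cong: if_cong)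
qed

definition cell_hom :: "'a topology \<Rightarrow> 'b topology \<Rightarrow> ('a \<times> real \<Rightarrow> 'b) \<Rightarrow> ('a \<times> real \<Rightarrow> 'b) \<Rightarrow>
    (('a \<times> real) \<times> real \<Rightarrow> 'b) set" where
  "cell_hom X Y H J = {\<alpha> \<in> cells X Y. slice (cyl X) \<alpha> 0 = H \<and> slice (cyl X) \<alpha> 1 = J}"

lemma cell_hom_cells: "\<alpha> \<in> cell_hom X Y H J \<Longrightarrow> \<alpha> \<in> cells X Y"
  by (simp add: cell_hom_def)

lemma cell_hom_ends:
  assumes "\<alpha> \<in> cell_hom X Y H J" "x \<in> topspace X" "0 \<le> s" "s \<le> 1"
  shows "\<alpha> ((x, s), 0) = H (x, s)" "\<alpha> ((x, s), 1) = J (x, s)"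
  using assms slice_apply[of "(x, s)" "cyl X" \<alpha>] by (auto simp: cell_hom_def)

text \<open>On the sides a cell does not move with t, so its values there can be read off from H at
  t = 0 and equally from J at t = 1.\<close>

lemma cell_hom_sides:
  assumes "\<alpha> \<in> cell_hom X Y H J" "x \<in> topspace X" "0 \<le> t" "t \<le> 1"
  shows "\<alpha> ((x, 0), t) = H (x, 0)" "\<alpha> ((x, 1), t) = H (x, 1)" "J (x, 0) = H (x, 0)" "J (x, 1) = H (x, 1)"
proof -
  obtain f g where fg: "\<And>x t. x \<in> topspace X \<Longrightarrow> 0 \<le> t \<Longrightarrow> t \<le> 1 \<Longrightarrow> \<alpha> ((x, 0), t) = f x"
      "\<And>x t. x \<in> topspace X \<Longrightarrow> 0 \<le> t \<Longrightarrow> t \<le> 1 \<Longrightarrow> \<alpha> ((x, 1), t) = g x"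
    using cellsE[OF cell_hom_cells[OF assms(1)]] by blast
  show "\<alpha> ((x, 0), t) = H (x, 0)" "\<alpha> ((x, 1), t) = H (x, 1)" "J (x, 0) = H (x, 0)" "J (x, 1) = H (x, 1)"
    using fg[of x 0] fg[of x 1] fg[of x t] assms(2-) cell_hom_ends[OF assms(1,2), of 0] cell_hom_ends[OF assms(1,2), of 1]
    by simp_all
qed

lemma cell_homI:
  assumes "\<alpha> \<in> maps (cyl (cyl X)) Y" "H \<in> maps (cyl X) Y" "J \<in> maps (cyl X) Y"
    "\<And>x s. x \<in> topspace X \<Longrightarrow> 0 \<le> s \<Longrightarrow> s \<le> 1 \<Longrightarrow> \<alpha> ((x, s), 0) = H (x, s)"
    "\<And>x s. x \<in> topspace X \<Longrightarrow> 0 \<le> s \<Longrightarrow> s \<le> 1 \<Longrightarrow> \<alpha> ((x, s), 1) = J (x, s)"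
    "\<And>x t. x \<in> topspace X \<Longrightarrow> 0 \<le> t \<Longrightarrow> t \<le> 1 \<Longrightarrow> \<alpha> ((x, 0), t) = f x"
    "\<And>x t. x \<in> topspace X \<Longrightarrow> 0 \<le> t \<Longrightarrow> t \<le> 1 \<Longrightarrow> \<alpha> ((x, 1), t) = g x"
  shows "\<alpha> \<in> cell_hom X Y H J"
  unfolding cell_hom_def
proof (intro CollectI conjI)
  show "\<alpha> \<in> cells X Y" by (rule cellsI[OF assms(1)]) (use assms(6,7) in auto)
  show "slice (cyl X) \<alpha> 0 = H" by (rule slice_eq) (use assms(2,4) in \<open>auto simp: maps_def\<close>)
  show "slice (cyl X) \<alpha> 1 = J" by (rule slice_eq) (use assms(3,5) in \<open>auto simp: maps_def\<close>)
qed

lemma cells_cell_hom: "\<alpha> \<in> cells X Y \<Longrightarrow> \<alpha> \<in> cell_hom X Y (slice (cyl X) \<alpha> 0) (slice (cyl X) \<alpha> 1)"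
  by (simp add: cell_hom_def)

lemma cell_hom_maps:
  assumes "\<alpha> \<in> cell_hom X Y H J"
  shows "\<alpha> \<in> maps (cyl (cyl X)) Y" "H \<in> maps (cyl X) Y" "J \<in> maps (cyl X) Y"
proof -
  have "\<alpha> \<in> cells X Y" "slice (cyl X) \<alpha> 0 = H" "slice (cyl X) \<alpha> 1 = J"
    using assms by (auto simp: cell_hom_def)
  with slice_maps[OF cells_cont, of \<alpha> X Y 0] slice_maps[OF cells_cont, of \<alpha> X Y 1]
  show "\<alpha> \<in> maps (cyl (cyl X)) Y" "H \<in> maps (cyl X) Y" "J \<in> maps (cyl X) Y"
    by (auto intro: cells_maps)
qed

lemma eqv_cell_hom: "eqv X Y \<alpha> \<beta> \<Longrightarrow> \<alpha> \<in> cell_hom X Y H J \<Longrightarrow> \<beta> \<in> cell_hom X Y H J"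
  using eqv_slice[of X Y \<alpha> \<beta> 0] eqv_slice[of X Y \<alpha> \<beta> 1] eqv_cells[of X Y \<alpha> \<beta>] by (simp add: cell_hom_def)

lemma const_cell_hom: "H \<in> maps (cyl X) Y \<Longrightarrow> const_htpy (cyl X) H \<in> cell_hom X Y H H"
  by (rule cell_homI[where f = "\<lambda>x. H (x, 0)" and g = "\<lambda>x. H (x, 1)"]) (auto intro: const_htpy_maps)

lemma concat_cell_hom:
  assumes \<alpha>: "\<alpha> \<in> cell_hom X Y H J" and \<beta>: "\<beta> \<in> cell_hom X Y J K"
  shows "concat_htpy (cyl X) \<beta> \<alpha> \<in> cell_hom X Y H K"
proof (rule cell_homI)
  show "concat_htpy (cyl X) \<beta> \<alpha> \<in> maps (cyl (cyl X)) Y"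
    by (rule concat_htpy_maps)
      (use cell_hom_maps[OF \<alpha>] cell_hom_maps[OF \<beta>] cell_hom_ends[OF \<alpha>] cell_hom_ends[OF \<beta>] in auto)
qed (use cell_hom_maps[OF \<alpha>] cell_hom_maps[OF \<beta>] cell_hom_ends[OF \<alpha>] cell_hom_ends[OF \<beta>]
   cell_hom_sides[OF \<alpha>] cell_hom_sides[OF \<beta>] in auto)

lemma concat_htpy_maps':
  assumes "H \<in> maps (cyl X) Y" "J \<in> maps (cyl X) Y" "slice X H 1 = slice X J 0"
  shows "concat_htpy X J H \<in> maps (cyl X) Y"
  by (rule concat_htpy_maps[OF assms(1,2)]) (use fun_cong[OF assms(3)] slice_apply in metis)

lemma hconcat_cell_hom:
  assumes \<alpha>: "\<alpha> \<in> cell_hom X Y H H'" and \<beta>: "\<beta> \<in> cell_hom X Y J J'" and HJ: "slice X H 1 = slice X J 0"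
  shows "hconcat_htpy X \<beta> \<alpha> \<in> cell_hom X Y (concat_htpy X J H) (concat_htpy X J' H')"
proof -
  have e: "H (x, 1) = J (x, 0)" if "x \<in> topspace X" for x
    using fun_cong[OF HJ, of x] that by simp
  note m = cell_hom_maps[OF \<alpha>] cell_hom_maps[OF \<beta>]
  note c = cell_hom_ends[OF \<alpha>] cell_hom_ends[OF \<beta>] cell_hom_sides[OF \<alpha>, of _ 0] cell_hom_sides[OF \<beta>, of _ 0]
  show ?thesis
  proof (rule cell_homI)
    show "hconcat_htpy X \<beta> \<alpha> \<in> maps (cyl (cyl X)) Y"
      by (rule hconcat_htpy_maps) (use m e cell_hom_sides[OF \<alpha>] cell_hom_sides[OF \<beta>] in auto)
    show "concat_htpy X J H \<in> maps (cyl X) Y" by (rule concat_htpy_maps) (use m e in auto)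
    show "concat_htpy X J' H' \<in> maps (cyl X) Y" by (rule concat_htpy_maps) (use m e c in auto)
    show "hconcat_htpy X \<beta> \<alpha> ((x, s), 0) = concat_htpy X J H (x, s)" if "x \<in> topspace X" "0 \<le> s" "s \<le> 1" for x s
      using that c by auto
    show "hconcat_htpy X \<beta> \<alpha> ((x, s), 1) = concat_htpy X J' H' (x, s)" if "x \<in> topspace X" "0 \<le> s" "s \<le> 1" for x s
      using that c by auto
    show "hconcat_htpy X \<beta> \<alpha> ((x, 0), t) = H (x, 0)" if "x \<in> topspace X" "0 \<le> t" "t \<le> 1" for x t
      using that cell_hom_sides[OF \<alpha>] by auto
    show "hconcat_htpy X \<beta> \<alpha> ((x, 1), t) = J (x, 1)" if "x \<in> topspace X" "0 \<le> t" "t \<le> 1" for x t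
      using that cell_hom_sides[OF \<beta>] by auto
  qed
qed

text \<open>The relative homotopies are concatenated in t for each u. They fit together because on
  the common edge both rest at J.\<close>

lemma concat_eqv:
  assumes \<alpha>: "\<alpha> \<in> cell_hom X Y H J" and \<beta>: "\<beta> \<in> cell_hom X Y J K" and "eqv X Y \<alpha> \<alpha>'" "eqv X Y \<beta> \<beta>'"
  shows "eqv X Y (concat_htpy (cyl X) \<beta> \<alpha>) (concat_htpy (cyl X) \<beta>' \<alpha>')"
proof -
  obtain \<Gamma> where \<Gamma>': "rel_homotopy X Y \<alpha> \<alpha>' \<Gamma>" by (rule eqvE[OF assms(3)])
  obtain \<Delta> where \<Delta>': "rel_homotopy X Y \<beta> \<beta>' \<Delta>" by (rule eqvE[OF assms(4)])
  note \<Gamma> = rel_homotopyD[OF \<Gamma>'] and \<Delta> = rel_homotopyD[OF \<Delta>']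
  note \<alpha>' = eqv_cell_hom[OF assms(3) \<alpha>] and \<beta>' = eqv_cell_hom[OF assms(4) \<beta>]
  note ends = cell_hom_ends[OF \<alpha>] cell_hom_ends[OF \<beta>]
  \<comment> \<open>Exchanges t and u, so that t is in the last place for the gluing.\<close>
  let ?sw = "\<lambda>z. ((fst (fst z), snd z), snd (fst z))"
  let ?G = "\<lambda>z. if snd (fst z) \<le> 1/2 then \<Gamma> (?sw ((fst (fst z), snd z), 2 * snd (fst z)))
      else \<Delta> (?sw ((fst (fst z), snd z), 2 * snd (fst z) - 1))"
  have sw: "continuous_map (cyl (cyl (cyl X))) (cyl (cyl (cyl X))) ?sw" by (intro cyl_intros) auto
  show ?thesis
  proof (rule eqvI[OF cell_hom_cells[OF concat_cell_hom[OF \<alpha> \<beta>]] cell_hom_cells[OF concat_cell_hom[OF \<alpha>' \<beta>']],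
      of ?G])
    show "continuous_map (cyl (cyl (cyl X))) Y ?G"
      by (rule continuous_map_glue[OF continuous_map_of[OF \<Gamma>(1) sw] continuous_map_of[OF \<Delta>(1) sw]])
        (auto intro!: cyl_intros simp: \<Gamma>(4) \<Delta>(4) ends)
  qed (auto simp: \<Gamma>(2-4) \<Delta>(2-4) ends)
qed

lemma hconcat_eqv:
  assumes \<alpha>: "\<alpha> \<in> cell_hom X Y H H'" and \<beta>: "\<beta> \<in> cell_hom X Y J J'" and HJ: "slice X H 1 = slice X J 0"
    and "eqv X Y \<alpha> \<alpha>'" "eqv X Y \<beta> \<beta>'"
  shows "eqv X Y (hconcat_htpy X \<beta> \<alpha>) (hconcat_htpy X \<beta>' \<alpha>')"
proof -
  obtain \<Gamma> where \<Gamma>': "rel_homotopy X Y \<alpha> \<alpha>' \<Gamma>" by (rule eqvE[OF assms(4)])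
  obtain \<Delta> where \<Delta>': "rel_homotopy X Y \<beta> \<beta>' \<Delta>" by (rule eqvE[OF assms(5)])
  note \<Gamma> = rel_homotopyD[OF \<Gamma>'] and \<Delta> = rel_homotopyD[OF \<Delta>']
  note \<alpha>' = eqv_cell_hom[OF assms(4) \<alpha>] and \<beta>' = eqv_cell_hom[OF assms(5) \<beta>]
  note sides = cell_hom_sides[OF \<alpha>] cell_hom_sides[OF \<beta>]
  have e: "H (x, 1) = J (x, 0)" if "x \<in> topspace X" for x
    using fun_cong[OF HJ, of x] that by simp
  \<comment> \<open>\<open>?q\<close> collects x, t and u, so that s can be glued as the last
    coordinate; \<open>?sw\<close> restores the order of the coordinates.\<close>
  let ?sw = "\<lambda>z. (((fst (fst (fst z)), snd z), snd (fst (fst z))), snd (fst z))"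
  let ?q = "\<lambda>z. ((fst (fst (fst z)), snd (fst z)), snd z)"
  let ?G = "\<lambda>z. if snd (fst (fst z)) \<le> 1/2 then \<Gamma> (?sw (?q z, 2 * snd (fst (fst z))))
      else \<Delta> (?sw (?q z, 2 * snd (fst (fst z)) - 1))"
  have sw: "continuous_map (cyl (cyl (cyl X))) (cyl (cyl (cyl X))) ?sw" by (intro cyl_intros) auto
  show ?thesis
  proof (rule eqvI[OF cell_hom_cells[OF hconcat_cell_hom[OF \<alpha> \<beta> HJ]] cell_hom_cells[OF hconcat_cell_hom[OF \<alpha>' \<beta>' HJ]],
      of "\<lambda>z. if snd (fst (fst z)) \<le> 1/2 then \<Gamma> (((fst (fst (fst z)), 2 * snd (fst (fst z))), snd (fst z)), snd z)
        else \<Delta> (((fst (fst (fst z)), 2 * snd (fst (fst z)) - 1), snd (fst z)), snd z)"])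
    have "continuous_map (cyl (cyl (cyl X))) Y ?G"
      by (rule continuous_map_glue[OF continuous_map_of[OF \<Gamma>(1) sw] continuous_map_of[OF \<Delta>(1) sw]])
        (auto intro!: cyl_intros simp: \<Gamma>(4) \<Delta>(4) sides e)
    then show "continuous_map (cyl (cyl (cyl X))) Y
       (\<lambda>z. if snd (fst (fst z)) \<le> 1/2 then \<Gamma> (((fst (fst (fst z)), 2 * snd (fst (fst z))), snd (fst z)), snd z)
        else \<Delta> (((fst (fst (fst z)), 2 * snd (fst (fst z)) - 1), snd (fst z)), snd z))"
      by (simp cong: if_cong)
  qed (auto simp: \<Gamma>(2-4) \<Delta>(2-4) sides e)
qed

section \<open>Reparametrizations\<close>

text \<open>The parameter type is left open: reparametrized homotopies have parameters in I,
  reparametrized cells in I \<times> I.\<close>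

definition pull :: "'a topology \<Rightarrow> ('a \<times> 'c \<Rightarrow> 'b) \<Rightarrow> (real \<times> real \<Rightarrow> 'c) \<Rightarrow> ('a \<times> real) \<times> real \<Rightarrow> 'b" where
  "pull X K \<rho> = (\<lambda>z\<in>topspace (cyl (cyl X)). K (fst (fst z), \<rho> (snd (fst z), snd z)))"

lemma pull_apply [simp]: "x \<in> topspace X \<Longrightarrow> 0 \<le> s \<Longrightarrow> s \<le> 1 \<Longrightarrow> 0 \<le> t \<Longrightarrow> t \<le> 1 \<Longrightarrow>
    pull X K \<rho> ((x, s), t) = K (x, \<rho> (s, t))"
  by (simp add: pull_def)

lemma continuous_map_pull:
  fixes K :: "'a \<times> 'c::topological_space \<Rightarrow> 'b"
  assumes K: "continuous_map (prod_topology X (top_of_set C)) Y K"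
    and \<rho>: "continuous_on S \<rho>" "\<And>z. z \<in> S \<Longrightarrow> \<rho> z \<in> C"
    and q: "continuous_map Z X q" and r: "continuous_map Z euclidean r" "\<And>z. z \<in> topspace Z \<Longrightarrow> r z \<in> S"
  shows "continuous_map Z Y (\<lambda>z. K (q z, \<rho> (r z)))"
  by (rule continuous_map_of[OF K], intro continuous_map_pairedI continuous_map_into_subtopology
      q continuous_map_param[OF \<rho>(1) r]) (use r \<rho>(2) in auto)

lemma continuous_map_euclidean_pair:
  "continuous_map Z euclidean f \<Longrightarrow> continuous_map Z euclidean g \<Longrightarrow> continuous_map Z euclidean (\<lambda>z. (f z, g z))"
  using continuous_map_pairedI[of Z euclidean f euclidean g] by simp

lemma pull_maps:
  fixes K :: "'a \<times> 'c::topological_space \<Rightarrow> 'b"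
  assumes "continuous_map (prod_topology X (top_of_set C)) Y K"
    "continuous_on ({0..1} \<times> {0..1}) \<rho>" "\<And>z. z \<in> {0..1} \<times> {0..1} \<Longrightarrow> \<rho> z \<in> C"
  shows "pull X K \<rho> \<in> maps (cyl (cyl X)) Y"
  unfolding pull_def
  by (rule mapsI, rule continuous_map_pull[OF assms])
    (auto intro!: cyl_intros continuous_map_euclidean_pair)

text \<open>The homotopy runs along straight lines inside \<open>C\<close>.\<close>

lemma pull_eqv:
  fixes K :: "'a \<times> 'c::real_normed_vector \<Rightarrow> 'b"
  assumes K: "continuous_map (prod_topology X (top_of_set C)) Y K" and C: "convex C"
    and \<rho>: "continuous_on ({0..1} \<times> {0..1}) \<rho>" "\<And>z. z \<in> {0..1} \<times> {0..1} \<Longrightarrow> \<rho> z \<in> C"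
    and \<rho>': "continuous_on ({0..1} \<times> {0..1}) \<rho>'" "\<And>z. z \<in> {0..1} \<times> {0..1} \<Longrightarrow> \<rho>' z \<in> C"
    and bd: "\<And>x s t u. x \<in> topspace X \<Longrightarrow> 0 \<le> s \<Longrightarrow> s \<le> 1 \<Longrightarrow> 0 \<le> t \<Longrightarrow> t \<le> 1 \<Longrightarrow> 0 \<le> u \<Longrightarrow> u \<le> 1 \<Longrightarrow>
       s = 0 \<or> s = 1 \<or> t = 0 \<or> t = 1 \<Longrightarrow> K (x, (1 - u) *\<^sub>R \<rho> (s, t) + u *\<^sub>R \<rho>' (s, t)) = K (x, \<rho> (s, t))"
    and cells: "pull X K \<rho> \<in> cells X Y"
  shows "eqv X Y (pull X K \<rho>) (pull X K \<rho>')"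
proof -
  obtain f g where fg: "\<And>x t. x \<in> topspace X \<Longrightarrow> 0 \<le> t \<Longrightarrow> t \<le> 1 \<Longrightarrow> pull X K \<rho> ((x, 0), t) = f x"
      "\<And>x t. x \<in> topspace X \<Longrightarrow> 0 \<le> t \<Longrightarrow> t \<le> 1 \<Longrightarrow> pull X K \<rho> ((x, 1), t) = g x"
    using cellsE[OF cells] by blast
  \<comment> \<open>At u = 1 the boundary condition compares \<rho>' with \<rho> on the sides, so
    independence of t is inherited.\<close>
  have cells': "pull X K \<rho>' \<in> cells X Y"
    by (rule cellsI[OF pull_maps[OF K \<rho>'], of f g])
      (use fg bd[of _ 0 _ 1] bd[of _ 1 _ 1] in \<open>auto simp del: pull_apply simp: pull_apply[symmetric]\<close>)
  let ?r = "\<lambda>v. (1 - snd v) *\<^sub>R \<rho> (fst v) + snd v *\<^sub>R \<rho>' (fst v)"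
  have c: "continuous_on (({0..1} \<times> {0..1}) \<times> {0..1}) ?r"
    by (intro continuous_intros continuous_on_compose2[OF \<rho>(1)] continuous_on_compose2[OF \<rho>'(1)]) auto
  have m: "?r v \<in> C" if "v \<in> ({0..1} \<times> {0..1}) \<times> {0..1}" for v
    by (rule convexD[OF C]) (use that \<rho>(2) \<rho>'(2) in auto)
  have "continuous_map (cyl (cyl (cyl X))) Y
     (\<lambda>z. K (fst (fst (fst z)), ?r ((snd (fst (fst z)), snd (fst z)), snd z)))"
    by (rule continuous_map_pull[OF K c m]) (auto intro!: cyl_intros continuous_map_euclidean_pair)
  then show ?thesis
    by (rule eqvI[OF cells cells']) (use bd in auto)
qed

section \<open>Hom-sets and compositions of \<open>Top_hom\<close> on representatives\<close>

lemma Top_hom_simps [simp]: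
  "ob (Top_hom X Y) = maps X Y"
  "arr1 (Top_hom X Y) = maps (cyl X) Y"
  "arr2 (Top_hom X Y) = cls X Y ` cells X Y"
  "src1 (Top_hom X Y) H = slice X H 0"
  "trg1 (Top_hom X Y) H = slice X H 1"
  "id1 (Top_hom X Y) f = const_htpy X f"
  "id2 (Top_hom X Y) H = cls X Y (const_htpy (cyl X) H)"
  "J \<odot>\<^bsub>Top_hom X Y\<^esub> H = concat_htpy X J H"
  "assoc (Top_hom X Y) K J H = cls X Y (reparam X assoc_param (concat_htpy X K (concat_htpy X J H)))"
  "lunit (Top_hom X Y) H = cls X Y (reparam X (\<lambda>s. min (2 * s) 1) H)"
  "runit (Top_hom X Y) H = cls X Y (reparam X (\<lambda>s. max 0 (2 * s - 1)) H)"
proof -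
  have "cells X Y = {\<alpha>. \<exists>f g H J. homotopy2 X Y f g H J \<alpha>}"
    by (intro set_eqI) (simp add: cells_iff)
  then show "arr2 (Top_hom X Y) = cls X Y ` cells X Y"
    by (simp add: Top_hom_def image_Collect)
qed (simp_all add: Top_hom_def homotopy_iff)

lemma src2_Top: "\<alpha> \<in> cells X Y \<Longrightarrow> src2 (Top_hom X Y) (cls X Y \<alpha>) = slice (cyl X) \<alpha> 0"
  and trg2_Top: "\<alpha> \<in> cells X Y \<Longrightarrow> trg2 (Top_hom X Y) (cls X Y \<alpha>) = slice (cyl X) \<alpha> 1"
  by (simp_all add: Top_hom_def cls_image_slice)

lemma hom1_Top: "H \<in> hom1 (Top_hom X Y) f g \<longleftrightarrow> H \<in> maps (cyl X) Y \<and> slice X H 0 = f \<and> slice X H 1 = g"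
  by (simp add: hom1_def)

lemma hom2_Top: "hom2 (Top_hom X Y) H J = cls X Y ` cell_hom X Y H J"
proof (intro equalityI subsetI)
  fix A assume "A \<in> hom2 (Top_hom X Y) H J"
  then have A: "A \<in> cls X Y ` cells X Y" "src2 (Top_hom X Y) A = H" "trg2 (Top_hom X Y) A = J"
    by (simp_all add: hom2_def)
  then obtain \<alpha> where "\<alpha> \<in> cells X Y" "A = cls X Y \<alpha>" by blast
  with A show "A \<in> cls X Y ` cell_hom X Y H J"
    by (simp add: src2_Top trg2_Top cell_hom_def)
next
  fix A assume "A \<in> cls X Y ` cell_hom X Y H J"
  then obtain \<alpha> where "\<alpha> \<in> cells X Y" "A = cls X Y \<alpha>" "slice (cyl X) \<alpha> 0 = H" "slice (cyl X) \<alpha> 1 = J"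
    unfolding cell_hom_def by blast
  then show "A \<in> hom2 (Top_hom X Y) H J"
    by (simp add: hom2_def src2_Top trg2_Top)
qed

lemma hom2_TopE:
  assumes "A \<in> hom2 (Top_hom X Y) H J"
  obtains \<alpha> where "\<alpha> \<in> cell_hom X Y H J" "A = cls X Y \<alpha>"
  using assms unfolding hom2_Top by blast

lemma hom2_TopI: "\<alpha> \<in> cell_hom X Y H J \<Longrightarrow> cls X Y \<alpha> \<in> hom2 (Top_hom X Y) H J"
  unfolding hom2_Top by (rule imageI)

text \<open>The definition takes a union over all representatives. By \<open>concat_eqv\<close> its
  members are one and the same class, and by \<open>cls_self\<close> there is at least one.\<close>

lemma vcomp_Top:
  assumes "\<alpha> \<in> cell_hom X Y H J" "\<beta> \<in> cell_hom X Y J K"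
  shows "cls X Y \<beta> \<cdot>\<^bsub>Top_hom X Y\<^esub> cls X Y \<alpha> = cls X Y (concat_htpy (cyl X) \<beta> \<alpha>)"
proof -
  have "cls X Y (concat_htpy (cyl X) \<beta>' \<alpha>') = cls X Y (concat_htpy (cyl X) \<beta> \<alpha>)"
    if "\<beta>' \<in> cls X Y \<beta>" "\<alpha>' \<in> cls X Y \<alpha>" for \<alpha>' \<beta>'
    using cls_cong[OF concat_eqv[OF assms]] that by (simp add: cls_eq)
  moreover have "cls X Y \<beta> \<cdot>\<^bsub>Top_hom X Y\<^esub> cls X Y \<alpha>
      = (\<Union>\<beta>'\<in>cls X Y \<beta>. \<Union>\<alpha>'\<in>cls X Y \<alpha>. cls X Y (concat_htpy (cyl X) \<beta>' \<alpha>'))"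
    by (simp add: Top_hom_def)
  moreover note cls_self[OF cell_hom_cells[OF assms(1)]] cls_self[OF cell_hom_cells[OF assms(2)]]
  ultimately show ?thesis by blast
qed

lemma hcomp_Top:
  assumes "\<alpha> \<in> cell_hom X Y H H'" "\<beta> \<in> cell_hom X Y J J'" "slice X H 1 = slice X J 0"
  shows "cls X Y \<beta> \<star>\<^bsub>Top_hom X Y\<^esub> cls X Y \<alpha> = cls X Y (hconcat_htpy X \<beta> \<alpha>)"
proof -
  have "cls X Y (hconcat_htpy X \<beta>' \<alpha>') = cls X Y (hconcat_htpy X \<beta> \<alpha>)"
    if "\<beta>' \<in> cls X Y \<beta>" "\<alpha>' \<in> cls X Y \<alpha>" for \<alpha>' \<beta>'
    using cls_cong[OF hconcat_eqv[OF assms]] that by (simp add: cls_eq)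
  moreover have "cls X Y \<beta> \<star>\<^bsub>Top_hom X Y\<^esub> cls X Y \<alpha>
      = (\<Union>\<beta>'\<in>cls X Y \<beta>. \<Union>\<alpha>'\<in>cls X Y \<alpha>. cls X Y (hconcat_htpy X \<beta>' \<alpha>'))"
    by (simp add: Top_hom_def)
  moreover note cls_self[OF cell_hom_cells[OF assms(1)]] cls_self[OF cell_hom_cells[OF assms(2)]]
  ultimately show ?thesis by blast
qed

lemma cyl_eqI:
  assumes "f \<in> extensional (topspace (cyl X))" "g \<in> extensional (topspace (cyl X))"
    "\<And>x s. x \<in> topspace X \<Longrightarrow> 0 \<le> s \<Longrightarrow> s \<le> 1 \<Longrightarrow> f (x, s) = g (x, s)"
  shows "f = g"
  by (rule extensionalityI[OF assms(1,2)]) (use assms(3) in auto)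

lemma cyl2_eqI:
  assumes "f \<in> extensional (topspace (cyl (cyl X)))" "g \<in> extensional (topspace (cyl (cyl X)))"
    "\<And>x s t. x \<in> topspace X \<Longrightarrow> 0 \<le> s \<Longrightarrow> s \<le> 1 \<Longrightarrow> 0 \<le> t \<Longrightarrow> t \<le> 1 \<Longrightarrow> f ((x, s), t) = g ((x, s), t)"
  shows "f = g"
  by (rule extensionalityI[OF assms(1,2)]) (use assms(3) in auto)

lemma htpy_extensional [simp]:
  "concat_htpy W J H \<in> extensional (topspace (cyl W))"
  "const_htpy W f \<in> extensional (topspace (cyl W))"
  "hconcat_htpy X \<beta> \<alpha> \<in> extensional (topspace (cyl (cyl X)))"
  "reparam X \<phi> K \<in> extensional (topspace (cyl (cyl X)))"
  "pull X K' \<rho> \<in> extensional (topspace (cyl (cyl X)))"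
  unfolding concat_htpy_def const_htpy_def hconcat_htpy_def reparam_def pull_def
  by (rule restrict_extensional)+

text \<open>Puts both parameters of a cell into one convex subset of a normed space, as
  \<open>pull_eqv\<close> requires.\<close>

definition square :: "(('a \<times> real) \<times> real \<Rightarrow> 'b) \<Rightarrow> 'a \<times> real \<times> real \<Rightarrow> 'b" where
  "square \<alpha> = (\<lambda>(x, s, t). \<alpha> ((x, s), t))"

lemma square_apply [simp]: "square \<alpha> (x, v) = \<alpha> ((x, fst v), snd v)"
  by (simp add: square_def case_prod_unfold)

lemma continuous_map_square:
  assumes "continuous_map (cyl (cyl X)) Y \<alpha>"
  shows "continuous_map (prod_topology X (top_of_set ({0..1} \<times> {0..1}))) Y (square \<alpha>)"
proof -
  let ?P = "prod_topology X (top_of_set ({0..1::real} \<times> {0..1::real}))"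
  have s: "continuous_map ?P euclidean (\<lambda>z. snd z)"
    using continuous_map_snd[of X "top_of_set ({0..1::real} \<times> {0..1::real})"]
    by (simp add: continuous_map_in_subtopology)
  have "continuous_map ?P (cyl (cyl X)) (\<lambda>z. ((fst z, fst (snd z)), snd (snd z)))"
    by (intro continuous_map_cylI continuous_map_fst continuous_map_param[OF _ s, of UNIV fst]
        continuous_map_param[OF _ s, of UNIV snd])
      (auto intro: continuous_intros)
  from continuous_map_of[OF assms this] show ?thesis
    by (simp add: square_def case_prod_unfold)
qed

text \<open>On \<open>s = 0\<close> and \<open>s = 1\<close> a cell does not depend on \<open>t\<close>, so there only the first component of
  a reparametrization of the square matters.\<close>

lemma square_eqv:
  assumes \<alpha>: "\<alpha> \<in> cells X Y"
    and \<rho>: "continuous_on ({0..1} \<times> {0..1}) \<rho>" "\<And>z. z \<in> {0..1} \<times> {0..1} \<Longrightarrow> \<rho> z \<in> {0..1} \<times> {0..1}"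
    and \<rho>': "continuous_on ({0..1} \<times> {0..1}) \<rho>'" "\<And>z. z \<in> {0..1} \<times> {0..1} \<Longrightarrow> \<rho>' z \<in> {0..1} \<times> {0..1}"
    and side: "\<And>t. 0 \<le> t \<Longrightarrow> t \<le> 1 \<Longrightarrow> fst (\<rho> (0, t)) = 0 \<and> fst (\<rho>' (0, t)) = 0 \<and>
        fst (\<rho> (1, t)) = 1 \<and> fst (\<rho>' (1, t)) = 1"
    and ends: "\<And>s. 0 \<le> s \<Longrightarrow> s \<le> 1 \<Longrightarrow> \<rho> (s, 0) = \<rho>' (s, 0) \<and> \<rho> (s, 1) = \<rho>' (s, 1)"
  shows "eqv X Y (pull X (square \<alpha>) \<rho>) (pull X (square \<alpha>) \<rho>')"
proof -
  obtain f g where fg: "\<And>x t. x \<in> topspace X \<Longrightarrow> 0 \<le> t \<Longrightarrow> t \<le> 1 \<Longrightarrow> \<alpha> ((x, 0), t) = f x"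
      "\<And>x t. x \<in> topspace X \<Longrightarrow> 0 \<le> t \<Longrightarrow> t \<le> 1 \<Longrightarrow> \<alpha> ((x, 1), t) = g x"
    using cellsE[OF \<alpha>] by blast
  note K = continuous_map_square[OF cells_cont[OF \<alpha>]]
  have C: "convex ({0..1::real} \<times> {0..1::real})" by (intro convex_Times) auto
  have b: "0 \<le> snd (\<rho> (s, t)) \<and> snd (\<rho> (s, t)) \<le> 1" "0 \<le> snd (\<rho>' (s, t)) \<and> snd (\<rho>' (s, t)) \<le> 1"
    if "0 \<le> s" "s \<le> 1" "0 \<le> t" "t \<le> 1" for s t
    using \<rho>(2)[of "(s, t)"] \<rho>'(2)[of "(s, t)"] that by (auto simp: mem_Times_iff)
  have cv: "0 \<le> (1 - u) * y + u * y' \<and> (1 - u) * y + u * y' \<le> 1"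
    if "0 \<le> u" "u \<le> 1" "0 \<le> y \<and> y \<le> 1" "0 \<le> y' \<and> y' \<le> 1" for u y y' :: real
    using that convex_bound_le[of y 1 y' "1 - u" u] by simp
  show ?thesis
  proof (rule pull_eqv[OF K C \<rho> \<rho>'])
    show "pull X (square \<alpha>) \<rho> \<in> cells X Y"
      by (rule cellsI[OF pull_maps[OF K \<rho>]]) (simp_all add: fg side b)
    fix x and s t u :: real
    assume x: "x \<in> topspace X" "0 \<le> s" "s \<le> 1" "0 \<le> t" "t \<le> 1" "0 \<le> u" "u \<le> 1"
      and "s = 0 \<or> s = 1 \<or> t = 0 \<or> t = 1"
    then consider "s = 0" | "s = 1" | "t = 0 \<or> t = 1" by blast
    then show "square \<alpha> (x, (1 - u) *\<^sub>R \<rho> (s, t) + u *\<^sub>R \<rho>' (s, t)) = square \<alpha> (x, \<rho> (s, t))"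
    proof cases
      case 1
      then show ?thesis using x b[of s t] cv[of u] by (simp add: side fg(1))
    next
      case 2
      then show ?thesis using x b[of s t] cv[of u] by (simp add: side fg(2))
    next
      case 3
      then have "\<rho>' (s, t) = \<rho> (s, t)" using ends[of s] x by auto
      then show ?thesis by (simp flip: scaleR_add_left)
    qed
  qed
qed

text \<open>Reparametrization in t alone; inverses, units and associativity of vertical composition
  are all instances.\<close>

definition vert :: "'a topology \<Rightarrow> (('a \<times> real) \<times> real \<Rightarrow> 'b) \<Rightarrow> (real \<Rightarrow> real) \<Rightarrow> ('a \<times> real) \<times> real \<Rightarrow> 'b" where
  "vert X \<alpha> \<phi> = pull X (square \<alpha>) (\<lambda>v. (fst v, \<phi> (snd v)))"

lemma vert_apply [simp]: "x \<in> topspace X \<Longrightarrow> 0 \<le> s \<Longrightarrow> s \<le> 1 \<Longrightarrow> 0 \<le> t \<Longrightarrow> t \<le> 1 \<Longrightarrow>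
    vert X \<alpha> \<phi> ((x, s), t) = \<alpha> ((x, s), \<phi> t)"
  by (simp add: vert_def)

lemma vert_eqv:
  assumes "\<alpha> \<in> cells X Y" "continuous_on {0..1} \<phi>" "continuous_on {0..1} \<psi>"
    "\<And>t. 0 \<le> t \<Longrightarrow> t \<le> 1 \<Longrightarrow> 0 \<le> \<phi> t \<and> \<phi> t \<le> 1 \<and> 0 \<le> \<psi> t \<and> \<psi> t \<le> 1" "\<phi> 0 = \<psi> 0" "\<phi> 1 = \<psi> 1"
  shows "eqv X Y (vert X \<alpha> \<phi>) (vert X \<alpha> \<psi>)"
  unfolding vert_def
  by (rule square_eqv[OF assms(1)])
    (auto intro!: continuous_intros continuous_on_compose2[OF assms(2)] continuous_on_compose2[OF assms(3)]
      simp: assms(4-))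

section \<open>Endpoint-preserving parameters and straight-line cells\<close>

definition param :: "(real \<Rightarrow> real) \<Rightarrow> bool" where
  "param p \<longleftrightarrow> continuous_on {0..1} p \<and> (\<forall>s\<in>{0..1}. 0 \<le> p s \<and> p s \<le> 1) \<and> p 0 = 0 \<and> p 1 = 1"

lemma paramD:
  assumes "param p"
  shows "continuous_on {0..1} p" "0 \<le> s \<Longrightarrow> s \<le> 1 \<Longrightarrow> 0 \<le> p s" "0 \<le> s \<Longrightarrow> s \<le> 1 \<Longrightarrow> p s \<le> 1"
    "p 0 = 0" "p 1 = 1"
  using assms by (auto simp: param_def)

lemma param_convex:
  assumes "param p" "param q" "0 \<le> s" "s \<le> 1" "0 \<le> t" "t \<le> 1"
  shows "0 \<le> (1 - t) * p s + t * q s" "(1 - t) * p s + t * q s \<le> 1"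
  using paramD(2,3)[OF assms(1,3,4)] paramD(2,3)[OF assms(2,3,4)] assms(5,6)
    convex_bound_le[of "p s" 1 "q s" "1 - t" t] by simp_all

text \<open>The parameter of a concatenation: p squeezed into the first half and q into the second.
  Clipping the arguments keeps the idle summand at its end value 1 or 0, which gives continuity
  without case distinction.\<close>

definition hsum :: "(real \<Rightarrow> real) \<Rightarrow> (real \<Rightarrow> real) \<Rightarrow> real \<Rightarrow> real" where
  "hsum q p s = (p (min (2 * s) 1) + q (max 0 (2 * s - 1))) / 2"

lemma param_id [simp]: "param (\<lambda>s. s)"
  by (simp add: param_def)

lemma param_comp: "param p \<Longrightarrow> param q \<Longrightarrow> param (\<lambda>s. p (q s))"
  unfolding param_def by (auto intro: continuous_on_compose2[of "{0..1}" p])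

lemma param_hsum:
  assumes p: "param p" and q: "param q"
  shows "param (hsum q p)"
  unfolding param_def
proof (intro conjI ballI)
  show "continuous_on {0..1} (hsum q p)"
    unfolding hsum_def
    by (intro continuous_intros continuous_on_compose2[OF paramD(1)[OF p]]
        continuous_on_compose2[OF paramD(1)[OF q]]) auto
  show "hsum q p 0 = 0" "hsum q p 1 = 1"
    by (simp_all add: hsum_def paramD(4,5)[OF p] paramD(4,5)[OF q])
  fix s :: real assume "s \<in> {0..1}"
  then show "0 \<le> hsum q p s" "hsum q p s \<le> 1"
    using paramD(2,3)[OF p, of "min (2 * s) 1"] paramD(2,3)[OF q, of "max 0 (2 * s - 1)"]
    by (auto simp: hsum_def)
qed

lemma param_left: "param (\<lambda>s. min (2 * s) 1)" and param_right: "param (\<lambda>s. max 0 (2 * s - 1))"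
  unfolding param_def by (auto intro!: continuous_intros)

text \<open>Continuity is immediate from this form. The outer maximum is correct because 2 s - 1
  overtakes s - 1/4 exactly at s = 3/4.\<close>

lemma assoc_param_eq: "0 \<le> s \<Longrightarrow> s \<le> 1 \<Longrightarrow> assoc_param s = max (min (s / 2) (1 / 4) + max 0 (s - 1 / 2)) (2 * s - 1)"
  by (auto simp: assoc_param_def max_def min_def)

lemma param_assoc: "param assoc_param"
proof -
  have "continuous_on {0..1} (\<lambda>s. max (min (s / 2) (1 / 4) + max 0 (s - 1 / 2)) (2 * s - 1 :: real))"
    by (intro continuous_intros) auto
  then have "continuous_on {0..1} assoc_param"
    by (rule continuous_on_eq) (simp add: assoc_param_eq)
  then show ?thesis by (auto simp: param_def assoc_param_def)
qed

definition rep :: "'a topology \<Rightarrow> ('a \<times> real \<Rightarrow> 'b) \<Rightarrow> (real \<Rightarrow> real) \<Rightarrow> 'a \<times> real \<Rightarrow> 'b" where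
  "rep X K p = (\<lambda>z\<in>topspace (cyl X). K (fst z, p (snd z)))"

lemma rep_extensional: "rep X K p \<in> extensional (topspace (cyl X))"
  unfolding rep_def by (rule restrict_extensional)

lemma rep_apply [simp]: "x \<in> topspace X \<Longrightarrow> 0 \<le> s \<Longrightarrow> s \<le> 1 \<Longrightarrow> rep X K p (x, s) = K (x, p s)"
  by (simp add: rep_def)

lemma rep_maps:
  assumes "K \<in> maps (cyl X) Y" "param p"
  shows "rep X K p \<in> maps (cyl X) Y"
  unfolding rep_def
  by (rule mapsI, rule continuous_map_of[OF maps_cont[OF assms(1)]], rule continuous_map_cylI[OF
      continuous_map_cyl_proj(1) continuous_map_param[OF paramD(1)[OF assms(2)] continuous_map_cyl_proj(4)]])
    (auto simp: paramD[OF assms(2)])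

lemma rep_id: "K \<in> maps (cyl X) Y \<Longrightarrow> rep X K (\<lambda>s. s) = K"
  by (rule maps_eqI[OF rep_maps]) auto

lemma rep_slice:
  assumes "param p"
  shows "slice X (rep X K p) 0 = slice X K 0" "slice X (rep X K p) 1 = slice X K 1"
  by (auto simp: slice_def restrict_def paramD(4,5)[OF assms])

text \<open>The common form of the structural cells of \<open>Top_hom\<close>: p = q gives identity
  cells, q the identity parameter gives the constraints.\<close>

definition line :: "'a topology \<Rightarrow> ('a \<times> real \<Rightarrow> 'b) \<Rightarrow> (real \<Rightarrow> real) \<Rightarrow> (real \<Rightarrow> real) \<Rightarrow> ('a \<times> real) \<times> real \<Rightarrow> 'b"
  where
  "line X K p q = pull X K (\<lambda>v. (1 - snd v) * p (fst v) + snd v * q (fst v))"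

lemma line_extensional: "line X K p q \<in> extensional (topspace (cyl (cyl X)))"
  unfolding line_def by (rule htpy_extensional)

lemma line_apply [simp]: "x \<in> topspace X \<Longrightarrow> 0 \<le> s \<Longrightarrow> s \<le> 1 \<Longrightarrow> 0 \<le> t \<Longrightarrow> t \<le> 1 \<Longrightarrow>
    line X K p q ((x, s), t) = K (x, (1 - t) * p s + t * q s)"
  by (simp add: line_def)

lemma line_continuous:
  assumes "param p" "param q"
  shows "continuous_on ({0..1} \<times> {0..1}) (\<lambda>v. (1 - snd v) * p (fst v) + snd v * q (fst v))"
  by (intro continuous_intros continuous_on_compose2[OF paramD(1)[OF assms(1)]]
      continuous_on_compose2[OF paramD(1)[OF assms(2)]]) auto

lemma line_cell_hom:
  assumes "K \<in> maps (cyl X) Y" "param p" "param q"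
  shows "line X K p q \<in> cell_hom X Y (rep X K p) (rep X K q)"
proof (rule cell_homI)
  show "line X K p q \<in> maps (cyl (cyl X)) Y"
    unfolding line_def
    by (rule pull_maps[of X "{0..1}", OF maps_cont[OF assms(1), unfolded cyl_def] line_continuous[OF assms(2,3)]])
      (auto simp: param_convex[OF assms(2,3)])
  show "line X K p q ((x, 0), t) = K (x, 0)" "line X K p q ((x, 1), t) = K (x, 1)"
    if "x \<in> topspace X" "0 \<le> t" "t \<le> 1" for x t
    using that by (simp_all add: paramD(4,5)[OF assms(2)] paramD(4,5)[OF assms(3)])
qed (simp_all add: rep_maps assms)

text \<open>\<open>pull_eqv\<close> for parameters in I. It is the coherence principle behind the
  constraint equations: a 2-cell that merely reparametrizes K is determined by its boundary
  parameters.\<close>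

lemma thin_eqv:
  assumes K: "K \<in> maps (cyl X) Y"
    and r: "continuous_on ({0..1} \<times> {0..1}) r" "\<And>z. z \<in> {0..1} \<times> {0..1} \<Longrightarrow> r z \<in> {0..1}"
    and r': "continuous_on ({0..1} \<times> {0..1}) r'" "\<And>z. z \<in> {0..1} \<times> {0..1} \<Longrightarrow> r' z \<in> {0..1}"
    and side: "\<And>t. 0 \<le> t \<Longrightarrow> t \<le> 1 \<Longrightarrow> r (0, t) = 0 \<and> r' (0, t) = 0 \<and> r (1, t) = 1 \<and> r' (1, t) = 1"
    and ends: "\<And>s. 0 \<le> s \<Longrightarrow> s \<le> 1 \<Longrightarrow> r (s, 0) = r' (s, 0) \<and> r (s, 1) = r' (s, 1)"
  shows "eqv X Y (pull X K r) (pull X K r')"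
proof -
  note K' = maps_cont[OF K, unfolded cyl_def]
  show ?thesis
  proof (rule pull_eqv[OF K' _ r r'])
    show "pull X K r \<in> cells X Y"
      by (rule cellsI[OF pull_maps[OF K' r], where f = "\<lambda>x. K (x, 0)" and g = "\<lambda>x. K (x, 1)"])
        (simp_all add: side)
    fix x and s t u :: real
    assume x: "x \<in> topspace X" "0 \<le> s" "s \<le> 1" "0 \<le> t" "t \<le> 1" "0 \<le> u" "u \<le> 1"
      and "s = 0 \<or> s = 1 \<or> t = 0 \<or> t = (1::real)"
    then have "r' (s, t) = r (s, t)" using side[of t] ends[of s] by auto
    then show "K (x, (1 - u) *\<^sub>R r (s, t) + u *\<^sub>R r' (s, t)) = K (x, r (s, t))"
      by (simp add: algebra_simps)
  qed simp
qed

text \<open>\<phi> need not take straight lines to straight lines, but the bent and the straight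
  parameter agree on the boundary, so \<open>thin_eqv\<close> exchanges them.\<close>

lemma line_rep_eqv:
  assumes K: "K \<in> maps (cyl X) Y" and \<phi>: "param \<phi>" and p: "param p" "param q"
  shows "eqv X Y (line X (rep X K \<phi>) p q) (line X K (\<lambda>s. \<phi> (p s)) (\<lambda>s. \<phi> (q s)))"
proof -
  have e: "line X (rep X K \<phi>) p q = pull X K (\<lambda>v. \<phi> ((1 - snd v) * p (fst v) + snd v * q (fst v)))"
    unfolding line_def pull_def using param_convex[OF p] by (auto simp: restrict_def fun_eq_iff)
  show ?thesis
    unfolding e unfolding line_def
  proof (rule thin_eqv[OF K])
    show "continuous_on ({0..1} \<times> {0..1}) (\<lambda>v. \<phi> ((1 - snd v) * p (fst v) + snd v * q (fst v)))"
      by (rule continuous_on_compose2[OF paramD(1)[OF \<phi>] line_continuous[OF p]])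
        (auto simp: param_convex[OF p])
    show "continuous_on ({0..1} \<times> {0..1}) (\<lambda>v. (1 - snd v) * \<phi> (p (fst v)) + snd v * \<phi> (q (fst v)))"
      by (rule line_continuous[OF param_comp[OF \<phi> p(1)] param_comp[OF \<phi> p(2)]])
  qed (auto simp: paramD[OF \<phi>] paramD(4,5)[OF p(1)] paramD(4,5)[OF p(2)] param_convex[OF p]
     param_convex[OF param_comp[OF \<phi> p(1)] param_comp[OF \<phi> p(2)]])
qed

lemma line_concat_eqv:
  assumes K: "K \<in> maps (cyl X) Y" and p: "param p" "param q" "param w"
  shows "eqv X Y (concat_htpy (cyl X) (line X K q w) (line X K p q)) (line X K p w)"
proof -
  \<comment> \<open>Moves from p to q while 2 t \<le> 1 and then from q to w; the clipped
    coefficients give one continuous formula for both halves.\<close>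
  let ?r = "\<lambda>v. p (fst v) + min (2 * snd v) 1 * (q (fst v) - p (fst v)) + max 0 (2 * snd v - 1) * (w (fst v) - q (fst v))"
  have c: "concat_htpy (cyl X) (line X K q w) (line X K p q) \<in> cell_hom X Y (rep X K p) (rep X K w)"
    by (rule concat_cell_hom[OF line_cell_hom line_cell_hom]) fact+
  have r1: "?r (s, t) = (1 - 2 * t) * p s + (2 * t) * q s" if "t \<le> 1/2" for s t
    using that by (simp add: algebra_simps)
  have r2: "?r (s, t) = (1 - (2 * t - 1)) * q s + (2 * t - 1) * w s" if "1/2 \<le> t" for s t
    using that by (simp add: algebra_simps)
  have e: "concat_htpy (cyl X) (line X K q w) (line X K p q) = pull X K ?r"
    by (rule cyl2_eqI[OF htpy_extensional(1,5)]) (auto simp: algebra_simps)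
  have b: "?r v \<in> {0..1}" if "v \<in> {0..1} \<times> {0..1}" for v
  proof -
    obtain s t where v: "v = (s, t)" by (cases v)
    show ?thesis
    proof (cases "t \<le> 1/2")
      case True
      then show ?thesis using that param_convex[OF p(1,2), of s "2 * t"] r1[OF True, of s] unfolding v by simp
    next
      case False
      then show ?thesis using that param_convex[OF p(2,3), of s "2 * t - 1"] r2[of t s] unfolding v by simp
    qed
  qed
  show ?thesis
    unfolding e unfolding line_def
  proof (rule thin_eqv[OF K _ b line_continuous[OF p(1,3)]])
    show "continuous_on ({0..1} \<times> {0..1}) ?r"
      by (intro continuous_intros continuous_on_compose2[OF paramD(1)[OF p(1)]]
          continuous_on_compose2[OF paramD(1)[OF p(2)]] continuous_on_compose2[OF paramD(1)[OF p(3)]]) auto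
  qed (auto simp: paramD(4,5)[OF p(1)] paramD(4,5)[OF p(2)] paramD(4,5)[OF p(3)] param_convex[OF p(1,3)])
qed

lemma hsum_low: "param q \<Longrightarrow> s \<le> 1/2 \<Longrightarrow> hsum q p s = p (2 * s) / 2"
  by (simp add: hsum_def paramD)

lemma hsum_high: "param p \<Longrightarrow> 1/2 \<le> s \<Longrightarrow> hsum q p s = (1 + q (2 * s - 1)) / 2"
  by (simp add: hsum_def paramD)

lemma concat_low: "x \<in> topspace X \<Longrightarrow> 0 \<le> y \<Longrightarrow> y \<le> 1 \<Longrightarrow> concat_htpy X G F (x, y / 2) = F (x, y)"
  by simp

text \<open>For y = 0 the point lies at 1/2, where \<open>concat_htpy\<close> still takes its first
  branch; matching of F and G covers this case.\<close>

lemma concat_high: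
  assumes "slice X F 1 = slice X G 0" "x \<in> topspace X" "0 \<le> y" "y \<le> 1"
  shows "concat_htpy X G F (x, (1 + y) / 2) = G (x, y)"
proof -
  have "2 * ((1 + y) / 2) - 1 = y" by (simp add: field_simps)
  then show ?thesis
    using fun_cong[OF assms(1), of x] assms(2-) by (subst concat_htpy_apply) auto
qed

text \<open>An equality and not only an equivalence: the two halves sit in the concatenation by the
  affine maps y / 2 and (1 + y) / 2, which commute with straight lines.\<close>

lemma line_hconcat:
  assumes FG: "slice X F 1 = slice X G 0" and p: "param p" "param q" "param p'" "param q'"
  shows "hconcat_htpy X (line X G p' q') (line X F p q) = line X (concat_htpy X G F) (hsum p' p) (hsum q' q)"
proof (rule cyl2_eqI[OF htpy_extensional(3) line_extensional])
  fix x and s t :: real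
  assume b: "x \<in> topspace X" "0 \<le> s" "s \<le> 1" "0 \<le> t" "t \<le> 1"
  show "hconcat_htpy X (line X G p' q') (line X F p q) ((x, s), t)
      = line X (concat_htpy X G F) (hsum p' p) (hsum q' q) ((x, s), t)"
  proof (cases "s \<le> 1/2")
    case True
    have e: "(1 - t) * hsum p' p s + t * hsum q' q s = ((1 - t) * p (2 * s) + t * q (2 * s)) / 2"
      using True by (simp add: hsum_low[OF p(3)] hsum_low[OF p(4)] algebra_simps add_divide_distrib diff_divide_distrib)
    have "hconcat_htpy X (line X G p' q') (line X F p q) ((x, s), t) = F (x, (1 - t) * p (2 * s) + t * q (2 * s))"
      using b True by simp
    also have "\<dots> = concat_htpy X G F (x, ((1 - t) * p (2 * s) + t * q (2 * s)) / 2)"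
      by (rule concat_low[OF b(1), symmetric]) (use b True in \<open>simp_all add: param_convex[OF p(1,2)]\<close>)
    finally show ?thesis unfolding line_apply[OF b] e .
  next
    case False
    have e: "(1 - t) * hsum p' p s + t * hsum q' q s = (1 + ((1 - t) * p' (2 * s - 1) + t * q' (2 * s - 1))) / 2"
      using False by (simp add: hsum_high[OF p(1)] hsum_high[OF p(2)] field_simps)
    have "hconcat_htpy X (line X G p' q') (line X F p q) ((x, s), t) = G (x, (1 - t) * p' (2 * s - 1) + t * q' (2 * s - 1))"
      using b False by simp
    also have "\<dots> = concat_htpy X G F (x, (1 + ((1 - t) * p' (2 * s - 1) + t * q' (2 * s - 1))) / 2)"
      by (rule concat_high[OF FG b(1), symmetric]) (use b False in \<open>simp_all add: param_convex[OF p(3,4)]\<close>)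
    finally show ?thesis unfolding line_apply[OF b] e .
  qed
qed

lemma rep_concat:
  assumes FG: "slice X F 1 = slice X G 0" and p: "param p" "param p'"
  shows "concat_htpy X (rep X G p') (rep X F p) = rep X (concat_htpy X G F) (hsum p' p)"
proof (rule cyl_eqI[OF htpy_extensional(1) rep_extensional])
  fix x and s :: real
  assume b: "x \<in> topspace X" "0 \<le> s" "s \<le> 1"
  show "concat_htpy X (rep X G p') (rep X F p) (x, s) = rep X (concat_htpy X G F) (hsum p' p) (x, s)"
  proof (cases "s \<le> 1/2")
    case True
    have "concat_htpy X (rep X G p') (rep X F p) (x, s) = F (x, p (2 * s))" using b True by simp
    also have "\<dots> = concat_htpy X G F (x, p (2 * s) / 2)"
      by (rule concat_low[OF b(1), symmetric]) (use b True in \<open>simp_all add: paramD[OF p(1)]\<close>)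
    finally show ?thesis unfolding rep_apply[OF b] hsum_low[OF p(2) True] .
  next
    case False
    have "concat_htpy X (rep X G p') (rep X F p) (x, s) = G (x, p' (2 * s - 1))" using b False by simp
    also have "\<dots> = concat_htpy X G F (x, (1 + p' (2 * s - 1)) / 2)"
      by (rule concat_high[OF FG b(1), symmetric]) (use b False in \<open>simp_all add: paramD[OF p(2)]\<close>)
    finally show ?thesis
      using False unfolding rep_apply[OF b] by (subst hsum_high[OF p(1)]) simp_all
  qed
qed

lemma line_const: "line X K p p = const_htpy (cyl X) (rep X K p)"
  by (rule cyl2_eqI[OF line_extensional htpy_extensional(2)]) (simp add: algebra_simps)

lemma line_reparam: "line X K p (\<lambda>s. s) = reparam X p K"
  by (rule cyl2_eqI[OF line_extensional htpy_extensional(4)]) simp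

lemma line_cong: "(\<And>s. 0 \<le> s \<Longrightarrow> s \<le> 1 \<Longrightarrow> p s = p' s) \<Longrightarrow> (\<And>s. 0 \<le> s \<Longrightarrow> s \<le> 1 \<Longrightarrow> q s = q' s) \<Longrightarrow>
    line X K p q = line X K p' q'"
  by (rule cyl2_eqI[OF line_extensional line_extensional]) simp

text \<open>The counterpart of \<open>vert\<close> in the coordinate s. Rebracketing a horizontal
  composite of cells, or padding a cell with constants, is an operation of this kind.\<close>

definition squash :: "'a topology \<Rightarrow> (('a \<times> real) \<times> real \<Rightarrow> 'b) \<Rightarrow> (real \<Rightarrow> real) \<Rightarrow> ('a \<times> real) \<times> real \<Rightarrow> 'b" where
  "squash X \<alpha> p = pull X (square \<alpha>) (\<lambda>v. (p (fst v), snd v))"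

lemma squash_apply [simp]: "x \<in> topspace X \<Longrightarrow> 0 \<le> s \<Longrightarrow> s \<le> 1 \<Longrightarrow> 0 \<le> t \<Longrightarrow> t \<le> 1 \<Longrightarrow>
    squash X \<alpha> p ((x, s), t) = \<alpha> ((x, p s), t)"
  by (simp add: squash_def)

lemma squash_cell_hom:
  assumes \<alpha>: "\<alpha> \<in> cell_hom X Y F F'" and p: "param p"
  shows "squash X \<alpha> p \<in> cell_hom X Y (rep X F p) (rep X F' p)"
proof (rule cell_homI)
  show "squash X \<alpha> p \<in> maps (cyl (cyl X)) Y"
    unfolding squash_def
    by (rule pull_maps[OF continuous_map_square[OF maps_cont[OF cell_hom_maps(1)[OF \<alpha>]]]])
      (auto intro!: continuous_intros continuous_on_compose2[OF paramD(1)[OF p]] simp: paramD[OF p])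
qed (simp_all add: cell_hom_maps[OF \<alpha>] cell_hom_ends[OF \<alpha>] cell_hom_sides(1,2)[OF \<alpha>] paramD[OF p] p rep_maps)

text \<open>Both sides reparametrize the square \<open>\<alpha>\<close>: one runs along \<open>t\<close> first, the other along \<open>s\<close>.\<close>

lemma squash_natural:
  assumes \<alpha>: "\<alpha> \<in> cell_hom X Y F F'" and p: "param p"
  shows "eqv X Y (concat_htpy (cyl X) (line X F' p (\<lambda>s. s)) (squash X \<alpha> p))
     (concat_htpy (cyl X) \<alpha> (line X F p (\<lambda>s. s)))"
proof -
  \<comment> \<open>Clipped clocks: \<open>?t1\<close> advances only for t \<le> 1/2,
    \<open>?t2\<close> only for t \<ge> 1/2.\<close>
  let ?t1 = "\<lambda>t::real. min (2 * t) 1" and ?t2 = "\<lambda>t::real. max 0 (2 * t - 1)"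
  let ?\<rho> = "\<lambda>v. ((1 - ?t2 (snd v)) * p (fst v) + ?t2 (snd v) * fst v, ?t1 (snd v))"
  let ?\<rho>' = "\<lambda>v. ((1 - ?t1 (snd v)) * p (fst v) + ?t1 (snd v) * fst v, ?t2 (snd v))"
  note c = param_convex[OF p param_id]
  have c': "0 \<le> (2 - 2 * t) * p s + (2 * t - 1) * s" "(2 - 2 * t) * p s + (2 * t - 1) * s \<le> 1"
    if "0 \<le> s" "s \<le> 1" "\<not> t * 2 \<le> 1" "t \<le> 1" for s t
    using c[of s "2 * t - 1"] that by simp_all
  have 1: "concat_htpy (cyl X) (line X F' p (\<lambda>s. s)) (squash X \<alpha> p) = pull X (square \<alpha>) ?\<rho>"
  proof (rule maps_eqI[where W = "cyl (cyl X)" and Y = Y])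
    have "concat_htpy (cyl X) (line X F' p (\<lambda>s. s)) (squash X \<alpha> p) \<in> cell_hom X Y (rep X F p) (rep X F' (\<lambda>s. s))"
      by (rule concat_cell_hom[OF squash_cell_hom[OF \<alpha> p] line_cell_hom]) (simp_all add: cell_hom_maps[OF \<alpha>] p)
    then show "concat_htpy (cyl X) (line X F' p (\<lambda>s. s)) (squash X \<alpha> p) \<in> maps (cyl (cyl X)) Y"
      by (rule cell_hom_maps)
    show "pull X (square \<alpha>) ?\<rho> \<in> maps (cyl (cyl X)) Y"
      by (rule pull_maps[OF continuous_map_square[OF maps_cont[OF cell_hom_maps(1)[OF \<alpha>]]]])
        (auto intro!: continuous_intros continuous_on_compose2[OF paramD(1)[OF p]] simp: paramD[OF p] c)
    show "concat_htpy (cyl X) (line X F' p (\<lambda>s. s)) (squash X \<alpha> p) z = pull X (square \<alpha>) ?\<rho> z"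
      if "z \<in> topspace (cyl (cyl X))" for z
      using that by (auto simp: paramD[OF p] c c' cell_hom_ends[OF \<alpha>])
  qed
  have 2: "concat_htpy (cyl X) \<alpha> (line X F p (\<lambda>s. s)) = pull X (square \<alpha>) ?\<rho>'"
  proof (rule maps_eqI[where W = "cyl (cyl X)" and Y = Y])
    have "concat_htpy (cyl X) \<alpha> (line X F p (\<lambda>s. s)) \<in> cell_hom X Y (rep X F p) F'"
      using concat_cell_hom[OF line_cell_hom, of F X Y p "\<lambda>s. s" \<alpha>] \<alpha> cell_hom_maps[OF \<alpha>] p by (simp add: rep_id)
    then show "concat_htpy (cyl X) \<alpha> (line X F p (\<lambda>s. s)) \<in> maps (cyl (cyl X)) Y"
      by (rule cell_hom_maps)
    show "pull X (square \<alpha>) ?\<rho>' \<in> maps (cyl (cyl X)) Y"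
      by (rule pull_maps[OF continuous_map_square[OF maps_cont[OF cell_hom_maps(1)[OF \<alpha>]]]])
        (auto intro!: continuous_intros continuous_on_compose2[OF paramD(1)[OF p]] simp: paramD[OF p] c)
    show "concat_htpy (cyl X) \<alpha> (line X F p (\<lambda>s. s)) z = pull X (square \<alpha>) ?\<rho>' z"
      if "z \<in> topspace (cyl (cyl X))" for z
      using that by (auto simp: paramD[OF p] c c' cell_hom_ends[OF \<alpha>])
  qed
  show ?thesis
    unfolding 1 2
    by (rule square_eqv[OF cell_hom_cells[OF \<alpha>]])
      (auto intro!: continuous_intros continuous_on_compose2[OF paramD(1)[OF p]] simp: paramD[OF p] c)
qed

section \<open>The bicategory of maps and homotopies\<close>

lemma slice_const [simp]: "f \<in> maps X Y \<Longrightarrow> 0 \<le> t \<Longrightarrow> t \<le> 1 \<Longrightarrow> slice X (const_htpy X f) t = f"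
  by (rule slice_eq) (auto simp: maps_def)

lemma slice_concat [simp]:
  "slice X (concat_htpy X J H) 0 = slice X H 0" "slice X (concat_htpy X J H) 1 = slice X J 1"
  by (auto simp: slice_def restrict_def)

lemma cell_hom_slices:
  assumes "\<alpha> \<in> cell_hom X Y H J"
  shows "slice X J 0 = slice X H 0" "slice X J 1 = slice X H 1"
  using cell_hom_sides(3,4)[OF assms _ order_refl zero_le_one] by (auto simp: slice_def restrict_def)

lemma vert_maps:
  assumes \<alpha>: "\<alpha> \<in> maps (cyl (cyl X)) Y" and \<phi>: "continuous_on {0..1} \<phi>" "\<And>t. 0 \<le> t \<Longrightarrow> t \<le> 1 \<Longrightarrow> 0 \<le> \<phi> t \<and> \<phi> t \<le> 1"
  shows "vert X \<alpha> \<phi> \<in> maps (cyl (cyl X)) Y"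
  unfolding vert_def
  by (rule pull_maps[OF continuous_map_square[OF maps_cont[OF \<alpha>]]])
    (auto intro!: continuous_intros continuous_on_compose2[OF \<phi>(1)] simp: \<phi>(2))

lemma vert_extensional: "vert X \<alpha> \<phi> \<in> extensional (topspace (cyl (cyl X)))"
  unfolding vert_def by (rule htpy_extensional)

text \<open>Reversing t gives the inverse. Going there and back follows the parameter 1 - |2 t - 1|,
  which has the same end values as the constant 0, so \<open>vert_eqv\<close> contracts it.\<close>

lemma hom2_inverse:
  assumes \<alpha>: "\<alpha> \<in> cell_hom X Y H J"
  shows "cls X Y \<alpha> \<in> iso2 (Top_hom X Y) H J"
proof -
  let ?r = "vert X \<alpha> (\<lambda>t. 1 - t)"
  note m = cell_hom_maps[OF \<alpha>]
  have r: "?r \<in> cell_hom X Y J H"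
  proof (rule cell_homI)
    show "?r \<in> maps (cyl (cyl X)) Y" by (rule vert_maps[OF m(1)]) (auto intro!: continuous_intros)
    show "?r ((x, 0), t) = H (x, 0)" "?r ((x, 1), t) = H (x, 1)" if "x \<in> topspace X" "0 \<le> t" "t \<le> 1" for x t
      using that cell_hom_sides(1,2)[OF \<alpha>, of x "1 - t"] by simp_all
  qed (simp_all add: m cell_hom_ends[OF \<alpha>])
  have "concat_htpy (cyl X) ?r \<alpha> = vert X \<alpha> (\<lambda>t. 1 - \<bar>2 * t - 1\<bar>)"
    by (rule cyl2_eqI[OF htpy_extensional(1) vert_extensional]) auto
  moreover have "const_htpy (cyl X) H = vert X \<alpha> (\<lambda>t. 0)"
    by (rule cyl2_eqI[OF htpy_extensional(2) vert_extensional]) (simp add: cell_hom_ends[OF \<alpha>])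
  moreover have "eqv X Y (vert X \<alpha> (\<lambda>t. 1 - \<bar>2 * t - 1\<bar>)) (vert X \<alpha> (\<lambda>t. 0))"
    by (rule vert_eqv[OF cell_hom_cells[OF \<alpha>]]) (auto intro!: continuous_intros)
  ultimately have 1: "cls X Y ?r \<cdot>\<^bsub>Top_hom X Y\<^esub> cls X Y \<alpha> = id2 (Top_hom X Y) H"
    by (simp add: vcomp_Top[OF \<alpha> r] cls_cong)
  have "concat_htpy (cyl X) \<alpha> ?r = vert X \<alpha> (\<lambda>t. \<bar>2 * t - 1\<bar>)"
    by (rule cyl2_eqI[OF htpy_extensional(1) vert_extensional]) auto
  moreover have "const_htpy (cyl X) J = vert X \<alpha> (\<lambda>t. 1)"
    by (rule cyl2_eqI[OF htpy_extensional(2) vert_extensional]) (simp add: cell_hom_ends[OF \<alpha>])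
  moreover have "eqv X Y (vert X \<alpha> (\<lambda>t. \<bar>2 * t - 1\<bar>)) (vert X \<alpha> (\<lambda>t. 1))"
    by (rule vert_eqv[OF cell_hom_cells[OF \<alpha>]]) (auto intro!: continuous_intros)
  ultimately have 2: "cls X Y \<alpha> \<cdot>\<^bsub>Top_hom X Y\<^esub> cls X Y ?r = id2 (Top_hom X Y) J"
    by (simp add: vcomp_Top[OF r \<alpha>] cls_cong)
  have "src2 (Top_hom X Y) (cls X Y \<alpha>) = H" "trg2 (Top_hom X Y) (cls X Y \<alpha>) = J"
    using \<alpha> by (auto simp: cell_hom_def src2_Top trg2_Top)
  then have "inverse2 (Top_hom X Y) (cls X Y \<alpha>) (cls X Y ?r)"
    using 1 2 hom2_TopI[OF r] by (simp add: inverse2_def)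
  then show ?thesis
    using hom2_TopI[OF \<alpha>] unfolding iso2_def by blast
qed

text \<open>Two cells of this kind over the same K that end in the identity parameter can be
  compared by their starting parameters alone.\<close>

definition thin :: "'a topology \<Rightarrow> 'a topology \<Rightarrow> ('a \<times> real \<Rightarrow> 'a) \<Rightarrow> (real \<Rightarrow> real) \<Rightarrow> (real \<Rightarrow> real) \<Rightarrow> 'a cell2" where
  "thin X Y K p q = cls X Y (line X K p q)"

section \<open>Calculus of thin cells\<close>

lemma thin_vcomp:
  assumes "K \<in> maps (cyl X) Y" "param p" "param q" "param w"
  shows "thin X Y K q w \<cdot>\<^bsub>Top_hom X Y\<^esub> thin X Y K p q = thin X Y K p w"
  unfolding thin_def
  using vcomp_Top[OF line_cell_hom[OF assms(1,2,3)] line_cell_hom[OF assms(1,3,4)]]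
    cls_cong[OF line_concat_eqv[OF assms]] by simp

lemma thin_hcomp:
  assumes "F \<in> maps (cyl X) Y" "G \<in> maps (cyl X) Y" "slice X F 1 = slice X G 0"
    "param p" "param q" "param p'" "param q'"
  shows "thin X Y G p' q' \<star>\<^bsub>Top_hom X Y\<^esub> thin X Y F p q = thin X Y (concat_htpy X G F) (hsum p' p) (hsum q' q)"
  unfolding thin_def
  using hcomp_Top[OF line_cell_hom[OF assms(1,4,5)] line_cell_hom[OF assms(2,6,7)]] assms(3)
    line_hconcat[OF assms(3-)] by (simp add: rep_slice[OF assms(4)] rep_slice[OF assms(6)])

text \<open>Brings constraints that start at differently bracketed composites over one common
  homotopy, so that they can be composed with \<open>thin_vcomp\<close>.\<close>

lemma thin_rep:
  assumes "K \<in> maps (cyl X) Y" "param \<phi>" "param p" "param q"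
  shows "thin X Y (rep X K \<phi>) p q = thin X Y K (\<lambda>s. \<phi> (p s)) (\<lambda>s. \<phi> (q s))"
  unfolding thin_def by (rule cls_cong[OF line_rep_eqv[OF assms]])

lemma thin_cong:
  "(\<And>s. 0 \<le> s \<Longrightarrow> s \<le> 1 \<Longrightarrow> p s = p' s) \<Longrightarrow> (\<And>s. 0 \<le> s \<Longrightarrow> s \<le> 1 \<Longrightarrow> q s = q' s) \<Longrightarrow>
    thin X Y K p q = thin X Y K p' q'"
  unfolding thin_def using line_cong[of p p' q q' X K] by simp

lemma thin_id: "H \<in> maps (cyl X) Y \<Longrightarrow> id2 (Top_hom X Y) H = thin X Y H (\<lambda>s. s) (\<lambda>s. s)"
  by (simp add: thin_def line_const rep_id)

lemma thin_constraints:
  "assoc (Top_hom X Y) K J H = thin X Y (concat_htpy X K (concat_htpy X J H)) assoc_param (\<lambda>s. s)"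
  "lunit (Top_hom X Y) H = thin X Y H (\<lambda>s. min (2 * s) 1) (\<lambda>s. s)"
  "runit (Top_hom X Y) H = thin X Y H (\<lambda>s. max 0 (2 * s - 1)) (\<lambda>s. s)"
  by (simp_all add: thin_def line_reparam)

lemma rep_assoc: "concat_htpy X (concat_htpy X K J) H = rep X (concat_htpy X K (concat_htpy X J H)) assoc_param"
  by (rule cyl_eqI[OF htpy_extensional(1) rep_extensional]) (auto simp: assoc_param_def algebra_simps)

lemma rep_left: "concat_htpy X (const_htpy X (slice X H 1)) H = rep X H (\<lambda>s. min (2 * s) 1)"
  by (rule cyl_eqI[OF htpy_extensional(1) rep_extensional]) auto

lemma rep_right: "concat_htpy X H (const_htpy X (slice X H 0)) = rep X H (\<lambda>s. max 0 (2 * s - 1))"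
  by (rule cyl_eqI[OF htpy_extensional(1) rep_extensional]) auto

lemma hsum_id: "hsum (\<lambda>s. s) (\<lambda>s. s) = (\<lambda>s. s)"
  by (auto simp: hsum_def fun_eq_iff min_def max_def)

text \<open>The pentagon, the triangle and the two equations for units reduce to these identities
  between piecewise linear functions.\<close>

lemma pentagon_param:
  "0 \<le> s \<Longrightarrow> s \<le> 1 \<Longrightarrow> hsum (\<lambda>s. s) assoc_param (assoc_param (hsum assoc_param (\<lambda>s. s) s)) = assoc_param (assoc_param s)"
  by (cases "s \<le> 1/2"; cases "s \<le> 3/4"; cases "s \<le> 7/8") (simp_all add: hsum_def assoc_param_def min_def max_def, auto simp: field_simps)

lemma triangle_param:
  "0 \<le> s \<Longrightarrow> s \<le> 1 \<Longrightarrow> hsum (\<lambda>s. s) (\<lambda>s. min (2 * s) 1) (assoc_param s) = hsum (\<lambda>s. max 0 (2 * s - 1)) (\<lambda>s. s) s"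
  by (auto simp: hsum_def assoc_param_def min_def max_def)

lemma left_unit_param: "0 \<le> s \<Longrightarrow> s \<le> 1 \<Longrightarrow> min (2 * assoc_param s) 1 = hsum (\<lambda>s. min (2 * s) 1) (\<lambda>s. s) s"
  by (auto simp: hsum_def assoc_param_def min_def max_def)

lemma right_unit_param: "0 \<le> s \<Longrightarrow> s \<le> 1 \<Longrightarrow>
    hsum (\<lambda>s. s) (\<lambda>s. max 0 (2 * s - 1)) (assoc_param s) = max 0 (2 * s - 1)"
  by (auto simp: hsum_def assoc_param_def min_def max_def)

section \<open>Pentagon, triangle and unit equations\<close>

lemma concat_rep_left:
  assumes "G \<in> maps (cyl X) Y" "slice X F 1 = slice X G 0" "param p"
  shows "concat_htpy X G (rep X F p) = rep X (concat_htpy X G F) (hsum (\<lambda>s. s) p)"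
  using rep_concat[OF assms(2,3) param_id] by (simp add: rep_id[OF assms(1)])

lemmas params = param_id param_assoc param_left param_right param_hsum param_comp

text \<open>Each edge is rewritten as a thin cell over the right-bracketed composite
  \<open>?K\<close>. The vertical composites then telescope, and the starting parameters are
  compared by \<open>pentagon_param\<close>.\<close>

lemma Top_pentagon:
  assumes "k \<in> hom1 (Top_hom X Y) d e" "h \<in> hom1 (Top_hom X Y) c d" "g \<in> hom1 (Top_hom X Y) b c" "f \<in> hom1 (Top_hom X Y) a b"
  shows "(id2 (Top_hom X Y) k \<star>\<^bsub>Top_hom X Y\<^esub> assoc (Top_hom X Y) h g f) \<cdot>\<^bsub>Top_hom X Y\<^esub>
      assoc (Top_hom X Y) k (h \<odot>\<^bsub>Top_hom X Y\<^esub> g) f \<cdot>\<^bsub>Top_hom X Y\<^esub>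
      (assoc (Top_hom X Y) k h g \<star>\<^bsub>Top_hom X Y\<^esub> id2 (Top_hom X Y) f)
    = assoc (Top_hom X Y) k h (g \<odot>\<^bsub>Top_hom X Y\<^esub> f) \<cdot>\<^bsub>Top_hom X Y\<^esub> assoc (Top_hom X Y) (k \<odot>\<^bsub>Top_hom X Y\<^esub> h) g f"
proof -
  let ?B = "Top_hom X Y" and ?i = "\<lambda>s::real. s" and ?a = assoc_param and ?c = "concat_htpy X"
  have m: "k \<in> maps (cyl X) Y" "h \<in> maps (cyl X) Y" "g \<in> maps (cyl X) Y" "f \<in> maps (cyl X) Y"
    and s: "slice X f 1 = slice X g 0" "slice X g 1 = slice X h 0" "slice X h 1 = slice X k 0"
    using assms by (simp_all add: hom1_Top)
  let ?K = "?c k (?c h (?c g f))"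
  have mm: "?c g f \<in> maps (cyl X) Y" "?c h (?c g f) \<in> maps (cyl X) Y" "?K \<in> maps (cyl X) Y"
    "?c h g \<in> maps (cyl X) Y" "?c k h \<in> maps (cyl X) Y" "?c k (?c h g) \<in> maps (cyl X) Y"
    by (simp_all add: concat_htpy_maps' m s)
  note P = param_hsum[OF param_assoc param_id] param_hsum[OF param_id param_assoc]
  note P' = P param_comp[OF param_assoc param_assoc] param_comp[OF P(1) param_assoc]
    param_comp[OF P(1) param_comp[OF param_assoc P(2)]]
  have e1: "?c k (?c (?c h g) f) = rep X ?K (hsum ?i ?a)"
    unfolding rep_assoc by (rule concat_rep_left[OF m(1)]) (simp_all add: s params)
  have A1: "id2 ?B k \<star>\<^bsub>?B\<^esub> assoc ?B h g f = thin X Y ?K (hsum ?i ?a) ?i"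
    unfolding thin_id[OF m(1)] thin_constraints
    by (subst thin_hcomp[OF mm(2) m(1)]) (simp_all add: s params hsum_id)
  have A2: "assoc ?B k (?c h g) f = thin X Y ?K (\<lambda>s. hsum ?i ?a (?a s)) (hsum ?i ?a)"
    unfolding thin_constraints e1 by (rule thin_rep[OF mm(3)]) (simp_all add: params)
  have e2: "?c (?c k (?c h g)) f = rep X (rep X ?K (hsum ?i ?a)) ?a"
    unfolding rep_assoc[of X k "?c h g" f] e1 ..
  have A3: "assoc ?B k h g \<star>\<^bsub>?B\<^esub> id2 ?B f
      = thin X Y ?K (\<lambda>s. hsum ?i ?a (?a (hsum ?a ?i s))) (\<lambda>s. hsum ?i ?a (?a s))"
  proof -
    \<comment> \<open>This cell lives over (k (h g)) f, which is \<open>?K\<close> reparametrized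
      twice; hence two uses of \<open>thin_rep\<close>.\<close>
    have "assoc ?B k h g \<star>\<^bsub>?B\<^esub> id2 ?B f = thin X Y (?c (?c k (?c h g)) f) (hsum ?a ?i) ?i"
      unfolding thin_id[OF m(4)] thin_constraints
      by (subst thin_hcomp[OF m(4) mm(6)]) (simp_all add: s params hsum_id)
    also have "\<dots> = thin X Y (rep X ?K (hsum ?i ?a)) (\<lambda>s. ?a (hsum ?a ?i s)) ?a"
      unfolding e2 by (rule thin_rep[OF rep_maps[OF mm(3)]]) (simp_all add: params)
    also have "\<dots> = thin X Y ?K (\<lambda>s. hsum ?i ?a (?a (hsum ?a ?i s))) (\<lambda>s. hsum ?i ?a (?a s))"
      by (rule thin_rep[OF mm(3)]) (simp_all add: params)
    finally show ?thesis .
  qed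
  have A4: "assoc ?B (?c k h) g f = thin X Y ?K (\<lambda>s. ?a (?a s)) ?a"
    unfolding thin_constraints rep_assoc[of X k h "?c g f"]
    by (rule thin_rep[OF mm(3)]) (simp_all add: params)
  have L: "(id2 ?B k \<star>\<^bsub>?B\<^esub> assoc ?B h g f) \<cdot>\<^bsub>?B\<^esub> assoc ?B k (?c h g) f \<cdot>\<^bsub>?B\<^esub> (assoc ?B k h g \<star>\<^bsub>?B\<^esub> id2 ?B f)
    = thin X Y ?K (\<lambda>s. hsum ?i ?a (?a (hsum ?a ?i s))) ?i"
    unfolding A1 A2 A3 by (simp only: thin_vcomp[OF mm(3)] P' param_id)
  have R: "assoc ?B k h (?c g f) \<cdot>\<^bsub>?B\<^esub> assoc ?B (?c k h) g f = thin X Y ?K (\<lambda>s. ?a (?a s)) ?i"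
    unfolding A4 unfolding thin_constraints by (simp only: thin_vcomp[OF mm(3)] P' param_id param_assoc)
  have "thin X Y ?K (\<lambda>s. hsum ?i ?a (?a (hsum ?a ?i s))) ?i = thin X Y ?K (\<lambda>s. ?a (?a s)) ?i"
    by (rule thin_cong) (simp_all add: pentagon_param)
  with L R show ?thesis unfolding Top_hom_simps(8) by (simp only:)
qed

lemma Top_triangle:
  assumes "g \<in> hom1 (Top_hom X Y) b c" "f \<in> hom1 (Top_hom X Y) a b"
  shows "(id2 (Top_hom X Y) g \<star>\<^bsub>Top_hom X Y\<^esub> lunit (Top_hom X Y) f) \<cdot>\<^bsub>Top_hom X Y\<^esub>
      assoc (Top_hom X Y) g (id1 (Top_hom X Y) b) f = runit (Top_hom X Y) g \<star>\<^bsub>Top_hom X Y\<^esub> id2 (Top_hom X Y) f"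
proof -
  let ?B = "Top_hom X Y" and ?i = "\<lambda>s::real. s" and ?a = assoc_param and ?c = "concat_htpy X"
    and ?l = "\<lambda>s::real. min (2 * s) 1" and ?r = "\<lambda>s::real. max 0 (2 * s - 1)"
  have m: "g \<in> maps (cyl X) Y" "f \<in> maps (cyl X) Y" and s: "slice X f 1 = slice X g 0" "b = slice X f 1"
    using assms by (simp_all add: hom1_Top)
  have mm: "?c g f \<in> maps (cyl X) Y" by (simp add: concat_htpy_maps' m s)
  have e: "?c g (?c (const_htpy X b) f) = rep X (?c g f) (hsum ?i ?l)"
    unfolding s(2) rep_left by (rule concat_rep_left[OF m(1) s(1)]) (simp add: params)
  have A: "id2 ?B g \<star>\<^bsub>?B\<^esub> lunit ?B f = thin X Y (?c g f) (hsum ?i ?l) ?i"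
    unfolding thin_id[OF m(1)] thin_constraints
    by (subst thin_hcomp[OF m(2,1) s(1)]) (simp_all add: params hsum_id)
  have A': "assoc ?B g (const_htpy X b) f = thin X Y (?c g f) (\<lambda>s. hsum ?i ?l (?a s)) (hsum ?i ?l)"
    unfolding thin_constraints e by (rule thin_rep[OF mm]) (simp_all add: params)
  have R: "runit ?B g \<star>\<^bsub>?B\<^esub> id2 ?B f = thin X Y (?c g f) (hsum ?r ?i) ?i"
    unfolding thin_id[OF m(2)] thin_constraints
    by (subst thin_hcomp[OF m(2,1) s(1)]) (simp_all add: params hsum_id)
  have "thin X Y (?c g f) (\<lambda>s. hsum ?i ?l (?a s)) ?i = thin X Y (?c g f) (hsum ?r ?i) ?i"
    by (rule thin_cong) (simp_all add: triangle_param)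
  then show ?thesis
    unfolding Top_hom_simps(6) A A' R by (subst thin_vcomp[OF mm]) (simp_all add: params)
qed

lemma Top_left_unit:
  assumes "g \<in> hom1 (Top_hom X Y) b c" "f \<in> hom1 (Top_hom X Y) a b"
  shows "lunit (Top_hom X Y) (g \<odot>\<^bsub>Top_hom X Y\<^esub> f) \<cdot>\<^bsub>Top_hom X Y\<^esub> assoc (Top_hom X Y) (id1 (Top_hom X Y) c) g f
    = lunit (Top_hom X Y) g \<star>\<^bsub>Top_hom X Y\<^esub> id2 (Top_hom X Y) f"
proof -
  let ?B = "Top_hom X Y" and ?i = "\<lambda>s::real. s" and ?a = assoc_param and ?c = "concat_htpy X"
    and ?l = "\<lambda>s::real. min (2 * s) 1"
  have m: "g \<in> maps (cyl X) Y" "f \<in> maps (cyl X) Y" and s: "slice X f 1 = slice X g 0" "c = slice X (?c g f) 1"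
    using assms by (simp_all add: hom1_Top)
  have mm: "?c g f \<in> maps (cyl X) Y" by (simp add: concat_htpy_maps' m s)
  have A: "assoc ?B (const_htpy X c) g f = thin X Y (?c g f) (\<lambda>s. ?l (?a s)) ?l"
    unfolding thin_constraints s(2) rep_left by (rule thin_rep[OF mm]) (simp_all add: params)
  have R: "lunit ?B g \<star>\<^bsub>?B\<^esub> id2 ?B f = thin X Y (?c g f) (hsum ?l ?i) ?i"
    unfolding thin_id[OF m(2)] thin_constraints
    by (subst thin_hcomp[OF m(2,1) s(1)]) (simp_all add: params hsum_id)
  have "thin X Y (?c g f) (\<lambda>s. ?l (?a s)) ?i = thin X Y (?c g f) (hsum ?l ?i) ?i"
    by (rule thin_cong) (simp_all only: left_unit_param)
  then show ?thesis
    unfolding Top_hom_simps(6,8) A R unfolding thin_constraints(2)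
    by (subst thin_vcomp[OF mm]) (simp_all add: params param_comp[OF param_left param_assoc])
qed

lemma Top_right_unit:
  assumes "g \<in> hom1 (Top_hom X Y) b c" "f \<in> hom1 (Top_hom X Y) a b"
  shows "(id2 (Top_hom X Y) g \<star>\<^bsub>Top_hom X Y\<^esub> runit (Top_hom X Y) f) \<cdot>\<^bsub>Top_hom X Y\<^esub>
     assoc (Top_hom X Y) g f (id1 (Top_hom X Y) a) = runit (Top_hom X Y) (g \<odot>\<^bsub>Top_hom X Y\<^esub> f)"
proof -
  let ?B = "Top_hom X Y" and ?i = "\<lambda>s::real. s" and ?a = assoc_param and ?c = "concat_htpy X"
    and ?r = "\<lambda>s::real. max 0 (2 * s - 1)"
  have m: "g \<in> maps (cyl X) Y" "f \<in> maps (cyl X) Y" and s: "slice X f 1 = slice X g 0" "a = slice X f 0"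
    using assms by (simp_all add: hom1_Top)
  have mm: "?c g f \<in> maps (cyl X) Y" by (simp add: concat_htpy_maps' m s)
  have e: "?c g (?c f (const_htpy X a)) = rep X (?c g f) (hsum ?i ?r)"
    unfolding s(2) rep_right by (rule concat_rep_left[OF m(1) s(1)]) (simp add: params)
  have A: "id2 ?B g \<star>\<^bsub>?B\<^esub> runit ?B f = thin X Y (?c g f) (hsum ?i ?r) ?i"
    unfolding thin_id[OF m(1)] thin_constraints
    by (subst thin_hcomp[OF m(2,1) s(1)]) (simp_all add: params hsum_id)
  have A': "assoc ?B g f (const_htpy X a) = thin X Y (?c g f) (\<lambda>s. hsum ?i ?r (?a s)) (hsum ?i ?r)"
    unfolding thin_constraints e by (rule thin_rep[OF mm]) (simp_all add: params)
  have "thin X Y (?c g f) (\<lambda>s. hsum ?i ?r (?a s)) ?i = thin X Y (?c g f) ?r ?i"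
    by (rule thin_cong) (simp_all only: right_unit_param)
  then show ?thesis
    unfolding Top_hom_simps(6,8) A A' unfolding thin_constraints(3)
    by (subst thin_vcomp[OF mm]) (simp_all add: params)
qed

text \<open>Naturality of all three constraints at once. For their parameters the squashed cell is
  the horizontal composite on the source side, by \<open>hconcat_assoc\<close>,
  \<open>hconcat_left\<close> and \<open>hconcat_right\<close>.\<close>

lemma thin_natural:
  assumes \<alpha>: "\<alpha> \<in> cell_hom X Y F F'" and p: "param p"
  shows "thin X Y F' p (\<lambda>s. s) \<cdot>\<^bsub>Top_hom X Y\<^esub> cls X Y (squash X \<alpha> p)
    = cls X Y \<alpha> \<cdot>\<^bsub>Top_hom X Y\<^esub> thin X Y F p (\<lambda>s. s)"
proof -
  note m = cell_hom_maps[OF \<alpha>]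
  have l: "line X F p (\<lambda>s. s) \<in> cell_hom X Y (rep X F p) F" "line X F' p (\<lambda>s. s) \<in> cell_hom X Y (rep X F' p) F'"
    using line_cell_hom[OF m(2) p param_id] line_cell_hom[OF m(3) p param_id] by (simp_all only: rep_id[OF m(2)] rep_id[OF m(3)])
  show ?thesis
    unfolding thin_def vcomp_Top[OF squash_cell_hom[OF \<alpha> p] l(2)] vcomp_Top[OF l(1) \<alpha>]
    by (rule cls_cong[OF squash_natural[OF \<alpha> p]])
qed

section \<open>Naturality, units and interchange on representatives\<close>

lemma squash_extensional: "squash X \<alpha> p \<in> extensional (topspace (cyl (cyl X)))"
  unfolding squash_def by (rule htpy_extensional)

lemma hconcat_assoc: "hconcat_htpy X (hconcat_htpy X \<gamma> \<beta>) \<alpha> = squash X (hconcat_htpy X \<gamma> (hconcat_htpy X \<beta> \<alpha>)) assoc_param"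
  by (rule cyl2_eqI[OF htpy_extensional(3) squash_extensional]) (auto simp: assoc_param_def algebra_simps)

text \<open>The constant padding is absorbed because \<alpha> does not move with t at s = 1.\<close>

lemma hconcat_left:
  assumes "\<alpha> \<in> cell_hom X Y H J"
  shows "hconcat_htpy X (const_htpy (cyl X) (const_htpy X (slice X H 1))) \<alpha> = squash X \<alpha> (\<lambda>s. min (2 * s) 1)"
  by (rule cyl2_eqI[OF htpy_extensional(3) squash_extensional]) (auto simp: cell_hom_sides(1,2)[OF assms])

lemma hconcat_right:
  assumes "\<alpha> \<in> cell_hom X Y H J"
  shows "hconcat_htpy X \<alpha> (const_htpy (cyl X) (const_htpy X (slice X H 0))) = squash X \<alpha> (\<lambda>s. max 0 (2 * s - 1))"
  by (rule cyl2_eqI[OF htpy_extensional(3) squash_extensional]) (auto simp: cell_hom_sides(1,2)[OF assms])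

lemma thin_iso:
  assumes "K \<in> maps (cyl X) Y" "param p"
  shows "thin X Y K p (\<lambda>s. s) \<in> iso2 (Top_hom X Y) (rep X K p) K"
  using hom2_inverse[OF line_cell_hom[OF assms param_id]] by (simp add: thin_def rep_id[OF assms(1)])

text \<open>The two bracketings differ by \<open>assoc_param\<close> applied to t. It has the
  endpoints of the identity parameter, so the difference vanishes on classes.\<close>

lemma vcomp_Top_assoc:
  assumes \<alpha>: "\<alpha> \<in> cell_hom X Y F G" and \<beta>: "\<beta> \<in> cell_hom X Y G H" and \<gamma>: "\<gamma> \<in> cell_hom X Y H K"
  shows "eqv X Y (concat_htpy (cyl X) (concat_htpy (cyl X) \<gamma> \<beta>) \<alpha>) (concat_htpy (cyl X) \<gamma> (concat_htpy (cyl X) \<beta> \<alpha>))"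
proof -
  let ?C = "concat_htpy (cyl X) \<gamma> (concat_htpy (cyl X) \<beta> \<alpha>)"
  have "concat_htpy (cyl X) (concat_htpy (cyl X) \<gamma> \<beta>) \<alpha> = vert X ?C assoc_param"
    by (rule cyl2_eqI[OF htpy_extensional(1) vert_extensional]) (auto simp: assoc_param_def algebra_simps)
  moreover have "?C = vert X ?C (\<lambda>t. t)"
    by (rule cyl2_eqI[OF htpy_extensional(1) vert_extensional]) auto
  moreover have "eqv X Y (vert X ?C assoc_param) (vert X ?C (\<lambda>t. t))"
    by (rule vert_eqv[OF cell_hom_cells[OF concat_cell_hom[OF concat_cell_hom[OF \<alpha> \<beta>] \<gamma>]]])
      (simp_all add: paramD[OF param_assoc] del: concat_htpy_apply)
  ultimately show ?thesis by simp
qed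

lemma vcomp_Top_id:
  assumes \<alpha>: "\<alpha> \<in> cell_hom X Y H J"
  shows "eqv X Y (concat_htpy (cyl X) (const_htpy (cyl X) J) \<alpha>) \<alpha>"
    "eqv X Y (concat_htpy (cyl X) \<alpha> (const_htpy (cyl X) H)) \<alpha>"
proof -
  have ext: "\<alpha> \<in> extensional (topspace (cyl (cyl X)))"
    using cell_hom_maps(1)[OF \<alpha>] by (simp add: maps_def)
  have 1: "concat_htpy (cyl X) (const_htpy (cyl X) J) \<alpha> = vert X \<alpha> (\<lambda>s. min (2 * s) 1)"
    by (rule cyl2_eqI[OF htpy_extensional(1) vert_extensional]) (auto simp: cell_hom_ends[OF \<alpha>])
  have 2: "concat_htpy (cyl X) \<alpha> (const_htpy (cyl X) H) = vert X \<alpha> (\<lambda>s. max 0 (2 * s - 1))"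
    by (rule cyl2_eqI[OF htpy_extensional(1) vert_extensional]) (auto simp: cell_hom_ends[OF \<alpha>])
  have 3: "vert X \<alpha> (\<lambda>t. t) = \<alpha>"
    by (rule cyl2_eqI[OF vert_extensional ext]) simp
  show "eqv X Y (concat_htpy (cyl X) (const_htpy (cyl X) J) \<alpha>) \<alpha>"
    using vert_eqv[OF cell_hom_cells[OF \<alpha>], of "\<lambda>s. min (2 * s) 1" "\<lambda>t. t"] paramD[OF param_left]
    unfolding 1 3 by simp
  show "eqv X Y (concat_htpy (cyl X) \<alpha> (const_htpy (cyl X) H)) \<alpha>"
    using vert_eqv[OF cell_hom_cells[OF \<alpha>], of "\<lambda>s. max 0 (2 * s - 1)" "\<lambda>t. t"] paramD[OF param_right]
    unfolding 2 3 by simp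
qed

text \<open>Interchange is strict already on representatives, since the two concatenations act on
  different coordinates.\<close>

lemma hconcat_concat: "hconcat_htpy X (concat_htpy (cyl X) \<beta>' \<beta>) (concat_htpy (cyl X) \<alpha>' \<alpha>)
    = concat_htpy (cyl X) (hconcat_htpy X \<beta>' \<alpha>') (hconcat_htpy X \<beta> \<alpha>)"
  by (rule cyl2_eqI[OF htpy_extensional(3,1)]) auto

lemma hconcat_const: "hconcat_htpy X (const_htpy (cyl X) J) (const_htpy (cyl X) H) = const_htpy (cyl X) (concat_htpy X J H)"
  by (rule cyl2_eqI[OF htpy_extensional(3,2)]) auto

lemma id1_Top_hom: "f \<in> maps X Y \<Longrightarrow> const_htpy X f \<in> hom1 (Top_hom X Y) f f"
  by (simp add: hom1_Top const_htpy_maps)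

lemma bicategory_Top: "bicategory (Top_hom X Y)"
proof (rule bicategory.intro, goal_cases)
  case 1 then show ?case by (simp add: slice_maps maps_cont)
next
  case 2 then show ?case by (simp add: slice_maps maps_cont)
next
  case (3 \<alpha>) then show ?case by (auto simp: src2_Top intro: cell_hom_maps(2)[OF cells_cell_hom])
next
  case (4 \<alpha>) then show ?case by (auto simp: trg2_Top intro: cell_hom_maps(3)[OF cells_cell_hom])
next
  case (5 \<alpha>) then show ?case by (auto simp: src2_Top trg2_Top cell_hom_slices[OF cells_cell_hom])
next
  case (6 \<alpha>) then show ?case by (auto simp: src2_Top trg2_Top cell_hom_slices[OF cells_cell_hom])
next
  case 7 then show ?case by (simp add: id1_Top_hom)
next
  case 8 then show ?case by (auto simp: hom1_Top intro!: concat_htpy_maps')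
next
  case 9 then show ?case by (simp add: hom2_TopI const_cell_hom)
next
  case (10 \<beta> g h \<alpha> f)
  then show ?case
    by (elim hom2_TopE) (simp add: vcomp_Top hom2_TopI concat_cell_hom)
next
  case (11 \<alpha> f g)
  then show ?case
    by (elim hom2_TopE) (simp add: vcomp_Top[OF _ const_cell_hom] cell_hom_maps cls_cong vcomp_Top_id)
next
  case (12 \<alpha> f g)
  then show ?case
    by (elim hom2_TopE) (simp add: vcomp_Top[OF const_cell_hom] cell_hom_maps cls_cong vcomp_Top_id)
next
  case (13 \<gamma> h k \<beta> g \<alpha> f)
  then obtain a b c where abc: "a \<in> cell_hom X Y f g" "b \<in> cell_hom X Y g h" "c \<in> cell_hom X Y h k"
    "\<alpha> = cls X Y a" "\<beta> = cls X Y b" "\<gamma> = cls X Y c"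
    by (elim hom2_TopE) blast
  show ?case
    unfolding abc(4-) vcomp_Top[OF abc(1,2)] vcomp_Top[OF abc(2,3)]
      vcomp_Top[OF abc(1) concat_cell_hom[OF abc(2,3)]] vcomp_Top[OF concat_cell_hom[OF abc(1,2)] abc(3)]
    by (rule cls_cong[OF vcomp_Top_assoc[OF abc(1-3)]])
next
  case (14 g b c f a \<beta> g' \<alpha> f')
  then show ?case
    by (elim hom2_TopE) (simp add: hcomp_Top hom1_Top hom2_TopI hconcat_cell_hom)
next
  case (15 g b c f a)
  then have m: "g \<in> maps (cyl X) Y" "f \<in> maps (cyl X) Y" and s: "slice X f 1 = slice X g 0"
    by (simp_all add: hom1_Top)
  show ?case
    unfolding Top_hom_simps hcomp_Top[OF const_cell_hom[OF m(2)] const_cell_hom[OF m(1)] s] hconcat_const ..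
next
  case (16 g b c f a \<beta> g' \<beta>' g'' \<alpha> f' \<alpha>' f'')
  then obtain u u' v v' where uv: "v \<in> cell_hom X Y g g'" "v' \<in> cell_hom X Y g' g''"
      "u \<in> cell_hom X Y f f'" "u' \<in> cell_hom X Y f' f''"
    and e: "\<beta> = cls X Y v" "\<beta>' = cls X Y v'" "\<alpha> = cls X Y u" "\<alpha>' = cls X Y u'"
    by (elim hom2_TopE) blast
  have s: "slice X f 1 = slice X g 0" using 16 by (simp add: hom1_Top)
  then have s': "slice X f' 1 = slice X g' 0"
    using cell_hom_slices[OF uv(1)] cell_hom_slices[OF uv(3)] by simp
  show ?case
    unfolding e vcomp_Top[OF uv(1,2)] vcomp_Top[OF uv(3,4)] hcomp_Top[OF uv(3,1) s] hcomp_Top[OF uv(4,2) s']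
      hcomp_Top[OF concat_cell_hom[OF uv(3,4)] concat_cell_hom[OF uv(1,2)] s]
      vcomp_Top[OF hconcat_cell_hom[OF uv(3,1) s] hconcat_cell_hom[OF uv(4,2) s']] hconcat_concat ..
next
  case (17 h c d g b f a)
  then have "concat_htpy X h (concat_htpy X g f) \<in> maps (cyl X) Y"
    by (auto simp: hom1_Top intro!: concat_htpy_maps')
  from thin_iso[OF this param_assoc] show ?case
    unfolding thin_constraints Top_hom_simps rep_assoc .
next
  case (18 h c d g b f a \<gamma> h' \<beta> g' \<alpha> f')
  then obtain u v w where uv: "w \<in> cell_hom X Y h h'" "v \<in> cell_hom X Y g g'" "u \<in> cell_hom X Y f f'"
    and e: "\<gamma> = cls X Y w" "\<beta> = cls X Y v" "\<alpha> = cls X Y u"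
    by (elim hom2_TopE) blast
  have s: "slice X f 1 = slice X g 0" "slice X g 1 = slice X h 0" using 18 by (simp_all add: hom1_Top)
  have s1: "slice X f 1 = slice X (concat_htpy X h g) 0" "slice X (concat_htpy X g f) 1 = slice X h 0"
    using s by simp_all
  note vu = hconcat_cell_hom[OF uv(3,2) s(1)] and wv = hconcat_cell_hom[OF uv(2,1) s(2)]
  show ?case
    unfolding e hcomp_Top[OF uv(3,2) s(1)] hcomp_Top[OF uv(2,1) s(2)] hcomp_Top[OF uv(3) wv s1(1)]
      hcomp_Top[OF vu uv(1) s1(2)] hconcat_assoc thin_constraints
    by (rule thin_natural[OF hconcat_cell_hom[OF vu uv(1) s1(2)] param_assoc])
next
  case (19 f a b)
  then have f: "f \<in> maps (cyl X) Y" and b: "b = slice X f 1" by (simp_all add: hom1_Top)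
  from thin_iso[OF f param_left] show ?case
    unfolding thin_constraints Top_hom_simps b rep_left .
next
  case (20 f a b \<alpha> f')
  then have f: "f \<in> maps (cyl X) Y" and b: "b = slice X f 1" by (simp_all add: hom1_Top)
  from 20 obtain u where u: "u \<in> cell_hom X Y f f'" "\<alpha> = cls X Y u" by (elim hom2_TopE)
  have c: "const_htpy X (slice X f 1) \<in> maps (cyl X) Y"
    by (simp add: const_htpy_maps slice_maps maps_cont f)
  have s: "slice X f 1 = slice X (const_htpy X (slice X f 1)) 0"
    by (rule slice_const[OF slice_maps[OF maps_cont[OF f]], symmetric]) simp_all
  show ?case
    unfolding u(2) b Top_hom_simps(6,7) hcomp_Top[OF u(1) const_cell_hom[OF c] s] hconcat_left[OF u(1)] thin_constraints
    by (rule thin_natural[OF u(1) param_left])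
next
  case (21 f a b)
  then have f: "f \<in> maps (cyl X) Y" and a: "a = slice X f 0" by (simp_all add: hom1_Top)
  from thin_iso[OF f param_right] show ?case
    unfolding thin_constraints Top_hom_simps a rep_right .
next
  case (22 f a b \<alpha> f')
  then have f: "f \<in> maps (cyl X) Y" and a: "a = slice X f 0" by (simp_all add: hom1_Top)
  from 22 obtain u where u: "u \<in> cell_hom X Y f f'" "\<alpha> = cls X Y u" by (elim hom2_TopE)
  have c: "const_htpy X (slice X f 0) \<in> maps (cyl X) Y"
    by (simp add: const_htpy_maps slice_maps maps_cont f)
  have s: "slice X (const_htpy X (slice X f 0)) 1 = slice X f 0"
    by (rule slice_const[OF slice_maps[OF maps_cont[OF f]]]) simp_all
  show ?case
    unfolding u(2) a Top_hom_simps(6,7) hcomp_Top[OF const_cell_hom[OF c] u(1) s] hconcat_right[OF u(1)] thin_constraints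
    by (rule thin_natural[OF u(1) param_right])
next
  case 23 then show ?case by (rule Top_pentagon)
next
  case 24 then show ?case by (rule Top_triangle)
qed

lemma unit_strict_bicategory_Top: "unit_strict_bicategory (Top_hom X Y)"
proof -
  interpret bicategory "Top_hom X Y" by (rule bicategory_Top)
  \<comment> \<open>A homotopy that is constant in s is fixed by concatenation with itself, and
    every straight-line reparametrization of it is stationary.\<close>
  have c: "concat_htpy X (const_htpy X f) (const_htpy X f) = const_htpy X f"
    "reparam X p (const_htpy X f) = const_htpy (cyl X) (const_htpy X f)"
    if "param p" for f p
  proof -
    show "concat_htpy X (const_htpy X f) (const_htpy X f) = const_htpy X f"
      by (rule cyl_eqI[OF htpy_extensional(1,2)]) auto
    show "reparam X p (const_htpy X f) = const_htpy (cyl X) (const_htpy X f)"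
      by (rule cyl2_eqI[OF htpy_extensional(4,2)]) (simp add: param_convex[OF that param_id])
  qed
  show ?thesis
  proof (unfold_locales, goal_cases)
    case 1 then show ?case by (simp add: c[OF param_id])
  next
    case 2 then show ?case by (simp add: c[OF param_left])
  next
    case 3 then show ?case by (simp add: c[OF param_right])
  next
    case 4 then show ?case by (rule Top_left_unit)
  next
    case 5 then show ?case by (rule Top_right_unit)
  qed
qed

section \<open>The tensor product of homotopies\<close>

definition tensor0 :: "'a topology \<Rightarrow> ('b \<Rightarrow> 'c) \<Rightarrow> ('a \<Rightarrow> 'b) \<Rightarrow> 'a \<Rightarrow> 'c" where
  "tensor0 X g f = (\<lambda>x\<in>topspace X. g (f x))"

definition tensor1 :: "'a topology \<Rightarrow> ('b \<times> real \<Rightarrow> 'c) \<Rightarrow> ('a \<times> real \<Rightarrow> 'b) \<Rightarrow> 'a \<times> real \<Rightarrow> 'c" where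
  "tensor1 X J H = (\<lambda>(x, s)\<in>topspace (cyl X). J (H (x, s), s))"

definition tensor2 :: "'a topology \<Rightarrow> (('b \<times> real) \<times> real \<Rightarrow> 'c) \<Rightarrow> (('a \<times> real) \<times> real \<Rightarrow> 'b) \<Rightarrow>
    ('a \<times> real) \<times> real \<Rightarrow> 'c" where
  "tensor2 X \<beta> \<alpha> = (\<lambda>((x, s), t)\<in>topspace (cyl (cyl X)). \<beta> ((\<alpha> ((x, s), t), s), t))"

lemma tensor_apply [simp]:
  "x \<in> topspace X \<Longrightarrow> tensor0 X g f x = g (f x)"
  "x \<in> topspace X \<Longrightarrow> 0 \<le> s \<Longrightarrow> s \<le> 1 \<Longrightarrow> tensor1 X J H (x, s) = J (H (x, s), s)"
  "x \<in> topspace X \<Longrightarrow> 0 \<le> s \<Longrightarrow> s \<le> 1 \<Longrightarrow> 0 \<le> t \<Longrightarrow> t \<le> 1 \<Longrightarrow>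
     tensor2 X \<beta> \<alpha> ((x, s), t) = \<beta> ((\<alpha> ((x, s), t), s), t)"
  by (simp_all add: tensor0_def tensor1_def tensor2_def)

lemma tensor_extensional:
  "tensor0 X g f \<in> extensional (topspace X)"
  "tensor1 X J H \<in> extensional (topspace (cyl X))"
  "tensor2 X \<beta> \<alpha> \<in> extensional (topspace (cyl (cyl X)))"
  unfolding tensor0_def tensor1_def tensor2_def by (rule restrict_extensional)+

lemma map_eqI:
  assumes "f \<in> extensional (topspace X)" "g \<in> extensional (topspace X)" "\<And>x. x \<in> topspace X \<Longrightarrow> f x = g x"
  shows "f = g"
  by (rule extensionalityI[OF assms(1,2)]) (rule assms(3))

lemma maps_cyl_in: "H \<in> maps (cyl X) Y \<Longrightarrow> x \<in> topspace X \<Longrightarrow> 0 \<le> s \<Longrightarrow> s \<le> 1 \<Longrightarrow> H (x, s) \<in> topspace Y"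
  by (rule maps_in) auto

lemma maps_cyl2_in: "\<alpha> \<in> maps (cyl (cyl X)) Y \<Longrightarrow> x \<in> topspace X \<Longrightarrow> 0 \<le> s \<Longrightarrow> s \<le> 1 \<Longrightarrow> 0 \<le> t \<Longrightarrow> t \<le> 1 \<Longrightarrow>
    \<alpha> ((x, s), t) \<in> topspace Y"
  by (rule maps_in) auto

lemma tensor0_maps: "g \<in> maps Y Z \<Longrightarrow> f \<in> maps X Y \<Longrightarrow> tensor0 X g f \<in> maps X Z"
  unfolding tensor0_def by (rule mapsI, rule continuous_map_of[OF maps_cont maps_cont])

lemma tensor1_maps:
  assumes "J \<in> maps (cyl Y) Z" "H \<in> maps (cyl X) Y"
  shows "tensor1 X J H \<in> maps (cyl X) Z"
proof -
  have "continuous_map (cyl X) (cyl Y) (\<lambda>z. (H z, snd z))"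
    by (rule continuous_map_cylI[OF maps_cont[OF assms(2)] continuous_map_cyl_proj(4)]) auto
  from mapsI[OF continuous_map_of[OF maps_cont[OF assms(1)] this]] show ?thesis
    by (simp add: tensor1_def case_prod_unfold)
qed

lemma tensor2_maps:
  assumes "\<beta> \<in> maps (cyl (cyl Y)) Z" "\<alpha> \<in> maps (cyl (cyl X)) Y"
  shows "tensor2 X \<beta> \<alpha> \<in> maps (cyl (cyl X)) Z"
proof -
  have "continuous_map (cyl (cyl X)) (cyl (cyl Y)) (\<lambda>z. ((\<alpha> z, snd (fst z)), snd z))"
    by (intro continuous_map_cylI maps_cont[OF assms(2)] continuous_map_cyl_proj) auto
  from mapsI[OF continuous_map_of[OF maps_cont[OF assms(1)] this]] show ?thesis
    by (simp add: tensor2_def case_prod_unfold)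
qed

lemma tensor1_slice:
  assumes "H \<in> maps (cyl X) Y" "0 \<le> s" "s \<le> 1"
  shows "slice X (tensor1 X J H) s = tensor0 X (slice Y J s) (slice X H s)"
  using assms(2,3) maps_cyl_in[OF assms(1) _ assms(2,3)] by (auto simp: slice_def tensor0_def restrict_def)

lemma tensor2_cell_hom:
  assumes \<beta>: "\<beta> \<in> cell_hom Y Z J J'" and \<alpha>: "\<alpha> \<in> cell_hom X Y H H'"
  shows "tensor2 X \<beta> \<alpha> \<in> cell_hom X Z (tensor1 X J H) (tensor1 X J' H')"
proof (rule cell_homI)
  note \<alpha>m = cell_hom_maps[OF \<alpha>] and \<beta>m = cell_hom_maps[OF \<beta>]
  note in_Y = maps_cyl_in[OF \<alpha>m(2)] maps_cyl_in[OF \<alpha>m(3)]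
  show "tensor2 X \<beta> \<alpha> \<in> maps (cyl (cyl X)) Z" by (rule tensor2_maps[OF \<beta>m(1) \<alpha>m(1)])
  show "tensor1 X J H \<in> maps (cyl X) Z" "tensor1 X J' H' \<in> maps (cyl X) Z"
    by (rule tensor1_maps[OF \<beta>m(2) \<alpha>m(2)] tensor1_maps[OF \<beta>m(3) \<alpha>m(3)])+
  show "tensor2 X \<beta> \<alpha> ((x, s), 0) = tensor1 X J H (x, s)" "tensor2 X \<beta> \<alpha> ((x, s), 1) = tensor1 X J' H' (x, s)"
    if "x \<in> topspace X" "0 \<le> s" "s \<le> 1" for x s
    using that by (simp_all add: cell_hom_ends[OF \<alpha>] cell_hom_ends[OF \<beta>] in_Y)
  show "tensor2 X \<beta> \<alpha> ((x, 0), t) = J (H (x, 0), 0)" "tensor2 X \<beta> \<alpha> ((x, 1), t) = J (H (x, 1), 1)"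
    if "x \<in> topspace X" "0 \<le> t" "t \<le> 1" for x t
    using that by (simp_all add: cell_hom_sides(1,2)[OF \<alpha>] cell_hom_sides(1,2)[OF \<beta>] in_Y)
qed

text \<open>The relative homotopies are composed pointwise at equal s, t and u. On the boundary
  \<Gamma> rests at \<alpha>, hence \<Delta> is evaluated at a fixed boundary point and rests as
  well.\<close>

lemma tensor2_eqv:
  assumes \<beta>: "\<beta> \<in> cell_hom Y Z J J'" and \<alpha>: "\<alpha> \<in> cell_hom X Y H H'" and "eqv Y Z \<beta> \<beta>'" "eqv X Y \<alpha> \<alpha>'"
  shows "eqv X Z (tensor2 X \<beta> \<alpha>) (tensor2 X \<beta>' \<alpha>')"
proof -
  obtain \<Gamma> where \<Gamma>': "rel_homotopy X Y \<alpha> \<alpha>' \<Gamma>" by (rule eqvE[OF assms(4)])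
  obtain \<Delta> where \<Delta>': "rel_homotopy Y Z \<beta> \<beta>' \<Delta>" by (rule eqvE[OF assms(3)])
  note \<Gamma> = rel_homotopyD[OF \<Gamma>'] and \<Delta> = rel_homotopyD[OF \<Delta>']
  note \<alpha>' = eqv_cell_hom[OF assms(4) \<alpha>] and \<beta>' = eqv_cell_hom[OF assms(3) \<beta>]
  \<comment> \<open>The facts about \<Delta> hold over points of Y, so the values of \<alpha> and
    \<alpha>' must be known to lie there.\<close>
  note in_Y = maps_cyl2_in[OF cell_hom_maps(1)[OF \<alpha>]] maps_cyl2_in[OF cell_hom_maps(1)[OF \<alpha>']]
  show ?thesis
  proof (rule eqvI[OF cell_hom_cells[OF tensor2_cell_hom[OF \<beta> \<alpha>]] cell_hom_cells[OF tensor2_cell_hom[OF \<beta>' \<alpha>']],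
      of "\<lambda>z. \<Delta> (((\<Gamma> z, snd (fst (fst z))), snd (fst z)), snd z)"])
    show "continuous_map (cyl (cyl (cyl X))) Z (\<lambda>z. \<Delta> (((\<Gamma> z, snd (fst (fst z))), snd (fst z)), snd z))"
      by (rule continuous_map_of[OF \<Delta>(1)]) (intro continuous_map_cylI \<Gamma>(1) continuous_map_cyl_proj, auto)
  next
    fix x and s t u :: real
    assume x: "x \<in> topspace X" "0 \<le> s" "s \<le> 1" "0 \<le> t" "t \<le> 1" "0 \<le> u" "u \<le> 1" "s = 0 \<or> s = 1 \<or> t = 0 \<or> t = 1"
    then show "(\<lambda>z. \<Delta> (((\<Gamma> z, snd (fst (fst z))), snd (fst z)), snd z)) (((x, s), t), u) = tensor2 X \<beta> \<alpha> ((x, s), t)"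
      using \<Delta>(4)[OF in_Y(1)[of x s t], of s t u] by (simp add: \<Gamma>(4))
  qed (simp_all add: \<Gamma>(2,3) \<Delta>(2,3) in_Y)
qed

lemma Top_tensor_simps [simp]:
  "pf0 (Top_tensor X Y Z) p = tensor0 X (fst p) (snd p)"
  "pf1 (Top_tensor X Y Z) q = tensor1 X (fst q) (snd q)"
  "pf_comp2 (Top_tensor X Y Z) q' q = id2 (Top_hom X Z)
     (tensor1 X (concat_htpy Y (fst q') (fst q)) (concat_htpy X (snd q') (snd q)))"
  "pf_unit (Top_tensor X Y Z) p = id2 (Top_hom X Z) (tensor1 X (const_htpy Y (fst p)) (const_htpy X (snd p)))"
  by (simp_all add: Top_tensor_def pf_strict_def tensor0_def tensor1_def case_prod_unfold)

lemma Top_tensor_cls: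
  assumes "\<beta> \<in> cell_hom Y Z J J'" "\<alpha> \<in> cell_hom X Y H H'"
  shows "pf2 (Top_tensor X Y Z) (cls Y Z \<beta>, cls X Y \<alpha>) = cls X Z (tensor2 X \<beta> \<alpha>)"
proof -
  have "cls X Z (tensor2 X \<beta>' \<alpha>') = cls X Z (tensor2 X \<beta> \<alpha>)"
    if "\<beta>' \<in> cls Y Z \<beta>" "\<alpha>' \<in> cls X Y \<alpha>" for \<alpha>' \<beta>'
    using cls_cong[OF tensor2_eqv[OF assms]] that by (simp add: cls_eq)
  moreover have "pf2 (Top_tensor X Y Z) (cls Y Z \<beta>, cls X Y \<alpha>)
      = (\<Union>\<beta>'\<in>cls Y Z \<beta>. \<Union>\<alpha>'\<in>cls X Y \<alpha>. cls X Z (tensor2 X \<beta>' \<alpha>'))"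
    by (simp add: Top_tensor_def pf_strict_def tensor2_def)
  moreover note cls_self[OF cell_hom_cells[OF assms(1)]] cls_self[OF cell_hom_cells[OF assms(2)]]
  ultimately show ?thesis by blast
qed

section \<open>Strict functoriality of the tensor\<close>

lemma tensor1_const:
  assumes "f \<in> maps X Y"
  shows "tensor1 X (const_htpy Y g) (const_htpy X f) = const_htpy X (tensor0 X g f)"
  by (rule cyl_eqI[OF tensor_extensional(2) htpy_extensional(2)]) (simp add: maps_in[OF assms])

text \<open>Strict because both factors are read at the same s, so the two concatenations switch
  together at s = 1/2.\<close>

lemma tensor1_concat:
  assumes "H \<in> maps (cyl X) Y" "H' \<in> maps (cyl X) Y"
  shows "tensor1 X (concat_htpy Y J' J) (concat_htpy X H' H) = concat_htpy X (tensor1 X J' H') (tensor1 X J H)"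
  by (rule cyl_eqI[OF tensor_extensional(2) htpy_extensional(1)])
    (simp add: maps_cyl_in[OF assms(1)] maps_cyl_in[OF assms(2)])

lemma tensor2_const:
  assumes "H \<in> maps (cyl X) Y"
  shows "tensor2 X (const_htpy (cyl Y) J) (const_htpy (cyl X) H) = const_htpy (cyl X) (tensor1 X J H)"
  by (rule cyl2_eqI[OF tensor_extensional(3) htpy_extensional(2)]) (simp add: maps_cyl_in[OF assms])

lemma tensor2_concat:
  assumes "\<alpha> \<in> maps (cyl (cyl X)) Y" "\<alpha>' \<in> maps (cyl (cyl X)) Y"
  shows "tensor2 X (concat_htpy (cyl Y) \<beta>' \<beta>) (concat_htpy (cyl X) \<alpha>' \<alpha>)
    = concat_htpy (cyl X) (tensor2 X \<beta>' \<alpha>') (tensor2 X \<beta> \<alpha>)"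
  by (rule cyl2_eqI[OF tensor_extensional(3) htpy_extensional(1)])
    (simp add: maps_cyl2_in[OF assms(1)] maps_cyl2_in[OF assms(2)])

lemma tensor2_hconcat:
  assumes "\<alpha> \<in> maps (cyl (cyl X)) Y" "\<alpha>' \<in> maps (cyl (cyl X)) Y"
  shows "tensor2 X (hconcat_htpy Y \<beta>' \<beta>) (hconcat_htpy X \<alpha>' \<alpha>)
    = hconcat_htpy X (tensor2 X \<beta>' \<alpha>') (tensor2 X \<beta> \<alpha>)"
  by (rule cyl2_eqI[OF tensor_extensional(3) htpy_extensional(3)])
    (simp add: maps_cyl2_in[OF assms(1)] maps_cyl2_in[OF assms(2)])

text \<open>Both factors are evaluated at the same point of the straight line from p s to s.\<close>

lemma tensor2_reparam:
  assumes "H \<in> maps (cyl X) Y" "param p"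
  shows "tensor2 X (reparam Y p J) (reparam X p H) = reparam X p (tensor1 X J H)"
  by (rule cyl2_eqI[OF tensor_extensional(3) htpy_extensional(4)])
    (simp add: maps_cyl_in[OF assms(1)] param_convex[OF assms(2) param_id])

text \<open>Gives preservation of \<open>assoc\<close>, \<open>lunit\<close> and
  \<open>runit\<close> uniformly, as all three are classes of reparametrizations.\<close>

lemma tensor_reparam_cls:
  assumes "H \<in> maps (cyl X) Y" "J \<in> maps (cyl Y) Z" "param p"
  shows "pf2 (Top_tensor X Y Z) (cls Y Z (reparam Y p J), cls X Y (reparam X p H)) = cls X Z (reparam X p (tensor1 X J H))"
  using Top_tensor_cls[OF line_cell_hom[OF assms(2,3) param_id] line_cell_hom[OF assms(1,3) param_id]]
  unfolding line_reparam tensor2_reparam[OF assms(1,3)] .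

lemma strict_functor_Top_tensor:
  "strict_functor (prod_bicat (Top_hom Y Z) (Top_hom X Y)) (Top_hom X Z) (Top_tensor X Y Z)"
proof (rule strict_functor.intro, goal_cases)
  case 1 then show ?case by (auto intro: tensor0_maps)
next
  case 2 then show ?case by (auto simp: hom1_Top tensor1_slice intro: tensor1_maps)
next
  case (3 r q q')
  then obtain \<alpha> \<beta> where "\<beta> \<in> cell_hom Y Z (fst q) (fst q')" "\<alpha> \<in> cell_hom X Y (snd q) (snd q')"
    "r = (cls Y Z \<beta>, cls X Y \<alpha>)"
    by (cases r) (auto elim!: hom2_TopE)
  then show ?case by (simp add: Top_tensor_cls hom2_TopI tensor2_cell_hom)
next
  case 4 then show ?case by (simp add: tensor1_const)
next
  case 5 then show ?case by (simp add: hom1_Top tensor1_concat)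
next
  case 6 then show ?case by (simp add: Top_tensor_cls[OF const_cell_hom const_cell_hom] tensor2_const)
next
  case (7 r' q' q'' r q)
  then obtain \<alpha> \<beta> \<alpha>' \<beta>' where h: "\<beta> \<in> cell_hom Y Z (fst q) (fst q')" "\<alpha> \<in> cell_hom X Y (snd q) (snd q')"
      "\<beta>' \<in> cell_hom Y Z (fst q') (fst q'')" "\<alpha>' \<in> cell_hom X Y (snd q') (snd q'')"
    and e: "r = (cls Y Z \<beta>, cls X Y \<alpha>)" "r' = (cls Y Z \<beta>', cls X Y \<alpha>')"
    by (cases r; cases r') (auto elim!: hom2_TopE)
  show ?case
    unfolding e prod_bicat_simps fst_conv snd_conv vcomp_Top[OF h(1,3)] vcomp_Top[OF h(2,4)]
      Top_tensor_cls[OF h(1,2)] Top_tensor_cls[OF h(3,4)]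
      Top_tensor_cls[OF concat_cell_hom[OF h(1,3)] concat_cell_hom[OF h(2,4)]]
      vcomp_Top[OF tensor2_cell_hom[OF h(1,2)] tensor2_cell_hom[OF h(3,4)]]
      tensor2_concat[OF cell_hom_maps(1)[OF h(2)] cell_hom_maps(1)[OF h(4)]] ..
next
  case (8 g b c f a r g' r0 f')
  then obtain \<alpha> \<beta> \<alpha>' \<beta>' where h: "\<beta> \<in> cell_hom Y Z (fst f) (fst f')" "\<alpha> \<in> cell_hom X Y (snd f) (snd f')"
      "\<beta>' \<in> cell_hom Y Z (fst g) (fst g')" "\<alpha>' \<in> cell_hom X Y (snd g) (snd g')"
    and e: "r0 = (cls Y Z \<beta>, cls X Y \<alpha>)" "r = (cls Y Z \<beta>', cls X Y \<alpha>')"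
    by (cases r; cases r0) (auto elim!: hom2_TopE)
  have s: "slice Y (fst f) 1 = slice Y (fst g) 0" "slice X (snd f) 1 = slice X (snd g) 0"
    using 8(1,2) by (simp_all add: hom1_Top)
  have s': "slice X (tensor1 X (fst f) (snd f)) 1 = slice X (tensor1 X (fst g) (snd g)) 0"
  proof -
    have "snd f \<in> maps (cyl X) Y" "snd g \<in> maps (cyl X) Y" using 8(1,2) by (simp_all add: hom1_Top)
    then show ?thesis using s by (simp add: tensor1_slice[where Y = Y])
  qed
  show ?case
    unfolding e prod_bicat_simps fst_conv snd_conv hcomp_Top[OF h(1,3) s(1)] hcomp_Top[OF h(2,4) s(2)]
      Top_tensor_cls[OF h(1,2)] Top_tensor_cls[OF h(3,4)]
      Top_tensor_cls[OF hconcat_cell_hom[OF h(1,3) s(1)] hconcat_cell_hom[OF h(2,4) s(2)]]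
      hcomp_Top[OF tensor2_cell_hom[OF h(1,2)] tensor2_cell_hom[OF h(3,4)] s']
      tensor2_hconcat[OF cell_hom_maps(1)[OF h(2)] cell_hom_maps(1)[OF h(4)]] ..
next
  case (9 h c d g b f a)
  then show ?case
    by (simp add: hom1_Top tensor_reparam_cls param_assoc concat_htpy_maps' tensor1_concat)
next
  case 10 then show ?case by (simp add: hom1_Top tensor_reparam_cls param_left)
next
  case 11 then show ?case by (simp add: hom1_Top tensor_reparam_cls param_right)
next
  case 12 then show ?case by simp
next
  case 13 then show ?case by simp
qed

section \<open>Strict associativity and unit laws of the tensor\<close>

lemma tensor0_assoc:
  assumes "f \<in> maps X Y"
  shows "tensor0 X (tensor0 Y h g) f = tensor0 X h (tensor0 X g f)"
  by (rule map_eqI[OF tensor_extensional(1,1)]) (simp add: maps_in[OF assms])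

lemma tensor1_assoc:
  assumes "H \<in> maps (cyl X) Y"
  shows "tensor1 X (tensor1 Y K J) H = tensor1 X K (tensor1 X J H)"
  by (rule cyl_eqI[OF tensor_extensional(2,2)]) (simp add: maps_cyl_in[OF assms])

lemma tensor2_assoc:
  assumes "\<alpha> \<in> maps (cyl (cyl X)) Y"
  shows "tensor2 X (tensor2 Y \<gamma> \<beta>) \<alpha> = tensor2 X \<gamma> (tensor2 X \<beta> \<alpha>)"
  by (rule cyl2_eqI[OF tensor_extensional(3,3)]) (simp add: maps_cyl2_in[OF assms])

text \<open>Restricted to the underlying set, since \<open>maps\<close> admits extensional functions
  only.\<close>

definition id_map :: "'a topology \<Rightarrow> 'a \<Rightarrow> 'a" where
  "id_map X = (\<lambda>x\<in>topspace X. x)"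

lemma id_map_apply [simp]: "x \<in> topspace X \<Longrightarrow> id_map X x = x"
  by (simp add: id_map_def)

lemma id_map_maps: "id_map X \<in> maps X X"
  unfolding id_map_def by (rule mapsI[OF continuous_map_ident])

lemma tensor0_id:
  assumes "f \<in> maps X Y"
  shows "tensor0 X (id_map Y) f = f" "tensor0 X f (id_map X) = f"
proof -
  have "f \<in> extensional (topspace X)" using assms by (simp add: maps_def)
  then show "tensor0 X (id_map Y) f = f" "tensor0 X f (id_map X) = f"
    by (auto intro!: map_eqI[OF tensor_extensional(1)] simp: maps_in[OF assms])
qed

lemma tensor1_id:
  assumes "H \<in> maps (cyl X) Y"
  shows "tensor1 X (const_htpy Y (id_map Y)) H = H" "tensor1 X H (const_htpy X (id_map X)) = H"
proof -
  have ext: "H \<in> extensional (topspace (cyl X))" using assms by (simp add: maps_def)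
  show "tensor1 X (const_htpy Y (id_map Y)) H = H" "tensor1 X H (const_htpy X (id_map X)) = H"
    by (rule cyl_eqI[OF tensor_extensional(2) ext]; simp add: maps_cyl_in[OF assms])+
qed

lemma tensor2_id:
  assumes "\<alpha> \<in> maps (cyl (cyl X)) Y"
  shows "tensor2 X (const_htpy (cyl Y) (const_htpy Y (id_map Y))) \<alpha> = \<alpha>"
    "tensor2 X \<alpha> (const_htpy (cyl X) (const_htpy X (id_map X))) = \<alpha>"
proof -
  have ext: "\<alpha> \<in> extensional (topspace (cyl (cyl X)))" using assms by (simp add: maps_def)
  show "tensor2 X (const_htpy (cyl Y) (const_htpy Y (id_map Y))) \<alpha> = \<alpha>"
    "tensor2 X \<alpha> (const_htpy (cyl X) (const_htpy X (id_map X))) = \<alpha>"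
    by (rule cyl2_eqI[OF tensor_extensional(3) ext]; simp add: maps_cyl2_in[OF assms])+
qed

lemma Top_tensor_assoc_cls:
  assumes "C \<in> cls Z W ` cells Z W" "B \<in> cls Y Z ` cells Y Z" "A \<in> cls X Y ` cells X Y"
  shows "pf2 (Top_tensor X Y W) (pf2 (Top_tensor Y Z W) (C, B), A) = pf2 (Top_tensor X Z W) (C, pf2 (Top_tensor X Y Z) (B, A))"
proof -
  from assms obtain \<alpha> \<beta> \<gamma> where "\<gamma> \<in> cells Z W" "\<beta> \<in> cells Y Z" "\<alpha> \<in> cells X Y"
    and e: "C = cls Z W \<gamma>" "B = cls Y Z \<beta>" "A = cls X Y \<alpha>"
    by blast
  note h = this(1-3)[THEN cells_cell_hom]
  show ?thesis
    unfolding e Top_tensor_cls[OF h(1,2)] Top_tensor_cls[OF h(2,3)]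
      Top_tensor_cls[OF tensor2_cell_hom[OF h(1,2)] h(3)] Top_tensor_cls[OF h(1) tensor2_cell_hom[OF h(2,3)]]
      tensor2_assoc[OF cell_hom_maps(1)[OF h(3)]] ..
qed

lemma Top_tensor_id_cls:
  assumes "A \<in> cls X Y ` cells X Y"
  shows "pf2 (Top_tensor X Y Y) (id2 (Top_hom Y Y) (const_htpy Y (id_map Y)), A) = A"
    "pf2 (Top_tensor X X Y) (A, id2 (Top_hom X X) (const_htpy X (id_map X))) = A"
proof -
  from assms obtain \<alpha> where \<alpha>: "\<alpha> \<in> cells X Y" and e: "A = cls X Y \<alpha>" by blast
  note h = cells_cell_hom[OF \<alpha>]
  note i = const_cell_hom[OF const_htpy_maps[OF id_map_maps]]
  show "pf2 (Top_tensor X Y Y) (id2 (Top_hom Y Y) (const_htpy Y (id_map Y)), A) = A"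
    "pf2 (Top_tensor X X Y) (A, id2 (Top_hom X X) (const_htpy X (id_map X))) = A"
    unfolding e Top_hom_simps(7) Top_tensor_cls[OF i h] Top_tensor_cls[OF h i] tensor2_id[OF cells_maps[OF \<alpha>]]
    by (rule refl)+
qed

text \<open>The constraints of a \<open>tricat\<close> are built from functors that take the record
  itself as argument. This partial record breaks the circle; its placeholders are overwritten in
  \<open>Top_tricat\<close>.\<close>

definition Top_pre :: "('a topology, 'a \<Rightarrow> 'a, 'a \<times> real \<Rightarrow> 'a, 'a cell2) tricat" where
  "Top_pre = \<lparr>tob = UNIV, thom = Top_hom, tcomp = Top_tensor, tunit = \<lambda>X. pf_const (Top_hom X X) (id_map X),
     tassoc = undefined, tlunit = undefined, trunit = undefined,
     tpi = undefined, tmu = undefined, tlambda = undefined, trho = undefined\<rparr>"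

text \<open>The functors from which the constraints are built only depend on the data of \<open>Top_pre\<close>.\<close>

definition Top_tricat :: "('a topology, 'a \<Rightarrow> 'a, 'a \<times> real \<Rightarrow> 'a, 'a cell2) tricat" where
  "Top_tricat = Top_pre\<lparr>
     tassoc := \<lambda>a b c d. eqv_id (Top_hom a d) (comp3_left Top_pre a b c d),
     tlunit := \<lambda>a b. eqv_id (Top_hom a b) (unit_comp Top_pre a b),
     trunit := \<lambda>a b. eqv_id (Top_hom a b) (comp_unit Top_pre a b),
     tpi := \<lambda>a b c d e p. id2 (Top_hom a e) (id1 (Top_hom a e) (pf0 (comp4_first Top_pre a b c d e) p)),
     tmu := \<lambda>a b c q. id2 (Top_hom a c) (id1 (Top_hom a c) (pf0 (Top_tensor a b c) q)),
     tlambda := \<lambda>a b c q. id2 (Top_hom a c) (id1 (Top_hom a c) (pf0 (unit_comp2 Top_pre a b c) q)),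
     trho := \<lambda>a b c q. id2 (Top_hom a c) (id1 (Top_hom a c) (pf0 (Top_tensor a b c) q))\<rparr>"

lemma Top_tricat_sel:
  "tob Top_tricat = UNIV" "thom Top_tricat = Top_hom" "tcomp Top_tricat = Top_tensor"
  "tunit Top_tricat = (\<lambda>X. pf_const (Top_hom X X) (id_map X))"
  by (simp_all add: Top_tricat_def Top_pre_def)

text \<open>These functors read only the hom-bicategories, the composition and the units, which the
  two records share.\<close>

lemma Top_pre_functors:
  "comp3_left Top_tricat = comp3_left Top_pre" "unit_comp Top_tricat = unit_comp Top_pre"
  "comp_unit Top_tricat = comp_unit Top_pre" "comp4_first Top_tricat = comp4_first Top_pre"
  "unit_comp2 Top_tricat = unit_comp2 Top_pre"
proof -
  have p: "thom Top_pre = Top_hom" "tcomp Top_pre = Top_tensor" "tunit Top_pre = (\<lambda>X. pf_const (Top_hom X X) (id_map X))"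
    by (simp_all add: Top_pre_def)
  have t: "thom2 Top_tricat = thom2 Top_pre" by (intro ext) (simp only: thom2_def Top_tricat_sel p)
  have c: "comp_times Top_tricat b c d A = comp_times Top_pre b c d A" for b c d A
    by (simp only: comp_times_def Top_tricat_sel p)
  show l: "comp3_left Top_tricat = comp3_left Top_pre"
    by (intro ext) (simp only: comp3_left_def c Top_tricat_sel p)
  show "unit_comp Top_tricat = unit_comp Top_pre"
    by (intro ext) (simp only: unit_comp_def Top_tricat_sel p)
  show "comp_unit Top_tricat = comp_unit Top_pre"
    by (intro ext) (simp only: comp_unit_def Top_tricat_sel p)
  show "comp4_first Top_tricat = comp4_first Top_pre"
    by (intro ext) (simp only: comp4_first_def l c t Top_tricat_sel p)
  show "unit_comp2 Top_tricat = unit_comp2 Top_pre"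
    by (intro ext) (simp only: unit_comp2_def l t Top_tricat_sel p)
qed

lemma strict_tricategory_Top: "strict_tricategory Top_tricat"
proof (rule strict_tricategory.intro, goal_cases)
  case 1 then show ?case by (simp add: Top_tricat_sel unit_strict_bicategory_Top)
next
  case 2 then show ?case by (simp add: Top_tricat_sel thom2_def strict_functor_Top_tensor)
next
  case 3 then show ?case
    unfolding Top_tricat_sel by (intro strict_functor_const unit_strict_bicategory_Top) (simp add: id_map_maps)
next
  case (4 a b c d)
  show ?case
    by (rule pf_agreeI)
      (simp_all add: thom3_def thom2_def comp3_left_def comp3_right_def comp_times_def times_comp_def functor_sel
        Top_tricat_sel tensor0_assoc tensor1_assoc Top_tensor_assoc_cls)
next
  case (5 a b)
  show ?case
    by (rule pf_agreeI)
      (simp_all add: unit_comp_def functor_sel Top_tricat_sel tensor0_id tensor1_id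
        Top_tensor_id_cls[unfolded Top_hom_simps])
next
  case (6 a b)
  show ?case
    by (rule pf_agreeI)
      (simp_all add: comp_unit_def functor_sel Top_tricat_sel tensor0_id tensor1_id
        Top_tensor_id_cls[unfolded Top_hom_simps])
\<comment> \<open>What is left are the equations prescribing the constraint data. They hold by
  construction once the functors over \<open>Top_tricat\<close> are replaced by those over
  \<open>Top_pre\<close>.\<close>
qed (simp_all only: Top_pre_functors, simp_all add: Top_tricat_def Top_pre_def)

theorem theorem10:
  shows "\<exists>T :: ('a topology, 'a \<Rightarrow> 'a, 'a \<times> real \<Rightarrow> 'a, 'a cell2) tricat.
           tricategory T \<and>
           tob T = UNIV \<and>
           (\<forall>X Y. thom T X Y = Top_hom X Y) \<and>
           (\<forall>X Y Z. tcomp T X Y Z = Top_tensor X Y Z)"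
  using strict_tricategory.tricategory[OF strict_tricategory_Top]
  by (intro exI[of _ Top_tricat]) (simp add: Top_tricat_sel)

end
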